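(* Let $p,q,m,n\in\mathbb Z_+$ be not all zero, $\mathfrak g=\mathfrak g_{(p,q|m,n)}$, $\ell\in\mathbb N$, $\mathbf z=(z_1,\dots,z_\ell)\in\mathbf X_\ell$. For $i=1,\dots,\ell$ let $d_i\in\mathbb N$, $\lambda_{(i)}\in\mathring{\mathcal P}^{d_i}_{(p,q|m,n)}$, $L_i=L(\mathfrak g,\mathring\lambda_{(i)}^{(p,q|m,n)})$; let $\mathbb L=L_1\otimes\cdots\otimes L_\ell$, $d=\sum_id_i$, and let $\xi=\mathring\lambda^{(p,q|m,n)}$, $\lambda\in\mathring{\mathcal P}^d_{(p,q|m,n)}$, be a singular weight of $\mathbb L$. Let $r,r'$, the partition $\mu$, the tensor product $\mathbb V$ of irreducible finite-dimensional polynomial $\mathfrak{gl}_{r'}$-modules, and the linear isomorphism $\Psi:\mathbb V^{\rm sing}_{\bar\mu^{r'|0}}\to\mathbb L^{\rm sing}_\xi$ be as defined in the context, write $\mathcal A^{\mathbf z}_{r'}=\mathcal A^{\mathbf z}_{(0,0|r',0)}$, and put $c(z)=\sum_{i=1}^\ell d_i(z-z_i)^{-1}$. (i) Let $v$ and $w$ be eigenvectors of $(\mathcal A^{\mathbf z}_{r'})_{\mathbb V^{\rm sing}_{\bar\mu^{r'|0}}}$ and $(\mathcal A^{\mathbf z}_{(p,q|m,n)})_{\mathbb L^{\rm sing}_\xi}$, respectively, and let $\mathrm D_v$ and $\mathcal D_w$ be the pseudo-differential operators associated to $(\mathrm{cdet}(\mathcal L^{\mathbf z}_{(0,0|r',0)}),v)$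 and $(\mathrm{Ber}(\mathcal L^{\mathbf z}_{(p,q|m,n)}),w)$, respectively. Then $\Psi(v)$ and $\Psi^{-1}(w)$ are eigenvectors of $(\mathcal A^{\mathbf z}_{(p,q|m,n)})_{\mathbb L^{\rm sing}_\xi}$ and $(\mathcal A^{\mathbf z}_{r'})_{\mathbb V^{\rm sing}_{\bar\mu^{r'|0}}}$, respectively, and $$\mathcal D_{\Psi(v)}(\Psi(v))=\big(\partial_z+c(z)\big)^{p-q+r}\,\mathrm D_v\,\partial_z^{m-n-r-r'}(\Psi(v)),$$ $$\mathcal D_w(\Psi^{-1}(w))=\big(\partial_z+c(z)\big)^{p-q+r}\,\mathrm D_{\Psi^{-1}(w)}\,\partial_z^{m-n-r-r'}(\Psi^{-1}(w)).$$ (ii) The map $\Upsilon\mapsto\Psi(\Upsilon)$ is a one-to-one correspondence between the set of eigenbases $\Upsilon$ for $(\mathcal A^{\mathbf z}_{r'})_{\mathbb V^{\rm sing}_{\bar\mu^{r'|0}}}$ and the set of eigenbases for $(\mathcal A^{\mathbf z}_{(p,q|m,n)})_{\mathbb L^{\rm sing}_\xi}$.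
   Context: Everything is over $\mathbb C$; $\mathbb N=\{1,2,\dots\}$, $\mathbb Z_+=\{0,1,2,\dots\}$, $\langle x\rangle=\max\{x,0\}$; $'$ on a partition is conjugation, $\ell(\mu)$ is the length of a partition. **Lie superalgebra.** $\mathbb I_{(p,q|m,n)}=\{-p,\dots,-1\}\cup\{-q+\frac12,\dots,-\frac12\}\cup\{1,\dots,m\}\cup\{\frac12,\dots,n-\frac12\}$, totally ordered ($<_{\mathbb I}$) by $-p<\cdots<-1<-q+\frac12<\cdots<-\frac12<1<\cdots<m<\frac12<\cdots<n-\frac12$. $\mathfrak g_{(p,q|m,n)}$ has basis $E_{i,j}$ ($i,j\in\mathbb I$), parity $2(i+j)$ mod 2, bracket $[E_{i,j},E_{k,l}]=\delta_{j,k}E_{i,l}-(-1)^{4(i+j)(k+l)}\delta_{i,l}E_{k,j}$; $\mathfrak g_{(0,0|r',0)}=\mathfrak{gl}_{r'}$. The Cartan subalgebra has basis $E_{i,i}$, dual basis $\epsilon_i$. For any total order $<$ on $\mathbb I$ one has the Borel subalgebra spanned by $E_{i,j}$, $i\le j$; the default is $<_{\mathbb I}$. $L(\mathfrak g,\xi)$ (resp. $L^\sigma(\mathfrak g,\xi)$) is the irreducible module with highest weight $\xi$ for the default Borel (resp. for the order $\sigma$). $M^{\sigma\text{-sing}}=\{v\in M:E_{i,j}v=0\ \forall i<_\sigma j\}$ and $M^{\sigma\text{-sing}}_\mu$ is its intersection with the $\mu$-weight space; "sing" without prefix refers to $<_{\mathbb I}$. A weight $\mu$ with $M^{\rm sing}_\mu\ne0$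 is a singular weight. Modules are $\mathbb Z_2$-graded with homogeneous weight vectors; tensor products use the sign rule. **Weights.** $\mathring{\mathcal P}^d_{(p,q|m,n)}$: integer sequences $\lambda_1\ge\cdots\ge\lambda_d$ with $\lambda_{m+1}\le n$, $\lambda_{d-p}\ge-q$ (conditions with index outside $\{1,\dots,d\}$ are void). $\lambda^+=(\langle\lambda_1\rangle,\dots,\langle\lambda_d\rangle)$, $\lambda^-=(\langle-\lambda_d\rangle,\dots,\langle-\lambda_1\rangle)$; $$\mathring\lambda^{(p,q|m,n)}=-\sum_{s=1}^p\langle\lambda^-_s-q\rangle\epsilon_{-s}-\sum_{s=1}^q(\lambda^-)'_s\epsilon_{-s+\frac12}+\sum_{i=1}^m\lambda^+_i\epsilon_i+\sum_{i=1}^n\langle(\lambda^+)'_i-m\rangle\epsilon_{i-\frac12}-d\Big(\sum_{s=1}^p\epsilon_{-s}-\sum_{s=1}^q\epsilon_{-s+\frac12}\Big).$$ Every singular weight of $\mathbb L$ has the form $\mathring\lambda^{(p,q|m,n)}$ with $\lambda\in\mathring{\mathcal P}^d_{(p,q|m,n)}$. **Setup, first part.** Fix $r\in\mathbb N$ with $m\le r$, $q\le r$, $(\lambda^+)'_1\le r$, $\lambda^-_1\le r$, and $(\lambda_{(i)}^+)'_1\le r$, $(\lambda_{(i)}^-)_1\le r$ for all $i$. Let $L'_i=L(\mathfrak g_{(p,r|r,n)},\mathring\lambda_{(i)}^{(p,r|r,n)})$, $\mathbb L'=L_1'\otimes\cdots\otimes L'_\ell$. $L_i$ is identified with the sum of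 the weight spaces of $L_i'$ of weights $\nu$ with $\nu(E_{j,j})=0$ for $j\in\{m+1,\dots,r\}$ and $\nu(E_{j,j})=d_i$ for $j\in\{-r+\frac12,\dots,-q-\frac12\}$. Let $\mu_{(i)}$, $\mu$ be the partitions with conjugates $\mu_{(i)}'=(d_i-(\lambda_{(i)}^-)'_r,\dots,d_i-(\lambda_{(i)}^-)'_1,(\lambda^+_{(i)})'_1,\dots,(\lambda_{(i)}^+)'_r)$ and $\mu'=(d-(\lambda^-)'_r,\dots,d-(\lambda^-)'_1,(\lambda^+)'_1,\dots,(\lambda^+)'_r)$. For a partition $\nu$ with $\nu_{a+1}\le b$ put $$\bar\nu^{a|b}=\sum_{i=1}^a\nu_i\epsilon_i+\sum_{i=1}^b\langle\nu'_i-a\rangle\epsilon_{-b+i-\frac12},\qquad \tilde\nu^{a|b}=\sum_{j=1}^b\nu'_j\epsilon_{-b+j-\frac12}+\sum_{j=1}^a\langle\nu_j-b\rangle\epsilon_j ,$$ weights of $\mathfrak g_{(0,b|a,0)}\cong\mathfrak{gl}_{a|b}$. Let $L_i''=L(\mathfrak g_{(0,r|r,0)},\tilde\mu_{(i)}^{r|r})$, identified with the sum of weight spaces of $L'_i$ of weights $\nu$ with $\nu(E_{j,j})=-d_i$ for $j\in\{-p,\dots,-1\}$ and $\nu(E_{j,j})=0$ for $j\in\{\frac12,\dots,n-\frac12\}$; $\mathbb L''=L_1''\otimes\cdots\otimes L_\ell''\subseteq\mathbb L'$. Let $\sigma$ be the total order on $\mathbb I_{(p,r|r,n)}$: $-r+\frac12<\cdots<-q-\frac12<-p<\cdots<-1<-q+\frac12<\cdots<-\frac12<1<\cdots<m<\frac12<\cdots<n-\frac12<m+1<\cdots<r$.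 Let $\xi'$ agree with $\xi$ on $E_{j,j}$, $j\in\mathbb I_{(p,q|m,n)}$, with $\xi'(E_{j,j})=d$ for $j\in\{-r+\frac12,\dots,-q-\frac12\}$ and $0$ for $j\in\{m+1,\dots,r\}$. Inside $\mathbb L'$: $(\mathbb L'')^{\rm sing}_{\tilde\mu^{r|r}}=(\mathbb L')^{\rm sing}_{\mathring\lambda^{(p,r|r,n)}}$ and $(\mathbb L')^{\sigma\text{-sing}}_{\xi'}=\mathbb L^{\rm sing}_\xi$. Odd reflections give $A\in U(\mathfrak g_{(p,r|r,n)})$, a product of elements $E_{i,j}$ with $ij>0$, $i+j\notin\mathbb Z$, such that $\varphi(v)=Av$ is an isomorphism $\varphi:(\mathbb L')^{\rm sing}_{\mathring\lambda^{(p,r|r,n)}}\to(\mathbb L')^{\sigma\text{-sing}}_{\xi'}$; fix such an $A$. Let $\theta$ be the total order $1<\cdots<r<-r+\frac12<\cdots<-\frac12$ on $\mathbb I_{(0,r|r,0)}$; there is $X\in U(\mathfrak g_{(0,r|r,0)})$, a product of elements $E_{i,j}$ with $i+j\notin\mathbb Z$, such that $\vartheta(v)=Xv$ is an isomorphism $\vartheta:(\mathbb L'')^{\theta\text{-sing}}_{\bar\mu^{r|r}}\to(\mathbb L'')^{\rm sing}_{\tilde\mu^{r|r}}$; fix such an $X$. Put $\psi=\varphi\circ\vartheta$. **Setup, second part.** Choose an integer $r'\ge r$ with $\ell(\mu)\le r'$ (then also $\ell(\mu_{(i)})\le r'$, and $\bar\mu^{r'|r}$, $\bar\mu_{(i)}^{r'|r}$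 equal $\bar\mu^{r'|0}=\sum_{j=1}^{r'}\mu_j\epsilon_j$, $\bar\mu_{(i)}^{r'|0}$). On $\mathbb I_{(0,r|r',0)}$ let $\pi$ be the total order $1<\cdots<r'<-r+\frac12<\cdots<-\frac12$ and $\theta'$ the total order $1<\cdots<r<-r+\frac12<\cdots<-\frac12<r+1<\cdots<r'$. Let $V_i=L(\mathfrak{gl}_{r'},\bar\mu_{(i)}^{r'|0})$, $\mathbb V=V_1\otimes\cdots\otimes V_\ell$, $V'_i=L(\mathfrak g_{(0,r|r',0)},\tilde\mu_{(i)}^{r'|r})=L^\pi(\mathfrak g_{(0,r|r',0)},\bar\mu_{(i)}^{r'|r})$, $\mathbb V'=V_1'\otimes\cdots\otimes V_\ell'$. $V_i$ is identified with the sum of weight spaces of $V_i'$ of weights vanishing on $E_{j,j}$, $j\in\{-r+\frac12,\dots,-\frac12\}$, and $L''_i$ with the sum of weight spaces of $V'_i$ of weights vanishing on $E_{j,j}$, $j\in\{r+1,\dots,r'\}$. Then $(\mathbb V')^{\pi\text{-sing}}_{\bar\mu^{r'|r}}=\mathbb V^{\rm sing}_{\bar\mu^{r'|0}}$ and $(\mathbb V')^{\theta'\text{-sing}}_{\bar\mu^{r|r}}=(\mathbb L'')^{\theta\text{-sing}}_{\bar\mu^{r|r}}$ (weights extended by $0$), and there is $Y\in U(\mathfrak g_{(0,r|r',0)})$ such that $\varsigma(v)=Yv$ is an isomorphism $\varsigma:(\mathbb V')^{\pi\text{-sing}}_{\bar\mu^{r'|r}}\to(\mathbb V')^{\theta'\text{-sing}}_{\bar\mu^{r|r}}$;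 fix such a $Y$. Put $\Psi=\psi\circ\varsigma$. **Gaudin algebra.** $\mathbf X_\ell=\{(z_1,\dots,z_\ell)\in\mathbb C^\ell:z_i\ne z_j\ (i\ne j)\}$. $A^{(i)}\in U(\mathfrak g)^{\otimes\ell}$ has $A$ in the $i$-th slot; $A(z)=\sum_iA^{(i)}/(z-z_i)$ expanded at $\infty$. For a superalgebra (or vector space) $\mathcal B$, $\mathcal B((z^{-1},\partial_z^{-1}))$ is the space of series $\sum_{j\le s}\sum_{i\le t}a_{ij}z^i\partial_z^j$, with product $\partial_z^iz^j=\sum_{k\ge0}\binom ik\binom jkk!\,z^{j-k}\partial_z^{i-k}$; for $f=\sum a_{ij}z^i\partial_z^j$ and a vector $v$, $fv=\sum(a_{ij}v)z^i\partial_z^j$. $\mathcal L^{\mathbf z}_{(p,q|m,n)}=[\delta_{i,j}\partial_z-(-1)^{2i}E_{i,j}(z)]_{i,j\in\mathbb I}$; $\mathrm{Ber}$ of it is the product in increasing order $<_{\mathbb I}$ of $d_i^{(-1)^{2i}}$, $d_i$ being the inverse of the $(i,i)$ entry of the inverse of the submatrix with indices $\le_{\mathbb I}i$. For $(0,0|r',0)$, $\mathrm{Ber}$ equals the column determinant $\mathrm{cdet}[a_{i,j}]=\sum_{\tau\in\mathfrak S_{r'}}(-1)^{l(\tau)}a_{\tau(1),1}\cdots a_{\tau(r'),r'}$. Writing $\mathrm{Ber}(\mathcal L^{\mathbf z}_{(p,q|m,n)})=\sum_{i\le p+m-q-n}b_i^{\mathbf z}\partial_z^i$, the Gaudin algebra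 $\mathcal A^{\mathbf z}_{(p,q|m,n)}\subset U(\mathfrak g)^{\otimes\ell}$ is generated by the coefficients of all $b_i^{\mathbf z}$; it is commutative and commutes with the diagonal action of $\mathfrak g$. $(\mathcal A)_V$ is the image of $\mathcal A$ in $\operatorname{End}(V)$; an eigenvector is a common eigenvector, an eigenbasis is a basis of common eigenvectors. If $b_i^{\mathbf z}v=c_iv$ with $c_i\in\mathbb C((z^{-1}))$, the pseudo-differential operator associated to $(\mathrm{Ber}(\mathcal L^{\mathbf z}),v)$ is $\sum_ic_i\partial_z^i$ (likewise for $\mathrm{cdet}$).
   Formalization: The conjugates of μ and μ_(i) use all columns of λ⁺ and λ_(i)⁺ instead of only the first r; the printed formula agrees when λ⁺_1, λ_(i)⁺_1 ≤ r, and otherwise drops columns so that Ψ cannot be an isomorphism. *)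

theory Defs
  imports
    Complex_Main
    "HOL-Library.Function_Algebras"
    "HOL-Combinatorics.Permutations"
    "HOL-Algebra.QuotRing"
    "HOL-Algebra.Generated_Rings"
begin

section \<open>Complex vector spaces\<close>

class complex_vector = ab_group_add +
  fixes scaleC :: "complex \<Rightarrow> 'a \<Rightarrow> 'a" (infixr \<open>*\<^sub>C\<close> 75)
  assumes scaleC_add_right: "a *\<^sub>C (x + y) = a *\<^sub>C x + a *\<^sub>C y"
    and scaleC_add_left: "(a + b) *\<^sub>C x = a *\<^sub>C x + b *\<^sub>C x"
    and scaleC_scaleC: "a *\<^sub>C b *\<^sub>C x = (a * b) *\<^sub>C x"
    and scaleC_one: "1 *\<^sub>C x = x"

instantiation complex :: complex_vector
begin
definition scaleC_complex :: "complex \<Rightarrow> complex \<Rightarrow> complex" where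
  "scaleC_complex a x = a * x"
instance
  by standard (simp_all add: scaleC_complex_def algebra_simps)
end

instantiation "fun" :: (type, complex_vector) complex_vector
begin
definition scaleC_fun :: "complex \<Rightarrow> ('a \<Rightarrow> 'b) \<Rightarrow> 'a \<Rightarrow> 'b" where
  "scaleC_fun a f = (\<lambda>x. a *\<^sub>C f x)"
instance
  by standard
    (simp_all add: scaleC_fun_def fun_eq_iff scaleC_add_right scaleC_add_left scaleC_scaleC scaleC_one)
end

global_interpretation cvec: vector_space "scaleC :: complex \<Rightarrow> 'a \<Rightarrow> 'a::complex_vector"
  by standard (fact scaleC_add_right scaleC_add_left scaleC_scaleC scaleC_one)+

definition linear_on :: "'v::complex_vector set \<Rightarrow> ('v \<Rightarrow> 'w::complex_vector) \<Rightarrow> bool" where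
  "linear_on S f \<longleftrightarrow> (\<forall>x\<in>S. \<forall>y\<in>S. f (x + y) = f x + f y) \<and> (\<forall>c. \<forall>x\<in>S. f (c *\<^sub>C x) = c *\<^sub>C f x)"


section \<open>The index sets and their orders\<close>

text \<open>
  A half-integer index i is encoded by the integer 2i: \<open>ev s\<close> encodes s and \<open>od s\<close> encodes
  s - 1/2. Hence an index i lies in \<open>\<int>\<close> iff its code is even, the parity 2(i + j) mod 2 of
  $E_{i,j}$ is the parity of the sum of the codes, and the code of \<open>-s + 1/2\<close> is \<open>od (1 - s)\<close>.
  A total order on a finite index set is given by the list of its elements in increasing order.
\<close>

definition ev :: "int \<Rightarrow> int" where "ev s = 2 * s"
definition od :: "int \<Rightarrow> int" where "od s = 2 * s - 1"

definition idx :: "nat \<Rightarrow> nat \<Rightarrow> nat \<Rightarrow> nat \<Rightarrow> int list" where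
  "idx p q m n = map ev [- int p..-1] @ map od [1 - int q..0] @ map ev [1..int m] @ map od [1..int n]"

definition before :: "int list \<Rightarrow> int \<Rightarrow> int \<Rightarrow> bool" where
  "before xs i j \<longleftrightarrow> (\<exists>a b. a < b \<and> b < length xs \<and> xs ! a = i \<and> xs ! b = j)"

definition sigma_order :: "nat \<Rightarrow> nat \<Rightarrow> nat \<Rightarrow> nat \<Rightarrow> nat \<Rightarrow> int list" where
  "sigma_order p q m n r =
     map od [1 - int r..- int q] @ map ev [- int p..-1] @ map od [1 - int q..0] @
     map ev [1..int m] @ map od [1..int n] @ map ev [int m + 1..int r]"

definition theta_order :: "nat \<Rightarrow> int list" where
  "theta_order r = map ev [1..int r] @ map od [1 - int r..0]"

definition pi_order :: "nat \<Rightarrow> nat \<Rightarrow> int list" where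
  "pi_order r r' = map ev [1..int r'] @ map od [1 - int r..0]"

definition theta'_order :: "nat \<Rightarrow> nat \<Rightarrow> int list" where
  "theta'_order r r' = map ev [1..int r] @ map od [1 - int r..0] @ map ev [int r + 1..int r']"


section \<open>Partitions and weights\<close>

text \<open>
  Sequences are functions on \<open>nat\<close> read at the arguments 1, 2, ...; the value at 0 is never used.
  Truncated subtraction on \<open>nat\<close> plays the role of the angle brackets.
\<close>

definition conj_part :: "(nat \<Rightarrow> nat) \<Rightarrow> nat \<Rightarrow> nat" where
  "conj_part \<nu> j = card {i. 1 \<le> i \<and> 1 \<le> j \<and> j \<le> \<nu> i}"

definition part_length :: "(nat \<Rightarrow> nat) \<Rightarrow> nat" where
  "part_length \<nu> = card {i. 1 \<le> i \<and> \<nu> i \<noteq> 0}"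

definition gen_parts :: "nat \<Rightarrow> nat \<Rightarrow> nat \<Rightarrow> nat \<Rightarrow> nat \<Rightarrow> (nat \<Rightarrow> int) set" where
  "gen_parts p q m n d = {la. (\<forall>i j. 1 \<le> i \<and> i \<le> j \<and> j \<le> d \<longrightarrow> la j \<le> la i) \<and>
     (m + 1 \<le> d \<longrightarrow> la (m + 1) \<le> int n) \<and>
     (p < d \<longrightarrow> - int q \<le> la (d - p))}"

definition plus_part :: "nat \<Rightarrow> (nat \<Rightarrow> int) \<Rightarrow> nat \<Rightarrow> nat" where
  "plus_part d la i = (if 1 \<le> i \<and> i \<le> d then nat (la i) else 0)"

definition minus_part :: "nat \<Rightarrow> (nat \<Rightarrow> int) \<Rightarrow> nat \<Rightarrow> nat" where
  "minus_part d la i = (if 1 \<le> i \<and> i \<le> d then nat (- la (d + 1 - i)) else 0)"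

definition eps :: "int \<Rightarrow> int \<Rightarrow> complex" where
  "eps i = (\<lambda>j. if j = i then 1 else 0)"

definition ring_wt :: "nat \<Rightarrow> nat \<Rightarrow> nat \<Rightarrow> nat \<Rightarrow> nat \<Rightarrow> (nat \<Rightarrow> int) \<Rightarrow> int \<Rightarrow> complex" where
  "ring_wt p q m n d la =
     - (\<Sum>s=1..p. of_nat (minus_part d la s - q) *\<^sub>C eps (ev (- int s)))
     - (\<Sum>s=1..q. of_nat (conj_part (minus_part d la) s) *\<^sub>C eps (od (1 - int s)))
     + (\<Sum>i=1..m. of_nat (plus_part d la i) *\<^sub>C eps (ev (int i)))
     + (\<Sum>i=1..n. of_nat (conj_part (plus_part d la) i - m) *\<^sub>C eps (od (int i)))
     - of_nat d *\<^sub>C ((\<Sum>s=1..p. eps (ev (- int s))) - (\<Sum>s=1..q. eps (od (1 - int s))))"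

text \<open>
  The partition \<open>\<mu>\<close> is the one whose conjugate is
  $(d-(\lambda^-)'_r, \ldots, d-(\lambda^-)'_1, (\lambda^+)'_1, (\lambda^+)'_2, \ldots)$.
  All columns of $\lambda^+$ are used, not just the first r: otherwise $\tilde\mu^{r|r}$ would
  not be the restriction of $\mathring\lambda^{(p,r|r,n)}$ when $\lambda^+_1 > r$.
\<close>

definition mu_conj :: "nat \<Rightarrow> nat \<Rightarrow> (nat \<Rightarrow> int) \<Rightarrow> nat \<Rightarrow> nat" where
  "mu_conj r d la j =
     (if j \<le> r then d - conj_part (minus_part d la) (r + 1 - j)
      else conj_part (plus_part d la) (j - r))"

definition mu_part :: "nat \<Rightarrow> nat \<Rightarrow> (nat \<Rightarrow> int) \<Rightarrow> nat \<Rightarrow> nat" where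
  "mu_part r d la = conj_part (mu_conj r d la)"

definition bar_wt :: "nat \<Rightarrow> nat \<Rightarrow> (nat \<Rightarrow> nat) \<Rightarrow> int \<Rightarrow> complex" where
  "bar_wt a b \<nu> =
     (\<Sum>i=1..a. of_nat (\<nu> i) *\<^sub>C eps (ev (int i)))
     + (\<Sum>i=1..b. of_nat (conj_part \<nu> i - a) *\<^sub>C eps (od (int i - int b)))"

definition tilde_wt :: "nat \<Rightarrow> nat \<Rightarrow> (nat \<Rightarrow> nat) \<Rightarrow> int \<Rightarrow> complex" where
  "tilde_wt a b \<nu> =
     (\<Sum>j=1..b. of_nat (conj_part \<nu> j) *\<^sub>C eps (od (int j - int b)))
     + (\<Sum>j=1..a. of_nat (\<nu> j - b) *\<^sub>C eps (ev (int j)))"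

definition ext_wt :: "nat \<Rightarrow> nat \<Rightarrow> nat \<Rightarrow> nat \<Rightarrow> nat \<Rightarrow> nat \<Rightarrow> (int \<Rightarrow> complex) \<Rightarrow> int \<Rightarrow> complex" where
  "ext_wt p q m n r d \<xi> j =
     (if j \<in> set (idx p q m n) then \<xi> j
      else if j \<in> od ` {1 - int r..- int q} then of_nat d
      else 0)"


section \<open>Modules over the general linear Lie superalgebra\<close>

text \<open>
  A module is a subspace of an ambient complex vector space, with its even part \<open>gr M False\<close>,
  its odd part \<open>gr M True\<close> and the operators \<open>act M i j\<close> by which $E_{i,j}$ acts.
\<close>

record 'v smod =
  gr :: "bool \<Rightarrow> 'v set"
  act :: "int \<Rightarrow> int \<Rightarrow> 'v \<Rightarrow> 'v"

definition space_of :: "'v::complex_vector smod \<Rightarrow> 'v set" where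
  "space_of M = {x + y | x y. x \<in> gr M False \<and> y \<in> gr M True}"

definition wt_space :: "int set \<Rightarrow> 'v::complex_vector smod \<Rightarrow> (int \<Rightarrow> complex) \<Rightarrow> 'v set" where
  "wt_space I M \<nu> = {v \<in> space_of M. \<forall>j\<in>I. act M j j v = \<nu> j *\<^sub>C v}"

definition wt_sum :: "int set \<Rightarrow> 'v::complex_vector smod \<Rightarrow> (int \<Rightarrow> complex) set \<Rightarrow> 'v set" where
  "wt_sum I M N = cvec.span (\<Union>\<nu>\<in>N. wt_space I M \<nu>)"

definition sing :: "int list \<Rightarrow> 'v::complex_vector smod \<Rightarrow> (int \<Rightarrow> complex) \<Rightarrow> 'v set" where
  "sing ord M \<nu> =
     {v \<in> space_of M. \<forall>i j. before ord i j \<longrightarrow> act M i j v = 0} \<inter> wt_space (set ord) M \<nu>"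

definition koszul :: "bool \<Rightarrow> bool \<Rightarrow> complex" where
  "koszul a b = (if a \<and> b then -1 else 1)"

definition supermodule :: "int set \<Rightarrow> 'v::complex_vector smod \<Rightarrow> bool" where
  "supermodule I M \<longleftrightarrow>
     (\<forall>a. cvec.subspace (gr M a)) \<and> gr M False \<inter> gr M True = {0} \<and>
     (\<forall>i\<in>I. \<forall>j\<in>I. linear_on (space_of M) (act M i j) \<and>
        (\<forall>a. act M i j ` gr M a \<subseteq> gr M (a \<noteq> odd (i + j)))) \<and>
     (\<forall>i\<in>I. \<forall>j\<in>I. \<forall>k\<in>I. \<forall>l\<in>I. \<forall>v\<in>space_of M.
        act M i j (act M k l v) - koszul (odd (i + j)) (odd (k + l)) *\<^sub>C act M k l (act M i j v) =
        (if j = k then act M i l v else 0)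
        - koszul (odd (i + j)) (odd (k + l)) *\<^sub>C (if i = l then act M k j v else 0)) \<and>
     (\<forall>\<nu>. \<exists>a. wt_space I M \<nu> \<subseteq> gr M a)"

definition submodule :: "int set \<Rightarrow> 'v::complex_vector smod \<Rightarrow> 'v set \<Rightarrow> bool" where
  "submodule I M N \<longleftrightarrow> cvec.subspace N \<and>
     N = {x + y | x y. x \<in> N \<inter> gr M False \<and> y \<in> N \<inter> gr M True} \<and>
     (\<forall>i\<in>I. \<forall>j\<in>I. act M i j ` N \<subseteq> N)"

definition irreducible_module :: "int set \<Rightarrow> 'v::complex_vector smod \<Rightarrow> bool" where
  "irreducible_module I M \<longleftrightarrow> supermodule I M \<and> space_of M \<noteq> {0} \<and>
     (\<forall>N. submodule I M N \<longrightarrow> N = {0} \<or> N = space_of M)"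

definition is_irr_hw :: "int list \<Rightarrow> (int \<Rightarrow> complex) \<Rightarrow> 'v::complex_vector smod \<Rightarrow> bool" where
  "is_irr_hw ord \<xi> M \<longleftrightarrow> irreducible_module (set ord) M \<and> (\<exists>v\<in>sing ord M \<xi>. v \<noteq> 0)"

text \<open>
  \<open>identifies I M M' S f\<close>: f identifies the module M over the Lie superalgebra with index
  set I with the subspace S of M'.
\<close>

definition identifies ::
  "int set \<Rightarrow> 'v::complex_vector smod \<Rightarrow> 'w::complex_vector smod \<Rightarrow> 'w set \<Rightarrow> ('v \<Rightarrow> 'w) \<Rightarrow> bool" where
  "identifies I M M' S f \<longleftrightarrow>
     linear_on (space_of M) f \<and> bij_betw f (space_of M) S \<and>
     (\<forall>a. f ` gr M a \<subseteq> gr M' a) \<and>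
     (\<forall>i\<in>I. \<forall>j\<in>I. \<forall>v\<in>space_of M. f (act M i j v) = act M' i j (f v))"


section \<open>Tensor products\<close>

text \<open>
  The tensor product of subspaces S 1, ..., S l is realised inside the dual of the space of
  multilinear forms: the pure tensor of \<open>vs 1, ..., vs l\<close> is evaluation at \<open>vs\<close>. Over a field
  this is a model of the tensor product, in any dimension.
\<close>

type_synonym 'v tensor = "((nat \<Rightarrow> 'v) \<Rightarrow> complex) \<Rightarrow> complex"

definition multilinear :: "nat \<Rightarrow> (nat \<Rightarrow> 'v::complex_vector set) \<Rightarrow> ((nat \<Rightarrow> 'v) \<Rightarrow> complex) \<Rightarrow> bool" where
  "multilinear l S \<phi> \<longleftrightarrow>
     (\<forall>vs ws. (\<forall>a\<in>{1..l}. vs a = ws a) \<longrightarrow> \<phi> vs = \<phi> ws) \<and>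
     (\<forall>a\<in>{1..l}. \<forall>vs. (\<forall>b\<in>{1..l}. vs b \<in> S b) \<longrightarrow> linear_on (S a) (\<lambda>x. \<phi> (vs(a := x))))"

definition pure_tensor :: "nat \<Rightarrow> (nat \<Rightarrow> 'v::complex_vector set) \<Rightarrow> (nat \<Rightarrow> 'v) \<Rightarrow> 'v tensor" where
  "pure_tensor l S vs = (\<lambda>\<phi>. if multilinear l S \<phi> then \<phi> vs else 0)"

text \<open>
  The tensor product of linear maps \<open>f a\<close> with values in \<open>S a\<close>; it sends the pure tensor of
  \<open>vs\<close> to the pure tensor of \<open>\<lambda>a. f a (vs a)\<close>.
\<close>

definition tensor_map ::
  "nat \<Rightarrow> (nat \<Rightarrow> 'w::complex_vector set) \<Rightarrow> (nat \<Rightarrow> 'v \<Rightarrow> 'w) \<Rightarrow> 'v tensor \<Rightarrow> 'w tensor" where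
  "tensor_map l S f T = (\<lambda>\<phi>. if multilinear l S \<phi> then T (\<lambda>vs. \<phi> (\<lambda>a. f a (vs a))) else 0)"

definition parity_op :: "'v::complex_vector smod \<Rightarrow> 'v \<Rightarrow> 'v" where
  "parity_op M v = (THE w. \<exists>x\<in>gr M False. \<exists>y\<in>gr M True. v = x + y \<and> w = x - y)"

text \<open>
  The action of $E_{i,j}^{(a)}$ (that is, of $E_{i,j}$ in the a-th slot) with the sign rule: an
  odd operator picks up the parities of the factors to its left.
\<close>

definition slot_act ::
  "nat \<Rightarrow> (nat \<Rightarrow> 'v::complex_vector smod) \<Rightarrow> nat \<Rightarrow> int \<Rightarrow> int \<Rightarrow> 'v tensor \<Rightarrow> 'v tensor" where
  "slot_act l M a i j = tensor_map l (\<lambda>b. space_of (M b))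
     (\<lambda>b. if b < a \<and> odd (i + j) then parity_op (M b) else if b = a then act (M b) i j else id)"

definition tensor_mod :: "nat \<Rightarrow> (nat \<Rightarrow> 'v::complex_vector smod) \<Rightarrow> 'v tensor smod" where
  "tensor_mod l M = \<lparr>
     gr = (\<lambda>c. cvec.span {pure_tensor l (\<lambda>b. space_of (M b)) vs | vs s.
             (\<forall>b\<in>{1..l}. vs b \<in> gr (M b) (s b)) \<and> odd (card {b\<in>{1..l}. s b}) = c}),
     act = (\<lambda>i j T. \<Sum>a=1..l. slot_act l M a i j T) \<rparr>"


section \<open>Enveloping algebras\<close>

definition free_alg :: "'g set \<Rightarrow> ('g list \<Rightarrow> complex) ring" where
  "free_alg G = \<lparr>
     carrier = {f. finite {w. f w \<noteq> 0} \<and> (\<forall>w. f w \<noteq> 0 \<longrightarrow> set w \<subseteq> G)},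
     monoid.mult = (\<lambda>f g w. \<Sum>k\<le>length w. f (take k w) * g (drop k w)),
     one = (\<lambda>w. if w = [] then 1 else 0),
     ring.zero = (\<lambda>_. 0),
     add = (\<lambda>f g w. f w + g w) \<rparr>"

definition word :: "'g list \<Rightarrow> 'g list \<Rightarrow> complex" where
  "word w = (\<lambda>u. if u = w then 1 else 0)"

text \<open>
  \<open>env I l\<close> is the l-th tensor power (as a superalgebra) of the universal enveloping algebra of
  the Lie superalgebra with index set I, presented by generators and relations: the generator
  \<open>(a, i, j)\<close> is $E_{i,j}^{(a)}$, and generators in different slots supercommute. In particular
  \<open>env I 1\<close> is the enveloping algebra itself.
\<close>

type_synonym gen = "nat \<times> int \<times> int"

abbreviation env_free :: "int set \<Rightarrow> nat \<Rightarrow> (gen list \<Rightarrow> complex) ring" where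
  "env_free I l \<equiv> free_alg ({1..l} \<times> I \<times> I)"

definition env_rels :: "int set \<Rightarrow> nat \<Rightarrow> (gen list \<Rightarrow> complex) set" where
  "env_rels I l =
     {word [(a, i, j), (b, k, h)]
        - koszul (odd (i + j)) (odd (k + h)) *\<^sub>C word [(b, k, h), (a, i, j)]
        - (if a = b then (if j = k then word [(a, i, h)] else 0)
             - koszul (odd (i + j)) (odd (k + h)) *\<^sub>C (if i = h then word [(a, k, j)] else 0)
           else 0)
      | a b i j k h. a \<in> {1..l} \<and> b \<in> {1..l} \<and> i \<in> I \<and> j \<in> I \<and> k \<in> I \<and> h \<in> I}"

definition env_ideal :: "int set \<Rightarrow> nat \<Rightarrow> (gen list \<Rightarrow> complex) set" where
  "env_ideal I l = Idl\<^bsub>env_free I l\<^esub> (env_rels I l)"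

definition env :: "int set \<Rightarrow> nat \<Rightarrow> (gen list \<Rightarrow> complex) set ring" where
  "env I l = env_free I l Quot env_ideal I l"

definition env_class :: "int set \<Rightarrow> nat \<Rightarrow> (gen list \<Rightarrow> complex) \<Rightarrow> (gen list \<Rightarrow> complex) set" where
  "env_class I l f = env_ideal I l +>\<^bsub>env_free I l\<^esub> f"

text \<open>The product of the elements $E_{i,j}$, (i, j) running through a list, in the enveloping algebra.\<close>

definition env_prod :: "int set \<Rightarrow> (int \<times> int) list \<Rightarrow> (gen list \<Rightarrow> complex) set" where
  "env_prod I w =
     foldr (\<lambda>(i, j) x. env_class I 1 (word [(1, i, j)]) \<otimes>\<^bsub>env I 1\<^esub> x) w \<one>\<^bsub>env I 1\<^esub>"

text \<open>
  The operator by which an element X of an enveloping algebra acts when each generator g acts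
  by \<open>\<rho> g\<close>; if the relations hold for \<open>\<rho>\<close>, the choice of the representative f is irrelevant.
\<close>

definition env_act ::
  "('g \<Rightarrow> 'v \<Rightarrow> 'v) \<Rightarrow> ('g list \<Rightarrow> complex) set \<Rightarrow> 'v \<Rightarrow> 'v::complex_vector" where
  "env_act \<rho> X v = (let f = (SOME f. f \<in> X) in \<Sum>w | f w \<noteq> 0. f w *\<^sub>C foldr \<rho> w v)"

definition module_act ::
  "'v::complex_vector smod \<Rightarrow> (gen list \<Rightarrow> complex) set \<Rightarrow> 'v \<Rightarrow> 'v" where
  "module_act M = env_act (\<lambda>(_, i, j). act M i j)"

definition tensor_act ::
  "nat \<Rightarrow> (nat \<Rightarrow> 'v::complex_vector smod) \<Rightarrow> (gen list \<Rightarrow> complex) set \<Rightarrow> 'v tensor \<Rightarrow> 'v tensor" where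
  "tensor_act l M = env_act (\<lambda>(a, i, j). slot_act l M a i j)"


section \<open>Pseudo-differential operators\<close>

definition int_binom :: "int \<Rightarrow> nat \<Rightarrow> int" where
  "int_binom a k = (\<Prod>i<k. a - int i) div fact k"

text \<open>A series f has \<open>f i j\<close> as its coefficient of $z^i \partial_z^j$.\<close>

definition psmon :: "('a, 'b) ring_scheme \<Rightarrow> int \<Rightarrow> int \<Rightarrow> 'a \<Rightarrow> int \<Rightarrow> int \<Rightarrow> 'a" where
  "psmon R k l a = (\<lambda>i j. if i = k \<and> j = l then a else \<zero>\<^bsub>R\<^esub>)"

definition psdo :: "('a, 'b) ring_scheme \<Rightarrow> (int \<Rightarrow> int \<Rightarrow> 'a) ring" where
  "psdo R = \<lparr>
     carrier = {f. (\<forall>i j. f i j \<in> carrier R) \<and>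
                   (\<exists>s t. \<forall>i j. f i j \<noteq> \<zero>\<^bsub>R\<^esub> \<longrightarrow> i \<le> t \<and> j \<le> s)},
     monoid.mult = (\<lambda>f g i j. finsum R
        (\<lambda>(k, l, u). add_pow R (int_binom l u * int_binom (i - k + int u) u * fact u :: int)
           (f k l \<otimes>\<^bsub>R\<^esub> g (i - k + int u) (j - l + int u)))
        {(k, l, u). f k l \<noteq> \<zero>\<^bsub>R\<^esub> \<and> g (i - k + int u) (j - l + int u) \<noteq> \<zero>\<^bsub>R\<^esub>}),
     one = psmon R 0 0 \<one>\<^bsub>R\<^esub>,
     ring.zero = (\<lambda>_ _. \<zero>\<^bsub>R\<^esub>),
     add = (\<lambda>f g i j. f i j \<oplus>\<^bsub>R\<^esub> g i j) \<rparr>"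

abbreviation deriv_op :: "('a, 'b) ring_scheme \<Rightarrow> int \<Rightarrow> int \<Rightarrow> 'a" where
  "deriv_op R \<equiv> psmon R 0 1 \<one>\<^bsub>R\<^esub>"

definition complex_ring :: "complex ring" where
  "complex_ring = \<lparr>carrier = UNIV, monoid.mult = (*), one = 1, ring.zero = 0, add = (+)\<rparr>"

abbreviation cpsdo :: "(int \<Rightarrow> int \<Rightarrow> complex) ring" where
  "cpsdo \<equiv> psdo complex_ring"

definition apply_psdo :: "(int \<Rightarrow> int \<Rightarrow> complex) \<Rightarrow> 'v::complex_vector \<Rightarrow> int \<Rightarrow> int \<Rightarrow> 'v" where
  "apply_psdo D v = (\<lambda>i j. D i j *\<^sub>C v)"

text \<open>Expansion at infinity of \<open>\<Sum>a=1..l. d a / (z - \<zeta> a)\<close>.\<close>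

definition c_series :: "nat \<Rightarrow> (nat \<Rightarrow> nat) \<Rightarrow> (nat \<Rightarrow> complex) \<Rightarrow> int \<Rightarrow> int \<Rightarrow> complex" where
  "c_series l d \<zeta> = (\<lambda>k j. if j = 0 \<and> k < 0
      then \<Sum>a=1..l. of_nat (d a) * \<zeta> a ^ nat (- k - 1) else 0)"


section \<open>Berezinian, column determinant and Gaudin algebra\<close>

definition is_mat_inv :: "('a, 'b) ring_scheme \<Rightarrow> int set \<Rightarrow> (int \<Rightarrow> int \<Rightarrow> 'a) \<Rightarrow> (int \<Rightarrow> int \<Rightarrow> 'a) \<Rightarrow> bool" where
  "is_mat_inv P J A B \<longleftrightarrow>
     (\<forall>i\<in>J. \<forall>j\<in>J. B i j \<in> carrier P) \<and>
     (\<forall>i\<in>J. \<forall>j\<in>J. finsum P (\<lambda>k. A i k \<otimes>\<^bsub>P\<^esub> B k j) J = (if i = j then \<one>\<^bsub>P\<^esub> else \<zero>\<^bsub>P\<^esub>) \<and>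
                   finsum P (\<lambda>k. B i k \<otimes>\<^bsub>P\<^esub> A k j) J = (if i = j then \<one>\<^bsub>P\<^esub> else \<zero>\<^bsub>P\<^esub>))"

definition mat_inv :: "('a, 'b) ring_scheme \<Rightarrow> int set \<Rightarrow> (int \<Rightarrow> int \<Rightarrow> 'a) \<Rightarrow> int \<Rightarrow> int \<Rightarrow> 'a" where
  "mat_inv P J A = (SOME B. is_mat_inv P J A B)"

definition quasidet :: "('a, 'b) ring_scheme \<Rightarrow> int list \<Rightarrow> (int \<Rightarrow> int \<Rightarrow> 'a) \<Rightarrow> nat \<Rightarrow> 'a" where
  "quasidet P ord A t = inv\<^bsub>P\<^esub> (mat_inv P (set (take (Suc t) ord)) A (ord ! t) (ord ! t))"

definition berezinian :: "('a, 'b) ring_scheme \<Rightarrow> int list \<Rightarrow> (int \<Rightarrow> int \<Rightarrow> 'a) \<Rightarrow> 'a" where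
  "berezinian P ord A = foldr (\<lambda>t x.
      (if even (ord ! t) then quasidet P ord A t else inv\<^bsub>P\<^esub> (quasidet P ord A t)) \<otimes>\<^bsub>P\<^esub> x)
      [0..<length ord] \<one>\<^bsub>P\<^esub>"

definition cdet :: "('a, 'b) ring_scheme \<Rightarrow> nat \<Rightarrow> (nat \<Rightarrow> nat \<Rightarrow> 'a) \<Rightarrow> 'a" where
  "cdet P N A = finsum P
     (\<lambda>\<tau>. add_pow P (sign \<tau> :: int) (foldr (\<lambda>k x. A (\<tau> k) k \<otimes>\<^bsub>P\<^esub> x) [1..<Suc N] \<one>\<^bsub>P\<^esub>))
     {\<tau>. \<tau> permutes {1..N}}"

text \<open>The expansion at infinity of $\sum_a E_{i,j}^{(a)} / (z - \zeta_a)$.\<close>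

definition E_series ::
  "int set \<Rightarrow> nat \<Rightarrow> (nat \<Rightarrow> complex) \<Rightarrow> int \<Rightarrow> int \<Rightarrow> int \<Rightarrow> int \<Rightarrow> (gen list \<Rightarrow> complex) set" where
  "E_series I l \<zeta> i j = (\<lambda>k s. if s = 0 \<and> k < 0
      then env_class I l (\<Sum>a=1..l. \<zeta> a ^ nat (- k - 1) *\<^sub>C word [(a, i, j)])
      else \<zero>\<^bsub>env I l\<^esub>)"

definition gaudin_matrix ::
  "int set \<Rightarrow> nat \<Rightarrow> (nat \<Rightarrow> complex) \<Rightarrow> int \<Rightarrow> int \<Rightarrow> int \<Rightarrow> int \<Rightarrow> (gen list \<Rightarrow> complex) set" where
  "gaudin_matrix I l \<zeta> i j =
     (if i = j then deriv_op (env I l) else \<zero>\<^bsub>psdo (env I l)\<^esub>)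
     \<ominus>\<^bsub>psdo (env I l)\<^esub>
     (if odd i then \<ominus>\<^bsub>psdo (env I l)\<^esub> E_series I l \<zeta> i j else E_series I l \<zeta> i j)"

definition ber_L ::
  "nat \<Rightarrow> nat \<Rightarrow> nat \<Rightarrow> nat \<Rightarrow> nat \<Rightarrow> (nat \<Rightarrow> complex) \<Rightarrow> int \<Rightarrow> int \<Rightarrow> (gen list \<Rightarrow> complex) set" where
  "ber_L p q m n l \<zeta> =
     berezinian (psdo (env (set (idx p q m n)) l)) (idx p q m n) (gaudin_matrix (set (idx p q m n)) l \<zeta>)"

definition cdet_L :: "nat \<Rightarrow> nat \<Rightarrow> (nat \<Rightarrow> complex) \<Rightarrow> int \<Rightarrow> int \<Rightarrow> (gen list \<Rightarrow> complex) set" where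
  "cdet_L N l \<zeta> =
     cdet (psdo (env (set (idx 0 0 N 0)) l)) N
       (\<lambda>i j. gaudin_matrix (set (idx 0 0 N 0)) l \<zeta> (ev (int i)) (ev (int j)))"

text \<open>A complex subalgebra is a subring containing the scalars.\<close>

definition gaudin_alg ::
  "nat \<Rightarrow> nat \<Rightarrow> nat \<Rightarrow> nat \<Rightarrow> nat \<Rightarrow> (nat \<Rightarrow> complex) \<Rightarrow> (gen list \<Rightarrow> complex) set set" where
  "gaudin_alg p q m n l \<zeta> =
     generate_ring (env (set (idx p q m n)) l)
       (range (\<lambda>c. env_class (set (idx p q m n)) l (c *\<^sub>C word [])) \<union>
        {ber_L p q m n l \<zeta> k i | k i. True})"

text \<open>The image of the Gaudin algebra in the endomorphisms of a subspace V of the tensor product of the modules \<open>M a\<close>.\<close>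

definition gaudin_image ::
  "nat \<Rightarrow> nat \<Rightarrow> nat \<Rightarrow> nat \<Rightarrow> nat \<Rightarrow> (nat \<Rightarrow> complex) \<Rightarrow> (nat \<Rightarrow> 'v::complex_vector smod) \<Rightarrow>
   'v tensor set \<Rightarrow> ('v tensor \<Rightarrow> 'v tensor) set" where
  "gaudin_image p q m n l \<zeta> M V = (\<lambda>X. restrict (tensor_act l M X) V) ` gaudin_alg p q m n l \<zeta>"

definition eigenvector :: "('v::complex_vector \<Rightarrow> 'v) set \<Rightarrow> 'v set \<Rightarrow> 'v \<Rightarrow> bool" where
  "eigenvector Ops V v \<longleftrightarrow> v \<in> V \<and> v \<noteq> 0 \<and> (\<forall>T\<in>Ops. \<exists>c. T v = c *\<^sub>C v)"

definition eigenbasis :: "('v::complex_vector \<Rightarrow> 'v) set \<Rightarrow> 'v set \<Rightarrow> 'v set \<Rightarrow> bool" where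
  "eigenbasis Ops V B \<longleftrightarrow>
     cvec.independent B \<and> cvec.span B = V \<and> (\<forall>v\<in>B. eigenvector Ops V v)"

text \<open>The scalar operator by which the coefficients of B act on a common eigenvector v.\<close>

definition assoc_psdo ::
  "nat \<Rightarrow> (nat \<Rightarrow> 'v::complex_vector smod) \<Rightarrow> (int \<Rightarrow> int \<Rightarrow> (gen list \<Rightarrow> complex) set) \<Rightarrow>
   'v tensor \<Rightarrow> int \<Rightarrow> int \<Rightarrow> complex" where
  "assoc_psdo l M B v = (\<lambda>k i. THE c. tensor_act l M (B k i) v = c *\<^sub>C v)"

end

theory Submission
  imports Defs "HOL-Library.Poly_Mapping" "HOL-Computational_Algebra.Formal_Power_Series"
begin

text \<open>Evaluating the Berezinian of the Gaudin matrix on a tensor product, a vector v is an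
eigenvector with operator D iff all coefficients of the Berezinian act on v by those of D. Two facts
carry the proof. First, the Gaudin matrix is a Manin matrix, so its Berezinian does not change when
neighbouring indices of opposite parities are transposed in the order, and it commutes with the
diagonal action; hence A, X and Y preserve operators. Second, in an order listing outermost the
indices with prescribed weight, an extremal sum of weight spaces makes the Gaudin matrix block triangular, with
\<open>\<partial> + c\<close> or \<open>\<partial>\<close> (or an inverse) as diagonal entry for each of these; the large Berezinian
is then the small one multiplied by powers of \<open>\<partial> + c\<close> on the left and of \<open>\<partial>\<close> on the right.
The correspondence composes four such truncations.\<close>

section \<open>The ring of pseudo-differential operators\<close>

text \<open>The statement forms Berezinians, with inverses picked by choice, over quotients of free
  algebras with carriers. The relations of the enveloping algebra enter the Manin property, but not
  the existence of the inverses: the Gaudin matrix is \<partial> plus order 0 already over the free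
  algebra. The Berezinian is therefore formed there, in type-class rings, and pushed to the carrier
  rings and to rings of operators. The exponents come from comparing orders. Let C be \<partial> + c
  and let D, D'', E be the series of corresponding vectors in L, L'', V. In L' the default order
  gives C^p D'' \<partial>^(-n), the order sigma gives C^(-(r-q)) D \<partial>^(r-m). In V' the
  order pi gives E \<partial>^(-r), the order theta' gives D'' \<partial>^(r'-r). Equating both
  pairs yields D = C^(p-q+r) E \<partial>^(m-n-r-r'). All multipliers are units, so every step is an
  equivalence and both directions come together. The main obstacle is extremality: the highest
  weights for the reordered Borel subalgebras are computed by odd reflections, and a total weight
  that is extremal must be shown extremal in each slot.\<close>

definition wick :: "int=>int=>nat=>int" where
 "wick l m u = int_binom l u*int_binom m u*fact u"

text \<open>A product of \<open>k\<close> consecutive integers is divisible by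
  \<open>fact k\<close>, so the integer division in \<open>int_binom\<close> is exact and the
  identities for real binomials apply.\<close>

lemma int_binom_gbinomial: "real_of_int (int_binom a k) = real_of_int a gchoose k"
proof -
 have "(fact k::int) dvd (\<Prod>i = 0..<k. a - int i)" unfolding gbinomial_int_mult_fact[symmetric] by (rule dvd_triv_left)
 hence "fact k*int_binom a k = (\<Prod>i = 0..<k. a - int i)" unfolding int_binom_def atLeast0LessThan by (rule dvd_mult_div_cancel)
 hence "real_of_int (fact k*int_binom a k) = real_of_int (\<Prod>i = 0..<k. a - int i)" by simp
 hence "fact k*real_of_int (int_binom a k) = (\<Prod>i = 0..<k. real_of_int a - real i)" by simp
 hence "fact k*real_of_int (int_binom a k) = fact k*(real_of_int a gchoose k)" by (simp only: gbinomial_mult_fact)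
 thus ?thesis by simp
qed

text \<open>Up to the factorial these are falling factorials, and a falling factorial of length
  \<open>a + b\<close> splits after its first \<open>a\<close> factors.\<close>

lemma gbinomial_fact_split:
 "(x gchoose (a + b))*fact (a + b) = (x gchoose a)*fact a*(((x::real) - of_nat a gchoose b)*fact b)"
proof -
 have "(\<Prod>i = 0..<a+b. x - of_nat i) = (\<Prod>i = 0..<a. x - of_nat i)*(\<Prod>i = 0..<b. x - of_nat a - of_nat i)"
  using prod.atLeastLessThan_concat[of 0 a "a+b" "%i. x - of_nat i"]
   prod.shift_bounds_nat_ivl[of "%i. x - of_nat i" 0 a b] by (simp add: add.commute diff_diff_eq)
 thus ?thesis by (simp add: gbinomial_mult_fact')
qed

text \<open>The coefficient identity behind associativity: both sides are the coefficient of
 \<open>z^(k+m+p-N) \<partial>^(l+n+q-N)\<close> in the product of three monomials.\<close>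

lemma wick_assoc:
 "(SUM u<=N. wick l m u*wick (l + n - int u) p (N - u)) =
  (SUM v<=N. wick n p v*wick l (m + p - int v) (N - v))"
proof -
 let ?l = "real_of_int l" and ?m = "real_of_int m" and ?n = "real_of_int n" and ?p = "real_of_int p"
 \<comment> \<open>\<open>wick l m u\<close> formally counts the ways in which \<open>u\<close> of
   \<open>l\<close> derivatives hit z^m. In \<open>T u v\<close>, \<open>u\<close> derivatives of
   \<partial>^l hit z^m, \<open>v\<close> of \<partial>^n hit z^p, and the remaining
   \<open>N - u - v\<close> of \<partial>^l hit z^p. Either side of the claim becomes the double sum
   of \<open>T\<close> by one use of Vandermonde's identity.\<close>
 define T where "T u v = (?n gchoose v)*(?m gchoose u)*(?l gchoose u)*fact u*((?p gchoose (N - u))*fact (N - u))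
   * ((?l - real u) gchoose (N - u - v))" for u v
 have key: "(?n gchoose v)*(?p gchoose v)*fact v*((?l gchoose (N - v))*fact (N - v)*((?m gchoose u)*((?p - real v) gchoose (N - v - u)))) = T u v"
  if uv: "u + v<=N" for u v
 proof -
  have e1: "(?p gchoose (N - u))*fact (N - u) = (?p gchoose v)*fact v*((?p - real v gchoose (N - v - u))*fact (N - v - u))"
   using gbinomial_fact_split[of ?p v "N - v - u"] uv by (simp add: add.commute)
  have e2: "(?l gchoose (N - v))*fact (N - v) = (?l gchoose u)*fact u*((?l - real u gchoose (N - u - v))*fact (N - u - v))"
   using gbinomial_fact_split[of ?l u "N - u - v"] uv by (simp add: add.commute)
  have e3: "N - u - v = N - v - u" by simp
  show ?thesis unfolding T_def e1 e2 e3 by (simp add: algebra_simps)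
 qed
 have "real_of_int (SUM v<=N. wick n p v*wick l (m + p - int v) (N - v)) =
   (SUM v<=N. (?n gchoose v)*(?p gchoose v)*fact v*((?l gchoose (N - v))*((?m + (?p - real v)) gchoose (N - v))*fact (N - v)))"
  by (simp add: wick_def int_binom_gbinomial add_diff_eq)
 also have "... = (SUM v<=N. SUM u<=N - v. (?n gchoose v)*(?p gchoose v)*fact v*((?l gchoose (N - v))*fact (N - v)*((?m gchoose u)*((?p - real v) gchoose (N - v - u)))))"
  by (rule sum.cong) (simp_all add: gbinomial_Vandermonde[symmetric] sum_distrib_left sum_distrib_right atMost_atLeast0 ac_simps)
 also have "... = (SUM v<=N. SUM u<=N - v. T u v)" by (intro sum.cong refl) (rule key, auto)
 also have "... = (SUM u<=N. SUM v<=N - u. T u v)" by (subst (1 2) sum.Sigma; (simp; fail)?)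
    (rule sum.reindex_bij_witness[where i = "%(u, v). (v, u)" and j = "%(u, v). (v, u)"], auto)
 also have "... = (SUM u<=N. (?m gchoose u)*(?l gchoose u)*fact u*((?p gchoose (N - u))*fact (N - u))*((?n + (?l - real u)) gchoose (N - u)))"
  by (rule sum.cong) (simp_all add: T_def gbinomial_Vandermonde[symmetric] sum_distrib_left sum_distrib_right atMost_atLeast0 ac_simps)
 also have "... = real_of_int (SUM u<=N. wick l m u*wick (l + n - int u) p (N - u))"
  by (simp add: wick_def int_binom_gbinomial algebra_simps)
 finally show ?thesis by linarith
qed

lemma wick_0 [simp]: "wick l m 0 = 1" by (simp add: wick_def int_binom_def)

lemma wick_left_0: "wick 0 m u = (if u = 0 then 1 else 0)" by (cases u) (simp_all add: wick_def int_binom_def lessThan_Suc_eq_insert_0)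

lemma wick_right_0: "wick l 0 u = (if u = 0 then 1 else 0)" by (cases u) (simp_all add: wick_def int_binom_def lessThan_Suc_eq_insert_0)

definition bounded :: "(int=>int=>'a::zero)=>int=>int=>bool" where
 "bounded f t s \<longleftrightarrow> (ALL i j. f i j~=0-->i<=t & j<=s)"

lemma boundedD: "bounded f t s==>f i j~=0==>i<=t & j<=s" by (auto simp: bounded_def)

lemma bounded_mono: "bounded f t s==>t<=t'==>s<=s'==>bounded f t' s'"
 by (force simp: bounded_def)

text \<open>The box is determined by the bounds and not by the supports. It is finite and common to
  all series with these bounds, so that products can be added and regrouped term by term.\<close>

definition star_box :: "int=>int=>int=>int=>int=>int=>(int \<times> int \<times> int \<times> int \<times> nat) set" where
 "star_box t s t' s' i j = {(k, l, m, n, u). k<=t & l<=s & m<=t' & n<=s' &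
   k + m - int u = i & l + n - int u = j}"

lemma finite_star_box: "finite (star_box t s t' s' i j)"
proof (rule finite_subset)
 show "star_box t s t' s' i j<={i-t'..t} \<times> {j-s'..s} \<times> {i-t..t'} \<times> {j-s..s'} \<times> {..nat (t+t'-i)}"
  by (auto simp: star_box_def)
qed simp

definition star :: "(int=>int=>'a::ring_1)=>(int=>int=>'a)=>int=>int=>'a" where
 "star f g i j = (SUM (k, l, m, n, u):{(k, l, m, n, u). f k l~=0 & g m n~=0 &
   k + m - int u = i & l + n - int u = j}. of_int (wick l m u)*(f k l*g m n))"

lemma star_box:
 assumes "bounded f t s" "bounded g t' s'"
 shows "star f g i j = (SUM (k, l, m, n, u):star_box t s t' s' i j. of_int (wick l m u)*(f k l*g m n))" unfolding star_def
 by (rule sum.mono_neutral_left[OF finite_star_box]) (use assms in \<open>auto simp: star_box_def bounded_def\<close>)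

lemma star_nonzero:
 assumes "star f g i j~=0"
 shows "EX k l m n u. f k l~=0 & g m n~=0 & k + m - int u = i & l + n - int u = j"
proof -
 obtain x where "x:{(k, l, m, n, u). f k l~=0 & g m n~=0 & k + m - int u = i & l + n - int u = j}"
  by (rule sum.not_neutral_contains_not_neutral[OF assms[unfolded star_def]])
 moreover obtain k l m n u where "x = (k, l, m, n, u)" by (cases x)
 ultimately have "f k l~=0 & g m n~=0 & k + m - int u = i & l + n - int u = j" by simp
 thus ?thesis by (intro exI)
qed

lemma bounded_star:
 assumes "bounded f t s" "bounded g t' s'"
 shows "bounded (star f g) (t + t') (s + s')" unfolding bounded_def
proof (intro allI impI)
 fix i j assume "star f g i j~=0"
 from star_nonzero[OF this] obtain k l m n u where "f k l~=0" "g m n~=0" "k + m - int u = i" "l + n - int u = j" by blast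
 with boundedD[OF assms(1) \<open>f k l \<noteq> 0\<close>] boundedD[OF assms(2) \<open>g m n \<noteq> 0\<close>]
 show "i<=t + t' & j<=s + s'" by linarith
qed

text \<open>Both sides are sums over three monomials, the total number \<open>N\<close> of
  derivatives spent on powers of z, and a splitting of \<open>N\<close> into two. For fixed
  monomials and \<open>N\<close> the scalars agree by \<open>wick_assoc\<close>.\<close>

lemma star_assoc:
 assumes f: "bounded f t1 s1" and g: "bounded g t2 s2" and h: "bounded h t3 s3"
 shows "star (star f g) h i j = star f (star g h) i j"
proof -
 define \<Theta> where "\<Theta> = {(k, l, m, n, p, q, N). k<=t1 & l<=s1 & m<=t2 & n<=s2 & p<=t3 & q<=s3 &
   k + m + p - int N = i & l + n + q - int N = j}"
 have fin: "finite \<Theta>"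
 proof (rule finite_subset)
  show "\<Theta><={i-t2-t3..t1} \<times> {j-s2-s3..s1} \<times> {i-t1-t3..t2} \<times> {j-s1-s3..s2} \<times> {i-t1-t2..t3} \<times> {j-s1-s2..s3} \<times> {..nat (t1+t2+t3-i)}"
   by (auto simp: \<Theta>_def)
 qed simp
 have "star (star f g) h i j = (SUM (k', l', p, q, v):star_box (t1+t2) (s1+s2) t3 s3 i j. of_int (wick l' p v) *
    ((SUM (k, l, m, n, u):star_box t1 s1 t2 s2 k' l'. of_int (wick l m u)*(f k l*g m n))*h p q))"
  by (simp add: star_box[OF bounded_star[OF f g] h] star_box[OF f g])
 also have "... = (SUM (k', l', p, q, v):star_box (t1+t2) (s1+s2) t3 s3 i j.
    (SUM (k, l, m, n, u):star_box t1 s1 t2 s2 k' l'. of_int (wick l m u*wick l' p v)*(f k l*(g m n*h p q))))"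
  by (intro sum.cong refl)
    (auto simp: sum_distrib_left sum_distrib_right split_def mult.assoc[symmetric] Ints_of_int
       intro!: sum.cong; metis mult.assoc mult_of_int_commute)
 also have "... = (SUM (k, l, m, n, p, q, N):\<Theta>. SUM u<=N. of_int (wick l m u*wick (l + n - int u) p (N - u))*(f k l*(g m n*h p q)))"
  unfolding split_def
  apply (subst sum.Sigma[OF finite_star_box], use finite_star_box in blast)
  apply (subst sum.Sigma[OF fin], blast)
  apply (rule sum.reindex_bij_witness[where
    i = "%((k,l,m,n,p,q,N),u). ((k+m-int u, l+n-int u, p, q, N-u), (k,l,m,n,u))" and
    j = "%((k',l',p,q,v),(k,l,m,n,u)). ((k,l,m,n,p,q,u+v),u)"]) by (auto simp: star_box_def \<Theta>_def)
 also have "... = (SUM (k, l, m, n, p, q, N):\<Theta>. of_int (SUM u<=N. wick l m u*wick (l + n - int u) p (N - u))*(f k l*(g m n*h p q)))"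
  by (simp add: sum_distrib_right split_def)
 also have "... = (SUM (k, l, m, n, p, q, N):\<Theta>. of_int (SUM v<=N. wick n p v*wick l (m + p - int v) (N - v))*(f k l*(g m n*h p q)))"
  by (simp only: wick_assoc)
 also have "... = (SUM (k, l, m, n, p, q, N):\<Theta>. SUM v<=N. of_int (wick n p v*wick l (m + p - int v) (N - v))*(f k l*(g m n*h p q)))"
  by (simp add: sum_distrib_right split_def)
 also have "... = (SUM (k, l, m', n', w):star_box t1 s1 (t2+t3) (s2+s3) i j.
    (SUM (m, n, p, q, v):star_box t2 s2 t3 s3 m' n'. of_int (wick n p v*wick l m' w)*(f k l*(g m n*h p q))))"
  unfolding split_def
  apply (subst sum.Sigma[OF fin], blast)
  apply (subst sum.Sigma[OF finite_star_box], use finite_star_box in blast)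
  apply (rule sum.reindex_bij_witness[where
    j = "%((k,l,m,n,p,q,N),v). ((k, l, m+p-int v, n+q-int v, N-v), (m,n,p,q,v))" and
    i = "%((k,l,m',n',w),(m,n,p,q,v)). ((k,l,m,n,p,q,v+w),v)"]) by (auto simp: star_box_def \<Theta>_def)
 also have "... = (SUM (k, l, m', n', w):star_box t1 s1 (t2+t3) (s2+s3) i j. of_int (wick l m' w) *
    (f k l*(SUM (m, n, p, q, v):star_box t2 s2 t3 s3 m' n'. of_int (wick n p v)*(g m n*h p q))))" by (intro sum.cong refl)
    (auto simp: sum_distrib_left split_def mult.assoc[symmetric]
       intro!: sum.cong; metis mult.assoc mult_of_int_commute)
 also have "... = star f (star g h) i j" by (simp add: star_box[OF f bounded_star[OF g h]] star_box[OF g h])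
 finally show ?thesis .
qed

lemma finite_diagonal:
 assumes "bounded f t s"
 shows "finite {u. f (i + int u) (j + int u)~=0}"
proof (rule finite_subset)
 show "{u. f (i + int u) (j + int u)~=0}<={..nat (t - i)}"
 proof
  fix u assume "u:{u. f (i + int u) (j + int u)~=0}"
  hence "i + int u<=t" using boundedD[OF assms] by blast
  thus "u:{..nat (t - i)}" by simp
 qed
qed simp

definition star_one :: "int=>int=>'a::ring_1" where
 "star_one = (%i j. if i = 0 & j = 0 then 1 else 0)"

lemma star_one_nz: "star_one k l~=(0::'a::ring_1) \<longleftrightarrow> k = 0 & l = 0" by (simp add: star_one_def)

lemma star_one_left:
 assumes "bounded f t s"
 shows "star star_one f i j = f i j"
proof -
 have "{(k, l, m, n, u). star_one k l~=(0::'a) & f m n~=0 & k + m - int u = i & l + n - int u = j}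
   = (%u. (0, 0, i + int u, j + int u, u)) ` {u. f (i + int u) (j + int u)~=0}" unfolding star_one_nz by auto
 hence "star star_one f i j = (SUM u:{u. f (i + int u) (j + int u)~=0}. of_int (wick 0 (i + int u) u)*f (i + int u) (j + int u))"
  unfolding star_def by (simp add: sum.reindex inj_on_def star_one_def)
 also have "... = (SUM u:{u. f (i + int u) (j + int u)~=0}. if u = 0 then f i j else 0)"
  by (intro sum.cong) (simp_all add: wick_left_0)
 also have "... = f i j" using finite_diagonal[OF assms] by (simp add: sum.delta)
 finally show ?thesis .
qed

lemma star_one_right:
 assumes "bounded f t s"
 shows "star f star_one i j = f i j"
proof -
 have "{(k, l, m, n, u). f k l~=0 & star_one m n~=(0::'a) & k + m - int u = i & l + n - int u = j}
   = (%u. (i + int u, j + int u, 0, 0, u)) ` {u. f (i + int u) (j + int u)~=0}" unfolding star_one_nz by auto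
 hence "star f star_one i j = (SUM u:{u. f (i + int u) (j + int u)~=0}. of_int (wick (j + int u) 0 u)*f (i + int u) (j + int u))"
  unfolding star_def by (simp add: sum.reindex inj_on_def star_one_def)
 also have "... = (SUM u:{u. f (i + int u) (j + int u)~=0}. if u = 0 then f i j else 0)"
  by (intro sum.cong) (simp_all add: wick_right_0)
 also have "... = f i j" using finite_diagonal[OF assms] by (simp add: sum.delta)
 finally show ?thesis .
qed

lemma bounded_add:
 fixes a b :: "int=>int=>'a::monoid_add"
 assumes "bounded a t s" "bounded b t s"
 shows "bounded (%i j. a i j + b i j) t s" unfolding bounded_def by (metis add.right_neutral assms(1,2) boundedD)

lemma star_add_left:
 assumes a: "bounded a t1 s1" and b: "bounded b t2 s2" and c: "bounded c t3 s3"
 shows "star (%i j. a i j + b i j) c i j = star a c i j + star b c i j"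
proof -
 have a': "bounded a (max t1 t2) (max s1 s2)" and b': "bounded b (max t1 t2) (max s1 s2)" using a b by (auto elim: bounded_mono)
 have ab: "bounded (%i j. a i j + b i j) (max t1 t2) (max s1 s2)" using a' b' by (rule bounded_add)
 show ?thesis by (simp add: star_box[OF a' c] star_box[OF b' c] star_box[OF ab c] sum.distrib[symmetric] split_def algebra_simps)
qed

lemma star_add_right:
 assumes b: "bounded b t1 s1" and c: "bounded c t2 s2" and a: "bounded a t3 s3"
 shows "star a (%i j. b i j + c i j) i j = star a b i j + star a c i j"
proof -
 have b': "bounded b (max t1 t2) (max s1 s2)" and c': "bounded c (max t1 t2) (max s1 s2)" using b c by (auto elim: bounded_mono)
 have bc: "bounded (%i j. b i j + c i j) (max t1 t2) (max s1 s2)" using b' c' by (rule bounded_add)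
 show ?thesis by (simp add: star_box[OF a b'] star_box[OF a c'] star_box[OF a bc] sum.distrib[symmetric] split_def algebra_simps)
qed

section \<open>The type of pseudo-differential operators and its elementary series\<close>

typedef (overloaded) 'a psd = "{f::int=>int=>'a::zero. EX t s. bounded f t s}"
 morphisms pcoef Psd by (rule exI[of _ "%_ _. 0"]) (auto simp: bounded_def)

setup_lifting type_definition_psd

lemma pcoef_bounded: "EX t s. bounded (pcoef f) t s" using pcoef by auto

lemma pcoef_Psd: "bounded f t s==>pcoef (Psd f) = f" by (rule Psd_inverse) auto

lemma psd_eqI: "(!!i j. pcoef f i j = pcoef g i j)==>f = g" by (simp add: pcoef_inject[symmetric] fun_eq_iff)

lemma bounded_star_ex:
 "EX t s. bounded f t s==>EX t s. bounded g t s==>EX t s. bounded (star f g) t s"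
 using bounded_star by blast

instantiation psd :: (ring_1) ring_1
begin

lift_definition zero_psd :: "'a psd" is "%_ _. 0" by (auto simp: bounded_def)
lift_definition one_psd :: "'a psd" is star_one by (rule exI[of _ 0], rule exI[of _ 0]) (auto simp: bounded_def star_one_def)
lift_definition plus_psd :: "'a psd=>'a psd=>'a psd" is "%f g i j. f i j + g i j"
proof clarify
 fix f g :: "int=>int=>'a" and t s t' s' assume "bounded f t s" "bounded g t' s'"
 hence "bounded (%i j. f i j + g i j) (max t t') (max s s')" by (intro bounded_add) (auto elim: bounded_mono)
 thus "EX t s. bounded (%i j. f i j + g i j) t s" by blast
qed
lift_definition uminus_psd :: "'a psd=>'a psd" is "%f i j. - f i j" by (simp add: bounded_def[abs_def])
definition minus_psd :: "'a psd=>'a psd=>'a psd" where "minus_psd f g = f + (- g)"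
lift_definition times_psd :: "'a psd=>'a psd=>'a psd" is star by (rule bounded_star_ex)

instance
proof
 fix a b c :: "'a psd"
 show "a*b*c = a*(b*c)" by transfer (auto simp: fun_eq_iff star_assoc)
 show "a + b + c = a + (b + c)" "a + b = b + a" "0 + a = a" "- a + a = 0" by (transfer, simp add: fun_eq_iff algebra_simps)+
 show "a - b = a + - b" by (simp add: minus_psd_def)
 show "(a + b)*c = a*c + b*c" by transfer (auto simp: fun_eq_iff star_add_left)
 show "a*(b + c) = a*b + a*c" by transfer (auto simp: fun_eq_iff star_add_right)
 show "1*a = a" "a*1 = a" by (transfer; clarsimp simp: fun_eq_iff; erule star_one_left star_one_right)+
 show "(0::'a psd)~=1" by transfer (auto simp: fun_eq_iff star_one_def)
qed

end

lemma pcoef_add [simp]: "pcoef (f + g) i j = pcoef f i j + pcoef g i j" by (simp add: plus_psd.rep_eq)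

lemma pcoef_uminus [simp]: "pcoef (- f) i j = - pcoef f i j" by (simp add: uminus_psd.rep_eq)

lemma pcoef_diff [simp]: "pcoef (f - g) i j = pcoef f i j - pcoef g i j" by (simp only: minus_psd_def pcoef_add pcoef_uminus) simp

lemma pcoef_zero [simp]: "pcoef 0 i j = 0" by (simp add: zero_psd.rep_eq)

lemma pcoef_one: "pcoef 1 i j = (if i = 0 & j = 0 then 1 else 0)" by (simp add: one_psd.rep_eq star_one_def)

lemma pcoef_mult: "pcoef (f*g) = star (pcoef f) (pcoef g)" by (simp add: times_psd.rep_eq)

lemma pcoef_sum: "pcoef (SUM x:X. f x) i j = (SUM x:X. pcoef (f x) i j)" by (induction X rule: infinite_finite_induct) auto

lift_definition pmon :: "int=>int=>'a::zero=>'a psd" is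
 "%k l a i j. if i = k & j = l then a else 0"
proof -
 fix k l and a :: 'a
 have "bounded (%i j. if i = k & j = l then a else 0) k l" by (simp add: bounded_def)
 thus "EX t s. bounded (%i j. if i = k & j = l then a else 0) t s" by blast
qed

lemma pcoef_pmon: "pcoef (pmon k l a) i j = (if i = k & j = l then a else 0)" by (simp add: pmon.rep_eq)

lemma pcoef_pmon_mult: "pcoef (pmon k 0 a*f) i j = a*pcoef f (i - k) j"
proof -
 obtain t s where f: "bounded (pcoef f) t s" using pcoef_bounded by blast
 have b: "bounded (pcoef (pmon k 0 a)) k 0" by (simp add: bounded_def pcoef_pmon)
 have "pcoef (pmon k 0 a*f) i j = (SUM (k', l, m, n, u):star_box k 0 t s i j.
   of_int (wick l m u)*(pcoef (pmon k 0 a) k' l*pcoef f m n))" by (simp add: pcoef_mult star_box[OF b f])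
 also have "... = (SUM x:star_box k 0 t s i j. if x = (k, 0, i - k, j, 0) then a*pcoef f (i - k) j else 0)"
 proof (rule sum.cong[OF refl])
  fix x assume x: "x:star_box k 0 t s i j"
  obtain k' l m n u where e: "x = (k', l, m, n, u)" by (cases x)
  show "(case x of (k', l, m, n, u)=>of_int (wick l m u)*(pcoef (pmon k 0 a) k' l*pcoef f m n))
    = (if x = (k, 0, i - k, j, 0) then a*pcoef f (i - k) j else 0)"
   using x by (cases "k' = k & l = 0 & u = 0") (auto simp: e pcoef_pmon wick_left_0 star_box_def)
 qed
 also have "... = a*pcoef f (i - k) j" using boundedD[OF f, of "i - k" j]
  by (cases "pcoef f (i - k) j = 0") (simp_all add: sum.delta[OF finite_star_box], simp add: star_box_def)
 finally show ?thesis .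
qed

lemma pcoef_mult_pmon: "pcoef (f*pmon 0 l a) i j = pcoef f i (j - l)*a"
proof -
 obtain t s where f: "bounded (pcoef f) t s" using pcoef_bounded by blast
 have b: "bounded (pcoef (pmon 0 l a)) 0 l" by (simp add: bounded_def pcoef_pmon)
 have "pcoef (f*pmon 0 l a) i j = (SUM (k, l', m, n, u):star_box t s 0 l i j.
   of_int (wick l' m u)*(pcoef f k l'*pcoef (pmon 0 l a) m n))" by (simp add: pcoef_mult star_box[OF f b])
 also have "... = (SUM x:star_box t s 0 l i j. if x = (i, j - l, 0, l, 0) then pcoef f i (j - l)*a else 0)"
 proof (rule sum.cong[OF refl])
  fix x assume x: "x:star_box t s 0 l i j"
  obtain k l' m n u where e: "x = (k, l', m, n, u)" by (cases x)
  show "(case x of (k, l', m, n, u)=>of_int (wick l' m u)*(pcoef f k l'*pcoef (pmon 0 l a) m n))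
    = (if x = (i, j - l, 0, l, 0) then pcoef f i (j - l)*a else 0)"
   using x by (cases "m = 0 & n = l & u = 0") (auto simp: e pcoef_pmon wick_right_0 star_box_def)
 qed
 also have "... = pcoef f i (j - l)*a" using boundedD[OF f, of i "j - l"]
  by (cases "pcoef f i (j - l) = 0") (simp_all add: sum.delta[OF finite_star_box], simp add: star_box_def)
 finally show ?thesis .
qed

lemma wick_right_1: "wick l 1 u = (if u = 0 then 1 else if u = 1 then l else 0)"
proof (cases "u>=2")
 case True
 hence "(\<Prod>i<u. 1 - int i) = 0" by (intro prod_zero) (auto intro!: bexI[of _ 1])
 with True show ?thesis by (simp only: wick_def int_binom_def) simp
next
 case False
 hence "u = 0 | u = 1" by linarith
 thus ?thesis by (auto simp: wick_def int_binom_def)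
qed

text \<open>Only \<open>u = 0\<close> and \<open>u = 1\<close> contribute, since z can be
  differentiated at most once.\<close>

lemma pcoef_mult_z: "pcoef (f*pmon 1 0 1) i j = pcoef f (i - 1) j + of_int (j + 1)*pcoef f i (j + 1)"
proof -
 obtain t s where f: "bounded (pcoef f) t s" using pcoef_bounded by blast
 have b: "bounded (pcoef (pmon 1 0 (1::'a))) 1 0" by (simp add: bounded_def pcoef_pmon)
 have "pcoef (f*pmon 1 0 1) i j = (SUM (k, l, m, n, u):star_box t s 1 0 i j.
   of_int (wick l m u)*(pcoef f k l*pcoef (pmon 1 0 1) m n))" by (simp add: pcoef_mult star_box[OF f b])
 also have "... = (SUM x:star_box t s 1 0 i j. (if x = (i - 1, j, 1, 0, 0) then pcoef f (i - 1) j else 0) +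
    (if x = (i, j + 1, 1, 0, 1) then of_int (j + 1)*pcoef f i (j + 1) else 0))"
 proof (rule sum.cong[OF refl])
  fix x assume x: "x:star_box t s 1 0 i j"
  obtain k l m n u where e: "x = (k, l, m, n, u)" by (cases x)
  show "(case x of (k, l, m, n, u)=>of_int (wick l m u)*(pcoef f k l*pcoef (pmon 1 0 1) m n))
    = (if x = (i - 1, j, 1, 0, 0) then pcoef f (i - 1) j else 0) +
     (if x = (i, j + 1, 1, 0, 1) then of_int (j + 1)*pcoef f i (j + 1) else 0)"
   using x by (cases "m = 1 & n = 0 & (u = 0 | u = 1)") (auto simp: e pcoef_pmon wick_right_1 star_box_def)
 qed
 also have "... = pcoef f (i - 1) j + of_int (j + 1)*pcoef f i (j + 1)"
  using boundedD[OF f, of "i - 1" j] boundedD[OF f, of i "j + 1"] by (cases "pcoef f (i - 1) j = 0"; cases "pcoef f i (j + 1) = 0")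
    (simp_all add: sum.distrib sum.delta[OF finite_star_box], simp_all add: star_box_def)
 finally show ?thesis .
qed

abbreviation pconst :: "'a::zero=>'a psd" where "pconst == pmon 0 0"
abbreviation pz :: "'a::zero_neq_one psd" where "pz == pmon 1 0 1"
abbreviation pd :: "'a::zero_neq_one psd" where "pd == pmon 0 1 1"
abbreviation pdi :: "'a::zero_neq_one psd" where "pdi == pmon 0 (-1) 1"

lemma pconst_add: "pconst (a + b) = pconst a + pconst (b::'a::ring_1)" by (rule psd_eqI) (simp add: pcoef_pmon)
lemma pconst_diff: "pconst (a - b) = pconst a - pconst (b::'a::ring_1)" by (rule psd_eqI) (simp add: pcoef_pmon)
lemma pconst_mult: "pconst (a*b) = pconst a*pconst (b::'a::ring_1)" by (rule psd_eqI) (simp add: pcoef_pmon pcoef_mult_pmon)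
lemma pconst_0 [simp]: "pconst 0 = (0::'a::ring_1 psd)" by (rule psd_eqI) (simp add: pcoef_pmon)
lemma pconst_1 [simp]: "pconst 1 = (1::'a::ring_1 psd)" by (rule psd_eqI) (simp add: pcoef_pmon pcoef_one)
lemma pconst_uminus: "pconst (- a) = - pconst (a::'a::ring_1)" by (rule psd_eqI) (simp add: pcoef_pmon)
lemma pconst_sum: "pconst (SUM x:X. f x) = (SUM x:X. pconst (f x::'a::ring_1))"
 by (induction X rule: infinite_finite_induct) (auto simp: pconst_add)

lemma pd_pdi [simp]: "pd*pdi = (1::'a::ring_1 psd)" "pdi*pd = (1::'a::ring_1 psd)"
 by (rule psd_eqI, simp add: pcoef_mult_pmon pcoef_pmon pcoef_one)+

lemma pd_pconst: "pd*pconst a = pconst a*(pd::'a::ring_1 psd)" by (rule psd_eqI) (simp add: pcoef_mult_pmon pcoef_pmon)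

lemma pz_pconst: "pz*pconst a = pconst a*(pz::'a::ring_1 psd)"
 by (rule psd_eqI) (simp add: pcoef_mult_pmon pcoef_pmon_mult pcoef_pmon)

lemma pd_pz: "pd*pz = pz*pd + (1::'a::ring_1 psd)" by (rule psd_eqI) (auto simp: pcoef_mult_z pcoef_pmon_mult pcoef_pmon pcoef_one)

text \<open>The expansion of 1/(z - a) at infinity, for an arbitrary ring element
  \<open>a\<close>.\<close>

lift_definition pgeom :: "'a::ring_1=>'a psd" is
 "%a i j. if j = 0 & i < 0 then a ^ nat (- i - 1) else 0"
proof -
 fix a :: 'a
 have "bounded (%i j. if j = 0 & i < 0 then a ^ nat (- i - 1) else 0) 0 0" by (simp add: bounded_def)
 thus "EX t s. bounded (%i j. if j = 0 & i < 0 then a ^ nat (- i - 1) else 0) t s" by blast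
qed

lemma pcoef_pgeom: "pcoef (pgeom a) i j = (if j = 0 & i < 0 then a ^ nat (- i - 1) else 0)" by (simp add: pgeom.rep_eq)

definition uinv :: "'a::ring_1=>'a=>bool" where
 "uinv x y \<longleftrightarrow> x*y = 1 & y*x = 1"

lemma uinvD: "uinv x y==>x*y = 1" "uinv x y==>y*x = 1" by (auto simp: uinv_def)

lemma uinv_sym: "uinv x y==>uinv y x" by (auto simp: uinv_def)

lemma uinv_unique: "uinv x y==>uinv x z==>y = z"
 unfolding uinv_def by (metis mult.assoc mult_1_left mult_1_right)

lemma uinv_mult: "uinv x x'==>uinv y y'==>uinv (x*y) (y'*x')"
 unfolding uinv_def by (metis mult.assoc mult_1_left mult_1_right)

lemma uinv_commute: "uinv x x'==>x*c = c*x==>x'*c = c*x'"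
 unfolding uinv_def by (metis mult.assoc mult_1_left mult_1_right)

lemma uinv_1 [simp]: "uinv 1 1" by (simp add: uinv_def)

definition rinv :: "'a::ring_1=>'a" where
 "rinv x = (THE y. uinv x y)"

lemma rinv_eq: "uinv x y==>rinv x = y" unfolding rinv_def using uinv_unique by blast

lemma power_nat_shift: "i < 0==>a ^ nat (- i) = a*a ^ nat (- i - 1)" for a :: "'a::monoid_mult"
proof -
 assume "i < 0"
 hence "nat (- i) = Suc (nat (- i - 1))" by simp
 thus ?thesis by simp
qed

lemma uinv_pgeom: "uinv (pz - pconst a) (pgeom a)" unfolding uinv_def
proof (intro conjI psd_eqI)
 fix i j :: int
 have *: "i - 1 < 0 \<longleftrightarrow> i = 0 | i < 0" "j + 1 = 0 \<longleftrightarrow> j = - 1" by linarith+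
 show "pcoef ((pz - pconst a)*pgeom a) i j = pcoef 1 i j"
  by (auto simp: left_diff_distrib pcoef_pmon_mult pcoef_pgeom pcoef_one * power_nat_shift)
 show "pcoef (pgeom a*(pz - pconst a)) i j = pcoef 1 i j"
  by (auto simp: right_diff_distrib pcoef_mult_z pcoef_mult_pmon pcoef_pgeom pcoef_one * power_nat_shift power_commutes)
qed

text \<open>\<open>z - a\<close> determines all the commutation rules of its inverse.\<close>

lemma pgeom_commute:
 assumes "a*b = b*(a::'a::ring_1)"
 shows "pgeom a*pconst b = pconst b*pgeom a" "pgeom a*pgeom b = pgeom b*pgeom a"
proof -
 have ab: "pconst a*pconst b = pconst b*pconst a" using assms by (simp add: pconst_mult[symmetric])
 have "(pz - pconst a)*pconst b = pconst b*(pz - pconst a)" by (simp add: algebra_simps pz_pconst ab)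
 from uinv_commute[OF uinv_pgeom this] show 1: "pgeom a*pconst b = pconst b*pgeom a" .
 have "(pz - pconst a)*(pz - pconst b) = (pz - pconst b)*(pz - pconst a)" by (simp add: algebra_simps pz_pconst ab)
 from uinv_commute[OF uinv_pgeom this] have "(pz - pconst b)*pgeom a = pgeom a*(pz - pconst b)" by simp
 from uinv_commute[OF uinv_pgeom this] show "pgeom a*pgeom b = pgeom b*pgeom a" by simp
qed

text \<open>The derivative of 1/(z - a) is -1/(z - a)^2: multiply the relation between \<partial>
  and z - a by the inverse of z - a on both sides.\<close>

lemma pd_pgeom: "pd*pgeom a = pgeom a*pd - pgeom a*pgeom (a::'a::ring_1)"
proof -
 let ?x = "pz - pconst a" and ?g = "pgeom a"
 have g: "?x*?g = 1" "?g*?x = 1" using uinv_pgeom[of a] by (auto simp: uinv_def)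
 have "pd*?x = ?x*pd + 1" by (simp add: algebra_simps pd_pz pd_pconst)
 hence "?g*(pd*?x)*?g = ?g*(?x*pd + 1)*?g" by simp
 moreover have "?g*(pd*?x)*?g = ?g*pd" by (simp add: mult.assoc g)
 moreover have "?g*(?x*pd + 1)*?g = pd*?g + ?g*?g"
  by (metis (no_types, lifting) distrib_left distrib_right g(2) mult.assoc mult_1_left mult_1_right)
 ultimately show ?thesis by (simp add: algebra_simps)
qed

subsection \<open>Filtrations and inversion\<close>

text \<open>Besides bounding the order in \<partial>, \<open>pord\<close> forbids positive powers of
  z. All powers of such a series then share a bound in z, which the sum of a Neumann series needs.
  The order alone, \<open>pdeg\<close>, is enough to show that an element vanishes.\<close>

definition pord :: "int=>'a::zero psd=>bool" where
 "pord s f \<longleftrightarrow> bounded (pcoef f) 0 s"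

definition pdeg :: "int=>'a::zero psd=>bool" where
 "pdeg s f \<longleftrightarrow> (ALL i j. pcoef f i j~=0-->j<=s)"

lemma pord_mult: "pord s f==>pord s' g==>pord (s + s') (f*g)"
 unfolding pord_def using bounded_star[of "pcoef f" 0 s "pcoef g" 0 s'] by (simp add: pcoef_mult)

lemma pord_add: "pord s f==>pord s g==>pord s (f + (g::'a::ring_1 psd))"
 unfolding pord_def plus_psd.rep_eq by (rule bounded_add)

lemma pord_uminus: "pord s (f::'a::ring_1 psd)==>pord s (- f)" by (simp add: pord_def bounded_def)

lemma pord_diff: "pord s f==>pord s g==>pord s (f - (g::'a::ring_1 psd))"
 by (simp only: diff_conv_add_uminus pord_add pord_uminus)

lemma pord_0 [simp]: "pord s (0::'a::ring_1 psd)" by (simp add: pord_def bounded_def)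

lemma pord_sum: "(!!x. x:X==>pord s (f x))==>pord s (SUM x:X. f x::'a::ring_1 psd)"
 by (induction X rule: infinite_finite_induct) (auto simp: pord_add)

lemma pord_mono: "pord s f==>s<=s'==>pord s' f" unfolding pord_def by (rule bounded_mono) auto

lemma pord_pmon: "k<=0==>l<=s==>pord s (pmon k l a)"
 by (simp add: pord_def bounded_def pcoef_pmon)

lemma pord_1 [simp]: "0<=s==>pord s (1::'a::ring_1 psd)" by (simp add: pord_def bounded_def pcoef_one)

lemma pord_pgeom [simp]: "pord 0 (pgeom a)" by (simp add: pord_def bounded_def pcoef_pgeom)

lemma pord_imp_pdeg: "pord s f==>pdeg s f" by (simp add: pord_def pdeg_def bounded_def)

lemma pdeg_mult:
 assumes "pdeg s f" "pdeg s' g" shows "pdeg (s + s') (f*g)" unfolding pdeg_def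
proof (intro allI impI)
 fix i j assume "pcoef (f*g) i j~=0"
 then obtain k l m n u where "pcoef f k l~=0" "pcoef g m n~=0" "l + n - int u = j"
  using star_nonzero[of "pcoef f" "pcoef g" i j] by (auto simp: pcoef_mult)
 with assms have "l<=s" "n<=s'" by (auto simp: pdeg_def)
 with \<open>l + n - int u = j\<close> show "j<=s + s'" by linarith
qed

lemma pdeg_add: "pdeg s f==>pdeg s g==>pdeg s (f + (g::'a::ring_1 psd))"
 unfolding pdeg_def pcoef_add by (metis add.right_neutral)

lemma pdeg_uminus: "pdeg s (f::'a::ring_1 psd)==>pdeg s (- f)" by (simp add: pdeg_def)

lemma pdeg_0 [simp]: "pdeg s (0::'a::ring_1 psd)" by (simp add: pdeg_def)

lemma pdeg_sum: "(!!x. x:X==>pdeg s (f x))==>pdeg s (SUM x:X. f x::'a::ring_1 psd)"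
 by (induction X rule: infinite_finite_induct) (auto simp: pdeg_add)

lemma pdeg_ex: "EX s. pdeg s f" using pcoef_bounded[of f] by (auto simp: pdeg_def bounded_def)

text \<open>The filtration by order is separated, so estimates of arbitrarily low order turn into
  equations.\<close>

lemma pdeg_all_zero:
 assumes "!!n::nat. pdeg (s - int n) f" shows "f = (0::'a::ring_1 psd)"
proof (rule psd_eqI)
 fix i j
 have "pdeg (s - int (nat (s - j + 1))) f" by (rule assms)
 hence "pcoef f i j~=0==>j<=s - int (nat (s - j + 1))" by (auto simp: pdeg_def)
 hence "pcoef f i j = 0" by (cases "j<=s") (auto)
 thus "pcoef f i j = pcoef 0 i j" by simp
qed

lemma pord_power: "pord (-1) x==>pord (- int n) ((x::'a::ring_1 psd) ^ n)"
proof (induction n)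
 case (Suc n)
 hence "pord (- 1 + - int n) (x*x ^ n)" by (intro pord_mult) auto
 thus ?case by simp
qed simp

text \<open>The geometric series of \<open>x\<close>. As \<open>x ^ n\<close> has order at most
  \<open>-n\<close>, each coefficient of the series is a finite sum, and the partial sums
  \<open>S N\<close> approach \<open>g\<close> in the order filtration.\<close>

lemma pneumann_left:
 assumes x: "pord (-1) (x::'a::ring_1 psd)"
 obtains g where "(1 - x)*g = 1" "g*(1 - x) = 1" "pord (-1) (g - 1)"
proof -
 define f where "f = (%i j. SUM n<=nat (- j). pcoef (x ^ n) i j)"
 have hi: "pcoef (x ^ n) i j = 0" if "- int n < j | 0 < i" for n i j
 proof (rule ccontr)
  assume "pcoef (x ^ n) i j~=0"
  hence "i<=0 & j <= - int n" using boundedD[OF pord_power[OF x, of n, unfolded pord_def]] by blast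
  with that show False by linarith
 qed
 have ext: "f i j = (SUM n<=N. pcoef (x ^ n) i j)" if "- int N<=j" for i j N
 proof -
  have "(SUM n<=N. pcoef (x ^ n) i j) = (SUM n<=nat (- j). pcoef (x ^ n) i j)"
   by (rule sum.mono_neutral_right) (use that in \<open>auto intro!: hi\<close>)
  thus ?thesis by (simp add: f_def)
 qed
 have bf: "bounded f 0 0" unfolding bounded_def
 proof (intro allI impI)
  fix i j assume "f i j~=0"
  hence "EX n. pcoef (x ^ n) i j~=0" unfolding f_def by (meson sum.neutral)
  then obtain n where "pcoef (x ^ n) i j~=0" ..
  hence "~ (- int n < j | 0 < i)" using hi by blast
  thus "i<=0 & j<=0" by linarith
 qed
 define g where "g = Psd f"
 have gf: "pcoef g = f" unfolding g_def using bf by (rule pcoef_Psd)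
 define S where "S N = (SUM n<=N. x ^ n)" for N
 have close: "pdeg (- int N - 1) (g - S N)" for N unfolding pdeg_def
 proof (intro allI impI)
  fix i j assume "pcoef (g - S N) i j~=0"
  hence "f i j~=(SUM n<=N. pcoef (x ^ n) i j)" by (simp add: gf S_def pcoef_sum)
  hence "~ - int N<=j" using ext by blast
  thus "j <= - int N - 1" by linarith
 qed
 have x1: "pdeg 0 (1 - x)" using x by (intro pord_imp_pdeg pord_diff) (auto elim: pord_mono)
 have S1: "(1 - x)*S N = 1 - x ^ Suc N" for N
 proof (induction N)
  case (Suc N)
  have "(1 - x)*S (Suc N) = (1 - x)*S N + (1 - x)*x ^ Suc N" by (simp add: S_def distrib_left del: power_Suc)
  thus ?case unfolding Suc by (simp add: left_diff_distrib)
 qed (simp add: S_def)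
 have S2: "S N*(1 - x) = 1 - x ^ Suc N" for N
 proof (induction N)
  case (Suc N)
  have "S (Suc N)*(1 - x) = S N*(1 - x) + x ^ Suc N*(1 - x)" by (simp add: S_def distrib_right del: power_Suc)
  thus ?case unfolding Suc by (simp add: right_diff_distrib power_commutes mult.assoc)
 qed (simp add: S_def)
 have xN: "pdeg (- 1 - int N) (x ^ Suc N)" for N using pord_imp_pdeg[OF pord_power[OF x, of "Suc N"]] by (simp add: algebra_simps)
 have eN: "- int N - 1 = - 1 - int N" for N by simp
 have "pdeg (- 1 - int N) ((1 - x)*g - 1)" for N
 proof -
  have "(1 - x)*g - 1 = (1 - x)*(g - S N) + - (x ^ Suc N)" using S1[of N] by (simp add: right_diff_distrib)
  moreover have "pdeg (- 1 - int N) ((1 - x)*(g - S N))" using pdeg_mult[OF x1 close[of N]] by (simp only: eN add_0_left)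
  ultimately show ?thesis using pdeg_add[OF _ pdeg_uminus[OF xN[of N]]] by simp
 qed
 from pdeg_all_zero[OF this] have 1: "(1 - x)*g = 1" by simp
 have "pdeg (- 1 - int N) (g*(1 - x) - 1)" for N
 proof -
  have "g*(1 - x) - 1 = (g - S N)*(1 - x) + - (x ^ Suc N)" using S2[of N] by (simp add: left_diff_distrib)
  moreover have "pdeg (- 1 - int N) ((g - S N)*(1 - x))" using pdeg_mult[OF close[of N] x1] by (simp only: eN add_0_right)
  ultimately show ?thesis using pdeg_add[OF _ pdeg_uminus[OF xN[of N]]] by simp
 qed
 from pdeg_all_zero[OF this] have 2: "g*(1 - x) = 1" by simp
 have "g - 1 = x*g" using 1 by (simp add: algebra_simps)
 moreover have "pord (-1 + 0) (x*g)" using x bf by (intro pord_mult) (auto simp: pord_def gf)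
 ultimately show thesis using 1 2 that by simp
qed

text \<open>Write \<open>f\<close> as \<open>pd * (1 - pdi * (pd - f))\<close> and invert the second
  factor by the Neumann series. The estimate keeps the leading term of the inverse, which allows it
  to be inverted in turn.\<close>

lemma pinverse_monic:
 assumes f: "pord 0 (f - pd)"
 shows "EX g. uinv f g & pord (-2) (g - (pdi::'a::ring_1 psd))"
proof -
 have "pord (-1) (pdi*(pd - f))" using pord_mult[OF pord_pmon[of 0 "-1" "-1"] pord_uminus[OF f]] by simp
 from pneumann_left[OF this] obtain g where g: "(1 - pdi*(pd - f))*g = 1" "g*(1 - pdi*(pd - f)) = 1"
  and g1: "pord (-1) (g - 1)" by metis
 have e: "1 - pdi*(pd - f) = pdi*f" by (simp add: algebra_simps)
 have "uinv (pd*(pdi*f)) (g*pdi)" using g unfolding e by (intro uinv_mult) (auto simp: uinv_def)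
 moreover have "pd*(pdi*f) = f" by (simp add: mult.assoc[symmetric])
 moreover have "pord (-1 + -1) ((g - 1)*pdi)" by (intro pord_mult g1 pord_pmon) auto
 ultimately show ?thesis by (intro exI[of _ "g*pdi"]) (simp add: algebra_simps)
qed

lemma pinverse_monic':
 assumes f: "pord (-2) (f - pdi)"
 shows "EX g. uinv f g & pord 0 (g - (pd::'a::ring_1 psd))"
proof -
 have "pord (-1) (pd*(pdi - f))" using pord_mult[OF pord_pmon[of 0 1 1] pord_uminus[OF f]] by simp
 from pneumann_left[OF this] obtain g where g: "(1 - pd*(pdi - f))*g = 1" "g*(1 - pd*(pdi - f)) = 1"
  and g1: "pord (-1) (g - 1)" by metis
 have e: "1 - pd*(pdi - f) = pd*f" by (simp add: algebra_simps)
 have "uinv (pdi*(pd*f)) (g*pd)" using g unfolding e by (intro uinv_mult) (auto simp: uinv_def)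
 moreover have "pdi*(pd*f) = f" by (simp add: mult.assoc[symmetric])
 moreover have "pord (-1 + 1) ((g - 1)*pd)" by (intro pord_mult g1 pord_pmon) auto
 ultimately show ?thesis by (intro exI[of _ "g*pd"]) (simp add: algebra_simps)
qed

subsection \<open>Functoriality\<close>

definition rhom :: "('a::ring_1=>'b::ring_1)=>bool" where
 "rhom h \<longleftrightarrow> h 1 = 1 & (ALL x y. h (x + y) = h x + h y) & (ALL x y. h (x*y) = h x*h y)"

lemma rhomD:
 assumes "rhom h"
 shows "h 1 = 1" "h (x + y) = h x + h y" "h (x*y) = h x*h y" "h 0 = 0" "h (- x) = - h x"
  "h (x - y) = h x - h y"
proof -
 show a: "h 1 = 1" "h (x + y) = h x + h y" "h (x*y) = h x*h y" for x y using assms by (auto simp: rhom_def)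
 have "h 0 + h 0 = h 0" using a(2)[of 0 0] by simp
 thus z: "h 0 = 0" by simp
 show m: "h (- x) = - h x" for x using a(2)[of x "-x"] z by (simp add: eq_neg_iff_add_eq_0 add.commute)
 show "h (x - y) = h x - h y" using a(2)[of x "-y"] m[of y] by simp
qed

lemma rhom_sum: "rhom h==>h (SUM x:X. f x) = (SUM x:X. h (f x))"
 by (induction X rule: infinite_finite_induct) (auto simp: rhomD)

lemma rhom_of_int: "rhom h==>h (of_int k) = of_int k"
proof (induction k)
 case (nonneg n) thus ?case by (induction n) (auto simp: rhomD)
next
 case (neg n)
 have "h (of_nat m) = of_nat m" for m using neg by (induction m) (auto simp: rhomD)
 hence "h (of_nat (Suc n)) = of_nat (Suc n)" by blast
 thus ?case using neg by (simp add: rhomD del: of_nat_Suc)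
qed

lemma rhom_uinv: "rhom h==>uinv x y==>uinv (h x) (h y)" unfolding uinv_def by (metis rhomD(1,3))

text \<open>The case distinction keeps the support bounded for an arbitrary function
  \<open>h\<close>, as the lifting requires.\<close>

lift_definition pmap :: "('a::zero=>'b::zero)=>'a psd=>'b psd" is
 "%h f i j. if f i j = 0 then 0 else h (f i j)"
proof -
 fix h :: "'a=>'b" and f :: "int=>int=>'a" assume "EX t s. bounded f t s"
 then obtain t s where "bounded f t s" by blast
 hence "bounded (%i j. if f i j = 0 then 0 else h (f i j)) t s" by (auto simp: bounded_def)
 thus "EX t s. bounded (%i j. if f i j = 0 then 0 else h (f i j)) t s" by blast
qed

lemma pcoef_pmap: "rhom h==>pcoef (pmap h f) i j = h (pcoef f i j)" by (simp add: pmap.rep_eq rhomD)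

lemma rhom_pmap:
 assumes h: "rhom h" shows "rhom (pmap h)" unfolding rhom_def
proof (intro conjI allI)
 show "pmap h 1 = 1" by (rule psd_eqI) (simp add: pcoef_pmap h pcoef_one rhomD[OF h])
 fix f g
 show "pmap h (f + g) = pmap h f + pmap h g" by (rule psd_eqI) (simp add: pcoef_pmap h rhomD[OF h])
 show "pmap h (f*g) = pmap h f*pmap h g"
 proof (rule psd_eqI)
  fix i j
  obtain t s t' s' where f: "bounded (pcoef f) t s" and g: "bounded (pcoef g) t' s'" using pcoef_bounded by metis
  have f': "bounded (pcoef (pmap h f)) t s" and g': "bounded (pcoef (pmap h g)) t' s'" using f g by (auto simp: bounded_def pmap.rep_eq)
  show "pcoef (pmap h (f*g)) i j = pcoef (pmap h f*pmap h g) i j"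
   by (simp add: pcoef_pmap h pcoef_mult star_box[OF f g] star_box[OF f' g'] rhom_sum rhomD rhom_of_int split_def)
 qed
qed

lemma pmap_pmon: "rhom h==>pmap h (pmon k l a) = pmon k l (h a)" by (rule psd_eqI) (simp add: pcoef_pmap pcoef_pmon rhomD)

lemma rhom_power: "rhom h==>h (x ^ n) = h x ^ n" by (induction n) (auto simp: rhomD)

lemma pmap_pgeom: "rhom h==>pmap h (pgeom a) = pgeom (h a)"
 by (rule psd_eqI) (simp add: pcoef_pmap pcoef_pgeom rhomD rhom_power)

section \<open>Quasideterminants and the Berezinian over a noncommutative ring\<close>

definition minv :: "int set=>(int=>int=>'a::ring_1)=>(int=>int=>'a)=>bool" where
 "minv J A B \<longleftrightarrow> (ALL i:J. ALL j:J. (SUM k:J. A i k*B k j) = (if i = j then 1 else 0) &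
   (SUM k:J. B i k*A k j) = (if i = j then 1 else 0))"

definition mati :: "int set=>(int=>int=>'a::ring_1)=>int=>int=>'a" where
 "mati J A = (SOME B. minv J A B)"

text \<open>The factor of the Berezinian at \<open>t\<close>: the quasideterminant
  \<open>rinv (mati J A t t)\<close> for even \<open>t\<close>, its inverse for odd
  \<open>t\<close>.\<close>

definition bfac :: "int set=>(int=>int=>'a::ring_1)=>int=>'a" where
 "bfac J A t = (if even t then rinv (mati J A t t) else rinv (rinv (mati J A t t)))"

definition ber :: "int list=>(int=>int=>'a::ring_1)=>'a" where
 "ber ord A = prod_list (map (%t. bfac (set (take (Suc t) ord)) A (ord ! t)) [0..<length ord])"

lemma ber_Nil [simp]: "ber [] A = 1" by (simp add: ber_def)

lemma ber_snoc: "ber (xs @ [t]) A = ber xs A*bfac (insert t (set xs)) A t"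
proof -
 have "map (%s. bfac (set (take (Suc s) (xs @ [t]))) A ((xs @ [t]) ! s)) [0..<length xs]
   = map (%s. bfac (set (take (Suc s) xs)) A (xs ! s)) [0..<length xs]" by (rule map_cong) (auto simp: nth_append)
 moreover have "map (%s. bfac (set (take (Suc s) (xs @ [t]))) A ((xs @ [t]) ! s)) [0..<length (xs @ [t])]
   = map (%s. bfac (set (take (Suc s) (xs @ [t]))) A ((xs @ [t]) ! s)) [0..<length xs] @ [bfac (insert t (set xs)) A t]" by simp
 ultimately show ?thesis by (simp only: ber_def prod_list.append) simp
qed

text \<open>A factor depends on the earlier indices only through their set, so a reordered prefix
  matters only through its own Berezinian.\<close>

lemma ber_append_cong:
 assumes "ber xs A = ber ys A" "set xs = set ys"
 shows "ber (xs @ zs) A = ber (ys @ zs) A"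
proof (induction zs rule: rev_induct)
 case (snoc z zs)
 have "ber (xs @ zs @ [z]) A = ber (xs @ zs) A*bfac (insert z (set (xs @ zs))) A z" using ber_snoc[of "xs @ zs" z A] by simp
 also have "... = ber (ys @ zs @ [z]) A" using ber_snoc[of "ys @ zs" z A] snoc assms(2) by simp
 finally show ?case .
qed (use assms in simp)

text \<open>The condition under which the quasideterminants for all orders on subsets of
  \<open>J\<close> exist and are units.\<close>

definition good :: "int set=>(int=>int=>'a::ring_1)=>bool" where
 "good J A \<longleftrightarrow> finite J & (ALL K<=J. EX B. minv K A B & (ALL t:K. EX d. uinv (B t t) d))"

lemma minvD:
 assumes "minv J A B" "i:J" "j:J"
 shows "(SUM k:J. A i k*B k j) = (if i = j then 1 else 0)" "(SUM k:J. B i k*A k j) = (if i = j then 1 else 0)"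
 using assms by (auto simp: minv_def)

lemma sum_delta_mult:
 fixes f :: "'b=>'a::ring_1"
 assumes "finite J" "j:J"
 shows "(SUM k:J. f k*(if k = j then 1 else 0)) = f j" "(SUM k:J. (if j = k then 1 else 0)*f k) = f j"
  "(SUM k:J. f k*(if j = k then 1 else 0)) = f j" "(SUM k:J. (if k = j then 1 else 0)*f k) = f j"
 using assms by (simp_all add: if_distrib if_distribR sum.delta sum.delta' cong: if_cong)

lemma minv_unique:
 assumes J: "finite J" and B: "minv J A B" and C: "minv J A C" and "i:J" "j:J"
 shows "B i j = C i j"
proof -
 have "B i j = (SUM k:J. B i k*(SUM l:J. A k l*C l j))" using assms by (simp add: minvD[OF C] sum_delta_mult)
 also have "... = (SUM l:J. (SUM k:J. B i k*A k l)*C l j)"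
  by (simp add: sum_distrib_left sum_distrib_right mult.assoc) (rule sum.swap)
 also have "... = C i j" using assms by (simp add: minvD[OF B] sum_delta_mult)
 finally show ?thesis .
qed

lemma mati_eq:
 assumes "finite J" "minv J A B" "i:J" "j:J"
 shows "mati J A i j = B i j"
proof -
 have "minv J A (mati J A)" unfolding mati_def by (rule someI[of "minv J A", OF assms(2)])
 thus ?thesis using minv_unique assms by blast
qed

lemma goodE:
 assumes "good J A" "K<=J"
 obtains B where "minv K A B" "!!t. t:K==>uinv (B t t) (rinv (B t t))" by (metis assms(1,2) good_def rinv_eq)

lemma good_minv_uinv:
 assumes "good J A" "K<=J" "minv K A B" "t:K"
 shows "uinv (B t t) (rinv (B t t))"
proof -
 have K: "finite K" using assms(1,2) by (auto simp: good_def intro: finite_subset)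
 obtain C where C: "minv K A C" "uinv (C t t) (rinv (C t t))" using goodE[OF assms(1,2)] assms(4) by blast
 thus ?thesis using minv_unique[OF K assms(3) C(1) assms(4,4)] by simp
qed

lemma bfac_eq:
 assumes "good J A" "K<=J" "minv K A B" "t:K"
 shows "bfac K A t = (if even t then rinv (B t t) else B t t)"
proof -
 have K: "finite K" using assms(1,2) by (auto simp: good_def intro: finite_subset)
 have "uinv (rinv (B t t)) (B t t)" using good_minv_uinv[OF assms] by (rule uinv_sym)
 thus ?thesis by (simp add: bfac_def mati_eq[OF K assms(3,4,4)] rinv_eq)
qed

text \<open>Inverting a principal submatrix means taking the Schur complement of
  \<open>B t t\<close> in the inverse \<open>B\<close> of the larger matrix. Neighbouring factors of
  the Berezinian can thus be read off from one inverse.\<close>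

lemma minv_remove:
 assumes J: "finite J" "t~:J" and B: "minv (insert t J) A B" and d: "uinv (B t t) d"
 shows "minv J A (%i j. B i j - B i t*d*B t j)" unfolding minv_def
proof (intro ballI conjI)
 fix i j assume ij: "i:J" "j:J"
 hence nt: "i~=t" "j~=t" using J by auto
 have 1: "(SUM k:J. A i k*B k j) = (if i = j then 1 else 0) - A i t*B t j"
  and 2: "(SUM k:J. A i k*B k t) = - (A i t*B t t)"
  and 3: "(SUM k:J. B i k*A k j) = (if i = j then 1 else 0) - B i t*A t j"
  and 4: "(SUM k:J. B t k*A k j) = - (B t t*A t j)"
  using minvD[OF B, of i j] minvD(1)[OF B, of i t] minvD(2)[OF B, of t j] ij nt J
  by (simp_all add: eq_diff_eq eq_neg_iff_add_eq_0 add.commute)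
 have "(SUM k:J. A i k*(B k j - B k t*d*B t j)) = (SUM k:J. A i k*B k j) - (SUM k:J. A i k*B k t)*d*B t j"
  by (simp add: right_diff_distrib sum_subtractf sum_distrib_right mult.assoc)
 also have "... = (if i = j then 1 else 0)" unfolding 1 2 using d by (simp add: mult.assoc uinv_def mult.assoc[of "B t t" d, symmetric])
 finally show "(SUM k:J. A i k*(B k j - B k t*d*B t j)) = (if i = j then 1 else 0)" .
 have "(SUM k:J. (B i k - B i t*d*B t k)*A k j) = (SUM k:J. B i k*A k j) - B i t*d*(SUM k:J. B t k*A k j)"
  by (simp add: left_diff_distrib sum_subtractf sum_distrib_left mult.assoc)
 also have "... = (if i = j then 1 else 0)" unfolding 3 4 using d by (simp add: mult.assoc uinv_def mult.assoc[of d "B t t", symmetric])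
 finally show "(SUM k:J. (B i k - B i t*d*B t k)*A k j) = (if i = j then 1 else 0)" .
qed

text \<open>Block inversion by bordering: \<open>e\<close> inverts the Schur complement of the old
  block, \<open>u\<close> is \<open>B\<close> times the new column and \<open>v\<close> the new row
  times \<open>B\<close>.\<close>

lemma minv_insert:
 assumes J: "finite J" "t~:J" and B: "minv J A B"
  and e: "uinv (A t t - (SUM i:J. SUM j:J. A t i*B i j*A j t)) e"
 defines "u == %i. SUM j:J. B i j*A j t" and "v == %j. SUM i:J. A t i*B i j"
 shows "minv (insert t J) A (%i j. if i = t then (if j = t then e else - (e*v j))
   else (if j = t then - (u i*e) else B i j + u i*e*v j))" (is "minv _ A ?C")
proof -
 have Au: "(SUM k:J. A i k*u k) = A i t" if "i:J" for i
 proof -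
  have "(SUM k:J. A i k*u k) = (SUM j:J. (SUM k:J. A i k*B k j)*A j t)"
   unfolding u_def by (simp add: sum_distrib_left sum_distrib_right mult.assoc) (rule sum.swap)
  thus ?thesis using that J by (simp add: minvD[OF B] sum_delta_mult)
 qed
 have vA: "(SUM k:J. v k*A k j) = A t j" if "j:J" for j
 proof -
  have "(SUM k:J. v k*A k j) = (SUM i:J. A t i*(SUM k:J. B i k*A k j))"
   unfolding v_def by (simp add: sum_distrib_left sum_distrib_right mult.assoc) (rule sum.swap)
  thus ?thesis using that J by (simp add: minvD[OF B] sum_delta_mult)
 qed
 define s where "s = A t t - (SUM k:J. A t k*u k)"
 have s1: "A t t - (SUM i:J. SUM j:J. A t i*B i j*A j t) = s" by (simp add: s_def u_def sum_distrib_left mult.assoc)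
 have s2: "s = A t t - (SUM k:J. v k*A k t)" unfolding s1[symmetric] v_def by (simp add: sum_distrib_right) (rule sum.swap)
 have se: "s*e = 1" "e*s = 1" using e unfolding s1 by (auto simp: uinv_def)
 have split: "(SUM k:insert t J. f k) = f t + (SUM k:J. f k)" for f :: "int=>'a" using J by simp
 have neq: "k~=t" if "k:J" for k using J that by auto
 define C where "C = ?C"
 have C: "C t t = e" "!!j. j:J==>C t j = - (e*v j)" "!!i. i:J==>C i t = - (u i*e)"
  "!!i j. i:J==>j:J==>C i j = B i j + u i*e*v j" using neq by (auto simp: C_def)
 have P1: "(SUM k:J. A i k*C k j) = (SUM k:J. A i k*B k j) + (SUM k:J. A i k*u k)*e*v j" if "j:J" for i j
  using that by (simp add: C sum_distrib_right distrib_left sum.distrib mult.assoc cong: sum.cong)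
 have P2: "(SUM k:J. A i k*C k t) = - ((SUM k:J. A i k*u k)*e)" for i
  by (simp add: C sum_distrib_right sum_negf mult.assoc cong: sum.cong)
 have P3: "(SUM k:J. C i k*A k j) = (SUM k:J. B i k*A k j) + u i*e*(SUM k:J. v k*A k j)" if "i:J" for i j
  using that by (simp add: C sum_distrib_left distrib_right sum.distrib mult.assoc cong: sum.cong)
 have P4: "(SUM k:J. C t k*A k j) = - (e*(SUM k:J. v k*A k j))" for j
  by (simp add: C sum_distrib_left sum_negf mult.assoc cong: sum.cong)
 have sAu: "(SUM k:J. A t k*u k) = A t t - s" by (simp add: s_def)
 have vAs: "(SUM k:J. v k*A k t) = A t t - s" by (simp add: s2)
 have AB: "(SUM k:J. A t k*B k j) = v j" "(SUM k:J. B i k*A k t) = u i" for i j by (simp_all add: v_def u_def)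
 have "minv (insert t J) A C" unfolding minv_def split
 proof (intro ballI conjI)
  fix i j assume ij: "i:insert t J" "j:insert t J"
  have "A t t*C t t + (SUM k:J. A t k*C k t) = 1" by (simp only: P2 C(1) sAu) (simp add: left_diff_distrib se)
  moreover have "A t t*C t j + (SUM k:J. A t k*C k j) = 0" if "j:J"
  proof -
   have "A t t*C t j + (SUM k:J. A t k*C k j) = v j - s*e*v j"
    by (simp only: P1[OF that] C(2)[OF that] sAu AB) (simp add: algebra_simps)
   thus ?thesis by (simp add: se)
  qed
  moreover have "A i t*C t t + (SUM k:J. A i k*C k t) = 0" if "i:J" by (simp add: P2 C(1) Au[OF that])
  moreover have "A i t*C t j + (SUM k:J. A i k*C k j) = (if i = j then 1 else 0)" if "i:J" "j:J"
   by (simp add: P1[OF that(2)] C(2)[OF that(2)] Au[OF that(1)] minvD[OF B that] mult.assoc)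
  ultimately show "A i t*C t j + (SUM k:J. A i k*C k j) = (if i = j then 1 else 0)" using ij J(2) by auto
  have "C t t*A t t + (SUM k:J. C t k*A k t) = 1" by (simp only: P4 C(1) vAs) (simp add: right_diff_distrib se)
  moreover have "C i t*A t t + (SUM k:J. C i k*A k t) = 0" if "i:J"
  proof -
   have "C i t*A t t + (SUM k:J. C i k*A k t) = u i - u i*(e*s)"
    by (simp only: P3[OF that] C(3)[OF that] vAs AB) (simp add: algebra_simps)
   thus ?thesis by (simp add: se)
  qed
  moreover have "C t t*A t j + (SUM k:J. C t k*A k j) = 0" if "j:J" by (simp add: P4 C(1) vA[OF that])
  moreover have "C i t*A t j + (SUM k:J. C i k*A k j) = (if i = j then 1 else 0)" if "i:J" "j:J"
   by (simp add: P3[OF that(1)] C(3)[OF that(1)] vA[OF that(2)] minvD[OF B that] mult.assoc)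
  ultimately show "C i t*A t j + (SUM k:J. C i k*A k j) = (if i = j then 1 else 0)" using ij J(2) by auto
 qed
 thus ?thesis by (simp only: C_def)
qed

subsection \<open>Existence for monic matrices of pseudo-differential operators\<close>

definition monic_mat :: "int set=>(int=>int=>'a::ring_1 psd)=>bool" where
 "monic_mat J A \<longleftrightarrow> finite J & (ALL i:J. ALL j:J. pord 0 (A i j - (if i = j then pd else 0)))"

text \<open>One index is added at a time. The inverse found so far has order -1, so the Schur
  complement is again \<partial> plus terms of order 0 and \<open>pinverse_monic\<close> applies.
  The estimate on the inverse is carried along to keep this going.\<close>

lemma monic_minv:
 assumes "finite J" "monic_mat J A"
 shows "EX B. minv J A B & (ALL i:J. ALL j:J. pord (-2) (B i j - (if i = j then pdi else 0)))" using assms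
proof (induction J rule: finite_induct)
 case empty
 show ?case by (simp add: minv_def)
next
 case (insert t J)
 have A: "pord 0 (A i j - (if i = j then pd else 0))" if "i:insert t J" "j:insert t J" for i j
  using insert.prems that unfolding monic_mat_def by blast
 have "monic_mat J A" using insert.prems insert.hyps(1) unfolding monic_mat_def by blast
 with insert.IH obtain B where B: "minv J A B" and Bo: "!!i j. i:J==>j:J==>pord (-2) (B i j - (if i = j then pdi else 0))"
  by blast
 have Bo1: "pord (-1) (B i j)" if "i:J" "j:J" for i j
 proof -
  have "pord (-1) ((B i j - (if i = j then pdi else 0)) + (if i = j then pdi else 0))"
   by (intro pord_add pord_mono[OF Bo[OF that]]) (auto intro: pord_pmon)
  thus ?thesis by simp
 qed
 have At: "pord 0 (A i t)" "pord 0 (A t i)" if "i:J" for i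
 proof -
  have "i~=t" "t~=i" using that insert.hyps by auto
  thus "pord 0 (A i t)" "pord 0 (A t i)" using A[of i t] A[of t i] that by simp_all
 qed
 define u where "u = (%i. SUM j:J. B i j*A j t)"
 define v where "v = (%j. SUM i:J. A t i*B i j)"
 have uo: "pord (-1) (u i)" if "i:J" for i unfolding u_def using that by (intro pord_sum) (use pord_mult[OF Bo1 At(1)] in auto)
 have vo: "pord (-1) (v i)" if "i:J" for i unfolding v_def using that by (intro pord_sum) (use pord_mult[OF At(2) Bo1] in auto)
 have tt: "pord 0 (A t t - pd)" using A[of t t] by simp
 have q: "pord (-1) (SUM i:J. SUM j:J. A t i*B i j*A j t)"
  by (intro pord_sum) (use pord_mult[OF pord_mult[OF At(2) Bo1] At(1)] in auto)
 have "pord 0 ((A t t - pd) - (SUM i:J. SUM j:J. A t i*B i j*A j t))" by (intro pord_diff tt pord_mono[OF q]) auto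
 hence "pord 0 (A t t - (SUM i:J. SUM j:J. A t i*B i j*A j t) - pd)" by (simp add: algebra_simps)
 from pinverse_monic[OF this] obtain e where e: "uinv (A t t - (SUM i:J. SUM j:J. A t i*B i j*A j t)) e"
  and eo: "pord (-2) (e - pdi)" by blast
 have eo1: "pord (-1) e"
 proof -
  have "pord (-1) ((e - pdi) + pdi)" by (intro pord_add pord_pmon pord_mono[OF eo]) auto
  thus ?thesis by simp
 qed
 let ?C = "%i j. if i = t then (if j = t then e else - (e*v j)) else (if j = t then - (u i*e) else B i j + u i*e*v j)"
 have "minv (insert t J) A ?C" using minv_insert[OF insert.hyps B e] unfolding u_def v_def .
 moreover have "pord (-2) (?C i j - (if i = j then pdi else 0))" if "i:insert t J" "j:insert t J" for i j
 proof -
  have ev: "pord (-2) (e*v j)" if "j:J" for j using pord_mult[OF eo1 vo[OF that]] by simp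
  have ue: "pord (-2) (u j*e)" if "j:J" for j using pord_mult[OF uo[OF that] eo1] by simp
  have uev: "pord (-2) (u i*e*v j)" if "i:J" "j:J" for i j
   by (rule pord_mono[OF pord_mult[OF ue[OF that(1)] vo[OF that(2)]]]) simp
  have "pord (-2) ((B i j - (if i = j then pdi else 0)) + u i*e*v j)" if "i:J" "j:J" for i j by (intro pord_add Bo uev that)
  hence "pord (-2) (B i j + u i*e*v j - (if i = j then pdi else 0))" if "i:J" "j:J" for i j
   using that by (simp add: algebra_simps)
  note BB = this
  consider "i = t" "j = t" | "i = t" "j:J" "j~=t" | "i:J" "i~=t" "j = t" | "i:J" "i~=t" "j:J" "j~=t"
   using \<open>i \<in> insert t J\<close> \<open>j \<in> insert t J\<close> by blast
  thus ?thesis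
  proof cases
   case 1 thus ?thesis using eo by simp
  next
   case 2 thus ?thesis using pord_uminus[OF ev[of j]] by simp
  next
   case 3 thus ?thesis using pord_uminus[OF ue[of i]] by simp
  next
   case 4 thus ?thesis using BB[of i j] by simp
  qed
 qed
 ultimately show ?case by blast
qed

text \<open>The diagonal entries of the inverse are \<open>pdi\<close> up to order -2, hence units
  by \<open>pinverse_monic'\<close>.\<close>

lemma monic_good:
 assumes "monic_mat J A"
 shows "good J A" unfolding good_def
proof (intro conjI allI impI)
 show "finite J" using assms by (simp add: monic_mat_def)
 fix K assume K: "K<=J"
 hence "finite K" using assms by (auto simp: monic_mat_def intro: finite_subset)
 moreover from this K have "monic_mat K A" using assms unfolding monic_mat_def by blast
 ultimately have "finite K" "monic_mat K A" by auto
 from monic_minv[OF this] obtain B where B: "minv K A B"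
  and Bo: "ALL i:K. ALL j:K. pord (-2) (B i j - (if i = j then pdi else 0))" by blast
 have "EX d. uinv (B t t) d" if "t:K" for t
 proof -
  have "pord (-2) (B t t - (if t = t then pdi else 0))" using Bo that by blast
  thus ?thesis using pinverse_monic'[of "B t t"] by auto
 qed
 with B show "EX B. minv K A B & (ALL t:K. EX d. uinv (B t t) d)" by blast
qed

lemma rhom_minv:
 assumes "rhom h" "minv J A B"
 shows "minv J (%i j. h (A i j)) (%i j. h (B i j))" unfolding minv_def
proof (intro ballI conjI)
 fix i j assume ij: "i:J" "j:J"
 have "(SUM k:J. h (A i k)*h (B k j)) = h (SUM k:J. A i k*B k j)"
  "(SUM k:J. h (B i k)*h (A k j)) = h (SUM k:J. B i k*A k j)"
  by (simp_all only: rhom_sum[OF assms(1)] rhomD(3)[OF assms(1)])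
 thus "(SUM k:J. h (A i k)*h (B k j)) = (if i = j then 1 else 0)"
  "(SUM k:J. h (B i k)*h (A k j)) = (if i = j then 1 else 0)"
  unfolding minvD[OF assms(2) ij] by (simp_all add: rhomD(1,4)[OF assms(1)])
qed

lemma rhom_good:
 assumes "rhom h" "good J A"
 shows "good J (%i j. h (A i j))" unfolding good_def
proof (intro conjI allI impI)
 show "finite J" using assms(2) by (simp add: good_def)
 fix K assume "K<=J"
 then obtain B where "minv K A B" "!!t. t:K==>uinv (B t t) (rinv (B t t))" using goodE[OF assms(2)] by blast
 thus "EX B. minv K (%i j. h (A i j)) B & (ALL t:K. EX d. uinv (B t t) d)"
  using rhom_minv[OF assms(1)] rhom_uinv[OF assms(1)] by blast
qed

lemma rhom_bfac:
 assumes h: "rhom h" and A: "good J A" and K: "K<=J" "t:K"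
 shows "h (bfac K A t) = bfac K (%i j. h (A i j)) t"
proof -
 obtain B where B: "minv K A B" "!!t. t:K==>uinv (B t t) (rinv (B t t))" using goodE[OF A K(1)] by blast
 have "rinv (h (B t t)) = h (rinv (B t t))" by (rule rinv_eq[OF rhom_uinv[OF h B(2)[OF K(2)]]])
 thus ?thesis by (simp add: bfac_eq[OF A K(1) B(1) K(2)] bfac_eq[OF rhom_good[OF h A] K(1) rhom_minv[OF h B(1)] K(2)])
qed

text \<open>Inverses are unique and are carried to inverses, so a Berezinian whose factors exist in
  the source may be computed there.\<close>

lemma rhom_ber:
 assumes h: "rhom h" and A: "good J A" and J: "set ord<=J"
 shows "h (ber ord A) = ber ord (%i j. h (A i j))" using J
proof (induction ord rule: rev_induct)
 case (snoc t xs)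
 thus ?case using rhom_bfac[OF h A, of "insert t (set xs)" t] by (simp add: ber_snoc rhomD[OF h])
qed (simp add: rhomD[OF h])

subsection \<open>Manin matrices\<close>

text \<open>The sign (-1)^(ij) is a map on elements instead of a scalar of the ring; identities
  between signs become case distinctions on parities.\<close>

definition sg :: "int=>int=>'a=>'a::ab_group_add" where
 "sg i j x = (if odd i & odd j then - x else x)"

lemma sg_sym: "sg i j x = sg j i x" by (auto simp: sg_def)

lemma sg_simps [simp]:
 "sg i j (sg i j x) = x" "sg i j (sg j i x) = x" "sg i j 0 = 0"
 "sg i j x = 0 \<longleftrightarrow> x = 0" "sg i j (- x) = - sg i j x"
 "even i==>sg i j x = x" "even j==>sg i j x = x" by (auto simp: sg_def)

lemma sg_odd: "odd i==>odd j==>sg i j x = - x" by (simp add: sg_def)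

lemma sg_mult: "sg i j x*y = sg i j (x*(y::'a::ring_1))" "x*sg i j y = sg i j (x*(y::'a::ring_1))" by (auto simp: sg_def)

lemma sg_add: "sg i j (x + y) = sg i j x + sg i j y" "sg i j (x - y) = sg i j x - sg i j y" by (auto simp: sg_def)

lemma sg_commute: "sg i j (sg k l x) = sg k l (sg i j x)" by (auto simp: sg_def)

lemma sg_sum: "sg i j (SUM x:X. f x) = (SUM x:X. sg i j (f x))" by (auto simp: sg_def sum_negf)

lemma pord_sg: "pord s (x::'a::ring_1 psd)==>pord s (sg i j x)" by (simp add: sg_def pord_uminus)

lemma pdeg_sg: "pdeg s (x::'a::ring_1 psd)==>pdeg s (sg i j x)" by (simp add: sg_def pdeg_uminus)

text \<open>The supercommutation relations
 $[A_{ij}, A_{kl}] = (-1)^{ij+ik+jk} [A_{kj}, A_{il}]$, rewritten so that they say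
 $(1 - P)\hat Q(1 + P) = 0$, where P is the super flip and
 $\hat Q_{ik,jl} = (-1)^{jk} A_{ij} A_{kl}$.\<close>

definition manin :: "int set=>(int=>int=>'a::ring_1)=>bool" where
 "manin J A \<longleftrightarrow> (ALL i:J. ALL k:J. ALL j:J. ALL l:J.
   sg j k (A i j*A k l) - sg i k (sg j i (A k j*A i l))
   + sg j l (sg l k (A i l*A k j)) - sg i k (sg j l (sg l i (A k l*A i j))) = 0)"

text \<open>The relation (1 - P) W (1 + P) = 0, where the array W has the entries (-1)^(jh) B_lh
  B_js at position (jl, sh). For a matrix \<open>B\<close> inverse to \<open>A\<close>, this array
  inverts the one in the Manin relation of \<open>A\<close>.\<close>

definition manin' :: "int set=>(int=>int=>'a::ring_1)=>bool" where
 "manin' J B \<longleftrightarrow> (ALL i:J. ALL k:J. ALL s:J. ALL h:J.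
   sg i h (B k h*B i s) - sg i k (sg k h (B i h*B k s))
   + sg s h (sg i s (B k s*B i h)) - sg i k (sg s h (sg k s (B i s*B k h))) = 0)"

lemma sum_pair_delta:
 fixes f :: "int=>int=>'a::ring_1"
 assumes "finite J" "i:J" "k:J"
 shows "(SUM j:J. SUM l:J. if j = i & l = k then f j l else 0) = f i k"
proof -
 have "(SUM j:J. SUM l:J. if j = i & l = k then f j l else 0) = (SUM j:J. if j = i then SUM l:J. if l = k then f j l else 0 else 0)"
  by (intro sum.cong) auto
 thus ?thesis using assms by simp
qed

text \<open>Contract over \<open>l\<close>, then over \<open>j\<close>; the first contraction forces
  \<open>k = h\<close>, where the two signs depending on \<open>j\<close> cancel.\<close>

lemma minv_tensor:
 assumes J: "finite J" and B: "minv J A B" and ij: "i:J" "k:J" "s:J" "h:J"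
 shows "(SUM j:J. SUM l:J. (sg j k (A i j*A k l))*(sg j h (B l h*B j s))) =
  (if k = h & i = s then 1 else 0)"
proof -
 have "(SUM j:J. SUM l:J. (sg j k (A i j*A k l))*(sg j h (B l h*B j s)))
   = (SUM j:J. sg j k (sg j h (A i j*((SUM l:J. A k l*B l h)*B j s))))"
  by (simp add: sum_distrib_left sum_distrib_right mult.assoc sg_mult sg_sum sg_commute[of _ h _ k])
 also have "... = (if k = h then SUM j:J. A i j*B j s else 0)" using ij by (auto simp: minvD[OF B])
 finally show ?thesis using ij by (simp add: minvD[OF B])
qed

text \<open>In operator form, let S be the super flip, so that Q W = 1; \<open>P\<close> is (1 -
  S)Q, \<open>V\<close> is W(1 + S) and \<open>X\<close> is (1 - S)V. Then P V = (1 - S)(1 + S) = 0.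
  The Manin relation of \<open>A\<close> says P S = - P, so P X = 2 P V = 0. As \<open>A\<close> is
  monic, P is (1 - S)\<partial>^2 up to a remainder \<open>R\<close> of order 1, and S X = - X.
  Hence 2 \<partial>^2 X = - R X, so the order of X is smaller than any bound on it, and X = 0 is
  the claim.\<close>

lemma manin_inverse:
 fixes A :: "int=>int=>'a::ring_1 psd"
 assumes tf: "ALL x::'a. x + x = 0-->x = 0"
  and mon: "monic_mat J A" and man: "manin J A" and B: "minv J A B"
 shows "manin' J B"
proof -
 have J: "finite J" using mon by (simp add: monic_mat_def)
 define Q where "Q i k j l = sg j k (A i j*A k l)" for i k j l
 define W where "W j l s h = sg j h (B l h*B j s)" for j l s h
 define P where "P i k j l = Q i k j l - sg i k (Q k i j l)" for i k j l
 define V where "V j l s h = W j l s h + sg s h (W j l h s)" for j l s h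
 define X where "X i k s h = V i k s h - sg i k (V k i s h)" for i k s h
 have QW: "(SUM j:J. SUM l:J. Q i k j l*W j l s h) = (if k = h & i = s then 1 else 0)"
  if "i:J" "k:J" "s:J" "h:J" for i k s h using minv_tensor[OF J B that] by (simp add: Q_def W_def)
 have PV: "(SUM j:J. SUM l:J. P i k j l*V j l s h) = 0"
  if "i:J" "k:J" "s:J" "h:J" for i k s h
 proof -
  have "(SUM j:J. SUM l:J. P i k j l*V j l s h)
    = (SUM j:J. SUM l:J. Q i k j l*W j l s h) + sg s h (SUM j:J. SUM l:J. Q i k j l*W j l h s)
     - sg i k ((SUM j:J. SUM l:J. Q k i j l*W j l s h) + sg s h (SUM j:J. SUM l:J. Q k i j l*W j l h s))"
  proof -
   have "P i k j l*V j l s h = Q i k j l*W j l s h + sg s h (Q i k j l*W j l h s)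
     - sg i k (Q k i j l*W j l s h + sg s h (Q k i j l*W j l h s))" for j l
    unfolding P_def V_def left_diff_distrib distrib_left sg_mult sg_add by (simp only: sg_commute[of s h i k]) (simp add: algebra_simps)
   thus ?thesis by (simp only: sum.distrib sum_subtractf sg_sum sg_add)
  qed
  also have "... = 0" unfolding QW[OF that] QW[OF that(1,2,4,3)] QW[OF that(2,1,3,4)] QW[OF that(2,1,4,3)]
   by (cases "k = h"; cases "i = s"; cases "k = s"; cases "i = h"; simp add: sg_def)
  finally show ?thesis .
 qed
 have Pflip: "P i k j l = - (sg j l (P i k l j))" if "i:J" "k:J" "j:J" "l:J" for i k j l
 proof -
  have "Q i k j l - sg i k (Q k i j l) + sg j l (Q i k l j) - sg i k (sg j l (Q k i l j)) = 0"
   using man that unfolding manin_def Q_def by blast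
  thus ?thesis by (simp only: P_def sg_add sg_commute[of j l i k]) (simp add: algebra_simps)
 qed
 have PX: "(SUM j:J. SUM l:J. P i k j l*X j l s h) = 0"
  if "i:J" "k:J" "s:J" "h:J" for i k s h
 proof -
  have "(SUM j:J. SUM l:J. P i k j l*(sg j l (V l j s h))) = (SUM l:J. SUM j:J. P i k j l*(sg j l (V l j s h)))"
   by (rule sum.swap)
  also have "... = (SUM l:J. SUM j:J. - (P i k l j*V l j s h))"
  proof (intro sum.cong refl)
   fix l j assume "l:J" "j:J"
   hence "P i k l j = - (sg j l (P i k j l))" using Pflip[of i k l j] that unfolding sg_sym[of l j] by blast
   thus "P i k j l*(sg j l (V l j s h)) = - (P i k l j*V l j s h)" by (simp add: sg_mult)
  qed
  also have "... = 0" using PV[OF that] by (simp add: sum_negf)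
  finally show ?thesis using PV[OF that] by (simp add: X_def right_diff_distrib sum_subtractf)
 qed
 have Xflip: "X k i s h = - (sg i k (X i k s h))" for i k s h by (simp add: X_def sg_add sg_sym[of k i])
 \<comment> \<open>What is left of \<open>P\<close> after its leading part (1 - S)\<partial>^2; one
   of the two factors \<partial> is lost in every remaining term.\<close>
 define R where "R i k j l = P i k j l - sg i k (if j = i & l = k then pd*pd else 0) + (if j = k & l = i then pd*pd else 0)" for i k j l
 have Ro: "pord 1 (R i k j l)" if ij: "i:J" "k:J" "j:J" "l:J" for i k j l
 proof -
  have q: "pord 1 (Q i k j l - sg j k (if i = j & k = l then pd*pd else 0))" if "i:J" "k:J" "j:J" "l:J" for i k j l
  proof -
   define a where "a = A i j - (if i = j then pd else 0)"
   define b where "b = A k l - (if k = l then pd else 0)"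
   have o: "pord 0 a" "pord 0 b" using mon that unfolding monic_mat_def a_def b_def by blast+
   have o1: "pord 1 (if i = j then pd else 0::'a psd)" "pord 1 (if k = l then pd else 0::'a psd)" by (auto intro: pord_pmon)
   have "A i j = a + (if i = j then pd else 0)" "A k l = b + (if k = l then pd else 0)" by (simp_all add: a_def b_def)
   hence "A i j*A k l - (if i = j & k = l then pd*pd else 0) = a*b + a*(if k = l then pd else 0) + (if i = j then pd else 0)*b"
    by (simp add: algebra_simps)
   moreover have "pord 1 (a*b + a*(if k = l then pd else 0) + (if i = j then pd else 0)*b)"
    using pord_mult[OF o(1) o(2)] pord_mult[OF o(1) o1(2)] pord_mult[OF o1(1) o(2)] by (intro pord_add) (auto elim: pord_mono)
   ultimately have "pord 1 (A i j*A k l - (if i = j & k = l then pd*pd else 0))" by simp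
   hence "pord 1 (sg j k (A i j*A k l - (if i = j & k = l then pd*pd else 0)))" by (rule pord_sg)
   thus ?thesis by (simp only: Q_def sg_add)
  qed
  have "R i k j l = (Q i k j l - sg j k (if i = j & k = l then pd*pd else 0))
    - sg i k (Q k i j l - sg j i (if k = j & i = l then pd*pd else 0))"
  proof -
   have e1: "sg j k (if i = j & k = l then pd*pd else 0) = sg i k (if j = i & l = k then pd*pd else (0::'a psd))" by auto
   have e2: "sg i k (sg j i (if k = j & i = l then pd*pd else 0)) = (if j = k & l = i then pd*pd else (0::'a psd))" by auto
   show ?thesis by (simp only: R_def P_def sg_add e1 e2) (simp add: algebra_simps)
  qed
  moreover have "pord 1 (sg i k (Q k i j l - sg j i (if k = j & i = l then pd*pd else 0)))" using q[OF ij(2,1,3,4)] by (rule pord_sg)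
  ultimately show ?thesis using q[OF ij] by (simp add: pord_diff)
 qed
 have XX: "X i k s h + X i k s h = - (pdi*(pdi*(sg i k (SUM j:J. SUM l:J. R i k j l*X j l s h))))"
  if ij: "i:J" "k:J" "s:J" "h:J" for i k s h
 proof -
  have "P i k j l*X j l s h = R i k j l*X j l s h + sg i k (if j = i & l = k then pd*pd*X j l s h else 0)
    - (if j = k & l = i then pd*pd*X j l s h else 0)" for j l
  proof -
   have "P i k j l = R i k j l + sg i k (if j = i & l = k then pd*pd else 0) - (if j = k & l = i then pd*pd else 0)"
    by (simp add: R_def)
   hence "P i k j l*X j l s h = R i k j l*X j l s h + sg i k (if j = i & l = k then pd*pd else 0)*X j l s h
     - (if j = k & l = i then pd*pd else 0)*X j l s h" by (simp only: left_diff_distrib distrib_right)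
   moreover have "(if c then a else 0)*x = (if c then a*x else 0)" for c and a x :: "'a psd" by simp
   ultimately show ?thesis by (simp only: sg_mult)
  qed
  hence "(SUM j:J. SUM l:J. P i k j l*X j l s h) = (SUM j:J. SUM l:J. R i k j l*X j l s h)
    + sg i k (pd*pd*X i k s h) - pd*pd*X k i s h"
   using sum_pair_delta[OF J ij(1,2), of "%j l. pd*pd*X j l s h"] sum_pair_delta[OF J ij(2,1), of "%j l. pd*pd*X j l s h"]
   by (simp only: sum.distrib sum_subtractf sg_sum[symmetric])
  hence "sg i k (pd*(pd*(X i k s h + X i k s h))) = - (SUM j:J. SUM l:J. R i k j l*X j l s h)"
   using PX[OF ij] by (simp add: Xflip[of k i] sg_mult sg_add distrib_left mult.assoc eq_neg_iff_add_eq_0 ac_simps)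
  hence "pdi*(pdi*(sg i k (sg i k (pd*(pd*(X i k s h + X i k s h)))))) =
    pdi*(pdi*(sg i k (- (SUM j:J. SUM l:J. R i k j l*X j l s h))))" by simp
  moreover have "pdi*(pdi*(pd*(pd*y))) = y" for y :: "'a psd" by (simp add: mult.assoc[symmetric] mult.assoc[of pdi pd])
  ultimately show ?thesis by simp
 qed
 \<comment> \<open>One step of the descent: a bound \<open>n\<close> common to the entries
   \<open>X i k s h\<close> with fixed \<open>s\<close>, \<open>h\<close> improves to
   \<open>n - 1\<close>, the factor 2 being removed by \<open>tf\<close>.\<close>
 have step: "pdeg (n - 1) (X i k s h)" if ij: "i:J" "k:J" "s:J" "h:J"
  and n: "!!i k. i:J==>k:J==>pdeg n (X i k s h)" for i k s h n
 proof -
  have ps: "pdeg (1 + n) (SUM j:J. SUM l:J. R i k j l*X j l s h)" by (intro pdeg_sum pdeg_mult pord_imp_pdeg Ro n ij)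
  have "pdeg (1 + n) (sg i k (SUM j:J. SUM l:J. R i k j l*X j l s h))" using ps by (rule pdeg_sg)
  moreover have "pdeg (- 1) (pdi::'a psd)" by (simp add: pord_imp_pdeg pord_pmon)
  ultimately have "pdeg (- 1 + (- 1 + (1 + n))) (X i k s h + X i k s h)" unfolding XX[OF ij] by (intro pdeg_uminus pdeg_mult)
  hence d: "pdeg (n - 1) (X i k s h + X i k s h)" by simp
  show ?thesis unfolding pdeg_def
  proof (intro allI impI)
   fix a b assume "pcoef (X i k s h) a b~=0"
   hence "pcoef (X i k s h + X i k s h) a b~=0" using tf unfolding pcoef_add by blast
   thus "b<=n - 1" using d unfolding pdeg_def by blast
  qed
 qed
 have X0: "X i k s h = 0" if ij: "i:J" "k:J" "s:J" "h:J" for i k s h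
 proof -
  have "ALL x:J\<times>J. EX m. pdeg m (X (fst x) (snd x) s h)" using pdeg_ex by blast
  then obtain g where g: "!!x. x:J \<times> J==>pdeg (g x) (X (fst x) (snd x) s h)" by metis
  define n0 where "n0 = Max (insert 0 (g ` (J \<times> J)))"
  have n0: "pdeg n0 (X i k s h)" if "i:J" "k:J" for i k
  proof -
   have "g (i, k)<=n0" unfolding n0_def using that J by (intro Max_ge) auto
   moreover have "pdeg (g (i, k)) (X i k s h)" using g[of "(i, k)"] that by simp
   ultimately show ?thesis unfolding pdeg_def using order_trans by blast
  qed
  have "pdeg (n0 - int n) (X i k s h)" if "i:J" "k:J" for n i k using that
  proof (induction n arbitrary: i k)
   case (Suc n)
   have "pdeg (n0 - int n - 1) (X i k s h)" by (rule step[OF Suc.prems ij(3,4) Suc.IH])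
   moreover have "n0 - int n - 1 = n0 - int (Suc n)" by simp
   ultimately show ?case by (simp only:)
  qed (simp add: n0)
  thus ?thesis using pdeg_all_zero that by blast
 qed
 show ?thesis unfolding manin'_def
 proof (intro ballI)
  fix i k s h assume "i:J" "k:J" "s:J" "h:J"
  from X0[OF this] show "sg i h (B k h*B i s) - sg i k (sg k h (B i h*B k s))
   + sg s h (sg i s (B k s*B i h)) - sg i k (sg s h (sg k s (B i s*B k h))) = 0"
   by (simp only: X_def V_def W_def sg_add sg_commute[of s h i k]) (simp add: algebra_simps)
 qed
qed

lemma manin'D:
 assumes "manin' J B" "i:J" "k:J" "s:J" "h:J"
 shows "sg i h (B k h*B i s) - sg i k (sg k h (B i h*B k s))
   + sg s h (sg i s (B k s*B i h)) - sg i k (sg s h (sg k s (B i s*B k h))) = 0" using assms unfolding manin'_def by blast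

lemma double_cancel:
 assumes tf: "ALL x::'a::ring_1. x + x = 0-->x = 0"
  and e: "e = (0::'a)" "(x - y) + (x - y) = e | (y - x) + (y - x) = e"
 shows "x = y" using e tf[rule_format, of "x - y"] tf[rule_format, of "y - x"] by auto

text \<open>Each identity is an instance of the relation with repeated indices, up to a factor 1, 2
  or 4 that \<open>tf\<close> removes.\<close>

lemma manin'_even_odd:
 assumes tf: "ALL x::'a::ring_1. x + x = 0-->x = 0"
  and B: "manin' J (B::int=>int=>'a)" and a: "a:J" "even a" and b: "b:J" "odd b"
 shows "B b a*B b a = 0" "B b a*B a a = B a a*B b a" "B b a*B b b = B b b*B b a"
  "B a a*B b b - B b b*B a a = B a b*B b a + B b a*B a b"
proof -
 note tf' = double_cancel[OF tf]
 have "(B b a*B b a + B b a*B b a) + (B b a*B b a + B b a*B b a) = 0"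
  using manin'D[OF B b(1) b(1) a(1) a(1)] a b by (simp add: sg_odd add.assoc)
 thus "B b a*B b a = 0" using tf by blast
 show "B b a*B a a = B a a*B b a"
  by (rule tf'[OF manin'D[OF B a(1) b(1) a(1) a(1)]]) (use a b in \<open>simp add: sg_odd algebra_simps\<close>)
 show "B b a*B b b = B b b*B b a"
  by (rule tf'[OF manin'D[OF B b(1) b(1) a(1) b(1)]]) (use a b in \<open>simp add: sg_odd algebra_simps\<close>)
 show "B a a*B b b - B b b*B a a = B a b*B b a + B b a*B a b"
  using manin'D[OF B a(1) b(1) a(1) b(1)] a b by (simp add: sg_odd algebra_simps)
qed

lemma manin'_even_even:
 assumes tf: "ALL x::'a::ring_1. x + x = 0-->x = 0"
  and B: "manin' J (B::int=>int=>'a)" and a: "a:J" "even a" and b: "b:J" "even b"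
 shows "B a b*B b b = B b b*B a b" "B a a*B b a = B b a*B a a"
  "B b b*B a a - B a b*B b a = B a a*B b b - B b a*B a b"
proof -
 note tf' = double_cancel[OF tf]
 show "B a b*B b b = B b b*B a b"
  by (rule tf'[OF manin'D[OF B a(1) b(1) b(1) b(1)]]) (use a b in \<open>simp add: sg_odd algebra_simps\<close>)
 show "B a a*B b a = B b a*B a a"
  by (rule tf'[OF manin'D[OF B a(1) b(1) a(1) a(1)]]) (use a b in \<open>simp add: sg_odd algebra_simps\<close>)
 show "B b b*B a a - B a b*B b a = B a a*B b b - B b a*B a b"
  using manin'D[OF B a(1) b(1) a(1) b(1)] a b by (simp add: algebra_simps)
qed

lemma manin'_odd_odd:
 assumes tf: "ALL x::'a::ring_1. x + x = 0-->x = 0"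
  and B: "manin' J (B::int=>int=>'a)" and a: "a:J" "odd a" and b: "b:J" "odd b"
 shows "B a a*B a b = B a b*B a a" "B b a*B b b = B b b*B b a"
  "B a a*B b b - B b b*B a a = B a b*B b a - B b a*B a b"
proof -
 note tf' = double_cancel[OF tf]
 show "B a a*B a b = B a b*B a a"
  by (rule tf'[OF manin'D[OF B a(1) a(1) a(1) b(1)]]) (use a b in \<open>simp add: sg_odd algebra_simps\<close>)
 show "B b a*B b b = B b b*B b a"
  by (rule tf'[OF manin'D[OF B b(1) b(1) a(1) b(1)]]) (use a b in \<open>simp add: sg_odd algebra_simps\<close>)
 show "B a a*B b b - B b b*B a a = B a b*B b a - B b a*B a b"
  using manin'D[OF B a(1) b(1) a(1) b(1)] a b by (simp add: sg_odd algebra_simps)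
qed

subsection \<open>Independence of the Berezinian of the order\<close>

lemma ber_snoc2: "ber (xs @ [a, b]) A = ber xs A*(bfac (insert a (set xs)) A a*bfac (insert a (insert b (set xs))) A b)"
 using ber_snoc[of xs a A] ber_snoc[of "xs @ [a]" b A] by (simp add: mult.assoc insert_commute)

text \<open>Both factors come from the one inverse \<open>B\<close>: the last from
  \<open>B b b\<close>, the one before from the Schur complement given by
  \<open>minv_remove\<close>. Two neighbouring factors are therefore a problem about a 2 by 2 block
  of \<open>B\<close>.\<close>

lemma bfac_pair:
 assumes A: "good J A" and K: "insert a (insert b K)<=J" "a~=b" "a~:K" "b~:K"
  and B: "minv (insert a (insert b K)) A B"
 shows "bfac (insert a K) A a = (if even a then rinv (B a a - B a b*rinv (B b b)*B b a) else B a a - B a b*rinv (B b b)*B b a)"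
  "bfac (insert a (insert b K)) A b = (if even b then rinv (B b b) else B b b)"
  "uinv (B b b) (rinv (B b b))" "uinv (B a a) (rinv (B a a))"
  "uinv (B a a - B a b*rinv (B b b)*B b a) (rinv (B a a - B a b*rinv (B b b)*B b a))"
proof -
 show u: "uinv (B b b) (rinv (B b b))" "uinv (B a a) (rinv (B a a))" using good_minv_uinv[OF A K(1) B] by auto
 have fin: "finite (insert a K)" using A K(1) by (auto simp: good_def intro: finite_subset)
 have "minv (insert b (insert a K)) A B" using B by (simp add: insert_commute)
 from minv_remove[OF fin _ this u(1)] K
 have C: "minv (insert a K) A (%i j. B i j - B i b*rinv (B b b)*B b j)" by auto
 have sub: "insert a K<=J" using K by auto
 show "bfac (insert a K) A a = (if even a then rinv (B a a - B a b*rinv (B b b)*B b a) else B a a - B a b*rinv (B b b)*B b a)"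
  using bfac_eq[OF A sub C, of a] by simp
 show "uinv (B a a - B a b*rinv (B b b)*B b a) (rinv (B a a - B a b*rinv (B b b)*B b a))"
  using good_minv_uinv[OF A sub C, of a] by simp
 show "bfac (insert a (insert b K)) A b = (if even b then rinv (B b b) else B b b)" using bfac_eq[OF A K(1) B, of b] by simp
qed

text \<open>Two expressions for the Berezinian of a 2 by 2 supermatrix. The product (x - y w^-1 z)(w
  - z x^-1 y) equals w x, because z squares to zero and passes through both inverses.\<close>

lemma superdet_swap:
 fixes x y z w :: "'a::ring_1"
 assumes r: "z*z = 0" "z*x = x*z" "z*w = w*z" "x*w - w*x = y*z + z*y"
  and x: "uinv x xi" and w: "uinv w wi" and e: "uinv (x - y*wi*z) e"
 shows "e*w = (w - z*xi*y)*xi"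
proof -
 have zx: "xi*z = z*xi" by (rule uinv_commute[OF x]) (simp add: r)
 have zw: "wi*z = z*wi" by (rule uinv_commute[OF w]) (simp add: r)
 have "(x - y*wi*z)*(w - z*xi*y) = x*w - x*(z*xi)*y - y*(wi*z*w) + y*wi*(z*z)*xi*y"
  by (simp add: algebra_simps)
 also have "x*(z*xi) = z" using x by (simp add: zx[symmetric] uinv_def mult.assoc[symmetric])
 also have "wi*z*w = z" using w by (simp add: zw uinv_def mult.assoc)
 also have "x*w - z*y - y*z + y*wi*(z*z)*xi*y = w*x" using r(1,4) by (simp add: algebra_simps)
 finally have "e*((x - y*wi*z)*(w - z*xi*y))*xi = e*(w*x)*xi" by simp
 moreover have "e*(w*x)*xi = e*w" using x by (simp add: mult.assoc uinv_def)
 moreover have "e*((x - y*wi*z)*(w - z*xi*y))*xi = (w - z*xi*y)*xi"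
  using e by (simp add: mult.assoc[symmetric] uinv_def)
 ultimately show ?thesis by simp
qed

lemma ber_pair_swap:
 fixes A :: "int=>int=>'a::ring_1"
 assumes tf: "ALL x::'a. x + x = 0-->x = 0"
  and A: "good J A" and K: "insert a (insert b K)<=J" "a~:K" "b~:K"
  and B: "minv (insert a (insert b K)) A B" "manin' (insert a (insert b K)) B"
  and par: "even a" "odd b"
 shows "bfac (insert a K) A a*bfac (insert a (insert b K)) A b = (B b b - B b a*rinv (B a a)*B a b)*rinv (B a a)"
  "bfac (insert b K) A b*bfac (insert b (insert a K)) A a = (B b b - B b a*rinv (B a a)*B a b)*rinv (B a a)"
proof -
 have ab: "a~=b" using par by auto
 have K': "insert b (insert a K)<=J" using K by auto
 have B': "minv (insert b (insert a K)) A B" using B(1) by (simp add: insert_commute)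
 note p = bfac_pair[OF A K(1) ab K(2,3) B(1)] and p' = bfac_pair[OF A K' ab[symmetric] K(3,2) B']
 note m = manin'_even_odd[OF tf B(2) _ par(1) _ par(2)]
 show "bfac (insert b K) A b*bfac (insert b (insert a K)) A a = (B b b - B b a*rinv (B a a)*B a b)*rinv (B a a)"
  using p'(1,2) par by simp
 show "bfac (insert a K) A a*bfac (insert a (insert b K)) A b = (B b b - B b a*rinv (B a a)*B a b)*rinv (B a a)"
  using superdet_swap[OF m p(4) p(3) p(5)] p(1,2) par by simp
qed

lemma manin_subset: "manin J A==>K<=J==>manin K A" unfolding manin_def by blast

lemma monic_subset: "monic_mat J A==>K<=J==>monic_mat K A"
 unfolding monic_mat_def using finite_subset by blast

text \<open>Two orders are linked by \<open>oswap\<close> if one arises from the other by transposing adjacent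
 indices of different parities.\<close>

inductive oswap :: "int list=>int list=>bool" where
 none: "oswap xs xs"
| transpose: "oswap xs (ys @ [a, b] @ zs)==>odd (a + b)==>oswap xs (ys @ [b, a] @ zs)"

lemma oswap_trans: "oswap ys zs==>oswap xs ys==>oswap xs zs"
 by (induction ys zs rule: oswap.induct) (auto intro: oswap.intros simp del: append_Cons)

lemma oswap_cong: "oswap xs ys==>oswap (us @ xs @ vs) (us @ ys @ vs)"
proof (induction xs ys rule: oswap.induct)
 case (transpose xs ys a b zs)
 have "oswap (us @ xs @ vs) ((us @ ys) @ [b, a] @ (zs @ vs))" by (rule oswap.transpose) (use transpose in simp_all)
 thus ?case by simp
qed (rule oswap.none)

lemma oswap_one:
 assumes "!!y. y:set ys==>odd (x + y)"
 shows "oswap (x # ys) (ys @ [x])" using assms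
proof (induction ys)
 case (Cons y ys)
 have "oswap (x # y # ys) ([] @ [x, y] @ ys)" by (simp add: oswap.none)
 from oswap.transpose[OF this] have 1: "oswap (x # y # ys) (y # x # ys)" using Cons.prems by simp
 have "oswap ([y] @ (x # ys) @ []) ([y] @ (ys @ [x]) @ [])" by (rule oswap_cong[OF Cons.IH]) (use Cons.prems in auto)
 thus ?case using oswap_trans[OF _ 1] by simp
qed (simp add: oswap.none)

lemma oswap_block:
 assumes "!!x y. x:set xs==>y:set ys==>odd (x + y)"
 shows "oswap (xs @ ys) (ys @ xs)" using assms
proof (induction xs rule: rev_induct)
 case (snoc x xs)
 have "oswap (x # ys) (ys @ [x])" using snoc.prems by (intro oswap_one) auto
 from oswap_cong[OF this, of xs "[]"] have 1: "oswap ((xs @ [x]) @ ys) ((xs @ ys) @ [x])" by simp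
 have "oswap (xs @ ys) (ys @ xs)" using snoc.prems by (intro snoc.IH) auto
 from oswap_cong[OF this, of "[]" "[x]"] have "oswap ((xs @ ys) @ [x]) ((ys @ xs) @ [x])" by simp
 from oswap_trans[OF this 1] show ?case by simp
qed (simp add: oswap.none)

lemma oswap_set: "oswap xs ys==>set ys = set xs & (distinct ys \<longleftrightarrow> distinct xs)"
 by (induction xs ys rule: oswap.induct) auto

text \<open>The factors before a transposed pair do not see it, and those after it depend on sets
  only. For the pair itself \<open>ber_pair_swap\<close> gives the same element in both
  orders.\<close>

theorem ber_oswap:
 fixes A :: "int=>int=>'a::ring_1 psd"
 assumes sw: "oswap xs ys" and tf: "ALL x::'a. x + x = 0-->x = 0"
  and mon: "monic_mat J A" and man: "manin J A" and xs: "set xs<=J" "distinct xs"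
 shows "ber ys A = ber xs A" using sw xs
proof (induction xs ys rule: oswap.induct)
 case (transpose xs ys a b zs)
 have tfp: "ALL x::'a psd. x + x = 0-->x = 0"
 proof (intro allI impI psd_eqI)
  fix x :: "'a psd" and i j assume "x + x = 0"
  hence "pcoef (x + x) i j = pcoef 0 i j" by (simp only:)
  hence "pcoef x i j + pcoef x i j = 0" by (simp only: pcoef_add pcoef_zero)
  with tf have "pcoef x i j = 0" by blast
  thus "pcoef x i j = pcoef 0 i j" by (simp only: pcoef_zero)
 qed
 have set: "set ys Un {a, b}<=J" and dis: "a~=b" "a~:set ys" "b~:set ys"
  using oswap_set[OF transpose.hyps(1)] transpose.prems by auto
 have gd: "good J A" by (rule monic_good[OF mon])
 have main: "bfac (insert a (set ys)) A a*bfac (insert a (insert b (set ys))) A b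
   = bfac (insert b (set ys)) A b*bfac (insert b (insert a (set ys))) A a"
  if ab: "even a" "odd b" "set ys Un {a, b}<=J" "a~:set ys" "b~:set ys" for a b
 proof -
  have sub: "insert a (insert b (set ys))<=J" using ab by auto
  obtain B where B: "minv (insert a (insert b (set ys))) A B" using goodE[OF gd sub] by blast
  have "manin' (insert a (insert b (set ys))) B" by (rule manin_inverse[OF tf monic_subset[OF mon sub] manin_subset[OF man sub] B])
  from ber_pair_swap[OF tfp gd sub ab(4,5) B this ab(1,2)] show ?thesis by simp
 qed
 have "bfac (insert a (set ys)) A a*bfac (insert a (insert b (set ys))) A b
   = bfac (insert b (set ys)) A b*bfac (insert b (insert a (set ys))) A a"
 proof (cases "even a")
  case True
  thus ?thesis using main[of a b] transpose.hyps(2) set dis by auto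
 next
  case False
  thus ?thesis using main[of b a] transpose.hyps(2) set dis by auto
 qed
 hence "ber (ys @ [a, b]) A = ber (ys @ [b, a]) A" by (simp add: ber_snoc2)
 hence "ber ((ys @ [a, b]) @ zs) A = ber ((ys @ [b, a]) @ zs) A" by (rule ber_append_cong) auto
 thus ?case using transpose by simp
qed simp

subsection \<open>Invariance of the Berezinian\<close>

text \<open>\<open>covar J g h X A\<close> says how the matrix A transforms under the adjoint action of an element X
 that behaves like $E_{g,h}$.\<close>

definition covar :: "int set=>int=>int=>'a::ring_1=>(int=>int=>'a)=>bool" where
 "covar J g h X A \<longleftrightarrow> (ALL k:J. ALL l:J. sg (g + h) k (X*A k l) - sg (g + h) l (A k l*X) =
   sg (g + h) g ((if k = h then A g l else 0) - (if l = g then A k h else 0)))"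

text \<open>The rule [T, A^-1] = - A^-1 [T, A] A^-1 for a diagonal matrix \<open>T\<close>.\<close>

lemma covar_inverse_aux:
 fixes A :: "int=>int=>'a::ring_1"
 assumes K: "finite K" and B: "minv K A B"
  and T: "!!k l. k:K==>l:K==>T k*A k l - A k l*T l = R k l"
  and ij: "i:K" "j:K"
 shows "T i*B i j - B i j*T j = - (SUM k:K. SUM l:K. B i k*R k l*B l j)"
proof -
 have "(SUM k:K. SUM l:K. B i k*R k l*B l j)
   = (SUM k:K. SUM l:K. B i k*(T k*A k l - A k l*T l)*B l j)"
  by (rule sum.cong[OF refl], rule sum.cong[OF refl]) (simp add: T)
 also have "... = (SUM k:K. B i k*T k*(SUM l:K. A k l*B l j)) - (SUM k:K. SUM l:K. B i k*A k l*(T l*B l j))"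
  by (simp add: algebra_simps sum_subtractf sum_distrib_left)
 also have "(SUM k:K. SUM l:K. B i k*A k l*(T l*B l j)) = (SUM l:K. (SUM k:K. B i k*A k l)*(T l*B l j))"
  by (simp add: sum_distrib_right) (rule sum.swap)
 also have "(SUM k:K. B i k*T k*(SUM l:K. A k l*B l j)) = B i j*T j"
  using ij K by (simp add: minvD[OF B] sum_delta_mult)
 also have "(SUM l:K. (SUM k:K. B i k*A k l)*(T l*B l j)) = T i*B i j"
  using ij K by (simp add: minvD[OF B] sum_delta_mult)
 finally show ?thesis by simp
qed

text \<open>The correction term of the covariance law involves one row or one column of
  \<open>A\<close>. Between two factors \<open>B\<close> it collapses to a single entry of
  \<open>B\<close>, which is why the inverse obeys the same law.\<close>

lemma covar_inverse:
 fixes A :: "int=>int=>'a::ring_1"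
 assumes K: "finite K" and B: "minv K A B" and X: "covar K g h X A" and gh: "g:K" "h:K"
 shows "covar K g h X B" unfolding covar_def
proof (intro ballI)
 fix i j assume ij: "i:K" "j:K"
 define R where "R k l = sg (g + h) g ((if k = h then A g l else 0) - (if l = g then A k h else 0))" for k l
 have T: "sg (g + h) k X*A k l - A k l*sg (g + h) l X = R k l" if "k:K" "l:K" for k l
  using X that unfolding covar_def R_def sg_mult by blast
 have "(SUM k:K. SUM l:K. B i k*R k l*B l j) = sg (g + h) g
   ((SUM k:K. SUM l:K. if k = h then B i k*(A g l*B l j) else 0) - (SUM k:K. SUM l:K. if l = g then B i k*A k h*B l j else 0))"
  unfolding R_def sg_mult sg_sum[symmetric] sum_subtractf[symmetric]
  by (intro arg_cong[where f = "sg (g + h) g"] sum.cong refl) (auto simp: algebra_simps)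
 also have "(SUM k:K. SUM l:K. if k = h then B i k*(A g l*B l j) else 0) = (SUM k:K. if k = h then B i k*(SUM l:K. A g l*B l j) else 0)"
  by (rule sum.cong[OF refl]) (auto simp: sum_distrib_left)
 also have "... = (if g = j then B i h else 0)" using K gh ij by (simp add: minvD[OF B])
 also have "(SUM k:K. SUM l:K. if l = g then B i k*A k h*B l j else 0) = (SUM l:K. if l = g then (SUM k:K. B i k*A k h)*B l j else 0)"
  by (subst sum.swap, rule sum.cong[OF refl]) (auto simp: sum_distrib_right)
 also have "... = (if i = h then B g j else 0)" using K gh ij by (simp add: minvD[OF B])
 finally have S: "(SUM k:K. SUM l:K. B i k*R k l*B l j) = sg (g + h) g ((if g = j then B i h else 0) - (if i = h then B g j else 0))" .
 have "sg (g + h) i X*B i j - B i j*sg (g + h) j X = - (SUM k:K. SUM l:K. B i k*R k l*B l j)"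
  by (rule covar_inverse_aux[OF K B T ij])
 also have "... = sg (g + h) g ((if i = h then B g j else 0) - (if j = g then B i h else 0))" unfolding S by (auto simp: sg_add)
 finally show "sg (g + h) i (X*B i j) - sg (g + h) j (B i j*X) =
   sg (g + h) g ((if i = h then B g j else 0) - (if j = g then B i h else 0))" by (simp only: sg_mult)
qed

text \<open>For \<open>g\<close> and \<open>h\<close> outside \<open>K\<close> the law has no
  correction term on \<open>K\<close>, so \<open>X\<close> supercommutes with the block and with its
  inverse. On the diagonal the two signs coincide.\<close>

lemma covar_outside:
 fixes A :: "int=>int=>'a::ring_1"
 assumes K: "finite K" and B: "minv K A B" and X: "covar K g h X A" and gh: "g~:K" "h~:K" and t: "t:K"
 shows "X*B t t = B t t*X"
proof -
 have T: "sg (g + h) k X*A k l - A k l*sg (g + h) l X = 0" if "k:K" "l:K" for k l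
 proof -
  have "k~=h" "l~=g" using gh that by auto
  moreover have "sg (g + h) k (X*A k l) - sg (g + h) l (A k l*X) = sg (g + h) g ((if k = h then A g l else 0) - (if l = g then A k h else 0))"
   using X that unfolding covar_def by blast
  ultimately show ?thesis by (simp add: sg_mult)
 qed
 have "sg (g + h) t X*B t t - B t t*sg (g + h) t X = 0" using covar_inverse_aux[OF K B T t t] by simp
 thus ?thesis by (auto simp: sg_def split: if_splits)
qed

lemma covar_subset: "covar J g h X A==>K<=J==>covar K g h X A" unfolding covar_def by blast

lemma covarD:
 assumes "covar J g h X A" "k:J" "l:J"
 shows "sg (g + h) k (X*A k l) - sg (g + h) l (A k l*X) =
   sg (g + h) g ((if k = h then A g l else 0) - (if l = g then A k h else 0))" using assms unfolding covar_def by blast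

lemma commute_bfac:
 assumes A: "good J A" and K: "K<=J" "t:K" and B: "minv K A B" and X: "X*B t t = B t t*X"
 shows "X*bfac K A t = bfac K A t*X" using bfac_eq[OF A K(1) B K(2)] uinv_commute[OF good_minv_uinv[OF A K(1) B K(2)], of X] X by simp

text \<open>These are 2 by 2 determinants in the arrangement met for an even pair (first two) and
  for an odd pair (last two), with \<open>X\<close> as raising or lowering element. The last
  hypothesis of each cancels the one commutator that is left over.\<close>

lemma det_commute:
 fixes x y z w X :: "'a::ring_1"
 shows "X*x = x*X - y==>X*y = y*X==>X*z = z*X + x - w==>X*w = w*X + y==>y*w = w*y ==>
   X*(w*x - y*z) = (w*x - y*z)*X"
  and "X*x = x*X + z==>X*y = y*X + w - x==>X*z = z*X==>X*w = w*X - z==>x*z = z*x ==>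
   X*(w*x - y*z) = (w*x - y*z)*X"
  and "X*x = x*X - y==>X*y = y*X==>X*z = z*X + x - w==>X*w = w*X + y==>x*y = y*x ==>
   X*(x*w - y*z) = (x*w - y*z)*X"
  and "X*x = x*X + z==>X*y = y*X + w - x==>X*z = z*X==>X*w = w*X - z==>z*w = w*z ==>
   X*(x*w - y*z) = (x*w - y*z)*X"
 by (simp_all add: right_diff_distrib left_diff_distrib distrib_left distrib_right mult.assoc[symmetric])
   (simp_all add: right_diff_distrib left_diff_distrib distrib_left distrib_right mult.assoc)

lemma assoc_rule: "a*b = c==>a*(b*t) = c*(t::'a::semigroup_mult)" by (simp only: mult.assoc[symmetric])

text \<open>The mixed pair: here \<open>X\<close> is odd and passes odd entries with a sign.
  \<open>Xi\<close> differentiates the inverse of \<open>x\<close>. In the second claim the Manin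
  relations are needed to bring all terms into one normal form.\<close>

lemma superdet_commute:
 fixes x y z w X :: "'a::ring_1"
 assumes x: "uinv x xi"
 shows "X*x = x*X - y==>X*y = - (y*X)==>X*z = w - x - z*X==>X*w = w*X - y ==>
   X*((w - z*xi*y)*xi) = ((w - z*xi*y)*xi)*X"
  and "X*x = x*X - z==>X*y = x - w - y*X==>X*z = - (z*X)==>X*w = w*X - z ==>
   z*z = 0==>z*x = x*z==>z*w = w*z==>x*w - w*x = y*z + z*y ==>
   X*((w - z*xi*y)*xi) = ((w - z*xi*y)*xi)*X"
proof -
 have xi: "x*xi = 1" "xi*x = 1" using x by (auto simp: uinv_def)
 have xi': "x*(xi*t) = t" "xi*(x*t) = t" for t by (simp_all only: assoc_rule[OF xi(1)] assoc_rule[OF xi(2)] mult_1_left)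
 have Xi: "X*xi = xi*X + xi*(c*xi)" if "X*x = x*X - c" for c
 proof -
  have "xi*(X*x)*xi = xi*(x*X - c)*xi" by (simp add: that)
  thus ?thesis by (simp add: algebra_simps xi xi')
 qed
 {
  assume r: "X*x = x*X - y" "X*y = - (y*X)" "X*z = w - x - z*X" "X*w = w*X - y"
  have r': "X*(x*t) = x*(X*t) - y*t" "X*(y*t) = - (y*(X*t))" "X*(z*t) = w*t - x*t - z*(X*t)"
   "X*(w*t) = w*(X*t) - y*t" "X*(xi*t) = xi*(X*t) + xi*(y*(xi*t))" for t
   by (simp_all only: assoc_rule[OF r(1)] assoc_rule[OF r(2)] assoc_rule[OF r(3)] assoc_rule[OF r(4)] assoc_rule[OF Xi[OF r(1)]]
      left_diff_distrib distrib_right mult_minus_left mult.assoc)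
  show "X*((w - z*xi*y)*xi) = ((w - z*xi*y)*xi)*X"
   by (simp add: left_diff_distrib right_diff_distrib distrib_left mult.assoc r r' Xi[OF r(1)] xi xi')
 }
 {
  assume r: "X*x = x*X - z" "X*y = x - w - y*X" "X*z = - (z*X)" "X*w = w*X - z"
   and m: "z*z = 0" "z*x = x*z" "z*w = w*z" "x*w - w*x = y*z + z*y"
  have r': "X*(x*t) = x*(X*t) - z*t" "X*(y*t) = x*t - w*t - y*(X*t)" "X*(z*t) = - (z*(X*t))"
   "X*(w*t) = w*(X*t) - z*t" "X*(xi*t) = xi*(X*t) + xi*(z*(xi*t))" for t
   by (simp_all only: assoc_rule[OF r(1)] assoc_rule[OF r(2)] assoc_rule[OF r(3)] assoc_rule[OF r(4)] assoc_rule[OF Xi[OF r(1)]]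
      left_diff_distrib distrib_right mult_minus_left mult.assoc)
  have zi: "xi*z = z*xi" by (rule uinv_commute[OF x]) (simp add: m)
  have c: "xi*(z*t) = z*(xi*t)" "z*(z*t) = 0" "x*(z*t) = z*(x*t)" "w*(z*t) = z*(w*t)" for t
   by (simp_all only: assoc_rule[OF zi] assoc_rule[OF m(1)] assoc_rule[OF m(2)[symmetric]] assoc_rule[OF m(3)[symmetric]] mult.assoc mult_zero_left)
  have yz: "y*(z*t) = x*(w*t) - w*(x*t) - z*(y*t)" for t
  proof -
   have "y*z = x*w - w*x - z*y" using m(4) by (simp add: algebra_simps)
   hence "y*z*t = (x*w - w*x - z*y)*t" by simp
   thus ?thesis by (simp add: left_diff_distrib mult.assoc)
  qed
  show "X*((w - z*xi*y)*xi) = ((w - z*xi*y)*xi)*X"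
   by (simp add: left_diff_distrib right_diff_distrib distrib_left mult.assoc r r' Xi[OF r(1)] xi xi' c zi yz m(1) m(2)[symmetric] m(3)[symmetric])
 }
qed

text \<open>Depending on the parities, the product of the two factors is the inverse of a 2 by 2
  determinant of \<open>B\<close>, such a determinant, or the superdeterminant
  \<open>(w - z * xi * y) * xi\<close>. On the entries of \<open>B\<close> the element
  \<open>X\<close> acts by the covariance law.\<close>

lemma commute_pair:
 fixes A :: "int=>int=>'a::ring_1"
 assumes tf: "ALL x::'a. x + x = 0-->x = 0"
  and A: "good J A" and K: "insert a (insert b K)<=J" "a~=b" "a~:K" "b~:K"
  and B: "minv (insert a (insert b K)) A B" "manin' (insert a (insert b K)) B"
  and X: "covar J g h X A" and gh: "{g, h} = {a, b}"
 shows "X*(bfac (insert a K) A a*bfac (insert a (insert b K)) A b) = (bfac (insert a K) A a*bfac (insert a (insert b K)) A b)*X"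
proof -
 let ?K = "insert a (insert b K)"
 have fin: "finite ?K" using A K(1) by (auto simp: good_def intro: finite_subset)
 have XB: "covar ?K g h X B" by (rule covar_inverse[OF fin B(1) covar_subset[OF X K(1)]]) (use gh in auto)
 note D = covarD[OF XB]
 note p = bfac_pair[OF A K B(1)]
 have ab: "(g = a & h = b) | (g = b & h = a)" using gh by (auto simp: doubleton_eq_iff)
 show ?thesis
 proof (cases "even (a + b)")
  case True
  have ev: "even (g + h)" using True ab by (auto simp: add.commute)
  define x y z w where "x = B a a" and "y = B a b" and "z = B b a" and "w = B b b"
  have r: "(X*x = x*X - y & X*y = y*X & X*z = z*X + x - w & X*w = w*X + y) |
    (X*x = x*X + z & X*y = y*X + w - x & X*z = z*X & X*w = w*X - z)" using ab
  proof
   assume "g = a & h = b"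
   thus ?thesis using D[of a a] D[of a b] D[of b a] D[of b b] ev K(2)
    unfolding x_def y_def z_def w_def by (intro disjI1) (auto simp: algebra_simps)
  next
   assume "g = b & h = a"
   thus ?thesis using D[of a a] D[of a b] D[of b a] D[of b b] ev K(2)
    unfolding x_def y_def z_def w_def by (intro disjI2) (auto simp: algebra_simps)
  qed
  show ?thesis
  proof (cases "even a")
   case ea: True
   with True have eb: "even b" by auto
   note m = manin'_even_even[OF tf B(2) _ ea _ eb]
   have yw: "y*w = w*y" "x*z = z*x" using m by (simp_all add: x_def y_def z_def w_def)
   have "X*(w*x - y*z) = (w*x - y*z)*X" using r det_commute(1)[of X x y z w] det_commute(2)[of X x z y w] yw by blast
   moreover have "uinv (w*(x - y*rinv w*z)) (rinv (x - y*rinv w*z)*rinv w)"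
    using p(3,5) unfolding x_def y_def z_def w_def by (intro uinv_mult)
   moreover have "w*(x - y*rinv w*z) = w*x - y*z"
   proof -
    have "w*(y*rinv w*z) = y*(w*rinv w)*z" by (simp add: mult.assoc[symmetric] yw(1))
    also have "w*rinv w = 1" using p(3) by (simp add: w_def uinv_def)
    finally show ?thesis by (simp add: right_diff_distrib)
   qed
   ultimately have "rinv (x - y*rinv w*z)*rinv w*X = X*(rinv (x - y*rinv w*z)*rinv w)"
    using uinv_commute[of "w*x - y*z" _ X] by simp
   thus ?thesis using p(1,2) ea eb by (simp add: x_def y_def z_def w_def)
  next
   case oa: False
   with True have ob: "odd b" by auto
   note m = manin'_odd_odd[OF tf B(2) _ oa _ ob]
   have yw: "x*y = y*x" "z*w = w*z" using m by (simp_all add: x_def y_def z_def w_def)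
   have "X*(x*w - y*z) = (x*w - y*z)*X" using r det_commute(3)[of X x y z w] det_commute(4)[of X x z y w] yw by blast
   moreover have "(x - y*rinv w*z)*w = x*w - y*z"
   proof -
    have "y*rinv w*z*w = y*(rinv w*w)*z" by (simp add: mult.assoc yw(2))
    also have "rinv w*w = 1" using p(3) by (simp add: w_def uinv_def)
    finally show ?thesis by (simp add: left_diff_distrib)
   qed
   ultimately show ?thesis using p(1,2) oa ob by (simp add: x_def y_def z_def w_def)
  qed
 next
  case False
  have main: "X*((B b b - B b a*rinv (B a a)*B a b)*rinv (B a a)) = ((B b b - B b a*rinv (B a a)*B a b)*rinv (B a a))*X"
   if ab: "(g = a & h = b) | (g = b & h = a)" and par: "even a" "odd b" and in_K: "a:?K" "b:?K"
    and u: "uinv (B a a) (rinv (B a a))" for a b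
  proof -
   have ne: "a~=b" "b~=a" using par by auto
   show ?thesis using ab
  proof
   assume gh: "g = a & h = b"
   show ?thesis by (rule superdet_commute(1)[OF u])
      (use D[OF in_K(1,1)] D[OF in_K] D[OF in_K(2,1)] D[OF in_K(2,2)] gh par ne in \<open>auto simp: sg_odd algebra_simps eq_neg_iff_add_eq_0 neg_eq_iff_add_eq_0\<close>)
  next
   assume gh: "g = b & h = a"
   note m = manin'_even_odd[OF tf B(2) in_K(1) par(1) in_K(2) par(2)]
   show ?thesis by (rule superdet_commute(2)[OF u _ _ _ _ m])
      (use D[OF in_K(1,1)] D[OF in_K] D[OF in_K(2,1)] D[OF in_K(2,2)] gh par ne in \<open>auto simp: sg_odd algebra_simps eq_neg_iff_add_eq_0 neg_eq_iff_add_eq_0\<close>)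
  qed
  qed
  show ?thesis
  proof (cases "even a")
   case ea: True
   hence ob: "odd b" using False by auto
   show ?thesis using main[OF ab ea ob _ _ p(4)] unfolding ber_pair_swap(1)[OF tf A K(1,3,4) B ea ob] by simp
  next
   case oa: False
   hence eb: "even b" using False by auto
   have sw: "insert b (insert a K) = ?K" by auto
   have "(g = b & h = a) | (g = a & h = b)" using ab by auto
   from main[OF this eb oa _ _ p(3)] show ?thesis
    using ber_pair_swap(2)[of J A b a K B, OF tf A _ K(4,3) _ _ eb oa] K(1) B unfolding sw by simp
  qed
 qed
qed

lemma commute_prod: "X*a = a*(X::'a::ring_1)==>X*b = b*X==>X*(a*b) = (a*b)*X"
 by (metis mult.assoc)

lemma commute_ber_prefix:
 assumes A: "good J A" and X: "covar J g h X A" and xs: "set xs<=J" "g~:set xs" "h~:set xs"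
 shows "X*ber xs A = ber xs A*X" using xs
proof (induction xs rule: rev_induct)
 case (snoc t xs)
 have sub: "insert t (set xs)<=J" using snoc.prems by auto
 obtain B where B: "minv (insert t (set xs)) A B" using goodE[OF A sub] by blast
 have "X*B t t = B t t*X" by (rule covar_outside[OF _ B covar_subset[OF X sub]]) (use snoc.prems in auto)
 from commute_bfac[OF A sub _ B this] snoc show ?case by (simp add: ber_snoc commute_prod)
qed simp

text \<open>The factor at a later \<open>t\<close> comes from a diagonal entry of an inverse whose
  index set contains \<open>g\<close> and \<open>h\<close>; since \<open>t\<close> differs from
  both, the covariance law has no correction term there.\<close>

lemma commute_ber_suffix:
 assumes A: "good J A" and X: "covar J g h X A" and xs: "X*ber xs A = ber xs A*X" "g:set xs" "h:set xs"
  and ys: "set (xs @ ys)<=J" "distinct (xs @ ys)"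
 shows "X*ber (xs @ ys) A = ber (xs @ ys) A*X" using ys
proof (induction ys rule: rev_induct)
 case (snoc t ys)
 let ?K = "insert t (set (xs @ ys))"
 have sub: "?K<=J" using snoc.prems by auto
 have fin: "finite ?K" by simp
 obtain B where B: "minv ?K A B" using goodE[OF A sub] by blast
 have "covar ?K g h X B" by (rule covar_inverse[OF fin B covar_subset[OF X sub]]) (use xs in auto)
 from covarD[OF this, of t t] have "X*B t t = B t t*X" using snoc.prems xs(2,3) by (auto simp: sg_def split: if_splits)
 from commute_bfac[OF A sub _ B this] have "X*bfac ?K A t = bfac ?K A t*X" by simp
 moreover have "X*ber (xs @ ys) A = ber (xs @ ys) A*X" using snoc by simp
 ultimately have "X*(ber (xs @ ys) A*bfac ?K A t) = (ber (xs @ ys) A*bfac ?K A t)*X" by (rule commute_prod[rotated])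
 thus ?case using ber_snoc[of "xs @ ys" t A] by simp
qed (use xs in simp)

lemma commute_ber_diag:
 assumes A: "good J A" and X: "covar J g g X A" and ys: "set ys<=J" "distinct ys"
 shows "X*ber ys A = ber ys A*X" using ys
proof (induction ys rule: rev_induct)
 case (snoc t ys)
 let ?K = "insert t (set ys)"
 have sub: "?K<=J" using snoc.prems by auto
 obtain B where B: "minv ?K A B" using goodE[OF A sub] by blast
 have "X*B t t = B t t*X"
 proof (cases "g:?K")
  case True
  have "covar ?K g g X B" by (rule covar_inverse[OF _ B covar_subset[OF X sub] True True]) simp
  from covarD[OF this, of t t] show ?thesis by (auto simp: sg_def split: if_splits)
 next
  case False
  thus ?thesis using covar_outside[OF _ B covar_subset[OF X sub], of t] by simp
 qed
 from commute_bfac[OF A sub _ B this] snoc show ?case by (simp add: ber_snoc commute_prod)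
qed simp

theorem commute_ber_adjacent:
 fixes A :: "int=>int=>'a::ring_1 psd"
 assumes tf: "ALL x::'a. x + x = 0-->x = 0"
  and mon: "monic_mat J A" and man: "manin J A" and X: "covar J g h X A" and gh: "{g, h} = {a, b}"
  and ord: "set (xs @ [a, b] @ ys)<=J" "distinct (xs @ [a, b] @ ys)"
 shows "X*ber (xs @ [a, b] @ ys) A = ber (xs @ [a, b] @ ys) A*X"
proof -
 have tfp: "ALL x::'a psd. x + x = 0-->x = 0"
 proof (intro allI impI psd_eqI)
  fix x :: "'a psd" and i j assume "x + x = 0"
  hence "pcoef (x + x) i j = pcoef 0 i j" by (simp only:)
  hence "pcoef x i j + pcoef x i j = 0" by (simp only: pcoef_add pcoef_zero)
  with tf have "pcoef x i j = 0" by blast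
  thus "pcoef x i j = pcoef 0 i j" by (simp only: pcoef_zero)
 qed
 have gd: "good J A" by (rule monic_good[OF mon])
 have sub: "insert a (insert b (set xs))<=J" using ord by auto
 obtain B where B: "minv (insert a (insert b (set xs))) A B" using goodE[OF gd sub] by blast
 have "manin' (insert a (insert b (set xs))) B" by (rule manin_inverse[OF tf monic_subset[OF mon sub] manin_subset[OF man sub] B])
 from commute_pair[OF tfp gd sub _ _ _ B this X gh] ord
 have 1: "X*(bfac (insert a (set xs)) A a*bfac (insert a (insert b (set xs))) A b)
   = (bfac (insert a (set xs)) A a*bfac (insert a (insert b (set xs))) A b)*X" by auto
 have "g~:set xs" "h~:set xs" using gh ord by (auto simp: doubleton_eq_iff)
 hence "X*ber xs A = ber xs A*X" using commute_ber_prefix[OF gd X] ord by auto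
 from commute_prod[OF this 1] have "X*ber (xs @ [a, b]) A = ber (xs @ [a, b]) A*X" by (simp add: ber_snoc2)
 from commute_ber_suffix[OF gd X this] gh ord show ?thesis by (auto simp: doubleton_eq_iff)
qed

text \<open>Neighbours in the order are settled by \<open>commute_ber_adjacent\<close>. By
  \<open>br\<close>, the element of a pair at larger distance is a supercommutator through the
  successor of the first index, which allows induction on the distance.\<close>

theorem commute_ber:
 fixes A :: "int=>int=>'a::ring_1 psd"
 assumes tf: "ALL x::'a. x + x = 0-->x = 0"
  and mon: "monic_mat (set ord) A" and man: "manin (set ord) A" and ord: "distinct ord"
  and X: "!!g h. g:set ord==>h:set ord==>covar (set ord) g h (X g h) A"
  and br: "!!g h k. g:set ord==>h:set ord==>k:set ord==>g~=k ==>
   EX s. X g k = X g h*X h k - sg s s (X h k*X g h)"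
  and gh: "g:set ord" "h:set ord"
 shows "X g h*ber ord A = ber ord A*X g h"
proof -
 have both: "X (ord ! i) (ord ! j)*ber ord A = ber ord A*X (ord ! i) (ord ! j) &
   X (ord ! j) (ord ! i)*ber ord A = ber ord A*X (ord ! j) (ord ! i)"
  if "j < length ord" "i < j" for i j using that
 proof (induction "j - i" arbitrary: i)
  case (Suc n)
  let ?b = "ber ord A"
  have i1: "Suc i < length ord" using Suc by linarith
  have dec: "ord = take i ord @ [ord ! i, ord ! Suc i] @ drop (Suc (Suc i)) ord" using i1 by (simp add: Cons_nth_drop_Suc)
  have adj: "X g h*?b = ?b*X g h" if "{g, h} = {ord ! i, ord ! Suc i}" for g h
  proof -
   have "g:set ord" "h:set ord" using that i1 by (auto simp: doubleton_eq_iff)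
   from commute_ber_adjacent[OF tf mon man X[OF this] that, of "take i ord" "drop (Suc (Suc i)) ord"]
   show ?thesis using ord unfolding dec[symmetric] by simp
  qed
  show ?case
  proof (cases "j = Suc i")
   case True
   thus ?thesis using adj by (auto simp: insert_commute)
  next
   case False
   hence IH: "X (ord ! Suc i) (ord ! j)*?b = ?b*X (ord ! Suc i) (ord ! j)"
    "X (ord ! j) (ord ! Suc i)*?b = ?b*X (ord ! j) (ord ! Suc i)" using Suc.hyps(1)[of "Suc i"] Suc.hyps(2) Suc.prems by auto
   have ne: "ord ! i~=ord ! j" using ord Suc.prems by (simp add: nth_eq_iff_index_eq)
   have m: "ord ! i:set ord" "ord ! j:set ord" "ord ! Suc i:set ord" using Suc.prems i1 by auto
   have c: "(Y*Z - sg s s (Z*Y))*?b = ?b*(Y*Z - sg s s (Z*Y))"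
    if "Y*?b = ?b*Y" "Z*?b = ?b*Z" for Y Z s using commute_prod[of ?b Y Z] commute_prod[of ?b Z Y] that
    by (simp add: left_diff_distrib right_diff_distrib sg_mult)
   have a: "X (ord ! i) (ord ! Suc i)*?b = ?b*X (ord ! i) (ord ! Suc i)" by (rule adj) simp
   have a': "X (ord ! Suc i) (ord ! i)*?b = ?b*X (ord ! Suc i) (ord ! i)" by (rule adj) auto
   obtain s where s: "X (ord ! i) (ord ! j) = X (ord ! i) (ord ! Suc i)*X (ord ! Suc i) (ord ! j)
     - sg s s (X (ord ! Suc i) (ord ! j)*X (ord ! i) (ord ! Suc i))" using br[OF m(1,3,2) ne] by blast
   obtain s' where s': "X (ord ! j) (ord ! i) = X (ord ! j) (ord ! Suc i)*X (ord ! Suc i) (ord ! i)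
     - sg s' s' (X (ord ! Suc i) (ord ! i)*X (ord ! j) (ord ! Suc i))" using br[OF m(2,3,1) ne[symmetric]] by blast
   show ?thesis unfolding s s' using c[OF a IH(1), of s] c[OF IH(2) a', of s'] by blast
  qed
 qed simp
 obtain i j where ij: "g = ord ! i" "i < length ord" "h = ord ! j" "j < length ord" using gh by (metis in_set_conv_nth)
 show ?thesis
 proof (cases i j rule: linorder_cases)
  case less
  thus ?thesis using both ij by blast
 next
  case equal
  thus ?thesis using commute_ber_diag[OF monic_good[OF mon] X[OF gh(1) gh(1)]] ord ij by auto
 next
  case greater
  thus ?thesis using both ij by blast
 qed
qed

subsection \<open>Truncation\<close>

text \<open>The multiplier e plays the role of a projection; its right annihilators make the matrix
 block triangular, so that outside the middle block only diagonal entries contribute.\<close>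

lemma truncation_diag:
 assumes K: "finite K" "t:K" and B: "minv K A B" and z: "!!k. k:K==>k~=t==>A k t*e = 0"
  and u: "A t t*e = e*u" "uinv u u'"
 shows "B t t*e = e*(u'::'a::ring_1)"
proof -
 have "e = (SUM k:K. B t k*A k t)*e" using minvD(2)[OF B K(2,2)] by simp
 also have "... = (SUM k:K. if k = t then B t t*(e*u) else 0)"
  unfolding sum_distrib_right using z u(1) by (intro sum.cong) (auto simp: mult.assoc)
 also have "... = B t t*e*u" using K by (simp add: mult.assoc)
 finally have "e*u' = B t t*e*u*u'" by (rule arg_cong)
 also have "... = B t t*e" by (simp add: mult.assoc uinvD(1)[OF u(2)])
 finally show ?thesis by simp
qed

text \<open>The rows outside \<open>C\<close> vanish on \<open>e\<close>, so the equation
  \<open>B A = 1\<close>, read in the columns of \<open>C\<close> and applied to \<open>e\<close>,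
  involves the block alone. There \<open>A\<close> acts as \<open>P\<close>, and \<open>D\<close>
  inverts \<open>P\<close>; \<open>e\<close> itself is never inverted.\<close>

lemma truncation_block:
 assumes K: "finite K" "C<=K" and B: "minv K A B" and D: "minv C P D"
  and z: "!!k j. k:K - C==>j:C==>A k j*e = 0"
  and P: "!!k j. k:C==>j:C==>A k j*e = e*P k j"
  and t: "t:C" "s:C"
 shows "B t s*e = e*(D t s::'a::ring_1)"
proof -
 have C: "finite C" using K finite_subset by blast
 have col: "(if t = j then e else 0) = (SUM k:C. B t k*e*P k j)" if j: "j:C" for j
 proof -
  have tK: "t:K" "j:K" using t j K by auto
  have "(if t = j then e else 0) = (SUM k:K. B t k*A k j)*e" by (simp add: minvD(2)[OF B tK])
  also have "... = (SUM k:C. B t k*A k j*e)"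
   unfolding sum_distrib_right using K z j by (intro sum.mono_neutral_right) (auto simp: mult.assoc)
  also have "... = (SUM k:C. B t k*e*P k j)" using P j by (intro sum.cong refl) (simp add: mult.assoc)
  finally show ?thesis .
 qed
 have "e*D t s = (SUM j:C. (if t = j then e else 0)*D j s)"
 proof -
  have "(SUM j:C. (if t = j then e else 0)*D j s) = (SUM j:C. if j = t then e*D j s else 0)" by (rule sum.cong) auto
  thus ?thesis using C t by simp
 qed
 also have "... = (SUM j:C. SUM k:C. B t k*e*P k j*D j s)" by (intro sum.cong refl) (simp only: col sum_distrib_right)
 also have "... = (SUM k:C. B t k*e*(SUM j:C. P k j*D j s))"
  by (subst sum.swap) (simp add: sum_distrib_left mult.assoc)
 also have "... = B t s*e" using C t by (simp add: minvD[OF D] sum_delta_mult)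
 finally show ?thesis by simp
qed

lemma bfac_mult_transfer:
 assumes A: "good J A" "K<=J" "minv K A B" "t:K" and e: "B t t*e = e*b" and b: "uinv b b'"
 shows "bfac K A t*e = e*(if even t then b' else b)"
proof -
 have u: "rinv (B t t)*B t t = 1" using good_minv_uinv[OF A] by (simp add: uinv_def)
 have "rinv (B t t)*(B t t*e)*b' = rinv (B t t)*e*(b*b')" unfolding e by (simp add: mult.assoc)
 moreover have "rinv (B t t)*(B t t*e) = e" by (simp add: mult.assoc[symmetric] u)
 ultimately have "rinv (B t t)*e = e*b'" by (simp add: uinvD(1)[OF b])
 with e show ?thesis by (simp add: bfac_eq[OF A])
qed

text \<open>The contribution of diagonal entries \<open>u\<close> with inverse \<open>u'\<close> to
  a Berezinian: odd indices contribute the inverse.\<close>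

definition par_prod :: "int list=>'a::ring_1=>'a=>'a" where
 "par_prod S u u' = prod_list (map (%s. if even s then u else u') S)"

lemma par_prod_simps [simp]:
 "par_prod [] u u' = 1" "par_prod (xs @ [t]) u u' = par_prod xs u u'*(if even t then u else u')" by (simp_all add: par_prod_def)

lemma intertwine_mult: "a*e = e*p==>b*e = e*q==>(a*b)*e = e*(p*(q::'a::ring_1))"
 by (metis mult.assoc)

text \<open>A factor sees only the indices up to its own. The vanishing rows of \<open>S1\<close>
  settle both the factors in \<open>S1\<close> and the coupling of \<open>cs\<close> to
  \<open>S1\<close>; for \<open>S2\<close> it is the vanishing columns that isolate the diagonal
  entry.\<close>

theorem ber_truncation:
 fixes A P :: "int=>int=>'a::ring_1"
 assumes A: "good J A" and J: "set (S1 @ cs @ S2)<=J" "distinct (S1 @ cs @ S2)" and P: "good (set cs) P"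
  and S1: "!!a j. a:set S1==>j:J==>j~=a==>A a j*e = 0" "!!a. a:set S1==>A a a*e = e*u"
  and S2: "!!b j. b:set S2==>j:J==>j~=b==>A j b*e = 0" "!!b. b:set S2==>A b b*e = e*v"
  and u: "uinv u u'" and v: "uinv v v'"
  and AP: "!!j k. j:set cs==>k:set cs==>A j k*e = e*P j k"
 shows "ber (S1 @ cs @ S2) A*e = e*(par_prod S1 u u'*ber cs P*par_prod S2 v v')"
proof -
 have 1: "ber xs A*e = e*par_prod xs u u'" if "EX zs. S1 = xs @ zs" for xs using that
 proof (induction xs rule: rev_induct)
  case (snoc t xs)
  hence t: "insert t (set xs)<=J" "insert t (set xs)<=set S1" using J by auto
  obtain B where B: "minv (insert t (set xs)) A B" using goodE[OF A t(1)] by blast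
  have "B t t*e = e*u'" by (rule truncation_diag[OF _ _ B _ S1(2) u]) (use S1(1) t in auto)
  from bfac_mult_transfer[OF A t(1) B _ this uinv_sym[OF u]]
  have b: "bfac (insert t (set xs)) A t*e = e*(if even t then u else u')" by simp
  have "ber xs A*e = e*par_prod xs u u'" using snoc by auto
  from intertwine_mult[OF this b] show ?case by (simp only: ber_snoc par_prod_simps)
 qed simp
 have 2: "ber (S1 @ xs) A*e = e*(par_prod S1 u u'*ber xs P)" if "EX zs. cs = xs @ zs" for xs using that
 proof (induction xs rule: rev_induct)
  case Nil
  thus ?case using 1[of S1] by simp
 next
  case (snoc t xs)
  let ?K = "insert t (set (S1 @ xs))" and ?C = "insert t (set xs)"
  from snoc have t: "?K<=J" "?C<=set cs" "?C<=?K" "?K - ?C<=set S1" "set cs<=J" "set S1 Int set cs = {}"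
   using J by auto
  obtain B where B: "minv ?K A B" using goodE[OF A t(1)] by blast
  obtain D where D: "minv ?C P D" using goodE[OF P t(2)] by blast
  have "B t t*e = e*D t t"
  proof (rule truncation_block[OF _ t(3) B D])
   fix k j assume "k:?K - ?C" "j:?C"
   hence "k:set S1" "j:J" "j~=k" using t by blast+
   thus "A k j*e = 0" by (rule S1(1))
  next
   fix k j assume "k:?C" "j:?C"
   thus "A k j*e = e*P k j" using AP t by blast
  qed auto
  from bfac_mult_transfer[OF A t(1) B _ this good_minv_uinv[OF P t(2) D]]
  have b: "bfac ?K A t*e = e*bfac ?C P t" using bfac_eq[OF P t(2) D] by simp
  have "ber (S1 @ xs) A*e = e*(par_prod S1 u u'*ber xs P)" using snoc by auto
  from intertwine_mult[OF this b] ber_snoc[of "S1 @ xs" t A] ber_snoc[of xs t P] show ?case by (simp add: mult.assoc)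
 qed
 have 3: "ber (S1 @ cs @ xs) A*e = e*(par_prod S1 u u'*ber cs P*par_prod xs v v')" if "EX zs. S2 = xs @ zs" for xs using that
 proof (induction xs rule: rev_induct)
  case Nil
  thus ?case using 2[of cs] by simp
 next
  case (snoc t xs)
  let ?K = "insert t (set (S1 @ cs @ xs))"
  from snoc have t: "?K<=J" "t:set S2" using J by auto
  obtain B where B: "minv ?K A B" using goodE[OF A t(1)] by blast
  have "B t t*e = e*v'" by (rule truncation_diag[OF _ _ B _ S2(2) v]) (use S2(1) t in auto)
  from bfac_mult_transfer[OF A t(1) B _ this uinv_sym[OF v]]
  have b: "bfac ?K A t*e = e*(if even t then v else v')" by simp
  have "ber (S1 @ cs @ xs) A*e = e*(par_prod S1 u u'*ber cs P*par_prod xs v v')" using snoc by auto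
  from intertwine_mult[OF this b] ber_snoc[of "S1 @ cs @ xs" t A] show ?case by (simp add: mult.assoc)
 qed
 show ?thesis using 3[of S2] by simp
qed

subsection \<open>Column determinants of Manin matrices\<close>

definition col_term :: "nat=>(nat=>nat=>'a::ring_1)=>(nat=>nat)=>(nat=>nat)=>'a" where
 "col_term N A f ta = prod_list (map (%k. A (ta k) (f k)) [1..<Suc N])"

text \<open>\<open>f\<close> says which column of \<open>A\<close> stands at each place; repeated
  columns occur in the proof of Cramer's rule.\<close>

definition coldet :: "nat=>(nat=>nat=>'a::ring_1)=>(nat=>nat)=>'a" where
 "coldet N A f = (\<Sum>ta | ta permutes {1..N}. of_int (sign ta)*col_term N A f ta)"

lemma col_term_split:
 assumes a: "1<=a" "a < N"
 shows "col_term N A f ta = prod_list (map (%k. A (ta k) (f k)) [1..<a]) *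
  (A (ta a) (f a)*A (ta (Suc a)) (f (Suc a)))*prod_list (map (%k. A (ta k) (f k)) [Suc (Suc a)..<Suc N])"
proof -
 have "[1..<Suc N] = [1..<a] @ [a..<Suc N]" using a upt_add_eq_append[of 1 a "Suc N - a"] by simp
 also have "[a..<Suc N] = a # Suc a # [Suc (Suc a)..<Suc N]" using a by (simp add: upt_conv_Cons)
 finally show ?thesis by (simp add: col_term_def mult.assoc)
qed

definition col_manin :: "nat=>(nat=>nat=>'a::ring_1)=>bool" where
 "col_manin M A \<longleftrightarrow> (ALL i:{1..M}. ALL j:{1..M}. ALL k:{1..M}. ALL l:{1..M}.
   A i j*A k l - A k j*A i l + A i l*A k j - A k l*A i j = 0)"

text \<open>Each permutation is paired with its composite with the transposition of two neighbouring
  places. In the four resulting terms the outer factors agree, and the middle ones combine to the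
  Manin relation for two rows and two columns.\<close>

lemma coldet_swap:
 fixes A :: "nat=>nat=>'a::ring_1"
 assumes tf: "ALL x::'a. x + x = 0-->x = 0"
  and man: "col_manin M A"
  and N: "N<=M" and f: "ALL k:{1..N}. f k:{1..M}" and a: "1<=a" "a < N"
 shows "coldet N A (f o Transposition.transpose a (Suc a)) = - coldet N A f"
proof -
 define t where "t = Transposition.transpose a (Suc a)"
 have tp: "t permutes {1..N}" unfolding t_def using a by (intro permutes_swap_id) auto
 have tv: "t a = Suc a" "t (Suc a) = a" "!!k. k~=a==>k~=Suc a==>t k = k" by (auto simp: t_def)
 have sgn: "sign (ta o t) = - sign ta" if "ta permutes {1..N}" for ta
 proof -
  have "permutation ta" "permutation t" using that tp by (auto simp: permutation_permutes)
  thus ?thesis by (simp add: sign_compose t_def sign_swap_id)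
 qed
 have flip: "coldet N A h = (\<Sum>ta | ta permutes {1..N}. - (of_int (sign ta)*col_term N A h (ta o t)))" for h
  unfolding coldet_def by (subst sum_permutations_compose_right[OF tp]) (intro sum.cong refl, simp add: sgn)
 have z: "col_term N A f ta - col_term N A f (ta o t) + col_term N A (f o t) ta - col_term N A (f o t) (ta o t) = 0"
  if ta: "ta permutes {1..N}" for ta
 proof -
  define L where "L = prod_list (map (%k. A (ta k) (f k)) [1..<a])"
  define R where "R = prod_list (map (%k. A (ta k) (f k)) [Suc (Suc a)..<Suc N])"
  have L: "prod_list (map (%k. A ((ta o t) k) (f k)) [1..<a]) = L" "prod_list (map (%k. A (ta k) ((f o t) k)) [1..<a]) = L"
   "prod_list (map (%k. A ((ta o t) k) ((f o t) k)) [1..<a]) = L"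
   unfolding L_def by (auto intro!: arg_cong[where f = prod_list] simp: tv(3))
  have R: "prod_list (map (%k. A ((ta o t) k) (f k)) [Suc (Suc a)..<Suc N]) = R"
   "prod_list (map (%k. A (ta k) ((f o t) k)) [Suc (Suc a)..<Suc N]) = R"
   "prod_list (map (%k. A ((ta o t) k) ((f o t) k)) [Suc (Suc a)..<Suc N]) = R"
   unfolding R_def by (auto intro!: arg_cong[where f = prod_list] simp: tv(3) simp del: upt_Suc)
  have "ta a:{1..N}" "ta (Suc a):{1..N}" "a:{1..N}" "Suc a:{1..N}"
   using permutes_in_image[OF ta] a by auto
  hence sub: "ta a:{1..M}" "f a:{1..M}" "ta (Suc a):{1..M}" "f (Suc a):{1..M}"
   using bspec[OF f, of a] bspec[OF f, of "Suc a"] N by auto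
  have "col_term N A f ta - col_term N A f (ta o t) + col_term N A (f o t) ta - col_term N A (f o t) (ta o t)
   = L*(A (ta a) (f a)*A (ta (Suc a)) (f (Suc a)) - A (ta (Suc a)) (f a)*A (ta a) (f (Suc a))
     + A (ta a) (f (Suc a))*A (ta (Suc a)) (f a) - A (ta (Suc a)) (f (Suc a))*A (ta a) (f a))*R"
   unfolding col_term_split[OF a] L R L_def[symmetric] R_def[symmetric]
   by (simp add: tv(1,2) left_diff_distrib right_diff_distrib distrib_left distrib_right mult.assoc)
  thus ?thesis using man[unfolded col_manin_def, rule_format, OF sub] by simp
 qed
 let ?x = "coldet N A f" and ?y = "coldet N A (f o t)"
 have "?x + ?x + (?y + ?y) = (\<Sum>ta | ta permutes {1..N}. of_int (sign ta) *
   (col_term N A f ta - col_term N A f (ta o t) + col_term N A (f o t) ta - col_term N A (f o t) (ta o t)))"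
  by (subst (2 4) flip) (simp add: coldet_def sum.distrib[symmetric] algebra_simps)
 also have "... = 0" using z by (intro sum.neutral) auto
 finally have "(?x + ?y) + (?x + ?y) = 0" by (simp add: ac_simps)
 with tf have "?x + ?y = 0" by blast
 thus ?thesis unfolding t_def by (simp add: eq_neg_iff_add_eq_0 add.commute)
qed

text \<open>The second of the equal columns is moved next to the first, changing only the sign; the
  swap of two equal neighbours both fixes and negates the determinant.\<close>

lemma coldet_equal_columns:
 fixes A :: "nat=>nat=>'a::ring_1"
 assumes tf: "ALL x::'a. x + x = 0-->x = 0"
  and man: "col_manin M A"
  and N: "N<=M" and f: "ALL k:{1..N}. f k:{1..M}" and ab: "1<=a" "a < b" "b<=N" "f a = f b"
 shows "coldet N A f = 0" using f ab
proof (induction "b - Suc a" arbitrary: b f)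
 case 0
 hence b: "b = Suc a" by simp
 have "f o Transposition.transpose a (Suc a) = f" using 0 b by (auto simp: fun_eq_iff Transposition.transpose_def)
 moreover have "coldet N A (f o Transposition.transpose a (Suc a)) = - coldet N A f"
  by (rule coldet_swap[OF tf man N 0(2)]) (use 0 b in auto)
 ultimately have "coldet N A f = - coldet N A f" by (simp only:)
 hence "coldet N A f + coldet N A f = 0" by (metis add.right_inverse)
 with tf show ?case by blast
next
 case (Suc n)
 obtain c where c: "b = Suc c" "a < c" by (rule that[of "b - 1"]) (use Suc.hyps(2) in auto)
 let ?g = "f o Transposition.transpose c (Suc c)"
 have g: "ALL k:{1..N}. ?g k:{1..M}"
 proof
  fix k assume "k:{1..N}"
  hence "Transposition.transpose c (Suc c) k:{1..N}" using c Suc.prems by (auto simp: Transposition.transpose_def)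
  thus "?g k:{1..M}" using Suc.prems(1) by simp
 qed
 have "?g a = f a" "?g c = f b" using c by (auto simp: Transposition.transpose_def)
 hence "coldet N A ?g = 0" using Suc.hyps(1)[of c ?g] Suc.hyps(2) Suc.prems c g by auto
 moreover have "coldet N A ?g = - coldet N A f" by (rule coldet_swap[OF tf man N Suc.prems(1)]) (use c Suc.prems in auto)
 ultimately show ?case by simp
qed

lemma coldet_expand:
 "coldet (Suc N) A f = (\<Sum>i=1..Suc N. (\<Sum>ta | ta permutes {1..Suc N} & ta (Suc N) = i. of_int (sign ta)*col_term N A f ta)*A i (f (Suc N)))"
proof -
 have fin: "finite {ta. ta permutes {1..Suc N}}" by (simp add: finite_permutations)
 have "coldet (Suc N) A f = (SUM i:{1..Suc N}. \<Sum>ta | ta:{ta. ta permutes {1..Suc N}} & ta (Suc N) = i. of_int (sign ta)*col_term (Suc N) A f ta)"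
  unfolding coldet_def by (rule sum.group[symmetric, OF fin]) (auto dest: permutes_in_image[of _ _ "Suc N"])
 also have "... = (\<Sum>i=1..Suc N. (\<Sum>ta | ta permutes {1..Suc N} & ta (Suc N) = i. of_int (sign ta)*col_term N A f ta)*A i (f (Suc N)))"
  unfolding sum_distrib_right by (intro sum.cong refl) (auto simp: col_term_def mult.assoc)
 finally show ?thesis .
qed

text \<open>Cramer's rule. The cofactors \<open>c i\<close> of the last column, paired with any
  other column, give a determinant with two equal columns; so the row \<open>c\<close> times
  \<open>A\<close> is the determinant times the last unit row. Multiplication by the inverse
  \<open>B\<close> expresses the cofactor \<open>c n\<close>, which is the determinant of size
  \<open>N\<close>, as the full determinant times the last diagonal entry of
  \<open>B\<close>.\<close>

lemma coldet_ber:
 fixes A :: "int=>int=>'a::ring_1"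
 assumes tf: "ALL x::'a. x + x = 0-->x = 0"
  and good: "good J A" and man: "manin J A" and N: "ev ` int ` {1..N}<=J"
 shows "coldet N (%i j. A (ev (int i)) (ev (int j))) id = ber (map (%i. ev (int i)) [1..<Suc N]) A" using N
proof (induction N)
 case 0
 have "{ta. ta permutes ({}::nat set)} = {id}" by auto
 thus ?case by (simp add: coldet_def col_term_def)
next
 case (Suc N)
 let ?A = "%i j. A (ev (int i)) (ev (int j))"
 define n where "n = Suc N"
 define e where "e = (%i. ev (int i))"
 have e_eq: "e i = e j \<longleftrightarrow> i = j" for i j by (simp add: e_def ev_def)
 let ?K = "e ` {1..n}"
 have K: "?K<=J" using Suc.prems by (auto simp: e_def n_def)
 have nK: "e n:?K" by (auto simp: n_def)
 have Ae: "?A i j = A (e i) (e j)" for i j by (simp add: e_def)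
 have inj: "inj_on e X" for X by (auto simp: inj_on_def e_eq)
 have man': "col_manin n ?A" unfolding col_manin_def
 proof (intro ballI)
  fix i j k l assume "i:{1..n}" "j:{1..n}" "k:{1..n}" "l:{1..n}"
  hence m: "e i:J" "e j:J" "e k:J" "e l:J" using K by auto
  have ev: "even (e x)" for x by (simp add: e_def ev_def)
  show "?A i j*?A k l - ?A k j*?A i l + ?A i l*?A k j - ?A k l*?A i j = 0"
   using man[unfolded manin_def, rule_format, OF m(1,3,2,4)] unfolding Ae by (simp only: sg_simps(6,7)[OF ev])
 qed
 define c where "c i = (\<Sum>ta | ta permutes {1..n} & ta n = i. of_int (sign ta)*col_term N ?A id ta)" for i
 have cA: "(\<Sum>i=1..n. c i*?A i j) = (if j = n then coldet n ?A id else 0)" if j: "j:{1..n}" for j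
 proof -
  have ct: "col_term N ?A (id(n := j)) ta = col_term N ?A id ta" for ta
   unfolding col_term_def by (intro arg_cong[where f = prod_list] map_cong) (auto simp: n_def)
  have ex: "coldet n ?A (id(n := j)) = (\<Sum>i=1..n. c i*?A i j)" unfolding c_def n_def coldet_expand[of N ?A] ct[unfolded n_def] by simp
  show ?thesis
  proof (cases "j = n")
   case True
   hence "id(n := j) = id" by auto
   with ex True show ?thesis by simp
  next
   case False
   have "coldet n ?A (id(n := j)) = 0" by (rule coldet_equal_columns[OF tf man', where a = j and b = n]) (use j False in auto)
   with ex False show ?thesis by simp
  qed
 qed
 obtain B where B: "minv ?K A B" "uinv (B (e n) (e n)) (rinv (B (e n) (e n)))" using goodE[OF good K] nK by blast
 have AB: "(\<Sum>j=1..n. ?A i j*B (e j) (e n)) = (if i = n then 1 else 0)" if "i:{1..n}" for i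
 proof -
  have "(SUM k:?K. A (e i) k*B k (e n)) = (if e i = e n then 1 else 0)" by (rule minvD(1)[OF B(1) _ nK]) (use that in auto)
  thus ?thesis unfolding Ae by (simp add: sum.reindex[OF inj] e_eq)
 qed
 have "c n = (\<Sum>i=1..n. c i*(\<Sum>j=1..n. ?A i j*B (e j) (e n)))"
 proof -
  have "(\<Sum>i=1..n. c i*(\<Sum>j=1..n. ?A i j*B (e j) (e n))) = (\<Sum>i=1..n. if i = n then c i else 0)"
   by (rule sum.cong[OF refl]) (simp only: AB, simp)
  thus ?thesis by (simp add: n_def)
 qed
 also have "... = (\<Sum>j=1..n. (\<Sum>i=1..n. c i*?A i j)*B (e j) (e n))"
  unfolding sum_distrib_left sum_distrib_right mult.assoc by (rule sum.swap)
 also have "... = (\<Sum>j=1..n. if j = n then coldet n ?A id*B (e n) (e n) else 0)" by (rule sum.cong[OF refl]) (simp only: cA, simp)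
 also have "... = coldet n ?A id*B (e n) (e n)" by (simp add: n_def)
 finally have cn: "c n = coldet n ?A id*B (e n) (e n)" .
 have "{ta. ta permutes {1..n} & ta n = n} = {ta. ta permutes {1..N}}"
 proof (intro equalityI subsetI; clarify)
  fix ta assume ta: "ta permutes {1..n}" "ta n = n"
  have "ta x = x" if "x:{1..n} - {1..N}" for x
  proof -
   have "x = n" using that by (auto simp: n_def)
   thus ?thesis using \<open>ta n = n\<close> by simp
  qed
  with ta(1) show "ta permutes {1..N}" by (rule permutes_superset)
 next
  fix ta assume "ta permutes {1..N}"
  moreover have "{1..N}<={1..n}" "n~:{1..N}" by (auto simp: n_def)
  ultimately show "ta permutes {1..n} & ta n = n" using permutes_subset permutes_not_in by metis
 qed
 hence "c n = coldet N ?A id" by (simp add: c_def coldet_def)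
 hence "coldet N ?A id*rinv (B (e n) (e n)) = coldet n ?A id"
  unfolding \<open>c n = coldet N ?A id\<close>[symmetric] cn mult.assoc uinvD(1)[OF B(2)] by simp
 moreover have "coldet N ?A id = ber (map e [1..<n]) A" unfolding e_def n_def by (rule Suc.IH) (use Suc.prems in auto)
 moreover have "ber (map e [1..<Suc n]) A = ber (map e [1..<n]) A*bfac ?K A (e n)"
 proof -
  have "{1..n} = insert n (set [1..<n])" by (auto simp: n_def)
  hence "insert (e n) (set (map e [1..<n])) = ?K" by (simp del: upt_Suc set_upt)
  moreover have "map e [1..<Suc n] = map e [1..<n] @ [e n]" by (simp add: n_def)
  ultimately show ?thesis using ber_snoc[of "map e [1..<n]" "e n" A] by simp
 qed
 moreover have "bfac ?K A (e n) = rinv (B (e n) (e n))" using bfac_eq[OF good K B(1) nK] by (simp add: e_def ev_def)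
 ultimately show ?case unfolding n_def[symmetric] e_def[symmetric] by (simp only:)
qed

section \<open>Transfer to rings with carrier\<close>

text \<open>The laws hold in the source by its type class and pass along the surjection, so they
  need not be checked on functions with carriers.\<close>

lemma ring_of_surj:
 fixes R :: "('r, 'b) ring_scheme" (structure) and h :: "'s::ring_1=>'r"
 assumes car: "!!x. h x:carrier R" and surj: "!!y. y:carrier R==>EX x. h x = y"
  and add: "!!x y. h (x + y) = h x \<oplus> h y" and mult: "!!x y. h (x*y) = h x \<otimes> h y"
  and one: "h 1 = \<one>" and zero: "h 0 = \<zero>"
 shows "ring R"
proof (rule ringI)
 show "abelian_group R"
 proof (rule abelian_groupI)
  fix x y z assume "x:carrier R" "y:carrier R" "z:carrier R"
  then obtain a b c where [simp]: "x = h a" "y = h b" "z = h c" using surj by metis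
  show "x \<oplus> y:carrier R" by (simp add: add[symmetric] car)
  show "x \<oplus> y \<oplus> z = x \<oplus> (y \<oplus> z)" by (simp add: add[symmetric] add.assoc)
  show "x \<oplus> y = y \<oplus> x" by (simp add: add[symmetric] add.commute)
  show "\<zero> \<oplus> x = x" by (simp add: add[symmetric] zero[symmetric])
  have "h (- a) \<oplus> x = \<zero>" by (simp add: add[symmetric] zero[symmetric])
  thus "EX y:carrier R. y \<oplus> x = \<zero>" using car by blast
 qed (simp add: zero[symmetric] car)
 show "Group.monoid R"
 proof (rule monoidI)
  fix x y z assume "x:carrier R" "y:carrier R" "z:carrier R"
  then obtain a b c where [simp]: "x = h a" "y = h b" "z = h c" using surj by metis
  show "x \<otimes> y:carrier R" by (simp add: mult[symmetric] car)
  show "x \<otimes> y \<otimes> z = x \<otimes> (y \<otimes> z)" by (simp add: mult[symmetric] mult.assoc)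
  show "\<one> \<otimes> x = x" "x \<otimes> \<one> = x" by (simp_all add: mult[symmetric] one[symmetric])
 qed (simp add: one[symmetric] car)
 fix x y z assume "x:carrier R" "y:carrier R" "z:carrier R"
 then obtain a b c where [simp]: "x = h a" "y = h b" "z = h c" using surj by metis
 show "(x \<oplus> y) \<otimes> z = x \<otimes> z \<oplus> y \<otimes> z" "z \<otimes> (x \<oplus> y) = z \<otimes> x \<oplus> z \<otimes> y"
  by (simp_all add: mult[symmetric] add[symmetric] distrib_left distrib_right)
qed

text \<open>A ring R with carrier is presented as a quotient of a type-class ring by a surjective
 homomorphism h; then so is the ring of pseudo-differential operators over R.\<close>

locale ring_presentation = ring R for R :: "('r, 'b) ring_scheme" (structure) +
 fixes h :: "'s::ring_1=>'r"
 assumes h_carrier: "!!x. h x:carrier R"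
  and h_surj: "!!y. y:carrier R==>EX x. h x = y"
  and h_add: "!!x y. h (x + y) = h x \<oplus> h y"
  and h_mult: "!!x y. h (x*y) = h x \<otimes> h y"
  and h_one: "h 1 = \<one>"
begin

lemma h_zero: "h 0 = \<zero>"
proof -
 have "h 0 \<oplus> h 0 = h 0" using h_add[of 0 0] by simp
 thus ?thesis using h_carrier add.r_cancel_one by metis
qed

lemma h_minus: "h (- x) = \<ominus> h x"
proof -
 have "h (- x) \<oplus> h x = \<zero>" using h_add[of "- x" x] h_zero by simp
 thus ?thesis using h_carrier minus_equality by metis
qed

lemma h_sum: "finite X==>h (SUM x:X. f x) = (\<Oplus>x\<in>X. h (f x))"
proof (induction X rule: finite_induct)
 case (insert x X)
 thus ?case using h_carrier by (simp add: h_add finsum_insert[of X x "%x. h (f x)"])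
qed (simp add: h_zero)

lemma h_add_pow: "h (of_int k*x) = [k] \<cdot> h x"
proof -
 have nat: "h (of_nat n*x) = [n] \<cdot> h x" for n
 proof (induction n)
  case (Suc n)
  have "h (of_nat (Suc n)*x) = h (of_nat n*x) \<oplus> h x" by (simp add: h_add[symmetric] distrib_right add.commute)
  also have "... = [Suc n] \<cdot> h x" using Suc h_carrier by simp
  finally show ?case .
 qed (simp add: h_zero)
 show ?thesis
 proof (cases "k>=0")
  case True
  have "of_int k = (of_nat (nat k)::'s)" using True by (metis of_int_of_nat_eq int_nat_eq)
  thus ?thesis using nat[of "nat k"] add_pow_int_ge[OF True] by metis
 next
  case False
  hence k: "k < 0" by simp
  have "of_int (- k) = (of_nat (nat (- k))::'s)" using k by simp
  hence "of_int k = - (of_nat (nat (- k))::'s)" by (simp only: of_int_minus minus_equation_iff[of "of_int k"])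
  hence "h (of_int k*x) = \<ominus> h (of_nat (nat (- k))*x)" by (simp add: h_minus[symmetric])
  thus ?thesis using nat[of "nat (- k)"] add_pow_int_lt[OF k] by metis
 qed
qed

definition hpsd :: "'s psd=>int=>int=>'r" where
 "hpsd f = (%i j. h (pcoef f i j))"

lemma psdo_sel:
 "carrier (psdo R) = {f. (ALL i j. f i j:carrier R) & (EX s t. ALL i j. f i j~=\<zero>-->i<=t & j<=s)}"
 "f \<oplus>\<^bsub>psdo R\<^esub> g = (%i j. f i j \<oplus> g i j)"
 "\<zero>\<^bsub>psdo R\<^esub> = (%_ _. \<zero>)"
 "\<one>\<^bsub>psdo R\<^esub> = psmon R 0 0 \<one>"
 "f \<otimes>\<^bsub>psdo R\<^esub> g = (%i j. finsum R
    (%(k, l, u). add_pow R (int_binom l u*int_binom (i - k + int u) u*fact u::int)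
      (f k l \<otimes>\<^bsub>R\<^esub> g (i - k + int u) (j - l + int u)))
    {(k, l, u). f k l~=\<zero>\<^bsub>R\<^esub> & g (i - k + int u) (j - l + int u)~=\<zero>\<^bsub>R\<^esub>})"
 by (simp_all add: psdo_def)

lemma hpsd_carrier: "hpsd f:carrier (psdo R)"
proof -
 obtain t s where "bounded (pcoef f) t s" using pcoef_bounded by blast
 hence "ALL i j. hpsd f i j~=\<zero>-->i<=t & j<=s"
  unfolding hpsd_def using h_zero boundedD by metis
 thus ?thesis unfolding psdo_sel hpsd_def using h_carrier by blast
qed

lemma hpsd_surj:
 assumes "F:carrier (psdo R)" shows "EX f. hpsd f = F"
proof -
 obtain s t where F: "!!i j. F i j:carrier R" and b: "!!i j. F i j~=\<zero>==>i<=t & j<=s"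
  using assms unfolding psdo_sel by auto
 define g where "g i j = (if F i j = \<zero> then 0 else (SOME x. h x = F i j))" for i j
 have hg: "h (g i j) = F i j" for i j using h_surj[OF F, of i j] h_zero by (auto simp: g_def intro: someI_ex)
 have "bounded g t s" using b by (auto simp: bounded_def g_def)
 hence "hpsd (Psd g) = F" by (simp add: hpsd_def pcoef_Psd hg)
 thus ?thesis ..
qed

lemma hpsd_add: "hpsd (f + g) = hpsd f \<oplus>\<^bsub>psdo R\<^esub> hpsd g" by (simp add: hpsd_def psdo_sel h_add)

lemma hpsd_zero: "hpsd 0 = \<zero>\<^bsub>psdo R\<^esub>" by (simp add: hpsd_def psdo_sel h_zero)

lemma hpsd_pmon: "hpsd (pmon k l a) = psmon R k l (h a)" by (auto simp: hpsd_def psmon_def fun_eq_iff h_zero pcoef_pmon)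

lemma hpsd_one: "hpsd 1 = \<one>\<^bsub>psdo R\<^esub>" using hpsd_pmon[of 0 0 1] by (simp add: psdo_sel h_one)

text \<open>The two products are indexed differently: on the right the exponents of the second
  factor are computed from \<open>k\<close>, \<open>l\<close>, \<open>u\<close>, and
  \<open>h\<close> may send nonzero coefficients to zero. Both sums are compared with the box
  \<open>T\<close>.\<close>

lemma hpsd_mult: "hpsd (f*g) = hpsd f \<otimes>\<^bsub>psdo R\<^esub> hpsd g"
proof (intro ext)
 fix i j
 obtain t s t' s' where f: "bounded (pcoef f) t s" and g: "bounded (pcoef g) t' s'" using pcoef_bounded by metis
 define T where "T = {(k, l, u). k<=t & l<=s & i - k + int u<=t' & j - l + int u<=s'}"
 have fin: "finite T"
 proof (rule finite_subset)
  show "T<={i - t'..t} \<times> {j - s'..s} \<times> {..nat (t + t' - i)}" by (auto simp: T_def)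
 qed simp
 define F where "F = (%(k, l, u). [(int_binom l u*int_binom (i - k + int u) u*fact u)] \<cdot>
   (hpsd f k l \<otimes> hpsd g (i - k + int u) (j - l + int u)))"
 have car: "F x:carrier R" for x using h_carrier by (auto simp: F_def hpsd_def split: prod.split)
 have "pcoef (f*g) i j = (SUM (k, l, u):T. of_int (wick l (i - k + int u) u)*(pcoef f k l*pcoef g (i - k + int u) (j - l + int u)))"
  unfolding pcoef_mult star_box[OF f g]
  by (rule sum.reindex_bij_witness[where i = "%(k, l, u). (k, l, i - k + int u, j - l + int u, u)" and j = "%(k, l, m, n, u). (k, l, u)"])
    (auto simp: star_box_def T_def)
 hence "hpsd (f*g) i j = (\<Oplus>x\<in>T. h ((%(k, l, u). of_int (wick l (i - k + int u) u)*(pcoef f k l*pcoef g (i - k + int u) (j - l + int u))) x))"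
  unfolding hpsd_def[of "f*g"] by (simp only: h_sum[OF fin])
 also have "... = (\<Oplus>x\<in>T. F x)"
 proof -
  have e: "h (of_int w*(a*b)) = [w] \<cdot> (h a \<otimes> h b)" for w a b using h_add_pow[of w "a*b"] by (simp only: h_mult[of a b])
  show ?thesis using car by (intro finsum_cong' refl) (auto simp only: F_def e hpsd_def wick_def split: prod.splits)
 qed
 finally have "hpsd (f*g) i j = (\<Oplus>x\<in>T. F x)" .
 also have "... = (\<Oplus>x\<in>{(k, l, u). hpsd f k l~=\<zero> & hpsd g (i - k + int u) (j - l + int u)~=\<zero>}. F x)"
 proof (rule add.finprod_mono_neutral_cong_right[OF fin, unfolded finsum_def[symmetric]])
  show "{(k, l, u). hpsd f k l~=\<zero> & hpsd g (i - k + int u) (j - l + int u)~=\<zero>}<=T"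
   using f g h_zero by (auto simp: T_def hpsd_def bounded_def) metis+
  fix x assume "x:T - {(k, l, u). hpsd f k l~=\<zero> & hpsd g (i - k + int u) (j - l + int u)~=\<zero>}"
  thus "F x = \<zero>" using h_carrier by (auto simp: F_def hpsd_def)
 qed (use car in auto)
 finally show "hpsd (f*g) i j = (hpsd f \<otimes>\<^bsub>psdo R\<^esub> hpsd g) i j" by (simp add: psdo_sel F_def)
qed

lemma psdo_ring: "ring (psdo R)"
 by (rule ring_of_surj[of hpsd]) (simp_all add: hpsd_carrier hpsd_surj hpsd_add hpsd_mult hpsd_one hpsd_zero)

text \<open>In turn \<open>psdo R\<close> is presented by the type of pseudo-differential operators over the
 presenting ring.\<close>

lemma psdo_presentation: "ring_presentation (psdo R) hpsd" by (rule ring_presentation.intro[OF psdo_ring]) (unfold_locales,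
  simp_all add: hpsd_carrier hpsd_surj hpsd_add hpsd_mult hpsd_one)

lemma inv_h:
 assumes "uinv x y" shows "inv h x = h y"
proof -
 have "h x \<otimes> h y = \<one>" "h y \<otimes> h x = \<one>" using assms by (simp_all add: h_mult[symmetric] uinv_def h_one)
 thus ?thesis using h_carrier inv_unique' by metis
qed

text \<open>\<open>mat_inv\<close> is a choice in the carrier, and \<open>h\<close> is not assumed
  injective. Row \<open>i\<close> of the chosen inverse is lifted to \<open>m\<close>. That
  \<open>m A\<close> is a unit row is known only after applying \<open>h\<close>, which suffices to
  compare \<open>m = (m A) B\<close> with row \<open>i\<close> of \<open>B\<close>.\<close>

lemma mat_inv_h:
 assumes MM: "!!i j. i:J==>j:J==>MM i j = h (A i j)"
  and J: "finite J" and B: "minv J A B" and ij: "i:J" "j:J"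
 shows "mat_inv R J MM i j = h (B i j)"
proof -
 have hB: "is_mat_inv R J MM (%i j. h (B i j))" unfolding is_mat_inv_def
 proof (intro conjI ballI)
  fix i j assume ij: "i:J" "j:J"
  have "(\<Oplus>k\<in>J. MM i k \<otimes> h (B k j)) = (\<Oplus>k\<in>J. h (A i k*B k j))"
   "(\<Oplus>k\<in>J. h (B i k) \<otimes> MM k j) = (\<Oplus>k\<in>J. h (B i k*A k j))"
   by (intro finsum_cong' refl; auto simp: MM ij h_mult h_carrier)+
  thus "(\<Oplus>k\<in>J. MM i k \<otimes> h (B k j)) = (if i = j then \<one> else \<zero>)"
   "(\<Oplus>k\<in>J. h (B i k) \<otimes> MM k j) = (if i = j then \<one> else \<zero>)"
   unfolding h_sum[OF J, symmetric] minvD[OF B ij] by (simp_all add: h_one h_zero)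
 qed (simp add: h_carrier)
 define M where "M = mat_inv R J MM"
 have "is_mat_inv R J MM M" unfolding M_def mat_inv_def by (rule someI[of "is_mat_inv R J MM", OF hB])
 hence Mc: "!!i j. i:J==>j:J==>M i j:carrier R"
  and M: "!!i j. i:J==>j:J==>(\<Oplus>k\<in>J. M i k \<otimes> MM k j) = (if i = j then \<one> else \<zero>)"
  unfolding is_mat_inv_def by blast+
 define m where "m k = (SOME x. h x = M i k)" for k
 have m: "h (m k) = M i k" if "k:J" for k unfolding m_def using h_surj[OF Mc[OF ij(1) that]] by (rule someI_ex)
 have mA: "h (SUM k:J. m k*A k l) = (if i = l then \<one> else \<zero>)" if "l:J" for l
 proof -
  have "h (SUM k:J. m k*A k l) = (\<Oplus>k\<in>J. M i k \<otimes> MM k l)"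
   unfolding h_sum[OF J] by (intro finsum_cong' refl) (auto simp: m h_mult Mc ij h_carrier MM that)
  thus ?thesis using M[OF ij(1) that] by simp
 qed
 have "h (m j) = h (SUM k:J. m k*(SUM l:J. A k l*B l j))" using J ij by (simp add: minvD[OF B] sum_delta_mult)
 also have "(SUM k:J. m k*(SUM l:J. A k l*B l j)) = (SUM l:J. (SUM k:J. m k*A k l)*B l j)"
  by (simp add: sum_distrib_left sum_distrib_right mult.assoc) (rule sum.swap)
 also have "h ... = (\<Oplus>l\<in>J. (if i = l then \<one> else \<zero>) \<otimes> h (B l j))"
 proof -
  have "h (SUM l:J. (SUM k:J. m k*A k l)*B l j) = (\<Oplus>l\<in>J. h ((SUM k:J. m k*A k l)*B l j))"
   by (rule h_sum[OF J])
  also have "... = (\<Oplus>l\<in>J. (if i = l then \<one> else \<zero>) \<otimes> h (B l j))"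
   unfolding h_mult by (intro finsum_cong' refl) (simp_all only: mA, auto simp: h_carrier)
  finally show ?thesis .
 qed
 also have "... = (\<Oplus>l\<in>J. if i = l then h (B l j) else \<zero>)" using h_carrier by (intro finsum_cong') auto
 also have "... = h (B i j)" using J ij h_carrier by (intro finsum_singleton) auto
 finally show ?thesis using m[OF ij(2)] by (simp add: M_def)
qed

lemma quasidet_h:
 assumes MM: "!!i j. i:J==>j:J==>MM i j = h (A i j)"
  and A: "good J A" and t: "t < length ord" "set ord<=J"
 shows "(if even (ord ! t) then quasidet R ord MM t else inv (quasidet R ord MM t))
   = h (bfac (set (take (Suc t) ord)) A (ord ! t))"
proof -
 let ?K = "set (take (Suc t) ord)"
 have K: "?K<=J" using t(2) set_take_subset by fast
 have tK: "ord ! t:?K" using t(1) by (auto simp: in_set_conv_nth intro!: exI[of _ t])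
 obtain B where B: "minv ?K A B" "!!t. t:?K==>uinv (B t t) (rinv (B t t))" using goodE[OF A K] by blast
 have u: "uinv (B (ord ! t) (ord ! t)) (rinv (B (ord ! t) (ord ! t)))" by (rule B(2)[OF tK])
 have "quasidet R ord MM t = h (rinv (B (ord ! t) (ord ! t)))"
 proof -
  have "mat_inv R ?K MM (ord ! t) (ord ! t) = h (B (ord ! t) (ord ! t))" by (rule mat_inv_h[OF _ _ B(1) tK tK]) (use MM K in auto)
  thus ?thesis unfolding quasidet_def by (simp add: inv_h[OF u])
 qed
 thus ?thesis by (simp add: bfac_eq[OF A K B(1) tK] inv_h[OF uinv_sym[OF u]])
qed

lemma berezinian_h:
 assumes MM: "!!i j. i:J==>j:J==>MM i j = h (A i j)"
  and A: "good J A" and J: "set ord<=J"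
 shows "berezinian R ord MM = h (ber ord A)"
proof -
 have "foldr (%t x. (if even (ord ! t) then quasidet R ord MM t else inv (quasidet R ord MM t)) \<otimes> x) ts \<one>
   = h (prod_list (map (%t. bfac (set (take (Suc t) ord)) A (ord ! t)) ts))" if "set ts<={..<length ord}" for ts
  using that
 proof (induction ts)
  case (Cons t ts)
  hence "t < length ord" by auto
  from quasidet_h[OF MM A this J] Cons show ?case by (simp add: h_mult)
 qed (simp add: h_one)
 from this[of "[0..<length ord]"] show ?thesis unfolding berezinian_def ber_def by fastforce
qed

lemma cdet_h:
 assumes MM: "!!i j. i:{1..N}==>j:{1..N}==>MM i j = h (A i j)"
 shows "cdet R N MM = h (coldet N A id)"
proof -
 have f: "foldr (%k x. MM (ta k) k \<otimes> x) ks \<one> = h (prod_list (map (%k. A (ta k) k) ks))"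
  if "ta permutes {1..N}" "set ks<={1..N}" for ta ks using that(2)
 proof (induction ks)
  case (Cons k ks)
  hence "k:{1..N}" "ta k:{1..N}" using permutes_in_image[OF that(1)] by auto
  with Cons show ?case by (simp add: h_mult MM)
 qed (simp add: h_one)
 have f': "foldr (%k x. MM (ta k) k \<otimes> x) [1..<Suc N] \<one> = h (col_term N A id ta)" if "ta permutes {1..N}" for ta
  unfolding col_term_def id_apply by (rule f[OF that]) auto
 have "cdet R N MM = (\<Oplus>ta\<in>{ta. ta permutes {1..N}}. h (of_int (sign ta)*col_term N A id ta))"
  unfolding cdet_def h_add_pow by (intro finsum_cong' refl) (auto simp only: f' h_carrier mem_Collect_eq h_add_pow[symmetric])
 also have "... = h (coldet N A id)" unfolding coldet_def by (rule h_sum[symmetric]) (simp add: finite_permutations)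
 finally show ?thesis .
qed

lemma int_pow_h:
 assumes "uinv x y"
 shows "h x [^] (k::int) = h (if k < 0 then y ^ nat (- k) else x ^ nat k)"
proof -
 have p: "h x [^] (n::nat) = h (x ^ n)" for x n by (induction n) (simp_all add: h_one h_mult power_commutes[symmetric] nat_pow_def)
 have "uinv (x ^ n) (y ^ n)" for n
 proof (induction n)
  case (Suc n)
  from uinv_mult[OF Suc assms] show ?case by (simp add: power_commutes)
 qed simp
 thus ?thesis by (auto simp: int_pow_def2 p inv_h)
qed

end

lemma complex_presentation: "ring_presentation complex_ring (%x. x)"
proof (rule ring_presentation.intro)
 show "ring complex_ring" by (rule ring_of_surj[of "%x. x"]) (auto simp: complex_ring_def)
qed (unfold_locales, auto simp: complex_ring_def)

section \<open>The free algebra and the enveloping algebras\<close>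

text \<open>With concatenation as addition of exponents, the convolution product of finitely
  supported functions on words is the product of the free algebra.\<close>

instantiation list :: (type) monoid_add
begin
definition zero_list :: "'a list" where "zero_list = []"
definition plus_list :: "'a list=>'a list=>'a list" where "plus_list = (@)"
instance by standard (simp_all add: zero_list_def plus_list_def)
end

type_synonym 'g falg = "'g list \<Rightarrow>\<^sub>0 complex"

abbreviation lkp :: "'g falg=>'g list=>complex" where "lkp == Poly_Mapping.lookup"

lemma falg_induct [case_names single add]:
 assumes s: "!!w c. P (Poly_Mapping.single w c)" and a: "!!x y. P x==>P y==>P (x + y)"
 shows "P (x::'g falg)"
proof (induction x rule: Poly_Mapping.update_induct)
 case const
 show ?case using s[of undefined 0] by simp
next
 case (update f w c)
 have "Poly_Mapping.update w c f = Poly_Mapping.single w c + f"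
  using update(1) by (intro poly_mapping_eqI) (auto simp: lookup_update lookup_add lookup_single when_def in_keys_iff)
 thus ?case using a[OF s update(3)] by simp
qed

lemma lkp_mult: "lkp (x*y) w = (SUM k<=length w. lkp x (take k w)*lkp y (drop k w))"
proof (induction x rule: falg_induct)
 case (single u c)
 show ?case
 proof (induction y rule: falg_induct)
  case (single v d)
  have "(SUM k<=length w. lkp (Poly_Mapping.single u c) (take k w)*lkp (Poly_Mapping.single v d) (drop k w))
    = (SUM k<=length w. if k = length u then (if w = u @ v then c*d else 0) else 0)"
  proof (rule sum.cong[OF refl])
   fix k assume k: "k:{..length w}"
   have iff: "u = take k w & v = drop k w \<longleftrightarrow> k = length u & w = u @ v" using k by (auto simp: min_def)
   have "lkp (Poly_Mapping.single u c) (take k w)*lkp (Poly_Mapping.single v d) (drop k w)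
     = (if u = take k w & v = drop k w then c*d else 0)" by (simp add: lookup_single when_def)
   thus "lkp (Poly_Mapping.single u c) (take k w)*lkp (Poly_Mapping.single v d) (drop k w)
     = (if k = length u then (if w = u @ v then c*d else 0) else 0)" unfolding iff by auto
  qed
  also have "... = lkp (Poly_Mapping.single u c*Poly_Mapping.single v d) w"
   by (auto simp: mult_single lookup_single when_def plus_list_def)
  finally show ?case by simp
 qed (simp add: distrib_left lookup_add sum.distrib)
qed (simp add: distrib_right lookup_add sum.distrib)

text \<open>The type \<open>'g falg\<close> admits all letters, \<open>free_alg G\<close> only those
  of \<open>G\<close>. Dropping the words with other letters is multiplicative, because a word is
  over \<open>G\<close> exactly if both pieces of any cut are.\<close>

definition frestr :: "'g set=>'g falg=>'g list=>complex" where
 "frestr G x = (%w. if set w<=G then lkp x w else 0)"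

lemma free_alg_sel:
 "carrier (free_alg G) = {f. finite {w. f w~=0} & (ALL w. f w~=0-->set w<=G)}"
 "f \<otimes>\<^bsub>free_alg G\<^esub> g = (%w. SUM k<=length w. f (take k w)*g (drop k w))"
 "\<one>\<^bsub>free_alg G\<^esub> = (%w. if w = [] then 1 else 0)"
 "\<zero>\<^bsub>free_alg G\<^esub> = (%_. 0)" "f \<oplus>\<^bsub>free_alg G\<^esub> g = (%w. f w + g w)"
 by (simp_all add: free_alg_def)

lemma frestr_surj:
 assumes "f:carrier (free_alg G)"
 shows "frestr G (Abs_poly_mapping f) = f" "lkp (Abs_poly_mapping f) = f" using assms by (auto simp: free_alg_sel frestr_def fun_eq_iff)

lemma frestr_carrier: "frestr G x:carrier (free_alg G)"
proof -
 have "finite {w. frestr G x w~=0}" by (rule finite_subset[of _ "{w. lkp x w~=0}"]) (auto simp: frestr_def)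
 thus ?thesis by (auto simp: free_alg_sel frestr_def)
qed

lemma frestr_mult: "frestr G (x*y) = frestr G x \<otimes>\<^bsub>free_alg G\<^esub> frestr G y"
proof
 fix w
 have sub: "set w<=G \<longleftrightarrow> set (take k w)<=G & set (drop k w)<=G" for k
  by (metis append_take_drop_id le_sup_iff set_append)
 show "frestr G (x*y) w = (frestr G x \<otimes>\<^bsub>free_alg G\<^esub> frestr G y) w"
 proof (cases "set w<=G")
  case True
  thus ?thesis using sub by (auto simp: frestr_def free_alg_sel lkp_mult intro!: sum.cong)
 next
  case False
  hence "frestr G x (take k w)*frestr G y (drop k w) = 0" for k using sub[of k] by (auto simp: frestr_def)
  hence "(frestr G x \<otimes>\<^bsub>free_alg G\<^esub> frestr G y) w = 0" unfolding free_alg_sel by (intro sum.neutral) blast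
  thus ?thesis using False by (simp add: frestr_def)
 qed
qed

lemma free_alg_presentation: "ring_presentation (free_alg G) (frestr G)"
proof -
 have r: "frestr G (x + y) = frestr G x \<oplus>\<^bsub>free_alg G\<^esub> frestr G y" "frestr G 0 = \<zero>\<^bsub>free_alg G\<^esub>" "frestr G 1 = \<one>\<^bsub>free_alg G\<^esub>" for x y
  by (auto simp: frestr_def free_alg_sel fun_eq_iff lookup_add lookup_one zero_list_def)
 have s: "EX x. frestr G x = f" if "f:carrier (free_alg G)" for f using frestr_surj(1)[OF that] by blast
 have "ring (free_alg G)" by (rule ring_of_surj[of "frestr G"]) (simp_all add: frestr_carrier frestr_mult r s)
 thus ?thesis by (rule ring_presentation.intro) (unfold_locales, simp_all add: frestr_carrier frestr_mult r s)
qed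

abbreviation egens :: "int set=>nat=>gen set" where "egens I l == {1..l} \<times> I \<times> I"

lemma word_carrier: "set w<=G==>word w:carrier (free_alg G)"
proof -
 assume "set w<=G"
 moreover have "{u. word w u~=0} = {w}" by (auto simp: word_def)
 ultimately show ?thesis by (auto simp: free_alg_sel word_def)
qed

lemma frestr_single: "set w<=G==>frestr G (Poly_Mapping.single w c) = c *\<^sub>C word w"
 by (auto simp: frestr_def word_def fun_eq_iff lookup_single when_def scaleC_fun_def scaleC_complex_def)

lemma scale_in_carrier: "f:carrier (free_alg G)==>c *\<^sub>C f:carrier (free_alg G)"
 by (auto simp: free_alg_sel scaleC_fun_def scaleC_complex_def elim!: rev_finite_subset)

lemma sub_in_carrier:
 assumes "f:carrier (free_alg G)" "g:carrier (free_alg G)"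
 shows "f - g:carrier (free_alg G)" "f + g:carrier (free_alg G)"
proof -
 have "finite ({w. f w~=0} Un {w. g w~=0})" using assms by (simp add: free_alg_sel)
 hence "finite {w. (f - g) w~=0}" "finite {w. (f + g) w~=0}" by (rule rev_finite_subset, auto)+
 thus "f - g:carrier (free_alg G)" "f + g:carrier (free_alg G)"
  using assms unfolding free_alg_sel by (simp_all, (metis add.right_neutral diff_zero)+)
qed

lemma env_rels_carrier: "env_rels I l<=carrier (env_free I l)"
proof
 fix x assume "x:env_rels I l"
 then obtain a b i j k h where x: "x = word [(a, i, j), (b, k, h)]
    - koszul (odd (i + j)) (odd (k + h)) *\<^sub>C word [(b, k, h), (a, i, j)]
    - (if a = b then (if j = k then word [(a, i, h)] else 0)
       - koszul (odd (i + j)) (odd (k + h)) *\<^sub>C (if i = h then word [(a, k, j)] else 0)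
      else 0)" and m: "a:{1..l}" "b:{1..l}" "i:I" "j:I" "k:I" "h:I" unfolding env_rels_def by blast
 have z: "0:carrier (env_free I l)" by (simp add: free_alg_sel)
 have w: "word [(a, i, j), (b, k, h)]:carrier (env_free I l)" "word [(b, k, h), (a, i, j)]:carrier (env_free I l)"
  "word [(a, i, h)]:carrier (env_free I l)" "word [(a, k, j)]:carrier (env_free I l)" using m by (auto intro!: word_carrier)
 have i1: "(if j = k then word [(a, i, h)] else 0):carrier (env_free I l)"
  "(if i = h then word [(a, k, j)] else 0):carrier (env_free I l)" using z w by auto
 have "(if a = b then (if j = k then word [(a, i, h)] else 0)
       - koszul (odd (i + j)) (odd (k + h)) *\<^sub>C (if i = h then word [(a, k, j)] else 0) else 0):carrier (env_free I l)"
  using sub_in_carrier(1)[OF i1(1) scale_in_carrier[OF i1(2)]] z by simp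
 thus "x:carrier (env_free I l)" unfolding x by (intro sub_in_carrier(1) scale_in_carrier w)
qed

definition henv :: "int set=>nat=>gen falg=>(gen list=>complex) set" where
 "henv I l x = env_class I l (frestr (egens I l) x)"

lemma env_ideal: "ideal (env_ideal I l) (env_free I l)" unfolding env_ideal_def
 by (rule ring.genideal_ideal[OF ring_presentation.axioms(1)[OF free_alg_presentation] env_rels_carrier])

lemma env_presentation: "ring_presentation (env I l) (henv I l)"
proof -
 interpret F: ring_presentation "env_free I l" "frestr (egens I l)" by (rule free_alg_presentation)
 interpret ideal "env_ideal I l" "env_free I l" by (rule env_ideal)
 have hom: "env_class I l:ring_hom (env_free I l) (env I l)" using rcos_ring_hom by (simp add: env_class_def[abs_def] env_def)
 have s: "EX x. henv I l x = y" if "y:carrier (env I l)" for y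
 proof -
  obtain f where "f:carrier (env_free I l)" "y = env_class I l f"
   using \<open>y \<in> carrier (env I l)\<close> unfolding env_def FactRing_def A_RCOSETS_def' env_class_def by auto
  thus ?thesis using F.h_surj by (metis henv_def)
 qed
 have c: "henv I l x:carrier (env I l)" for x unfolding henv_def by (rule ring_hom_closed[OF hom F.h_carrier])
 have a: "henv I l (x + y) = henv I l x \<oplus>\<^bsub>env I l\<^esub> henv I l y" for x y
  unfolding henv_def F.h_add by (rule ring_hom_add[OF hom F.h_carrier F.h_carrier])
 have m: "henv I l (x*y) = henv I l x \<otimes>\<^bsub>env I l\<^esub> henv I l y" for x y
  unfolding henv_def F.h_mult by (rule ring_hom_mult[OF hom F.h_carrier F.h_carrier])
 have o: "henv I l 1 = \<one>\<^bsub>env I l\<^esub>" unfolding henv_def F.h_one by (rule ring_hom_one[OF hom])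
 show ?thesis by (rule ring_presentation.intro, subst env_def, rule quotient_is_ring)
    (unfold_locales, simp_all only: c s a m o)
qed

subsection \<open>The matrix of the Gaudin model over the free algebra\<close>

definition fvar :: "gen=>gen falg" where "fvar g = Poly_Mapping.single [g] 1"
definition fsc :: "complex=>gen falg" where "fsc c = Poly_Mapping.single [] c"

lemma fsc_power: "fsc c ^ n = fsc (c ^ n)"
proof (induction n)
 case 0
 have "fsc 1 = 1" by (simp add: fsc_def zero_list_def[symmetric])
 thus ?case by simp
qed (simp add: fsc_def mult_single plus_list_def)

lemma fvar_fsc: "fvar g*fsc c = Poly_Mapping.single [g] c" "fsc c*fvar g = Poly_Mapping.single [g] c"
 by (simp_all add: fvar_def fsc_def mult_single plus_list_def)

definition efree :: "nat=>(nat=>complex)=>int=>int=>gen falg psd" where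
 "efree l ze i j = (\<Sum>a=1..l. pconst (fvar (a, i, j))*pgeom (fsc (ze a)))"

text \<open>The Gaudin matrix before the relations of the enveloping algebra are imposed. It is
  monic already, so its Berezinian exists here and can be mapped to every quotient and every ring of
  operators.\<close>

definition afree :: "nat=>(nat=>complex)=>int=>int=>gen falg psd" where
 "afree l ze i j = (if i = j then pd else 0) - (if odd i then - efree l ze i j else efree l ze i j)"

lemma pord_efree: "pord 0 (efree l ze i j)" unfolding efree_def
proof (rule pord_sum)
 fix a
 have "pord (0 + 0) (pconst (fvar (a, i, j))*pgeom (fsc (ze a)))" by (rule pord_mult) (simp_all add: pord_pmon)
 thus "pord 0 (pconst (fvar (a, i, j))*pgeom (fsc (ze a)))" by simp
qed

lemma monic_afree: "finite J==>monic_mat J (afree l ze)"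
 unfolding monic_mat_def afree_def using pord_efree pord_uminus by fastforce

context
 fixes I :: "int set" and l :: nat
begin

interpretation E: ring_presentation "env I l" "henv I l" by (rule env_presentation)
interpretation P: ring_presentation "psdo (env I l)" E.hpsd by (rule E.psdo_presentation)

lemma E_series_efree:
 assumes "i:I" "j:I"
 shows "E_series I l ze i j = E.hpsd (efree l ze i j)"
proof (intro ext)
 fix k s
 have "pcoef (efree l ze i j) k s = (\<Sum>a=1..l. fvar (a, i, j)*(if s = 0 & k < 0 then fsc (ze a ^ nat (- k - 1)) else 0))"
  unfolding efree_def pcoef_sum by (rule sum.cong) (auto simp: pcoef_pmon_mult pcoef_pgeom fsc_power)
 moreover have "frestr (egens I l) (\<Sum>a=1..l. fvar (a, i, j)*fsc (c a)) = (\<Sum>a=1..l. c a *\<^sub>C word [(a, i, j)])" for c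
 proof -
  have add: "frestr (egens I l) (x + y) = frestr (egens I l) x + frestr (egens I l) y" for x y
   by (simp add: frestr_def fun_eq_iff lookup_add)
  have zero: "frestr (egens I l) 0 = 0" by (simp add: frestr_def fun_eq_iff)
  have "frestr (egens I l) (sum f X) = (SUM a:X. frestr (egens I l) (f a))" if "finite X" for f and X :: "nat set"
   using that by (induction X rule: finite_induct) (simp_all only: add zero sum.empty sum.insert not_False_eq_True)
  hence "frestr (egens I l) (\<Sum>a=1..l. fvar (a, i, j)*fsc (c a)) = (\<Sum>a=1..l. frestr (egens I l) (fvar (a, i, j)*fsc (c a)))"
   by simp
  also have "... = (\<Sum>a=1..l. c a *\<^sub>C word [(a, i, j)])"
   using assms by (intro sum.cong) (auto simp: fvar_fsc intro!: frestr_single)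
  finally show ?thesis .
 qed
 ultimately show "E_series I l ze i j k s = E.hpsd (efree l ze i j) k s"
  using E.h_zero by (auto simp: E_series_def E.hpsd_def henv_def)
qed

lemma gaudin_matrix_afree:
 assumes "i:I" "j:I"
 shows "gaudin_matrix I l ze i j = E.hpsd (afree l ze i j)"
 unfolding gaudin_matrix_def afree_def a_minus_def E_series_efree[OF assms]
 using E.hpsd_pmon[of 0 1 1] by (auto simp: E.h_one P.h_minus P.h_zero diff_conv_add_uminus P.h_add simp del: add_uminus_conv_diff)

end

lemma ber_L_free:
 "ber_L p q m n l ze k i = henv (set (idx p q m n)) l (pcoef (ber (idx p q m n) (afree l ze)) k i)"
proof -
 let ?I = "set (idx p q m n)"
 interpret E: ring_presentation "env ?I l" "henv ?I l" by (rule env_presentation)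
 interpret P: ring_presentation "psdo (env ?I l)" E.hpsd by (rule E.psdo_presentation)
 have "ber_L p q m n l ze = E.hpsd (ber (idx p q m n) (afree l ze))" unfolding ber_L_def
  by (rule P.berezinian_h[of ?I]) (auto simp: gaudin_matrix_afree intro: monic_good monic_afree)
 thus ?thesis by (simp add: E.hpsd_def)
qed

lemma cdet_L_free:
 "cdet_L N l ze k i = henv (set (idx 0 0 N 0)) l (pcoef (coldet N (%i j. afree l ze (ev (int i)) (ev (int j))) id) k i)"
proof -
 let ?I = "set (idx 0 0 N 0)"
 interpret E: ring_presentation "env ?I l" "henv ?I l" by (rule env_presentation)
 interpret P: ring_presentation "psdo (env ?I l)" E.hpsd by (rule E.psdo_presentation)
 have "cdet_L N l ze = E.hpsd (coldet N (%i j. afree l ze (ev (int i)) (ev (int j))) id)"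
  unfolding cdet_L_def by (rule P.cdet_h) (auto intro!: gaudin_matrix_afree simp: idx_def)
 thus ?thesis by (simp add: E.hpsd_def)
qed

section \<open>Linear maps\<close>

abbreviation clin :: "('v::complex_vector=>'w::complex_vector)=>bool" where
 "clin f == linear_on UNIV f"

lemma linear_onD:
 "linear_on S f==>x:S==>y:S==>f (x + y) = f x + f y"
 "linear_on S f==>x:S==>f (c *\<^sub>C x) = c *\<^sub>C f x" by (auto simp: linear_on_def)

lemma linear_on_subset: "linear_on S f==>T<=S==>linear_on T f" unfolding linear_on_def by blast

lemma linear_on_zero: "linear_on S f==>x:S==>f 0 = 0" using linear_onD(2)[of S f x 0] by simp

lemma linear_on_diff:
 assumes "linear_on S f" "cvec.subspace S" "x:S" "y:S"
 shows "f (x - y) = f x - f y"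
proof -
 have "f (x + (- 1) *\<^sub>C y) = f x + (- 1) *\<^sub>C f y" using assms by (simp only: linear_onD(1) linear_onD(2) cvec.subspace_scale)
 thus ?thesis by simp
qed

lemma linear_on_sum:
 assumes "linear_on S f" "cvec.subspace S" "!!x. x:X==>g x:S"
 shows "f (SUM x:X. g x) = (SUM x:X. f (g x))"
proof -
 have z: "f 0 = 0" using linear_on_zero[OF assms(1) cvec.subspace_0[OF assms(2)]] .
 show ?thesis using assms(3)
 proof (induction X rule: infinite_finite_induct)
  case (insert x X)
  thus ?case using assms(1,2) by (simp add: linear_onD(1) cvec.subspace_sum)
 qed (simp_all add: z)
qed

lemma clin_linear: "Vector_Spaces.linear (*\<^sub>C) (*\<^sub>C) f \<longleftrightarrow> clin f"
 unfolding Vector_Spaces.linear_iff linear_on_def by (auto intro: cvec.vector_space_axioms)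

lemma cvec_pair: "vector_space_pair (scaleC::complex=>'v::complex_vector=>_) (scaleC::complex=>'w::complex_vector=>_)"
 by (rule vector_space_pair.intro) (fact cvec.vector_space_axioms)+

lemma span_eq_on:
 assumes x: "x:cvec.span B" and f: "linear_on (cvec.span B) f" and g: "linear_on (cvec.span B) g" and B: "!!b. b:B==>f b = g b"
 shows "f x = g x"
proof -
 have "x:cvec.span B & f x = g x" using x
 proof (induction rule: cvec.span_induct_alt)
  case base
  thus ?case using linear_on_zero[OF f cvec.span_zero] linear_on_zero[OF g cvec.span_zero] by (simp add: cvec.span_zero)
 next
  case (step c x y)
  hence "x:cvec.span B" by (simp add: cvec.span_base)
  with step show ?case using linear_onD[OF f] linear_onD[OF g] B by (simp add: cvec.span_add cvec.span_scale)
 qed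
 thus ?thesis ..
qed

lemma linear_on_extend:
 assumes S: "cvec.subspace S" and f: "linear_on S f"
 obtains g where "clin g" "!!x. x:S==>g x = f x"
proof -
 obtain B where B: "B<=S" "cvec.independent B" "S<=cvec.span B" using cvec.maximal_independent_subset by blast
 have SB: "S = cvec.span B" using B S by (metis cvec.span_minimal subset_antisym)
 obtain g where g: "clin g" "!!x. x:B==>g x = f x"
  using vector_space_pair.linear_independent_extend[OF cvec_pair B(2), of f] by (auto simp: clin_linear)
 show ?thesis by (rule that[OF g(1)], rule span_eq_on[where B = B]) (use SB f g linear_on_subset[OF g(1)] in auto)
qed

lemma linear_on_left_inverse:
 fixes f :: "'v::complex_vector=>'w::complex_vector"
 assumes S: "cvec.subspace S" and f: "linear_on S f" and inj: "inj_on f S"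
 obtains g where "clin g" "range g<=S" "!!x. x:S==>g (f x) = x"
proof -
 obtain h where h: "clin h" "!!x. x:S==>h x = f x" by (rule linear_on_extend[OF S f]) blast
 have "inj_on h S" using inj h(2) by (simp add: inj_on_def)
 from vector_space_pair.linear_exists_left_inverse_on[OF cvec_pair _ S this] h(1)
 obtain g where "range g<=S" "clin g" "ALL v:S. g (h v) = v" by (auto simp: clin_linear)
 thus ?thesis using that h(2) by simp
qed

lemma projection_exists:
 fixes S :: "'v::complex_vector set"
 assumes S: "cvec.subspace S"
 obtains P where "clin P" "!!x. P x:S" "!!x. x:S==>P x = x"
proof -
 have "linear_on S (%x. x)" "inj_on (%x. x) S" by (auto simp: linear_on_def)
 from linear_on_left_inverse[OF S this] show ?thesis using that by (metis rangeI subset_iff)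
qed

lemma subspace_image:
 assumes S: "cvec.subspace S" and f: "linear_on S f"
 shows "cvec.subspace (f ` S)"
proof (rule cvec.subspaceI)
 show "0:f ` S" using linear_on_zero[OF f] cvec.subspace_0[OF S] by (metis image_eqI)
 fix x y assume "x:f ` S" "y:f ` S"
 then obtain a b where "x = f a" "y = f b" "a:S" "b:S" by auto
 thus "x + y:f ` S" using linear_onD(1)[OF f, of a b] cvec.subspace_add[OF S, of a b] by (metis image_eqI)
next
 fix c x assume "x:f ` S"
 then obtain a where "x = f a" "a:S" by auto
 thus "c *\<^sub>C x:f ` S" using linear_onD(2)[OF f] cvec.subspace_scale[OF S] by (metis image_eqI)
qed

text \<open>All tensor spaces in question lie in full function spaces \<open>'x => complex\<close>.
  Such a space is never zero, so its endomorphisms satisfy \<open>0 ~= 1\<close> and form a type of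
  class \<open>ring_1\<close>, to which the theory of matrices applies.\<close>

typedef 'x lin = "{f::('x=>complex)=>('x=>complex). clin f}"
 morphisms lapp Lin by (rule exI[of _ "%x. x"]) (simp add: linear_on_def)

lemma clin_lapp: "clin (lapp T)" using lapp by blast

lemma lapp_simps [simp]:
 "lapp T (x + y) = lapp T x + lapp T y" "lapp T (c *\<^sub>C x) = c *\<^sub>C lapp T x" "lapp T 0 = 0"
 "lapp T (x - y) = lapp T x - lapp T y" "lapp T (- x) = - lapp T x"
proof -
 show a: "lapp T (x + y) = lapp T x + lapp T y" and c: "lapp T (c *\<^sub>C x) = c *\<^sub>C lapp T x" for x y c
  using clin_lapp[of T] by (auto simp: linear_on_def)
 show "lapp T 0 = 0" using linear_on_zero[OF clin_lapp] by blast
 show d: "lapp T (x - y) = lapp T x - lapp T y" for x y using linear_on_diff[OF clin_lapp] by simp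
 show "lapp T (- x) = - lapp T x" using d[of 0 x] \<open>lapp T 0 = 0\<close> by (simp del: minus_apply)
qed

lemma lin_eqI: "(!!x. lapp S x = lapp T x)==>S = T" by (metis ext lapp_inject)

instantiation lin :: (type) ring_1
begin
definition zero_lin :: "'a lin" where "zero_lin = Lin (%x. 0)"
definition one_lin :: "'a lin" where "one_lin = Lin (%x. x)"
definition plus_lin :: "'a lin=>'a lin=>'a lin" where "plus_lin S T = Lin (%x. lapp S x + lapp T x)"
definition minus_lin :: "'a lin=>'a lin=>'a lin" where "minus_lin S T = Lin (%x. lapp S x - lapp T x)"
definition uminus_lin :: "'a lin=>'a lin" where "uminus_lin S = Lin (%x. - lapp S x)"
definition times_lin :: "'a lin=>'a lin=>'a lin" where "times_lin S T = Lin (%x. lapp S (lapp T x))"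

lemma lapp_ops:
 "lapp 0 x = 0" "lapp 1 x = x" "lapp (S + T) x = lapp S x + lapp T x" "lapp (S - T) x = lapp S x - lapp T x"
 "lapp (- S) x = - lapp S x" "lapp (S*T) x = lapp S (lapp T x)"
 unfolding zero_lin_def one_lin_def plus_lin_def minus_lin_def uminus_lin_def times_lin_def
 by (subst Lin_inverse, simp add: linear_on_def scaleC_add_right scaleC_scaleC mult.commute cvec.scale_right_diff_distrib, simp)+

instance
proof
 have "lapp 0 (%_. 1::complex)~=lapp (1::'a lin) (%_. 1)" by (simp add: lapp_ops fun_eq_iff)
 thus "0~=(1::'a lin)" by metis
qed (rule lin_eqI, simp add: lapp_ops)+
end

declare lapp_ops [simp]

lemma lapp_sum: "lapp (SUM a:X. f a) x = (SUM a:X. lapp (f a) x)" by (induction X rule: infinite_finite_induct) simp_all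

lemma lapp_Lin: "clin f==>lapp (Lin f) x = f x" by (simp add: Lin_inverse)

lemma lapp_prod_list: "lapp (prod_list (map rh w)) v = foldr (%g. lapp (rh g)) w v" by (induction w) simp_all

lemma lin_tf: "ALL x::'x lin. x + x = 0-->x = 0"
proof (intro allI impI lin_eqI)
 fix x :: "'x lin" and v assume "x + x = 0"
 hence "lapp x v + lapp x v = 0" by (metis lapp_ops(1,3))
 thus "lapp x v = lapp 0 v" by (simp add: fun_eq_iff)
qed

definition lsc :: "complex=>'x lin" where "lsc c = Lin (%x. c *\<^sub>C x)"

lemma lapp_lsc [simp]: "lapp (lsc c) x = c *\<^sub>C x"
 unfolding lsc_def by (rule lapp_Lin) (simp add: linear_on_def scaleC_add_right scaleC_scaleC mult.commute)

lemma lsc_commute: "x*lsc c = lsc c*x" by (rule lin_eqI) simp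

lemma rhom_lsc: "rhom lsc" unfolding rhom_def by (auto intro!: lin_eqI simp: scaleC_add_left scaleC_scaleC scaleC_one)

section \<open>Evaluation of the free algebra\<close>

definition leval :: "('g=>'x lin)=>'g falg=>'x lin" where
 "leval rh x = (SUM w:Poly_Mapping.keys x. lsc (lkp x w)*prod_list (map rh w))"

lemma leval_superset:
 assumes "finite X" "Poly_Mapping.keys x<=X"
 shows "leval rh x = (SUM w:X. lsc (lkp x w)*prod_list (map rh w))" unfolding leval_def using assms
 by (intro sum.mono_neutral_left) (auto simp: in_keys_iff rhomD(4)[OF rhom_lsc])

lemma leval_single: "leval rh (Poly_Mapping.single w c) = lsc c*prod_list (map rh w)" by (subst leval_superset[of "{w}"]) auto

lemma leval_add: "leval rh (x + y) = leval rh x + leval rh y"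
proof -
 let ?X = "Poly_Mapping.keys x Un Poly_Mapping.keys y"
 show ?thesis
  using leval_superset[of ?X x rh] leval_superset[of ?X y rh] leval_superset[of ?X "x + y" rh] Poly_Mapping.keys_add[of x y]
  by (simp add: lookup_add rhomD(2)[OF rhom_lsc] distrib_right sum.distrib)
qed

lemma rhom_leval: "rhom (leval rh)" unfolding rhom_def
proof (intro conjI allI)
 show "leval rh 1 = 1" using leval_single[of rh 0 1] by (simp add: zero_list_def rhomD(1)[OF rhom_lsc] flip: single_one)
 show "leval rh (x*y) = leval rh x*leval rh y" for x y
 proof (induction x rule: falg_induct)
  case (single u c)
  show ?case
  proof (induction y rule: falg_induct)
   case (single v d)
   have "lsc (c*d)*(prod_list (map rh u)*prod_list (map rh v)) = lsc c*prod_list (map rh u)*(lsc d*prod_list (map rh v))"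
    by (rule lin_eqI) (simp add: scaleC_scaleC)
   thus ?case by (simp add: mult_single plus_list_def leval_single)
  qed (simp add: distrib_left leval_add)
 qed (simp add: distrib_right leval_add)
qed (rule leval_add)

lemma leval_fvar: "leval rh (fvar g) = rh g" "leval rh (fsc c) = lsc c"
 by (simp_all add: fvar_def fsc_def leval_single rhomD(1)[OF rhom_lsc])

section \<open>Eigenvalue series\<close>

definition eig :: "'x lin psd=>complex psd=>('x=>complex)=>bool" where
 "eig F D v \<longleftrightarrow> (ALL i j. lapp (pcoef F i j) v = pcoef D i j *\<^sub>C v)"

lemma lapp_of_int: "lapp (of_int k::'x lin) v = of_int k *\<^sub>C v"
proof -
 have "(of_int k::'x lin) = lsc (of_int k)" using rhom_of_int[OF rhom_lsc] by metis
 thus ?thesis by (simp only: lapp_lsc)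
qed

text \<open>The coefficients of \<open>G\<close> act first and produce scalars, which the linear
  coefficients of \<open>F\<close> pass; the factors \<open>wick\<close> are the same in both
  products.\<close>

lemma eig_mult:
 assumes "eig F D v" "eig G E v" shows "eig (F*G) (D*E) v" unfolding eig_def
proof (intro allI)
 fix i j
 obtain t1 s1 t2 s2 t3 s3 t4 s4 where b: "bounded (pcoef F) t1 s1" "bounded (pcoef D) t2 s2" "bounded (pcoef G) t3 s3" "bounded (pcoef E) t4 s4"
  using pcoef_bounded by metis
 define t s t' s' where "t = max t1 t2" "s = max s1 s2" "t' = max t3 t4" "s' = max s3 s4"
 hence B: "bounded (pcoef F) t s" "bounded (pcoef D) t s" "bounded (pcoef G) t' s'" "bounded (pcoef E) t' s'"
  using b by (auto elim!: bounded_mono)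
 have "lapp (pcoef (F*G) i j) v = (SUM (k, l, m, n, u):star_box t s t' s' i j. lapp (of_int (wick l m u)*(pcoef F k l*pcoef G m n)) v)"
  unfolding pcoef_mult star_box[OF B(1,3)] lapp_sum by (simp add: case_prod_unfold)
 also have "... = (SUM (k, l, m, n, u):star_box t s t' s' i j. (of_int (wick l m u)*(pcoef D k l*pcoef E m n)) *\<^sub>C v)"
  using assms unfolding eig_def by (intro sum.cong refl) (auto simp: lapp_of_int scaleC_scaleC mult_ac)
 also have "... = pcoef (D*E) i j *\<^sub>C v"
  unfolding pcoef_mult star_box[OF B(2,4)] cvec.scale_sum_left by (simp add: case_prod_unfold)
 finally show "lapp (pcoef (F*G) i j) v = pcoef (D*E) i j *\<^sub>C v" .
qed

lemma eig_pmap_lsc: "eig (pmap lsc D) D v" by (simp add: eig_def pcoef_pmap[OF rhom_lsc])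

lemma eig_exists:
 assumes v: "v~=0" and e: "!!i j. EX c. lapp (pcoef F i j) v = c *\<^sub>C v"
 shows "EX D. eig F D v"
proof -
 obtain D where D: "lapp (pcoef F i j) v = D i j *\<^sub>C v" for i j using e by metis
 have "D i j = 0" if "pcoef F i j = 0" for i j using D[of i j] v that by simp
 hence "EX t s. bounded D t s" using pcoef_bounded[of F] unfolding bounded_def by metis
 hence "pcoef (Psd D) = D" by (simp add: Psd_inverse)
 thus ?thesis using D unfolding eig_def by metis
qed

section \<open>Representations of the Gaudin algebra\<close>

text \<open>Letters outside the index range act by 0, which makes evaluation insensitive to the
  words that \<open>frestr\<close> drops.\<close>

definition env_rep :: "int set=>nat=>(gen=>'x lin)=>bool" where
 "env_rep I l rh \<longleftrightarrow> (ALL g. g~:egens I l-->rh g = 0) &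
   (ALL a:{1..l}. ALL b:{1..l}. ALL i:I. ALL j:I. ALL k:I. ALL h:I.
    rh (a, i, j)*rh (b, k, h) - sg (i + j) (k + h) (rh (b, k, h)*rh (a, i, j)) =
    (if a = b then (if j = k then rh (a, i, h) else 0) - sg (i + j) (k + h) (if i = h then rh (a, k, j) else 0) else 0))"

lemma koszul_sg: "koszul (odd a) (odd b) *\<^sub>C x = sg a b x" by (auto simp: koszul_def sg_def scaleC_one)

lemma lsc_koszul: "lsc (koszul (odd a) (odd b))*x = sg a b x" by (rule lin_eqI) (auto simp: sg_def koszul_def scaleC_one)

lemma leval_frestr:
 assumes z: "!!g. g~:G==>rh g = 0"
 shows "leval rh (Abs_poly_mapping (frestr G x)) = leval rh x"
proof -
 let ?y = "Abs_poly_mapping (frestr G x)"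
 have y: "lkp ?y = frestr G x" using frestr_surj(2)[OF frestr_carrier] .
 have zw: "prod_list (map rh w) = 0" if w: "~ set w<=G" for w
 proof -
  obtain u g v where "w = u @ g # v" "g~:G" using w by (metis split_list subsetI)
  thus ?thesis using z by simp
 qed
 have sub: "Poly_Mapping.keys ?y<=Poly_Mapping.keys x" by (simp add: subset_iff in_keys_iff y, simp add: frestr_def)
 show ?thesis unfolding leval_superset[OF Poly_Mapping.finite_keys sub] unfolding leval_def y
  by (rule sum.cong[OF refl], simp add: frestr_def zw)
qed

lemma frestr_Abs:
 assumes "f:carrier (free_alg G)" "g:carrier (free_alg G)"
 shows "Abs_poly_mapping (f \<oplus>\<^bsub>free_alg G\<^esub> g) = Abs_poly_mapping f + Abs_poly_mapping g"
  "frestr G (Abs_poly_mapping f*Abs_poly_mapping g) = f \<otimes>\<^bsub>free_alg G\<^esub> g"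
proof -
 have c: "f \<oplus>\<^bsub>free_alg G\<^esub> g:carrier (free_alg G)"
  using ring.ring_simprules(1)[OF ring_presentation.axioms(1)[OF free_alg_presentation] assms] .
 show "Abs_poly_mapping (f \<oplus>\<^bsub>free_alg G\<^esub> g) = Abs_poly_mapping f + Abs_poly_mapping g"
  by (rule poly_mapping_eqI) (simp only: frestr_surj(2)[OF c] frestr_surj(2)[OF assms(1)] frestr_surj(2)[OF assms(2)] lookup_add, simp add: free_alg_sel)
 show "frestr G (Abs_poly_mapping f*Abs_poly_mapping g) = f \<otimes>\<^bsub>free_alg G\<^esub> g"
  by (simp only: frestr_mult frestr_surj(1)[OF assms(1)] frestr_surj(1)[OF assms(2)])
qed

text \<open>The carrier elements that evaluate to 0 form an ideal of the carrier ring, so the ideal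
  generated by \<open>R\<close> is contained in it.\<close>

lemma leval_genideal:
 assumes z: "!!g. g~:G==>rh g = 0" and R: "R<=carrier (free_alg G)"
  and R0: "!!f. f:R==>leval rh (Abs_poly_mapping f) = 0" and f: "f:Idl\<^bsub>free_alg G\<^esub> R"
 shows "leval rh (Abs_poly_mapping f) = 0"
proof -
 interpret F: ring_presentation "free_alg G" "frestr G" by (rule free_alg_presentation)
 define K where "K = {f:carrier (free_alg G). leval rh (Abs_poly_mapping f) = 0}"
 have A: "leval rh (Abs_poly_mapping (f \<otimes>\<^bsub>free_alg G\<^esub> g)) = leval rh (Abs_poly_mapping f)*leval rh (Abs_poly_mapping g)"
  if "f:carrier (free_alg G)" "g:carrier (free_alg G)" for f g
  using leval_frestr[of G rh, OF z, of "Abs_poly_mapping f*Abs_poly_mapping g"] frestr_Abs(2)[OF that] rhomD(3)[OF rhom_leval] by metis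
 have add: "leval rh (Abs_poly_mapping (f \<oplus>\<^bsub>free_alg G\<^esub> g)) = leval rh (Abs_poly_mapping f) + leval rh (Abs_poly_mapping g)"
  if "f:carrier (free_alg G)" "g:carrier (free_alg G)" for f g using frestr_Abs(1)[OF that] by (simp add: leval_add)
 have zero: "leval rh (Abs_poly_mapping \<zero>\<^bsub>free_alg G\<^esub>) = 0"
  using leval_frestr[of G rh, OF z, of 0] F.h_zero by (simp add: leval_def)
 have "ideal K (free_alg G)"
 proof (rule idealI[OF F.ring_axioms])
  show "subgroup K (add_monoid (free_alg G))"
  proof (rule group.subgroupI[OF F.add.group_axioms])
   show "K<=carrier (add_monoid (free_alg G))" by (auto simp: K_def)
   show "K~={}" using zero F.zero_closed by (auto simp: K_def)
   fix x assume x: "x:K"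
   hence xc: "x:carrier (free_alg G)" "leval rh (Abs_poly_mapping x) = 0" by (auto simp: K_def)
   have "leval rh (Abs_poly_mapping (x \<oplus>\<^bsub>free_alg G\<^esub> \<ominus>\<^bsub>free_alg G\<^esub> x)) = 0"
    using zero xc F.r_neg by simp
   hence "leval rh (Abs_poly_mapping (\<ominus>\<^bsub>free_alg G\<^esub> x)) = 0"
    using add[OF xc(1) F.a_inv_closed[OF xc(1)]] xc by simp
   hence "\<ominus>\<^bsub>free_alg G\<^esub> x:K" using F.a_inv_closed[OF xc(1)] by (simp add: K_def)
   thus "inv\<^bsub>add_monoid (free_alg G)\<^esub> x:K" unfolding a_inv_def .
  next
   fix x y assume "x:K" "y:K"
   hence "x \<oplus>\<^bsub>free_alg G\<^esub> y:K" unfolding K_def using F.a_closed add by simp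
   thus "x \<otimes>\<^bsub>add_monoid (free_alg G)\<^esub> y:K" by simp
  qed
 qed (auto simp: K_def A simp del: F.m_closed intro: F.m_closed)
 moreover have "R<=K" using R R0 by (auto simp: K_def)
 ultimately have "Idl\<^bsub>free_alg G\<^esub> R<=K" by (rule F.genideal_minimal)
 thus ?thesis using f by (auto simp: K_def)
qed

lemma env_rep_zero: "env_rep I l rh==>g~:egens I l==>rh g = 0"
 unfolding env_rep_def by blast

lemma rep_bracket:
 assumes "env_rep I l rh" "a:{1..l}" "b:{1..l}" "i:I" "j:I" "k:I" "h:I"
 shows "rh (a, i, j)*rh (b, k, h) - sg (i + j) (k + h) (rh (b, k, h)*rh (a, i, j)) =
    (if a = b then (if j = k then rh (a, i, h) else 0) - sg (i + j) (k + h) (if i = h then rh (a, k, j) else 0) else 0)"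
 using assms unfolding env_rep_def by blast

lemma lkp_word:
 "lkp (fvar g) = word [g]" "lkp (fvar g*fvar g') = word [g, g']"
 "lkp (fsc c*x) = c *\<^sub>C lkp x" "lkp (x - y) = lkp x - lkp y" "lkp 0 = 0"
proof -
 show "lkp (fvar g) = word [g]" "lkp (fvar g*fvar g') = word [g, g']"
  by (auto simp: fun_eq_iff fvar_def mult_single plus_list_def lookup_single word_def when_def)
 show "lkp (fsc c*x) = c *\<^sub>C lkp x"
 proof
  fix w
  have "lkp (fsc c*x) w = (SUM k<=length w. if k = 0 then c*lkp x w else 0)"
   unfolding lkp_mult by (rule sum.cong) (auto simp: fsc_def lookup_single when_def)
  thus "lkp (fsc c*x) w = (c *\<^sub>C lkp x) w" by (simp add: scaleC_fun_def scaleC_complex_def)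
 qed
qed (simp_all add: fun_eq_iff lookup_minus)

lemma leval_env_ideal:
 assumes rh: "env_rep I l rh" and f: "f:env_ideal I l"
 shows "leval rh (Abs_poly_mapping f) = 0"
proof (rule leval_genideal[OF env_rep_zero[OF rh] env_rels_carrier _ f[unfolded env_ideal_def]])
 fix x assume "x:env_rels I l"
 then obtain a b i j k h where e: "x = word [(a, i, j), (b, k, h)]
    - koszul (odd (i + j)) (odd (k + h)) *\<^sub>C word [(b, k, h), (a, i, j)]
    - (if a = b then (if j = k then word [(a, i, h)] else 0)
       - koszul (odd (i + j)) (odd (k + h)) *\<^sub>C (if i = h then word [(a, k, j)] else 0)
      else 0)" and m: "a:{1..l}" "b:{1..l}" "i:I" "j:I" "k:I" "h:I" unfolding env_rels_def by blast
 define s where "s = koszul (odd (i + j)) (odd (k + h))"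
 have s: "lsc s*T = sg (i + j) (k + h) T" for T :: "'a lin" unfolding s_def by (rule lsc_koszul)
 define y :: "gen falg" where "y = fvar (a, i, j)*fvar (b, k, h) - fsc s*(fvar (b, k, h)*fvar (a, i, j))
    - (if a = b then (if j = k then fvar (a, i, h) else 0) - fsc s*(if i = h then fvar (a, k, j) else 0) else 0)"
 have "lkp y = x" unfolding y_def e s_def[symmetric] lkp_word by (simp only: lkp_word if_distrib[of lkp])
 hence xy: "Abs_poly_mapping x = y" by auto
 have "leval rh y = rh (a, i, j)*rh (b, k, h) - lsc s*(rh (b, k, h)*rh (a, i, j)) -
   (if a = b then (if j = k then rh (a, i, h) else 0) - lsc s*(if i = h then rh (a, k, j) else 0) else 0)"
  unfolding y_def by (simp only: rhomD[OF rhom_leval] leval_fvar if_distrib[of "leval rh"])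
 thus "leval rh (Abs_poly_mapping x) = 0" unfolding xy s using rep_bracket[OF rh m] by (simp only: diff_self)
qed

text \<open>\<open>env_act\<close> picks some representative of a class; any two differ by an
  element of the ideal, which evaluates to 0. The set \<open>W\<close> is where the given operators
  agree with those of the representation.\<close>

lemma env_act_leval:
 assumes rh: "env_rep I l rh"
  and W: "!!g w. g:egens I l==>w:W==>rh0 g w:W & lapp (rh g) w = rh0 g w" and v: "v:W"
 shows "env_act rh0 (henv I l x) v = lapp (leval rh x) v"
proof -
 interpret F: ring_presentation "env_free I l" "frestr (egens I l)" by (rule free_alg_presentation)
 interpret ideal "env_ideal I l" "env_free I l" by (rule env_ideal)
 define f where "f = (SOME f. f:henv I l x)"
 have e: "henv I l x = env_ideal I l +>\<^bsub>env_free I l\<^esub> frestr (egens I l) x" by (simp add: henv_def env_class_def)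
 have "frestr (egens I l) x:henv I l x" unfolding e by (rule a_rcos_self[OF F.h_carrier])
 hence "f:henv I l x" unfolding f_def by (metis someI_ex)
 then obtain h where h: "h:env_ideal I l" "f = h \<oplus>\<^bsub>env_free I l\<^esub> frestr (egens I l) x"
  unfolding e a_r_coset_def' by auto
 have hc: "h:carrier (env_free I l)" using h(1) a_subset by auto
 have fc: "f:carrier (env_free I l)" unfolding h(2) by (rule F.a_closed[OF hc F.h_carrier])
 have "leval rh (Abs_poly_mapping f) = leval rh x"
  unfolding h(2) frestr_Abs(1)[OF hc F.h_carrier] leval_add leval_env_ideal[OF rh h(1)] add_0_left
  by (rule leval_frestr) (rule env_rep_zero[OF rh])
 have fold: "foldr rh0 w v:W & foldr (%g. lapp (rh g)) w v = foldr rh0 w v" if "set w<=egens I l" for w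
  using that v W by (induction w) auto
 have "env_act rh0 (henv I l x) v = (\<Sum>w | f w~=0. f w *\<^sub>C foldr rh0 w v)"
  by (simp add: env_act_def f_def[symmetric])
 also have "... = (\<Sum>w | f w~=0. f w *\<^sub>C foldr (%g. lapp (rh g)) w v)"
  using fc by (intro sum.cong) (auto simp: free_alg_sel fold)
 also have "... = lapp (leval rh (Abs_poly_mapping f)) v" unfolding leval_def lapp_sum
  by (intro sum.cong) (auto simp: frestr_surj(2)[OF fc] lapp_prod_list in_keys_iff)
 finally show ?thesis by (simp add: \<open>leval rh (Abs_poly_mapping f) = leval rh x\<close>)
qed

definition gmat :: "nat=>(nat=>complex)=>(gen=>'x lin)=>int=>int=>'x lin psd" where
 "gmat l ze rh i j = pmap (leval rh) (afree l ze i j)"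

text \<open>The sum of E^(a)/(z - z_a)^n: \<open>n = 0\<close> is the diagonal action,
  \<open>n = 1\<close> the series in the Gaudin matrix, and \<open>n = 2\<close> minus the
  derivative of the latter.\<close>

definition eseries :: "nat=>nat=>(nat=>complex)=>(gen=>'x lin)=>int=>int=>'x lin psd" where
 "eseries n l ze rh i j = (\<Sum>a=1..l. pconst (rh (a, i, j))*pgeom (lsc (ze a)) ^ n)"

lemma gmat_eseries: "gmat l ze rh i j = (if i = j then pd else 0) - (if odd i then - eseries 1 l ze rh i j else eseries 1 l ze rh i j)"
 unfolding gmat_def afree_def efree_def eseries_def
 by (simp add: rhomD[OF rhom_pmap[OF rhom_leval]] rhom_sum[OF rhom_pmap[OF rhom_leval]] pmap_pmon[OF rhom_leval]
  pmap_pgeom[OF rhom_leval] leval_fvar rhomD[OF rhom_leval])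

lemma ber_gmat: "finite J==>set ord<=J==>ber ord (gmat l ze rh) = pmap (leval rh) (ber ord (afree l ze))"
 unfolding gmat_def by (rule rhom_ber[OF rhom_pmap[OF rhom_leval] monic_good[OF monic_afree], symmetric])

lemma monic_gmat: "finite J==>monic_mat J (gmat l ze rh)"
proof -
 have "pord 0 (eseries 1 l ze rh i j)" for i j unfolding eseries_def
 proof (rule pord_sum)
  fix a
  have "pord (0 + 0) (pconst (rh (a, i, j))*pgeom (lsc (ze a)) ^ 1)" by (rule pord_mult) (simp_all add: pord_pmon)
  thus "pord 0 (pconst (rh (a, i, j))*pgeom (lsc (ze a)) ^ 1)" by simp
 qed
 moreover assume "finite J"
 ultimately show ?thesis unfolding monic_mat_def gmat_eseries using pord_uminus by fastforce
qed

lemma pgeom_pconst_commute: "pgeom (lsc c)*pconst x = pconst x*pgeom (lsc c)"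
 by (rule psd_eqI) (simp add: pcoef_pmon_mult pcoef_mult_pmon pcoef_pgeom lsc_commute rhom_power[OF rhom_lsc, symmetric])

lemma pd_eseries: "pd*eseries 1 l ze rh i j = eseries 1 l ze rh i j*pd - eseries 2 l ze rh i j"
proof -
 have "pd*(pconst x*pgeom a) = pconst x*pgeom a*pd - pconst x*(pgeom a) ^ 2" for x a :: "'a lin"
  by (simp add: mult.assoc[symmetric] pd_pconst, simp add: mult.assoc pd_pgeom right_diff_distrib power2_eq_square)
 thus ?thesis by (simp add: eseries_def sum_distrib_left sum_distrib_right sum_subtractf)
qed

lemma pconst_sg: "pconst (sg a b (x::'a::ring_1)) = sg a b (pconst x)" by (simp add: sg_def pconst_uminus)

context
 fixes I :: "int set" and l :: nat and ze :: "nat=>complex" and rh :: "gen=>'x lin"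
 assumes rh: "env_rep I l rh"
begin

text \<open>Different slots supercommute, so only the terms with \<open>a = b\<close> survive, and
  in these the powers of 1/(z - z_a) multiply.\<close>

lemma eseries_bracket:
 assumes m: "i:I" "j:I" "k:I" "h:I"
 shows "eseries N l ze rh i j*eseries M l ze rh k h - sg (i + j) (k + h) (eseries M l ze rh k h*eseries N l ze rh i j) =
  (if j = k then eseries (N + M) l ze rh i h else 0) - sg (i + j) (k + h) (if i = h then eseries (N + M) l ze rh k j else 0)"
proof -
 define G :: "nat=>'x lin psd" where "G a = pgeom (lsc (ze a))" for a
 have GP: "G a ^ n*pconst x = pconst x*G a ^ n" for a n x by (rule power_commuting_commutes) (simp only: G_def pgeom_pconst_commute)
 have GG1: "G a*G b = G b*G a" for a b unfolding G_def by (rule pgeom_commute) (rule lsc_commute)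
 have GG: "G a ^ n*G b ^ k = G b ^ k*G a ^ n" for a b n k
  by (rule power_commuting_commutes[OF power_commuting_commutes[OF GG1, symmetric], symmetric, THEN sym])
 have tt: "pconst x*G a ^ n*(pconst y*G b ^ k) = pconst (x*y)*(G a ^ n*G b ^ k)" for x y a b n k
 proof -
  have "pconst x*G a ^ n*(pconst y*G b ^ k) = pconst x*(G a ^ n*pconst y)*G b ^ k" by (simp only: mult.assoc)
  thus ?thesis by (simp only: GP pconst_mult mult.assoc)
 qed
 have "eseries N l ze rh i j*eseries M l ze rh k h - sg (i + j) (k + h) (eseries M l ze rh k h*eseries N l ze rh i j)
   = (\<Sum>a=1..l. \<Sum>b=1..l. pconst (rh (a, i, j)*rh (b, k, h) - sg (i + j) (k + h) (rh (b, k, h)*rh (a, i, j)))*(G a ^ N*G b ^ M))"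
 proof -
  have "eseries M l ze rh k h*eseries N l ze rh i j = (\<Sum>a=1..l. \<Sum>b=1..l. pconst (rh (b, k, h)*rh (a, i, j))*(G a ^ N*G b ^ M))"
   unfolding eseries_def G_def[symmetric] sum_product by (subst sum.swap) (simp only: tt GG)
  moreover have "eseries N l ze rh i j*eseries M l ze rh k h = (\<Sum>a=1..l. \<Sum>b=1..l. pconst (rh (a, i, j)*rh (b, k, h))*(G a ^ N*G b ^ M))"
   unfolding eseries_def G_def[symmetric] sum_product by (simp only: tt GG)
  ultimately show ?thesis by (simp only: sg_sum pconst_diff pconst_sg left_diff_distrib sg_mult sum_subtractf)
 qed
 also have "... = (\<Sum>a=1..l. \<Sum>b=1..l. if a = b then pconst ((if j = k then rh (a, i, h) else 0) - sg (i + j) (k + h) (if i = h then rh (a, k, j) else 0))*(G a ^ (N + M)) else 0)"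
  by (intro sum.cong refl) (simp add: rep_bracket[OF rh] m power_add)
 also have "... = (\<Sum>a=1..l. pconst ((if j = k then rh (a, i, h) else 0) - sg (i + j) (k + h) (if i = h then rh (a, k, j) else 0))*(G a ^ (N + M)))"
  by (intro sum.cong refl) (simp add: sum.delta')
 also have "... = (if j = k then eseries (N + M) l ze rh i h else 0) - sg (i + j) (k + h) (if i = h then eseries (N + M) l ze rh k j else 0)"
  unfolding eseries_def G_def by (simp add: pconst_diff pconst_sg sg_mult left_diff_distrib sum_subtractf sg_sum)
 finally show ?thesis .
qed

end

text \<open>Here \<open>E2\<close> stands for minus the derivative of \<open>E\<close>, and the same
  series appears in the bracket of two entries of \<open>E\<close>. This coincidence is what makes
  the matrix Manin.\<close>

lemma gaudin_bracket:
 fixes E E2 :: "int=>int=>'r::ring_1"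
 assumes br: "E i j*E k h - sg (i + j) (k + h) (E k h*E i j) = (if j = k then E2 i h else 0) - sg (i + j) (k + h) (if i = h then E2 k j else 0)"
  and dE: "d*E i j = E i j*d - E2 i j" "d*E k h = E k h*d - E2 k h"
  and A: "A = (%i j. (if i = j then d else 0) - (if odd i then - E i j else E i j))"
 shows "A i j*A k h - sg (i + j) (k + h) (A k h*A i j) =
  sg i i (sg k k ((if j = k then E2 i h else 0) - sg (i + j) (k + h) (if i = h then E2 k j else 0)))
  + (if i = j then sg k k (E2 k h) else 0) - (if k = h then sg i i (E2 i j) else 0)"
proof -
 define e where "e a b = sg a a (E a b)" for a b
 define dt where "dt a b = (if a = b then d else 0)" for a b :: int
 have A': "A a b = dt a b - e a b" for a b by (simp add: A dt_def e_def sg_def)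
 have ee: "e i j*e k h - sg (i + j) (k + h) (e k h*e i j) =
  sg i i (sg k k ((if j = k then E2 i h else 0) - sg (i + j) (k + h) (if i = h then E2 k j else 0)))"
  unfolding br[symmetric] e_def by (simp add: sg_add sg_mult sg_commute)
 have de: "dt i j*e k h - sg (i + j) (k + h) (e k h*dt i j) = (if i = j then - sg k k (E2 k h) else 0)"
  by (simp add: dt_def e_def sg_mult dE sg_add)
 have ed: "e i j*dt k h - sg (i + j) (k + h) (dt k h*e i j) = (if k = h then sg i i (E2 i j) else 0)"
  by (simp add: dt_def e_def sg_mult dE sg_add)
 have dd: "dt i j*dt k h - sg (i + j) (k + h) (dt k h*dt i j) = 0" by (auto simp: dt_def sg_def)
 have "A i j*A k h - sg (i + j) (k + h) (A k h*A i j) =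
  (dt i j*dt k h - sg (i + j) (k + h) (dt k h*dt i j)) - (dt i j*e k h - sg (i + j) (k + h) (e k h*dt i j))
  - (e i j*dt k h - sg (i + j) (k + h) (dt k h*e i j)) + (e i j*e k h - sg (i + j) (k + h) (e k h*e i j))"
  unfolding A' by (simp add: algebra_simps sg_add)
 thus ?thesis unfolding ee de ed dd by simp
qed

lemma manin_bracket:
 fixes A :: "int=>int=>'r::ring_1"
 assumes "!!i j k l. i:I==>j:I==>k:I==>l:I ==>
  sg j k (A i j*A k l - sg (i + j) (k + l) (A k l*A i j)) + sg j l (sg l k (A i l*A k j - sg (i + l) (k + j) (A k j*A i l))) = 0"
 shows "manin I A" unfolding manin_def
proof (intro ballI)
 fix i k j l assume m: "i:I" "k:I" "j:I" "l:I"
 have 1: "sg j k (sg (i + j) (k + l) x) = sg i k (sg j l (sg l i x))" "sg j l (sg l k (sg (i + l) (k + j) x)) = sg i k (sg j i x)" for x :: 'r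
  by (auto simp: sg_def)
 from assms[OF m(1,3,2,4)] show "sg j k (A i j*A k l) - sg i k (sg j i (A k j*A i l))
   + sg j l (sg l k (A i l*A k j)) - sg i k (sg j l (sg l i (A k l*A i j))) = 0" unfolding sg_add 1 by (simp add: algebra_simps)
qed

text \<open>Brackets of entries contain only series of exponent 2, arising from brackets and from
  derivatives. When \<open>j\<close> and \<open>h\<close> are exchanged and the two brackets added
  with signs, the two kinds cancel each other.\<close>

lemma manin_gmat:
 assumes rh: "env_rep I l rh"
 shows "manin I (gmat l ze rh)"
proof (rule manin_bracket)
 fix i j k h assume m: "i:I" "j:I" "k:I" "h:I"
 have A: "gmat l ze rh = (%i j. (if i = j then pd else 0) - (if odd i then - eseries 1 l ze rh i j else eseries 1 l ze rh i j))"
  by (intro ext) (rule gmat_eseries)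
 have B: "gmat l ze rh i j*gmat l ze rh k h - sg (i + j) (k + h) (gmat l ze rh k h*gmat l ze rh i j) =
  sg i i (sg k k ((if j = k then eseries 2 l ze rh i h else 0) - sg (i + j) (k + h) (if i = h then eseries 2 l ze rh k j else 0)))
  + (if i = j then sg k k (eseries 2 l ze rh k h) else 0) - (if k = h then sg i i (eseries 2 l ze rh i j) else 0)"
  if "i:I" "j:I" "k:I" "h:I" for i j k h
  by (rule gaudin_bracket[OF _ pd_eseries pd_eseries A]) (use eseries_bracket[OF rh that, of 1 ze 1] in \<open>simp only: one_add_one\<close>)
 have id: "sg j k (sg i i (sg k k ((if j = k then x else 0) - sg (i + j) (k + h) (if i = h then y else 0)))
  + (if i = j then sg k k z else 0) - (if k = h then sg i i w else 0))
  + sg j h (sg h k (sg i i (sg k k ((if h = k then w else 0) - sg (i + h) (k + j) (if i = j then z else 0)))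
  + (if i = h then sg k k y else 0) - (if k = j then sg i i x else 0))) = 0" for x y z w :: "'a lin psd"
  by (cases "even i"; cases "even j"; cases "even k"; cases "even h"; cases "j = k"; cases "i = h"; cases "i = j"; cases "k = h")
    (simp_all add: sg_def)
 show "sg j k (gmat l ze rh i j*gmat l ze rh k h - sg (i + j) (k + h) (gmat l ze rh k h*gmat l ze rh i j))
  + sg j h (sg h k (gmat l ze rh i h*gmat l ze rh k j - sg (i + h) (k + j) (gmat l ze rh k j*gmat l ze rh i h))) = 0"
  unfolding B[OF m] B[OF m(1,4,3,2)] by (rule id)
qed

text \<open>The diagonal action has exponent 0: it commutes with \<partial>, and its bracket with a
  series of exponent 1 has exponent 1 again.\<close>

lemma covar_gmat:
 assumes rh: "env_rep I l rh" and gh: "g:I" "h:I"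
 shows "covar I g h (eseries 0 l ze rh g h) (gmat l ze rh)" unfolding covar_def
proof (intro ballI)
 fix k h' assume m: "k:I" "h':I"
 have dX: "pd*eseries 0 l ze rh g h = eseries 0 l ze rh g h*pd"
  by (simp add: eseries_def sum_distrib_left sum_distrib_right pd_pconst)
 define X E where "X = eseries 0 l ze rh g h" "E = eseries 1 l ze rh"
 define R where "R = (if h = k then E g h' else 0) - sg (g + h) (k + h') (if g = h' then E k h else 0)"
 have br: "X*E k h' - sg (g + h) (k + h') (E k h'*X) = R"
  using eseries_bracket[OF rh gh m, of 0 ze 1] by (simp only: X_E_def R_def add_0_left)
 have "sg (g + h) k (X*(if odd k then - E k h' else E k h')) - sg (g + h) h' ((if odd k then - E k h' else E k h')*X)
  = sg k k (sg (g + h) k (X*E k h' - sg (g + h) (k + h') (E k h'*X)))" by (auto simp: sg_def algebra_simps)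
 hence kod: "sg (g + h) k (X*(if odd k then - E k h' else E k h')) - sg (g + h) h' ((if odd k then - E k h' else E k h')*X)
  = sg k k (sg (g + h) k R)" unfolding br .
 have dk: "sg (g + h) k (X*(if k = h' then pd else 0)) - sg (g + h) h' ((if k = h' then pd else 0)*X) = 0"
  using dX by (simp add: X_E_def)
 have 1: "sg (g + h) k (X*gmat l ze rh k h') - sg (g + h) h' (gmat l ze rh k h'*X) = - sg k k (sg (g + h) k R)"
  unfolding gmat_eseries X_E_def(2)[symmetric] right_diff_distrib left_diff_distrib sg_add
  using kod dk by (simp add: algebra_simps del: if_split)
 show "sg (g + h) k (eseries 0 l ze rh g h*gmat l ze rh k h') - sg (g + h) h' (gmat l ze rh k h'*eseries 0 l ze rh g h) =
  sg (g + h) g ((if k = h then gmat l ze rh g h' else 0) - (if h' = g then gmat l ze rh k h else 0))"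
  unfolding 1[unfolded X_E_def(1)] R_def unfolding gmat_eseries X_E_def(2)[symmetric]
  by (cases "even g"; cases "even h"; cases "even k"; cases "even h'"; cases "h = k"; cases "g = h'")
    (simp_all add: sg_def)
qed

lemma gmat_commute:
 assumes rh: "env_rep (set ord) l rh" and ord: "distinct ord" and gh: "g:set ord" "h:set ord"
 shows "eseries 0 l ze rh g h*ber ord (gmat l ze rh) = ber ord (gmat l ze rh)*eseries 0 l ze rh g h"
proof (rule commute_ber[where X = "eseries 0 l ze rh"])
 fix g h k assume m: "g:set ord" "h:set ord" "k:set ord" "g~=k"
 have "sg (g + h) (h + k) x = sg ((g + h)*(h + k)) ((g + h)*(h + k)) x" for x :: "'a lin psd" by (simp add: sg_def)
 with eseries_bracket[OF rh m(1,2,2,3), of 0 ze 0] m(4)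
 have "eseries 0 l ze rh g k = eseries 0 l ze rh g h*eseries 0 l ze rh h k - sg ((g + h)*(h + k)) ((g + h)*(h + k)) (eseries 0 l ze rh h k*eseries 0 l ze rh g h)"
  by simp
 thus "EX s. eseries 0 l ze rh g k = eseries 0 l ze rh g h*eseries 0 l ze rh h k - sg s s (eseries 0 l ze rh h k*eseries 0 l ze rh g h)" ..
qed (rule lin_tf, rule monic_gmat, simp, rule manin_gmat[OF rh], rule ord, rule covar_gmat[OF rh], assumption+, (rule gh)+)

lemma ber_gmat_commute:
 assumes rh: "env_rep (set ord) l rh" and ord: "distinct ord" and gh: "g:set ord" "h:set ord"
 shows "(\<Sum>a=1..l. rh (a, g, h))*pcoef (ber ord (gmat l ze rh)) i j = pcoef (ber ord (gmat l ze rh)) i j*(\<Sum>a=1..l. rh (a, g, h))"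
proof -
 have "eseries 0 l ze rh g h = pconst (\<Sum>a=1..l. rh (a, g, h))" by (simp add: eseries_def pconst_sum)
 with arg_cong[OF gmat_commute[OF assms, of ze], of "%x. pcoef x i j"]
 show ?thesis by (simp only: pcoef_pmon_mult pcoef_mult_pmon diff_zero)
qed

lemma ber_gmat_oswap:
 assumes "env_rep I l rh" "finite I" "oswap xs ys" "set xs<=I" "distinct xs"
 shows "ber ys (gmat l ze rh) = ber xs (gmat l ze rh)"
 by (rule ber_oswap[OF assms(3) lin_tf monic_gmat[OF assms(2)] manin_gmat[OF assms(1)] assms(4,5)])

lemma coldet_gmat:
 assumes rh: "env_rep I l rh" and I: "finite I" "ev ` int ` {1..N}<=I"
 shows "coldet N (%i j. gmat l ze rh (ev (int i)) (ev (int j))) id = ber (map (%i. ev (int i)) [1..<Suc N]) (gmat l ze rh)"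
proof (rule coldet_ber[OF _ monic_good[OF monic_gmat[OF I(1)]] manin_gmat[OF rh] I(2)])
 show "ALL x::'a lin psd. x + x = 0-->x = 0"
 proof (intro allI impI psd_eqI)
  fix x :: "'a lin psd" and i j assume "x + x = 0"
  hence "pcoef x i j + pcoef x i j = 0" by (metis pcoef_add pcoef_zero)
  thus "pcoef x i j = pcoef 0 i j" using lin_tf[rule_format, of "pcoef x i j"] by simp
 qed
qed

section \<open>Tensor products\<close>

lemma multilinearD:
 "multilinear l S ph==>a:{1..l}==>(!!b. b:{1..l}==>vs b:S b)==>linear_on (S a) (%x. ph (vs(a := x)))"
 unfolding multilinear_def by auto

lemma multilinear_pullback:
 assumes ph: "multilinear l S ph" and f: "!!a. a:{1..l}==>linear_on (S' a) (f a) & f a ` S' a<=S a"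
 shows "multilinear l S' (%vs. ph (%a. f a (vs a)))" unfolding multilinear_def
proof (intro conjI allI ballI impI)
 fix vs ws :: "nat=>'b" assume "ALL a:{1..l}. vs a = ws a"
 thus "ph (%a. f a (vs a)) = ph (%a. f a (ws a))" using ph unfolding multilinear_def by simp
next
 fix a and vs :: "nat=>'b" assume a: "a:{1..l}" and vs: "ALL b:{1..l}. vs b:S' b"
 have fvs: "ALL b:{1..l}. f b (vs b):S b" using f vs by blast
 have L: "linear_on (S a) (%x. ph ((%b. f b (vs b))(a := x)))" by (rule multilinearD[OF ph a]) (use fvs in blast)
 have u: "(%c. f c ((vs(a := x)) c)) = (%b. f b (vs b))(a := f a x)" for x by auto
 have "linear_on (S' a) (f a)" "f a ` S' a<=S a" using f a by auto
 thus "linear_on (S' a) (%x. ph (%c. f c ((vs(a := x)) c)))"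
  using L unfolding u linear_on_def by (simp add: image_subset_iff)
qed

lemma tensor_map_pure:
 assumes "!!a. a:{1..l}==>linear_on (S' a) (f a) & f a ` S' a<=S a"
 shows "tensor_map l S f (pure_tensor l S' vs) = pure_tensor l S (%a. f a (vs a))"
proof
 fix ph
 have "multilinear l S ph==>multilinear l S' (%vs. ph (%a. f a (vs a)))"
  by (rule multilinear_pullback) (use assms in auto)
 thus "tensor_map l S f (pure_tensor l S' vs) ph = pure_tensor l S (%a. f a (vs a)) ph"
  by (auto simp: tensor_map_def pure_tensor_def)
qed

lemma clin_tensor_map: "clin (tensor_map l S f)" by (auto simp: linear_on_def tensor_map_def fun_eq_iff scaleC_fun_def scaleC_complex_def)

lemma pure_tensor_cong: "(!!a. a:{1..l}==>vs a = ws a)==>pure_tensor l S vs = pure_tensor l S ws"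
proof
 fix ph assume "!!a. a:{1..l}==>vs a = ws a"
 hence "multilinear l S ph==>ph vs = ph ws" unfolding multilinear_def by presburger
 thus "pure_tensor l S vs ph = pure_tensor l S ws ph" by (simp add: pure_tensor_def)
qed

lemma linear_pure_tensor:
 assumes "a:{1..l}" "!!b. b:{1..l}==>vs b:S b"
 shows "linear_on (S a) (%x. pure_tensor l S (vs(a := x)))"
proof -
 have L: "linear_on (S a) (%x. ph (vs(a := x)))" if "multilinear l S ph" for ph using multilinearD[OF that assms] .
 show ?thesis unfolding linear_on_def
 proof (intro conjI ballI allI ext)
  fix x y ph assume "x:S a" "y:S a"
  thus "pure_tensor l S (vs(a := x + y)) ph = (pure_tensor l S (vs(a := x)) + pure_tensor l S (vs(a := y))) ph"
   using linear_onD(1)[OF L] by (simp add: pure_tensor_def)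
 next
  fix c x ph assume "x:S a"
  thus "pure_tensor l S (vs(a := c *\<^sub>C x)) ph = (c *\<^sub>C pure_tensor l S (vs(a := x))) ph"
   using linear_onD(2)[OF L] by (simp add: pure_tensor_def scaleC_fun_def scaleC_complex_def)
 qed
qed

text \<open>The entries are expanded slot by slot; in the induction the slots beyond
  \<open>k\<close> already hold generators.\<close>

lemma pure_span:
 assumes S: "!!b. b:{1..l}==>S b = cvec.span (B b)"
  and vs: "!!b. b:{1..l}==>vs b:S b"
 shows "pure_tensor l S vs:cvec.span {pure_tensor l S ws | ws. ALL b:{1..l}. ws b:B b}"
proof -
 define N where "N = cvec.span {pure_tensor l S ws | ws. ALL b:{1..l}. ws b:B b}"
 have N: "cvec.subspace N" unfolding N_def by (rule cvec.subspace_span)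
 have "pure_tensor l S vs:N"
  if "k<=l" "ALL b:{1..l}. vs b:S b" "ALL b:{1..l}. k < b-->vs b:B b" for k vs using that
 proof (induction k arbitrary: vs)
  case 0
  thus ?case unfolding N_def by (intro cvec.span_base) fastforce
 next
  case (Suc k)
  define a where "a = Suc k"
  have a: "a:{1..l}" using Suc.prems by (simp add: a_def)
  define f where "f x = pure_tensor l S (vs(a := x))" for x
  have L: "linear_on (cvec.span (B a)) f" unfolding f_def S[OF a, symmetric] by (rule linear_pure_tensor[OF a]) (use Suc.prems in blast)
  have in_span: "f x:N" if "x:B a" for x unfolding f_def
  proof (rule Suc.IH)
   have "x:S a" using S[OF a] that by (simp add: cvec.span_base)
   thus "ALL b:{1..l}. (vs(a := x)) b:S b" using Suc.prems(2) by simp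
   show "ALL b:{1..l}. k < b-->(vs(a := x)) b:B b" using Suc.prems(3) that by (auto simp: a_def)
  qed (use Suc.prems in simp)
  have "x:cvec.span (B a) & f x:N" if "x:cvec.span (B a)" for x using that
  proof (induction rule: cvec.span_induct_alt)
   case base
   thus ?case using linear_on_zero[OF L] cvec.subspace_0[OF N] cvec.span_zero by metis
  next
   case (step c x y)
   hence x: "x:cvec.span (B a)" by (simp add: cvec.span_base)
   hence c: "c *\<^sub>C x:cvec.span (B a)" by (rule cvec.span_scale)
   have "f (c *\<^sub>C x + y) = c *\<^sub>C f x + f y" using linear_onD(1)[OF L c] linear_onD(2)[OF L x] step(2) by metis
   moreover have "c *\<^sub>C f x + f y:N"
    by (rule cvec.subspace_add[OF N cvec.subspace_scale[OF N in_span[OF step(1)]]]) (use step(2) in blast)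
   ultimately show ?case using cvec.span_add[OF c] step(2) by metis
  qed
  moreover have "vs a:cvec.span (B a)" using Suc.prems(2) S[OF a] a by blast
  ultimately have "f (vs a):N" by blast
  thus ?case by (simp add: f_def)
 qed
 from this[of l vs] vs show ?thesis unfolding N_def[symmetric] by auto
qed

lemma space_of_span: "cvec.subspace (gr M False)==>cvec.subspace (gr M True)==>space_of M = cvec.span (gr M False Un gr M True)"
 unfolding space_of_def cvec.span_Un by (simp add: cvec.span_eq_iff[THEN iffD2])

lemma supermoduleD:
 assumes "supermodule I M"
 shows "cvec.subspace (gr M a)" "cvec.subspace (space_of M)" "gr M a<=space_of M"
  "i:I==>j:I==>linear_on (space_of M) (act M i j)"
  "i:I==>j:I==>v:gr M a==>act M i j v:gr M (a~=odd (i + j))"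
  "i:I==>j:I==>k:I==>h:I==>v:space_of M ==>
   act M i j (act M k h v) - sg (i + j) (k + h) (act M k h (act M i j v)) =
    (if j = k then act M i h v else 0) - sg (i + j) (k + h) (if i = h then act M k j v else 0)"
  "EX a. wt_space I M ny<=gr M a" "gr M False Int gr M True = {0}"
  "space_of M = cvec.span (gr M False Un gr M True)"
proof -
 note s = assms[unfolded supermodule_def koszul_sg]
 note s1 = conjunct1[OF s] and s2 = conjunct2[OF s]
 note s3 = conjunct1[OF conjunct2[OF s2]] and s4 = conjunct1[OF conjunct2[OF conjunct2[OF s2]]]
 show 1: "cvec.subspace (gr M a)" for a using s1 by (rule spec)
 show e: "space_of M = cvec.span (gr M False Un gr M True)" by (rule space_of_span[OF 1 1])
 show "cvec.subspace (space_of M)" unfolding e by (rule cvec.subspace_span)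
 show "gr M a<=space_of M" unfolding e by (cases a) (auto intro: cvec.span_base)
 show "i:I==>j:I==>linear_on (space_of M) (act M i j)" using s3 by (simp only: Ball_def)
 show "i:I==>j:I==>v:gr M a==>act M i j v:gr M (a~=odd (i + j))"
  using s3 by (meson image_subset_iff)
 show "i:I==>j:I==>k:I==>h:I==>v:space_of M ==>
   act M i j (act M k h v) - sg (i + j) (k + h) (act M k h (act M i j v)) =
    (if j = k then act M i h v else 0) - sg (i + j) (k + h) (if i = h then act M k j v else 0)" using s4 by (simp only: Ball_def)
 show "EX a. wt_space I M ny<=gr M a" using conjunct2[OF conjunct2[OF conjunct2[OF s2]]] by (rule spec)
 show "gr M False Int gr M True = {0}" using conjunct1[OF s2] .
qed

lemma supermodule_closed: "supermodule I M==>i:I==>j:I==>v:space_of M==>act M i j v:space_of M"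
proof -
 assume s: "supermodule I M" "i:I" "j:I" "v:space_of M"
 then obtain x y where v: "v = x + y" "x:gr M False" "y:gr M True" unfolding space_of_def by blast
 have c: "act M i j x:space_of M" "act M i j y:space_of M" "x:space_of M" "y:space_of M"
  using supermoduleD(5)[OF s(1-3)] v supermoduleD(3)[OF s(1)] by blast+
 thus ?thesis unfolding v(1) using linear_onD(1)[OF supermoduleD(4)[OF s(1-3)]] cvec.subspace_add[OF supermoduleD(2)[OF s(1)]] by metis
qed

lemma parity_op_eq:
 assumes M: "supermodule I M" and x: "x:gr M False" and y: "y:gr M True"
 shows "parity_op M (x + y) = x - y" unfolding parity_op_def
proof (rule the_equality)
 fix w assume "EX x':gr M False. EX y':gr M True. x + y = x' + y' & w = x' - y'"
 then obtain x' y' where h: "x':gr M False" "y':gr M True" "x + y = x' + y'" "w = x' - y'" by blast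
 have e: "x - x' = y' - y" using h(3) by (simp add: algebra_simps)
 have "x - x':gr M False" using x h supermoduleD(1)[OF M] cvec.subspace_diff by blast
 moreover have "x - x':gr M True" unfolding e using y h supermoduleD(1)[OF M] cvec.subspace_diff by blast
 ultimately have "x - x' = 0" using supermoduleD(8)[OF M] by blast
 thus "w = x - y" using h e by simp
qed (use x y in blast)

lemma parity_op:
 assumes M: "supermodule I M"
 shows "linear_on (space_of M) (parity_op M)" "parity_op M ` space_of M<=space_of M"
  "v:gr M a==>parity_op M v = (if a then -1 else 1) *\<^sub>C v"
proof -
 note sub = supermoduleD(1)[OF M]
 have 0: "0:gr M a" for a using sub cvec.subspace_0 by blast
 show "v:gr M a==>parity_op M v = (if a then -1 else 1) *\<^sub>C v"
  using parity_op_eq[OF M, of v 0] parity_op_eq[OF M, of 0 v] 0 by (cases a) (simp_all add: scaleC_one)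
 show "parity_op M ` space_of M<=space_of M"
 proof safe
  fix v assume "v:space_of M"
  then obtain x y where v: "v = x + y" "x:gr M False" "y:gr M True" unfolding space_of_def by blast
  hence "parity_op M v = x + (- y)" "- y:gr M True" using parity_op_eq[OF M] cvec.subspace_neg[OF sub] by auto
  thus "parity_op M v:space_of M" unfolding space_of_def using v(2) by blast
 qed
 show "linear_on (space_of M) (parity_op M)" unfolding linear_on_def
 proof (intro conjI ballI allI)
  fix v w c assume "v:space_of M"
  then obtain x y where v: "v = x + y" "x:gr M False" "y:gr M True" unfolding space_of_def by blast
  have "c *\<^sub>C v = c *\<^sub>C x + c *\<^sub>C y" "c *\<^sub>C x:gr M False" "c *\<^sub>C y:gr M True"
   using v cvec.subspace_scale[OF sub] by (auto simp: scaleC_add_right)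
  with v show "parity_op M (c *\<^sub>C v) = c *\<^sub>C parity_op M v"
   using parity_op_eq[OF M] by (simp add: cvec.scale_right_diff_distrib)
  assume "w:space_of M"
  then obtain x' y' where w: "w = x' + y'" "x':gr M False" "y':gr M True" unfolding space_of_def by blast
  have e: "v + w = (x + x') + (y + y')" using v w by simp
  have c: "x + x':gr M False" "y + y':gr M True" using v w cvec.subspace_add[OF sub] by auto
  show "parity_op M (v + w) = parity_op M v + parity_op M w"
   unfolding e parity_op_eq[OF M c] using parity_op_eq[OF M v(2,3)] parity_op_eq[OF M w(2,3)] v(1) w(1) by simp
 qed
qed

locale tensor_family =
 fixes I :: "int set" and l :: nat and M :: "nat=>'v::complex_vector smod"
 assumes M: "!!a. a:{1..l}==>supermodule I (M a)"
begin

abbreviation "S == %b. space_of (M b)"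
abbreviation "W == space_of (tensor_mod l M)"
abbreviation "pt == pure_tensor l S"

definition homog :: "(nat=>'v)=>(nat=>bool)=>bool" where
 "homog vs s \<longleftrightarrow> (ALL b:{1..l}. vs b:gr (M b) (s b))"

lemma homog_space: "homog vs s==>b:{1..l}==>vs b:S b"
 unfolding homog_def using supermoduleD(3)[OF M] by blast

lemma W_homog: "W = cvec.span {pt vs | vs s. homog vs s}"
proof -
 let ?P = "%c. {pt vs | vs s. (ALL b:{1..l}. vs b:gr (M b) (s b)) & odd (card {b:{1..l}. s b}) = c}"
 have "W = cvec.span (cvec.span (?P False) Un cvec.span (?P True))"
  by (subst space_of_span) (simp_all add: tensor_mod_def cvec.subspace_span)
 also have "... = cvec.span (?P False Un ?P True)"
  by (intro antisym cvec.span_minimal cvec.subspace_span Un_least cvec.span_mono) (auto intro: cvec.span_base)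
 also have "?P False Un ?P True = {pt vs | vs s. homog vs s}" unfolding homog_def by blast
 finally show ?thesis .
qed

lemma W_subspace: "cvec.subspace W" unfolding W_homog by (rule cvec.subspace_span)

lemma W_span:
 assumes B: "!!b. b:{1..l}==>S b = cvec.span (B b)"
 shows "W = cvec.span {pt vs | vs. ALL b:{1..l}. vs b:B b}"
proof
 show "W<=cvec.span {pt vs | vs. ALL b:{1..l}. vs b:B b}" unfolding W_homog
 proof (intro cvec.span_minimal cvec.subspace_span subsetI)
  fix x assume "x:{pt vs | vs s. homog vs s}"
  then obtain vs s where "x = pt vs" "homog vs s" by auto
  thus "x:cvec.span {pt vs | vs. ALL b:{1..l}. vs b:B b}" using pure_span[of l S B vs, OF B] homog_space by blast
 qed
next
 have P: "pt vs:W" if "!!b. b:{1..l}==>vs b:S b" for vs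
 proof -
  have "pt vs:cvec.span {pt vs | vs. ALL b:{1..l}. vs b:gr (M b) False Un gr (M b) True}"
   by (rule pure_span) (use that supermoduleD(9)[OF M] in auto)
  also have "... <= W" unfolding W_homog
  proof (intro cvec.span_mono subsetI)
   fix x assume "x:{pt vs | vs. ALL b:{1..l}. vs b:gr (M b) False Un gr (M b) True}"
   then obtain vs where vs: "x = pt vs" "ALL b:{1..l}. vs b:gr (M b) False Un gr (M b) True" by auto
   hence "homog vs (%b. vs b:gr (M b) True)" unfolding homog_def by (metis Un_iff)
   thus "x:{pt vs | vs s. homog vs s}" using vs by auto
  qed
  finally show ?thesis .
 qed
 show "cvec.span {pt vs | vs. ALL b:{1..l}. vs b:B b}<=W"
 proof (intro cvec.span_minimal W_subspace subsetI)
  fix x assume "x:{pt vs | vs. ALL b:{1..l}. vs b:B b}"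
  then obtain vs where x: "x = pt vs" and vs: "ALL b:{1..l}. vs b:B b" by blast
  show "x:W" unfolding x by (rule P) (use vs B cvec.span_base in blast)
 qed
qed

lemma pt_in_W: "(!!b. b:{1..l}==>vs b:S b)==>pt vs:W"
proof -
 assume a: "!!b. b:{1..l}==>vs b:S b"
 have "S b = cvec.span (S b)" if "b:{1..l}" for b using supermoduleD(2)[OF M[OF that]] by (metis cvec.span_eq_iff)
 hence e: "W = cvec.span {pt vs | vs. ALL b:{1..l}. vs b:S b}" by (rule W_span)
 show ?thesis unfolding e by (rule cvec.span_base) (use a in blast)
qed

lemma clin_slot: "clin (slot_act l M a i j)" unfolding slot_act_def by (rule clin_tensor_map)

lemma slot_pt:
 assumes "i:I" "j:I"
 shows "slot_act l M a i j (pt vs) =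
  pt (%b. (if b < a & odd (i + j) then parity_op (M b) else if b = a then act (M b) i j else id) (vs b))"
 unfolding slot_act_def
proof (rule tensor_map_pure)
 fix b assume b: "b:{1..l}"
 let ?f = "if b < a & odd (i + j) then parity_op (M b) else if b = a then act (M b) i j else id"
 consider "?f = parity_op (M b)" | "?f = act (M b) i j" | "?f = id" by metis
 thus "linear_on (S b) ?f & ?f ` S b<=S b"
 proof cases
  case 1
  show ?thesis unfolding 1 using parity_op[OF M[OF b]] by blast
 next
  case 2
  show ?thesis unfolding 2 using supermoduleD(4)[OF M[OF b] assms] supermodule_closed[OF M[OF b] assms] by blast
 next
  case 3
  show ?thesis unfolding 3 by (simp add: linear_on_def)
 qed
qed

definition nodd :: "(nat=>bool)=>nat=>nat" where
 "nodd s a = card {b:{1..l}. b < a & s b}"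

lemma odd_nodd_upd:
 assumes "a:{1..l}"
 shows "odd (nodd (s(a := (s a~=e))) b) \<longleftrightarrow> (odd (nodd s b)~=(e & a < b))"
proof -
 define A where "A = {c:{1..l}. c < b & s c & c~=a}"
 have fin: "finite A" "a~:A" by (auto simp: A_def)
 have 1: "nodd s' b = card A + (if a < b & s' a then 1 else 0)" if "!!c. c~=a==>s' c = s c" for s'
 proof -
  have "{c:{1..l}. c < b & s' c} = (if a < b & s' a then insert a A else A)"
   using assms that unfolding A_def by (auto; metis)
  thus ?thesis unfolding nodd_def using fin by simp
 qed
 show ?thesis using 1[of s] 1[of "s(a := (s a~=e))"] by auto
qed

definition sgn :: "bool=>nat=>complex" where "sgn e n = koszul e (odd n)"

text \<open>The parity operators in the slots before \<open>a\<close> give one sign for each odd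
  entry there. They are put in one slot at a time, with \<open>nodd s k\<close> counting the odd
  entries before slot \<open>k\<close>.\<close>

lemma slot_homog:
 assumes ij: "i:I" "j:I" and vs: "homog vs s" and a: "a:{1..l}"
 shows "slot_act l M a i j (pt vs) = sgn (odd (i + j)) (nodd s a) *\<^sub>C pt (vs(a := act (M a) i j (vs a)))"
  "homog (vs(a := act (M a) i j (vs a))) (s(a := (s a~=odd (i + j))))"
proof -
 show "homog (vs(a := act (M a) i j (vs a))) (s(a := (s a~=odd (i + j))))"
  using vs a supermoduleD(5)[OF M[OF a] ij] unfolding homog_def by auto
 define us where "us = vs(a := act (M a) i j (vs a))"
 have us: "b:{1..l}==>us b:S b" for b
  using homog_space[OF vs] a supermodule_closed[OF M[OF a] ij] by (simp add: us_def)
 have "pt (%b. if b < k & odd (i + j) then parity_op (M b) (us b) else us b) =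
  sgn (odd (i + j)) (nodd s k) *\<^sub>C pt us" if "k<=a" for k using that
 proof (induction k)
  case 0
  show ?case by (simp add: nodd_def sgn_def koszul_def scaleC_one)
 next
  case (Suc k)
  define ws where "ws = (%b. if b < k & odd (i + j) then parity_op (M b) (us b) else us b)"
  have ws: "b:{1..l}==>ws b:S b" for b using us parity_op(2)[OF M] by (auto simp: ws_def)
  show ?case
  proof (cases "odd (i + j) & k:{1..l}")
   case True
   hence k: "k:{1..l}" and o: "odd (i + j)" by auto
   have lp: "linear_on (S k) (%x. pt (ws(k := x)))" by (rule linear_pure_tensor[OF k ws])
   have "us k:gr (M k) (s k)" using vs k Suc.prems unfolding homog_def us_def by auto
   from parity_op(3)[OF M[OF k] this] have p: "parity_op (M k) (us k) = (if s k then -1 else 1) *\<^sub>C us k" .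
   have "pt (%b. if b < Suc k & odd (i + j) then parity_op (M b) (us b) else us b) = pt (ws(k := (if s k then -1 else 1) *\<^sub>C us k))"
    by (rule pure_tensor_cong) (use o p in \<open>simp add: ws_def less_Suc_eq\<close>)
   also have "... = (if s k then -1 else 1) *\<^sub>C pt (ws(k := us k))" by (rule linear_onD(2)[OF lp us[OF k]])
   also have "ws(k := us k) = ws" by (auto simp: ws_def)
   finally have 1: "pt (%b. if b < Suc k & odd (i + j) then parity_op (M b) (us b) else us b) = (if s k then -1 else 1) *\<^sub>C pt ws" .
   have "{b:{1..l}. b < Suc k & s b} = (if s k then insert k {b:{1..l}. b < k & s b} else {b:{1..l}. b < k & s b})"
    using k by (auto simp: less_Suc_eq)
   hence "nodd s (Suc k) = (if s k then Suc (nodd s k) else nodd s k)" unfolding nodd_def by simp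
   thus ?thesis unfolding 1 using Suc.IH Suc.prems o by (auto simp: ws_def sgn_def koszul_def scaleC_scaleC scaleC_one)
  next
   case False
   have "nodd s (Suc k) = nodd s k" if "k~:{1..l}"
   proof -
    have "{b:{1..l}. b < Suc k & s b} = {b:{1..l}. b < k & s b}" using that by (auto simp: less_Suc_eq)
    thus ?thesis by (simp add: nodd_def)
   qed
   hence 2: "sgn (odd (i + j)) (nodd s (Suc k)) = sgn (odd (i + j)) (nodd s k)" using False by (auto simp: sgn_def koszul_def)
   have "pt (%b. if b < Suc k & odd (i + j) then parity_op (M b) (us b) else us b) = pt ws"
    by (rule pure_tensor_cong) (use False in \<open>auto simp: ws_def less_Suc_eq\<close>)
   thus ?thesis unfolding 2 using Suc.IH Suc.prems by (simp add: ws_def)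
  qed
 qed
 from this[of a] have "pt (%b. if b < a & odd (i + j) then parity_op (M b) (us b) else us b) = sgn (odd (i + j)) (nodd s a) *\<^sub>C pt us" by simp
 moreover have "slot_act l M a i j (pt vs) = pt (%b. if b < a & odd (i + j) then parity_op (M b) (us b) else us b)"
  unfolding slot_pt[OF ij] by (rule pure_tensor_cong) (auto simp: us_def)
 ultimately show "slot_act l M a i j (pt vs) = sgn (odd (i + j)) (nodd s a) *\<^sub>C pt us" by simp
qed

lemma slot_W:
 assumes "i:I" "j:I" "a:{1..l}" "T:W"
 shows "slot_act l M a i j T:W"
proof -
 have "x:{T. slot_act l M a i j T:W}" if "x:{pt vs | vs s. homog vs s}" for x
 proof -
  obtain vs s where x: "x = pt vs" "homog vs s" using \<open>x \<in> _\<close> by auto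
  have "pt (vs(a := act (M a) i j (vs a))):W" by (rule pt_in_W[OF homog_space[OF slot_homog(2)[OF assms(1,2) x(2) assms(3)]]])
  thus ?thesis unfolding mem_Collect_eq x(1) slot_homog(1)[OF assms(1,2) x(2) assms(3)] by (rule cvec.subspace_scale[OF W_subspace])
 qed
 moreover have "cvec.subspace {T. slot_act l M a i j T:W}"
 proof (rule cvec.subspaceI)
  show "0:{T. slot_act l M a i j T:W}"
   using cvec.subspace_0[OF W_subspace] by (simp only: mem_Collect_eq linear_on_zero[OF clin_slot UNIV_I])
  fix x y c assume x: "x:{T. slot_act l M a i j T:W}"
  show "c *\<^sub>C x:{T. slot_act l M a i j T:W}"
   using x cvec.subspace_scale[OF W_subspace] by (simp only: mem_Collect_eq linear_onD(2)[OF clin_slot UNIV_I])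
  assume "y:{T. slot_act l M a i j T:W}"
  thus "x + y:{T. slot_act l M a i j T:W}"
   using x cvec.subspace_add[OF W_subspace] by (simp only: mem_Collect_eq linear_onD(1)[OF clin_slot UNIV_I UNIV_I])
 qed
 ultimately have "cvec.span {pt vs | vs s. homog vs s}<={T. slot_act l M a i j T:W}" by (intro cvec.span_minimal subsetI)
 thus ?thesis using assms(4) unfolding W_homog by auto
qed

end

context tensor_family
begin

text \<open>By linearity homogeneous pure tensors suffice. In different slots, the operator in the
  earlier slot changes the number of odd entries that the other one sees, and this produces the sign
  \<open>koszul e f\<close>. In the same slot the signs agree and the relation of the module
  \<open>M a\<close> remains.\<close>

lemma slot_relations:
 assumes m: "a:{1..l}" "b:{1..l}" "i:I" "j:I" "k:I" "h:I" and T: "T:W"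
 shows "slot_act l M a i j (slot_act l M b k h T) - sg (i + j) (k + h) (slot_act l M b k h (slot_act l M a i j T)) =
  (if a = b then (if j = k then slot_act l M a i h T else 0) - sg (i + j) (k + h) (if i = h then slot_act l M a k j T else 0) else 0)"
  (is "?L T = ?R T")
proof (rule span_eq_on[where B = "{pt vs | vs s. homog vs s}" and f = ?L and g = ?R and x = T])
 have c: "clin (slot_act l M a i j)" for a i j by (rule clin_slot)
 note cl = linear_onD[OF c UNIV_I] linear_onD(1)[OF c UNIV_I UNIV_I] linear_on_zero[OF c UNIV_I]
 have sgc: "sg x y (c *\<^sub>C T) = c *\<^sub>C sg x y T" for x y c and T :: "'v tensor" by (simp add: sg_def)
 have "clin ?L" unfolding linear_on_def by (simp only: cl sg_add sgc cvec.scale_right_diff_distrib add_diff_add) simp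
 thus "linear_on (cvec.span {pt vs | vs s. homog vs s}) ?L" by (rule linear_on_subset) simp
 have ifc: "clin (%T. if b then X T else Y T)" if "clin X" "clin Y" for b and X Y :: "'v tensor=>'v tensor"
  using that by (cases b) simp_all
 have cz: "clin (%T. 0::'v tensor)" by (simp only: linear_on_def cvec.scale_zero_right add_0_left) blast
 have cd: "clin (%T. X T - sg x y (Y T))" if "clin X" "clin Y" for x y and X Y :: "'v tensor=>'v tensor"
  by (simp only: linear_on_def linear_onD(1)[OF that(1) UNIV_I UNIV_I] linear_onD(2)[OF that(1) UNIV_I]
   linear_onD(1)[OF that(2) UNIV_I UNIV_I] linear_onD(2)[OF that(2) UNIV_I] sg_add sgc cvec.scale_right_diff_distrib add_diff_add) blast
 have "clin ?R" by (intro ifc cd cz c)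
 thus "linear_on (cvec.span {pt vs | vs s. homog vs s}) ?R" by (rule linear_on_subset) simp
 show "T:cvec.span {pt vs | vs s. homog vs s}" using T unfolding W_homog .
 fix T assume "T:{pt vs | vs s. homog vs s}"
 then obtain vs s where T: "T = pt vs" and vs: "homog vs s" by blast
 define e f where "e = odd (i + j)" "f = odd (k + h)"
 have A: "slot_act l M a i j (slot_act l M b k h (pt vs)) =
   (sgn f (nodd s b)*sgn e (nodd (s(b := (s b~=f))) a)) *\<^sub>C
    pt (vs(b := act (M b) k h (vs b), a := act (M a) i j ((vs(b := act (M b) k h (vs b))) a)))"
  using slot_homog[OF m(5,6) vs m(2)] slot_homog(1)[OF m(3,4) slot_homog(2)[OF m(5,6) vs m(2)] m(1)]
  by (simp only: e_f_def linear_onD(2)[OF c UNIV_I] scaleC_scaleC)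
 have B: "slot_act l M b k h (slot_act l M a i j (pt vs)) =
   (sgn e (nodd s a)*sgn f (nodd (s(a := (s a~=e))) b)) *\<^sub>C
    pt (vs(a := act (M a) i j (vs a), b := act (M b) k h ((vs(a := act (M a) i j (vs a))) b)))"
  using slot_homog[OF m(3,4) vs m(1)] slot_homog(1)[OF m(5,6) slot_homog(2)[OF m(3,4) vs m(1)] m(2)]
  by (simp only: e_f_def linear_onD(2)[OF c UNIV_I] scaleC_scaleC)
 show "?L T = ?R T"
 proof (cases "a = b")
  case False
  have sg: "sgn f (nodd s b)*sgn e (nodd (s(b := (s b~=f))) a) =
    koszul e f*(sgn e (nodd s a)*sgn f (nodd (s(a := (s a~=e))) b))"
   using False odd_nodd_upd[OF m(1), of s e b] odd_nodd_upd[OF m(2), of s f a] by (auto simp: sgn_def koszul_def)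
  have "?L T = (koszul e f*(sgn e (nodd s a)*sgn f (nodd (s(a := (s a~=e))) b))) *\<^sub>C pt (vs(b := act (M b) k h (vs b), a := act (M a) i j (vs a)))
   - koszul e f *\<^sub>C (sgn e (nodd s a)*sgn f (nodd (s(a := (s a~=e))) b)) *\<^sub>C pt (vs(a := act (M a) i j (vs a), b := act (M b) k h (vs b)))"
   unfolding T A B sg koszul_sg[symmetric] e_f_def[symmetric] by (simp only: fun_upd_apply if_False False False[symmetric])
  also have "... = 0" using False by (simp add: scaleC_scaleC fun_upd_twist)
  finally show ?thesis by (simp only: False if_False)
 next
  case True
  define si where "si = sgn e (nodd s a)*sgn f (nodd s a)"
  have nn: "odd (nodd (s(a := (s a~=e))) a) = odd (nodd s a)" for e using odd_nodd_upd[OF m(1), of s e a] by simp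
  have s1: "sgn f (nodd s a)*sgn e (nodd (s(a := (s a~=f))) a) = si" "sgn e (nodd s a)*sgn f (nodd (s(a := (s a~=e))) a) = si"
   by (simp_all only: si_def sgn_def nn mult.commute)
  have s2: "j = k==>sgn (odd (i + h)) (nodd s a) = si" "i = h==>sgn (odd (k + j)) (nodd s a) = si"
   by (auto simp: si_def sgn_def koszul_def e_f_def)
  define F where "F x = pt (vs(a := x))" for x
  have F: "linear_on (S a) F" unfolding F_def by (rule linear_pure_tensor[OF m(1)]) (use homog_space[OF vs] in blast)
  have va: "vs a:S a" using homog_space[OF vs m(1)] .
  note cl = supermodule_closed[OF M[OF m(1)]]
  note rel = supermoduleD(6)[OF M[OF m(1)] m(3-6) va]
  note sub = supermoduleD(2)[OF M[OF m(1)]]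
  have zero: "0:S a" using cvec.subspace_0[OF sub] .
  have Fsg: "F (sg x y v) = sg x y (F v)" if "v:S a" for x y v using linear_onD(2)[OF F that, of "- 1"] by (auto simp: sg_def)
  have sgS: "sg x y v:S a" if "v:S a" for x y v using that cvec.subspace_neg[OF sub] by (auto simp: sg_def)
  have F0: "F 0 = 0" using linear_on_zero[OF F zero] .
  have Fdiff: "F (x - y) = F x - F y" if "x:S a" "y:S a" for x y by (rule linear_on_diff[OF F sub that])
  have c1: "(if j = k then act (M a) i h (vs a) else 0):S a" "(if i = h then act (M a) k j (vs a) else 0):S a"
   using cl m va zero by auto
  have c2: "act (M a) i j (act (M a) k h (vs a)):S a" "act (M a) k h (act (M a) i j (vs a)):S a" using cl m va by auto
  have A': "slot_act l M a i j (slot_act l M a k h (pt vs)) = si *\<^sub>C F (act (M a) i j (act (M a) k h (vs a)))"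
   using A True s1 by (simp add: F_def)
  have B': "slot_act l M a k h (slot_act l M a i j (pt vs)) = si *\<^sub>C F (act (M a) k h (act (M a) i j (vs a)))"
   using B True s1 by (simp add: F_def)
  have "?L T = si *\<^sub>C (F (act (M a) i j (act (M a) k h (vs a)) - sg (i + j) (k + h) (act (M a) k h (act (M a) i j (vs a)))))"
   unfolding T True[symmetric] A' B' Fdiff[OF c2(1) sgS[OF c2(2)]] Fsg[OF c2(2)] sgc cvec.scale_right_diff_distrib ..
  also have "... = si *\<^sub>C (F (if j = k then act (M a) i h (vs a) else 0) - sg (i + j) (k + h) (F (if i = h then act (M a) k j (vs a) else 0)))"
   unfolding rel Fdiff[OF c1(1) sgS[OF c1(2)]] Fsg[OF c1(2)] ..
  also have "... = (if j = k then si *\<^sub>C F (act (M a) i h (vs a)) else 0) - sg (i + j) (k + h) (if i = h then si *\<^sub>C F (act (M a) k j (vs a)) else 0)"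
   by (simp only: F0 cvec.scale_right_diff_distrib sgc[symmetric] if_distrib[of F] if_distrib[of "scaleC si"] cvec.scale_zero_right)
  also have "(if j = k then si *\<^sub>C F (act (M a) i h (vs a)) else 0) = (if j = k then slot_act l M a i h T else 0)"
   unfolding T slot_homog(1)[OF m(3,6) vs m(1)] F_def using s2(1) by simp
  also have "(if i = h then si *\<^sub>C F (act (M a) k j (vs a)) else 0) = (if i = h then slot_act l M a k j T else 0)"
   unfolding T slot_homog(1)[OF m(5,4) vs m(1)] F_def using s2(2) by simp
  finally show ?thesis using True by simp
 qed
qed

text \<open>The relations of \<open>slot_act\<close> are available on \<open>W\<close>. Composition
  with a linear projection onto \<open>W\<close> yields operators that satisfy them on the whole
  ambient space, as a representation in the ring \<open>lin\<close> requires.\<close>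

definition projW :: "'v tensor=>'v tensor" where
 "projW = (SOME P. clin P & (ALL x. P x:W) & (ALL x:W. P x = x))"

lemma projW: "clin projW" "projW x:W" "x:W==>projW x = x"
proof -
 have "EX P. clin P & (ALL x. P x:W) & (ALL x:W. P x = x)"
  using projection_exists[OF W_subspace] by metis
 from someI_ex[OF this, folded projW_def]
 show "clin projW" "projW x:W" "x:W==>projW x = x" by auto
qed

definition trep :: "gen=>((nat=>'v)=>complex) lin" where
 "trep g = (if g:egens I l then Lin (%T. (case g of (a, i, j)=>slot_act l M a i j) (projW T)) else 0)"

lemma lapp_trep: "(a, i, j):egens I l==>lapp (trep (a, i, j)) T = slot_act l M a i j (projW T)" unfolding trep_def
 by (simp only: if_True case_prod_conv, rule lapp_Lin)
   (simp only: linear_on_def linear_onD(1)[OF projW(1) UNIV_I UNIV_I] linear_onD(2)[OF projW(1) UNIV_I]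
    linear_onD(1)[OF clin_slot UNIV_I UNIV_I] linear_onD(2)[OF clin_slot UNIV_I], blast)

lemma lapp_trep_W: "(a, i, j):egens I l==>T:W==>lapp (trep (a, i, j)) T = slot_act l M a i j T"
 by (simp only: lapp_trep projW(3))

lemma trep_closed: "g:egens I l==>lapp (trep g) T:W" by (cases g) (auto simp: lapp_trep intro!: slot_W projW)

lemma env_rep_trep: "env_rep I l trep" unfolding env_rep_def
proof (intro conjI allI ballI impI)
 show "g~:egens I l==>trep g = 0" for g unfolding trep_def by (simp only: if_False)
 fix a b i j k h assume m: "a:{1..l}" "b:{1..l}" "i:I" "j:I" "k:I" "h:I"
 have sgl: "lapp (sg x y S) T = sg x y (lapp S T)" for x y S T by (simp add: sg_def)
 have ifl: "lapp (if c then S else 0) T = (if c then lapp S T else 0)" for c S T by simp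
 have mm: "(a, i, j):egens I l" "(b, k, h):egens I l" "(a, i, h):egens I l" "(a, k, j):egens I l" using m by auto
 show "trep (a, i, j)*trep (b, k, h) - sg (i + j) (k + h) (trep (b, k, h)*trep (a, i, j)) =
  (if a = b then (if j = k then trep (a, i, h) else 0) - sg (i + j) (k + h) (if i = h then trep (a, k, j) else 0) else 0)"
 proof (rule lin_eqI)
  fix T
  have cl: "slot_act l M b k h (projW T):W" "slot_act l M a i j (projW T):W" using slot_W m projW by auto
  show "lapp (trep (a, i, j)*trep (b, k, h) - sg (i + j) (k + h) (trep (b, k, h)*trep (a, i, j))) T =
   lapp (if a = b then (if j = k then trep (a, i, h) else 0) - sg (i + j) (k + h) (if i = h then trep (a, k, j) else 0) else 0) T"
   using slot_relations[OF m projW(2)[of T]]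
   by (simp only: lapp_ops sgl ifl lapp_trep[OF mm(1)] lapp_trep[OF mm(2)] lapp_trep[OF mm(3)] lapp_trep[OF mm(4)] projW(3)[OF cl(1)] projW(3)[OF cl(2)])
 qed
qed

lemma leval_trep_W: "v:W==>lapp (leval trep x) v:W"
proof (induction x rule: falg_induct)
 case (single w c)
 have "foldr (%g. lapp (trep g)) w v:W"
 proof (induction w)
  case (Cons g w)
  show ?case
  proof (cases "g:egens I l")
   case True
   thus ?thesis using trep_closed by simp
  next
   case False
   hence "trep g = 0" by (simp only: trep_def if_False)
   thus ?thesis using cvec.subspace_0[OF W_subspace] by (simp only: foldr.simps o_apply lapp_ops)
  qed
 qed (use single in simp)
 thus ?case by (simp add: leval_single lapp_prod_list cvec.subspace_scale[OF W_subspace])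
next
 case (add x y)
 thus ?case using cvec.subspace_add[OF W_subspace] by (simp only: leval_add lapp_ops)
qed

lemma tensor_act_henv: "v:W==>tensor_act l M (henv I l x) v = lapp (leval trep x) v" unfolding tensor_act_def
 by (rule env_act_leval[OF env_rep_trep, of W]) (auto simp: lapp_trep_W slot_W)

lemma act_trep: "v:W==>i:I==>j:I==>act (tensor_mod l M) i j v = lapp (\<Sum>a=1..l. trep (a, i, j)) v"
proof -
 assume m: "v:W" "i:I" "j:I"
 have "act (tensor_mod l M) i j v = (\<Sum>a=1..l. slot_act l M a i j v)" by (simp add: tensor_mod_def)
 also have "... = (\<Sum>a=1..l. lapp (trep (a, i, j)) v)" by (rule sum.cong[OF refl], subst lapp_trep_W) (use m in auto)
 finally show ?thesis unfolding lapp_sum .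
qed

end

section \<open>Intertwiners\<close>

lemma clin_comp: "clin f==>clin g==>linear_on S (%T. f (g T))" by (simp add: linear_on_def)

locale tensor_embedding = small: tensor_family K l M + big: tensor_family I l N
 for K I :: "int set" and l :: nat and M :: "nat=>'v::complex_vector smod" and N :: "nat=>'w::complex_vector smod" +
 fixes f :: "nat=>'v=>'w"
 assumes KI: "K<=I"
  and f_lin: "!!a. a:{1..l}==>linear_on (space_of (M a)) (f a)"
  and f_inj: "!!a. a:{1..l}==>inj_on (f a) (space_of (M a))"
  and f_gr: "!!a e. a:{1..l}==>f a ` gr (M a) e<=gr (N a) e"
  and f_act: "!!a i j v. a:{1..l}==>i:K==>j:K==>v:space_of (M a)==>f a (act (M a) i j v) = act (N a) i j (f a v)"
begin

abbreviation (input) "small_gens == {small.pt vs | vs s. small.homog vs s}"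

definition F :: "'v tensor=>'w tensor" where "F = tensor_map l (%a. space_of (N a)) f"

lemma clin_F: "clin F" unfolding F_def by (rule clin_tensor_map)

lemma f_space: "a:{1..l}==>v:space_of (M a)==>f a v:space_of (N a)"
proof -
 assume a: "a:{1..l}" and "v:space_of (M a)"
 then obtain x y where v: "v = x + y" "x:gr (M a) False" "y:gr (M a) True" unfolding space_of_def by blast
 have "f a v = f a x + f a y" unfolding v(1) using linear_onD(1)[OF f_lin[OF a]] v supermoduleD(3)[OF small.M[OF a]] by blast
 thus ?thesis using f_gr[OF a] v unfolding space_of_def by blast
qed

lemma F_pt: "F (small.pt vs) = big.pt (%a. f a (vs a))" unfolding F_def by (rule tensor_map_pure) (use f_lin f_space in auto)

lemma F_homog: "small.homog vs s==>big.homog (%a. f a (vs a)) s"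
 unfolding small.homog_def big.homog_def using f_gr by blast

lemma F_W: "T:small.W==>F T:big.W"
proof -
 have "small.W<={T. F T:big.W}" unfolding small.W_homog
 proof (rule cvec.span_minimal)
  show "small_gens<={T. F T:big.W}"
  proof
   fix T assume "T:small_gens"
   then obtain vs s where T: "T = small.pt vs" and vs: "small.homog vs s" by blast
   show "T:{T. F T:big.W}" unfolding mem_Collect_eq T F_pt by (rule big.pt_in_W[OF big.homog_space[OF F_homog[OF vs]]])
  qed
  show "cvec.subspace {T. F T:big.W}"
  proof (rule cvec.subspaceI)
   show "0:{T. F T:big.W}"
    using cvec.subspace_0[OF big.W_subspace] by (simp only: mem_Collect_eq linear_on_zero[OF clin_F UNIV_I])
   fix x y c assume x: "x:{T. F T:big.W}"
   show "c *\<^sub>C x:{T. F T:big.W}"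
    using x cvec.subspace_scale[OF big.W_subspace] by (simp only: mem_Collect_eq linear_onD(2)[OF clin_F UNIV_I])
   assume "y:{T. F T:big.W}"
   thus "x + y:{T. F T:big.W}"
    using x cvec.subspace_add[OF big.W_subspace] by (simp only: mem_Collect_eq linear_onD(1)[OF clin_F UNIV_I UNIV_I])
  qed
 qed
 thus "T:small.W==>F T:big.W" by blast
qed

lemma F_slot:
 assumes m: "a:{1..l}" "i:K" "j:K" and T: "T:small.W"
 shows "F (slot_act l M a i j T) = slot_act l N a i j (F T)"
proof (rule span_eq_on[where B = "small_gens"
   and f = "%T. F (slot_act l M a i j T)" and g = "%T. slot_act l N a i j (F T)" and x = T])
 show "linear_on (cvec.span small_gens) (%T. F (slot_act l M a i j T))" by (rule clin_comp[OF clin_F small.clin_slot])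
 show "linear_on (cvec.span small_gens) (%T. slot_act l N a i j (F T))" by (rule clin_comp[OF big.clin_slot clin_F])
 show "T:cvec.span small_gens" using T unfolding small.W_homog .
 fix T assume "T:small_gens"
 then obtain vs s where T: "T = small.pt vs" and vs: "small.homog vs s" by blast
 have I: "i:I" "j:I" using m KI by auto
 have u: "(%b. f b (vs b))(a := act (N a) i j (f a (vs a))) = (%b. f b ((vs(a := act (M a) i j (vs a))) b))"
  using f_act[OF m small.homog_space[OF vs m(1)]] by auto
 show "F (slot_act l M a i j T) = slot_act l N a i j (F T)"
  unfolding T F_pt small.slot_homog(1)[OF m(2,3) vs m(1)] big.slot_homog(1)[OF I F_homog[OF vs] m(1)]
   linear_onD(2)[OF clin_F UNIV_I] F_pt u ..
qed

text \<open>Left inverses \<open>g a\<close> exist slot by slot, and their tensor product undoes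
  \<open>F\<close> on pure tensors.\<close>

lemma F_inj: "inj_on F small.W"
proof -
 have "EX g. clin g & range g<=space_of (M a) & (ALL x:space_of (M a). g (f a x) = x)" if "a:{1..l}" for a
  using linear_on_left_inverse[OF supermoduleD(2)[OF small.M[OF that]] f_lin[OF that] f_inj[OF that]] by metis
 then obtain g where g: "!!a. a:{1..l}==>clin (g a)" "!!a. a:{1..l}==>range (g a)<=space_of (M a)"
  "!!a x. a:{1..l}==>x:space_of (M a)==>g a (f a x) = x" by metis
 define G where "G = tensor_map l (%a. space_of (M a)) g"
 have "G (F T) = T" if "T:small.W" for T
 proof (rule span_eq_on[where B = "small_gens" and f = "%T. G (F T)" and g = "%T. T" and x = T])
  have c: "clin G" unfolding G_def by (rule clin_tensor_map)
  show "linear_on (cvec.span small_gens) (%T. G (F T))" by (rule clin_comp[OF c clin_F])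
  show "linear_on (cvec.span small_gens) (%T. T)" by (simp add: linear_on_def)
  show "T:cvec.span small_gens" using that unfolding small.W_homog .
  fix T assume "T:small_gens"
  then obtain vs s where T: "T = small.pt vs" and vs: "small.homog vs s" by blast
  have "G (F T) = small.pt (%a. g a (f a (vs a)))" unfolding T F_pt G_def
  proof (rule tensor_map_pure)
   fix a assume a: "a:{1..l}"
   show "linear_on (space_of (N a)) (g a) & g a ` space_of (N a)<=space_of (M a)"
    using linear_on_subset[OF g(1)[OF a]] g(2)[OF a] by blast
  qed
  also have "... = T" unfolding T by (rule pure_tensor_cong) (use g(3) small.homog_space[OF vs] in blast)
  finally show "G (F T) = T" .
 qed
 thus ?thesis by (metis inj_onI)
qed

end

text \<open>Take the product of \<open>T - e\<close> over the eigenvalues \<open>e\<close> other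
  than \<open>mw\<close> in some expression of \<open>x\<close>. It multiplies \<open>x\<close> by a
  nonzero scalar and kills the generators with those eigenvalues.\<close>

lemma eigenspace_span:
 assumes T: "clin T" and G: "!!g. g:G==>T g = wt g *\<^sub>C g" and x: "x:cvec.span G" "T x = mw *\<^sub>C x"
 shows "x:cvec.span {g:G. wt g = mw}"
proof -
 obtain t r where t: "finite t" "t<=G" "x = (SUM a:t. r a *\<^sub>C a)" using x(1) unfolding cvec.span_explicit by blast
 obtain es where es: "set es = wt ` t - {mw}" using t(1) by (metis finite_Diff finite_imageI finite_list)
 define Q where "Q = foldr (%e x. T x - e *\<^sub>C x) es"
 have Qe: "foldr (%e x. T x - e *\<^sub>C x) es v = (\<Prod>e\<leftarrow>es. c - e) *\<^sub>C v" if "T v = c *\<^sub>C v" for v c and es :: "complex list"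
 proof (induction es)
  case (Cons e es)
  have "foldr (%e x. T x - e *\<^sub>C x) (e # es) v = ((\<Prod>e\<leftarrow>es. c - e)*c) *\<^sub>C v - (e*(\<Prod>e\<leftarrow>es. c - e)) *\<^sub>C v"
   by (simp only: foldr.simps o_apply Cons.IH linear_onD(2)[OF T UNIV_I] that scaleC_scaleC)
  also have "... = (\<Prod>e\<leftarrow>e # es. c - e) *\<^sub>C v"
   unfolding cvec.scale_left_diff_distrib[symmetric] by (simp add: left_diff_distrib mult.commute)
  finally show ?case .
 qed (simp add: scaleC_one)
 have Ql: "clin (foldr (%e x. T x - e *\<^sub>C x) es)" for es :: "complex list"
 proof (induction es)
  case (Cons e es)
  have "clin (%x. T x - e *\<^sub>C x)"
   by (simp only: linear_on_def linear_onD(1)[OF T UNIV_I UNIV_I] linear_onD(2)[OF T UNIV_I] scaleC_add_right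
    cvec.scale_right_diff_distrib scaleC_scaleC mult.commute add_diff_add) blast
  from clin_comp[OF this Cons] show ?case by (simp only: foldr.simps o_def)
 qed (simp add: linear_on_def)
 have "(\<Prod>e\<leftarrow>es. mw - e) *\<^sub>C x = Q x" unfolding Q_def by (rule Qe[OF x(2), symmetric])
 also have "... = (SUM a:t. Q (r a *\<^sub>C a))" unfolding t(3) by (rule linear_on_sum[OF Ql[of es, folded Q_def]]) simp_all
 also have "... = (SUM a:t. (\<Prod>e\<leftarrow>es. wt a - e) *\<^sub>C r a *\<^sub>C a)"
 proof (rule sum.cong[OF refl])
  fix a assume a: "a:t"
  have "T (r a *\<^sub>C a) = wt a *\<^sub>C (r a *\<^sub>C a)" using G a t(2) by (auto simp: linear_onD(2)[OF T UNIV_I] scaleC_scaleC mult.commute)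
  thus "Q (r a *\<^sub>C a) = (\<Prod>e\<leftarrow>es. wt a - e) *\<^sub>C r a *\<^sub>C a" unfolding Q_def by (rule Qe)
 qed
 also have "... : cvec.span {g:G. wt g = mw}"
 proof (rule cvec.span_sum)
  fix a assume a: "a:t"
  show "(\<Prod>e\<leftarrow>es. wt a - e) *\<^sub>C r a *\<^sub>C a:cvec.span {g:G. wt g = mw}"
  proof (cases "wt a = mw")
   case True
   thus ?thesis using a t(2) by (intro cvec.span_scale cvec.span_base) auto
  next
   case False
   hence "wt a:set es" using a es by auto
   hence "(\<Prod>e\<leftarrow>es. wt a - e) = 0" by (auto simp: prod_list_zero_iff)
   thus ?thesis by (simp add: cvec.span_zero)
  qed
 qed
 finally have "(\<Prod>e\<leftarrow>es. mw - e) *\<^sub>C x:cvec.span {g:G. wt g = mw}" .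
 hence px: "prod_list (map (%e. mw - e) es) *\<^sub>C x:cvec.span {g:G. wt g = mw}" .
 define p where "p = (\<Prod>e\<leftarrow>es. mw - e)"
 have p: "p~=0" using es by (auto simp: p_def prod_list_zero_iff)
 have "inverse p *\<^sub>C p *\<^sub>C x:cvec.span {g:G. wt g = mw}"
  using px unfolding p_def[symmetric] by (rule cvec.span_scale)
 thus ?thesis by (simp only: scaleC_scaleC left_inverse[OF p] scaleC_one)
qed

section \<open>Embeddings onto extremal sums of weight spaces\<close>

lemma wt_spaceD: "v:wt_space I M ny==>v:space_of M" "v:wt_space I M ny==>j:I==>act M j j v = ny j *\<^sub>C v"
 by (auto simp: wt_space_def)

lemma wt_space_act:
 assumes M: "supermodule I M" and v: "v:wt_space I M ny" and ij: "i:I" "j:I"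
 shows "act M i j v:wt_space I M (%k. ny k + (if k = i then 1 else 0) - (if k = j then 1 else 0))" unfolding wt_space_def
proof (intro CollectI conjI ballI)
 show "act M i j v:space_of M" using supermodule_closed[OF M ij wt_spaceD(1)[OF v]] .
 fix k assume k: "k:I"
 have z: "act M a b 0 = 0" if "a:I" "b:I" for a b
  using linear_on_zero[OF supermoduleD(4)[OF M that]] cvec.subspace_0[OF supermoduleD(2)[OF M]] .
 have "act M k k (act M i j v) - act M i j (act M k k v) = (if k = i then act M k j v else 0) - (if k = j then act M i k v else 0)"
  using supermoduleD(6)[OF M k k ij wt_spaceD(1)[OF v]] by simp
 moreover have "act M i j (act M k k v) = ny k *\<^sub>C act M i j v"
  unfolding wt_spaceD(2)[OF v k] by (rule linear_onD(2)[OF supermoduleD(4)[OF M ij] wt_spaceD(1)[OF v]])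
 ultimately have "act M k k (act M i j v) = ny k *\<^sub>C act M i j v + ((if k = i then act M k j v else 0) - (if k = j then act M i k v else 0))"
  by (simp add: diff_eq_eq add.commute)
 thus "act M k k (act M i j v) = (ny k + (if k = i then 1 else 0) - (if k = j then 1 else 0)) *\<^sub>C act M i j v"
  by (auto simp: scaleC_add_left cvec.scale_left_diff_distrib scaleC_one)
qed

text \<open>The diagonal entry of the Gaudin matrix is \<partial> - E(z) at even and \<partial> +
  E(z) at odd indices; with this choice of weights it becomes \<partial> + c in both cases.\<close>

abbreviation (input) osgn :: "int=>nat=>complex" where
 "osgn s k == (if odd s then of_nat k else - of_nat k)"

text \<open>The image consists of the weights that take the value \<open>dt a s\<close> in slot
  \<open>a\<close> at each \<open>s\<close> of \<open>S1\<close> and \<open>S2\<close>. By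
  \<open>ext1\<close> and \<open>ext2\<close> these values are extremal, the largest at
  \<open>S1\<close> and the smallest at \<open>S2\<close>, and other weights differ from them by
  natural numbers.\<close>

locale weight_embedding = tensor_embedding "set cs" "set (S1 @ cs @ S2)" l M N f
 for cs S1 S2 :: "int list" and l :: nat and M :: "nat=>'v::complex_vector smod" and N :: "nat=>'w::complex_vector smod"
  and f :: "nat=>'v=>'w" +
 fixes ds :: "nat=>nat" and J :: "int set" and dt :: "nat=>int=>complex"
 defines J: "J == set (S1 @ cs @ S2)" and dt: "dt == (%a s. if s:set S2 then 0 else osgn s (ds a))"
 assumes dist: "distinct (S1 @ cs @ S2)"
  and weights: "!!a. a:{1..l}==>space_of (N a) = cvec.span (\<Union>ny. wt_space J (N a) ny)"
  and image: "!!a. a:{1..l}==>f a ` space_of (M a) = wt_sum J (N a) {ny. ALL s:set S1 Un set S2. ny s = dt a s}"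
  and ext1: "!!a v ny s. a:{1..l}==>v:wt_space J (N a) ny==>v~=0==>s:set S1==>EX k::nat. ny s = dt a s - of_nat k"
  and ext2: "!!a v ny s. a:{1..l}==>v:wt_space J (N a) ny==>v~=0==>s:set S2==>EX k::nat. ny s = of_nat k"
begin

lemma N: "a:{1..l}==>supermodule J (N a)" unfolding J by (rule big.M)

lemma act_span_zero:
 assumes a: "a:{1..l}" and ij: "i:J" "j:J" and x: "x:wt_sum J (N a) X" and c: "!!ny v. ny:X==>v:wt_space J (N a) ny==>act (N a) i j v = c *\<^sub>C v"
 shows "act (N a) i j x = c *\<^sub>C x"
proof (rule span_eq_on[where f = "act (N a) i j" and g = "%x. c *\<^sub>C x", OF x[unfolded wt_sum_def]])
 have "cvec.span (UN ny:X. wt_space J (N a) ny)<=space_of (N a)"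
  by (rule cvec.span_minimal[OF _ supermoduleD(2)[OF N[OF a]]]) (auto dest: wt_spaceD)
 thus "linear_on (cvec.span (UN ny:X. wt_space J (N a) ny)) (act (N a) i j)"
  by (rule linear_on_subset[OF supermoduleD(4)[OF N[OF a] ij]])
qed (auto simp: linear_on_def scaleC_add_right scaleC_scaleC mult.commute c)

text \<open>E_{s,j} would raise the weight at an \<open>s\<close> of \<open>S1\<close> above its
  maximum, and E_{j,s} would lower it at an \<open>s\<close> of \<open>S2\<close> below 0.\<close>

lemma f_kill:
 assumes a: "a:{1..l}" and v: "v:space_of (M a)" and j: "j:J"
 shows "s:set S1==>j~=s==>act (N a) s j (f a v) = 0"
  "s:set S2==>j~=s==>act (N a) j s (f a v) = 0"
  "s:set S1 Un set S2==>act (N a) s s (f a v) = dt a s *\<^sub>C f a v"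
proof -
 let ?X = "{ny. ALL s:set S1 Un set S2. ny s = dt a s}"
 have fv: "f a v:wt_sum J (N a) ?X" using image[OF a] v by blast
 show "act (N a) s j (f a v) = 0" if s: "s:set S1" "j~=s"
 proof -
  have sJ: "s:J" using s J by auto
  have "act (N a) s j u = 0 *\<^sub>C u" if "ny:?X" "u:wt_space J (N a) ny" for ny u
  proof (rule ccontr)
   assume "act (N a) s j u~=0 *\<^sub>C u"
   hence "act (N a) s j u~=0" by simp
   from ext1[OF a wt_space_act[OF N[OF a] that(2) sJ j] this s(1)] obtain k :: nat where "ny s + 1 = dt a s - of_nat k" using s by auto
   moreover have "ny s = dt a s" using that(1) s by auto
   ultimately have "of_nat (Suc k) = (0::complex)" by (simp add: algebra_simps)
   thus False by (simp only: of_nat_eq_0_iff)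
  qed
  from act_span_zero[OF a sJ j fv this] show ?thesis by simp
 qed
 show "act (N a) j s (f a v) = 0" if s: "s:set S2" "j~=s"
 proof -
  have sJ: "s:J" using s J by auto
  have "act (N a) j s u = 0 *\<^sub>C u" if "ny:?X" "u:wt_space J (N a) ny" for ny u
  proof (rule ccontr)
   assume "act (N a) j s u~=0 *\<^sub>C u"
   hence "act (N a) j s u~=0" by simp
   from ext2[OF a wt_space_act[OF N[OF a] that(2) j sJ] this s(1)] obtain k :: nat where "ny s - 1 = of_nat k" using s by auto
   moreover have "ny s = 0" using that(1) s dt by auto
   ultimately have "of_nat k = (- 1::complex)" by simp
   hence "of_nat (Suc k) = (0::complex)" by simp
   thus False by (simp only: of_nat_eq_0_iff)
  qed
  from act_span_zero[OF a j sJ fv this] show ?thesis by simp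
 qed
 show "act (N a) s s (f a v) = dt a s *\<^sub>C f a v" if s: "s:set S1 Un set S2"
 proof (rule act_span_zero[OF a _ _ fv])
  show "s:J" "s:J" using s J by auto
  fix ny u assume "ny:?X" "u:wt_space J (N a) ny"
  thus "act (N a) s s u = dt a s *\<^sub>C u" using wt_spaceD(2) s \<open>s \<in> J\<close> by fastforce
 qed
qed

lemma slot_F:
 assumes a: "a:{1..l}" and ij: "i:J" "j:J" and T: "T:small.W" and e: "even (i + j) | c = 0"
  and c: "!!v. v:space_of (M a)==>act (N a) i j (f a v) = c *\<^sub>C f a v"
 shows "slot_act l N a i j (F T) = c *\<^sub>C F T"
proof (rule span_eq_on[where B = "small_gens"
   and f = "%T. slot_act l N a i j (F T)" and g = "%T. c *\<^sub>C F T" and x = T])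
 show "T:cvec.span small_gens" using T unfolding small.W_homog .
 show "linear_on (cvec.span small_gens) (%T. slot_act l N a i j (F T))" by (rule clin_comp[OF big.clin_slot clin_F])
 have "clin (%T::'w tensor. c *\<^sub>C T)" by (simp only: linear_on_def scaleC_add_right scaleC_scaleC mult.commute) blast
 thus "linear_on (cvec.span small_gens) (%T. c *\<^sub>C F T)" by (rule clin_comp[OF _ clin_F])
 fix T assume "T:small_gens"
 then obtain vs s where T: "T = small.pt vs" and vs: "small.homog vs s" by blast
 have fv: "b:{1..l}==>f b (vs b):space_of (N b)" for b using f_space small.homog_space[OF vs] by blast
 have hv: "big.homog (%b. f b (vs b)) s" by (rule F_homog[OF vs])
 have "slot_act l N a i j (F T) = big.sgn (odd (i + j)) (big.nodd s a) *\<^sub>C big.pt ((%b. f b (vs b))(a := c *\<^sub>C f a (vs a)))"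
  unfolding T F_pt big.slot_homog(1)[OF ij[unfolded J] hv a] c[OF small.homog_space[OF vs a]] ..
 also have "big.pt ((%b. f b (vs b))(a := c *\<^sub>C f a (vs a))) = c *\<^sub>C big.pt ((%b. f b (vs b))(a := f a (vs a)))"
 proof (rule linear_onD(2)[OF _ fv[OF a]])
  show "linear_on (space_of (N a)) (%x. big.pt ((%b. f b (vs b))(a := x)))" by (rule linear_pure_tensor[OF a fv])
 qed
 also have "(%b. f b (vs b))(a := f a (vs a)) = (%b. f b (vs b))" by auto
 also have "big.sgn (odd (i + j)) (big.nodd s a) *\<^sub>C c *\<^sub>C big.pt (%b. f b (vs b)) = c *\<^sub>C big.pt (%b. f b (vs b))"
  using e by (auto simp: big.sgn_def koszul_def scaleC_one)
 finally show "slot_act l N a i j (F T) = c *\<^sub>C F T" unfolding T F_pt .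
qed

lemma slot_kill:
 assumes a: "a:{1..l}" and T: "T:small.W" and j: "j:J"
 shows "s:set S1==>j~=s==>slot_act l N a s j (F T) = 0"
  "s:set S2==>j~=s==>slot_act l N a j s (F T) = 0"
  "s:set S1 Un set S2==>slot_act l N a s s (F T) = dt a s *\<^sub>C F T"
 using slot_F[OF a _ j T, of s 0] slot_F[OF a j _ T, of s 0] slot_F[OF a _ _ T, of s s "dt a s"] f_kill[OF a _ j] f_kill(3)[OF a _ j] J
 by auto

end

lemma before_append:
 "before (xs @ ys) i j \<longleftrightarrow> before xs i j | before ys i j | (i:set xs & j:set ys)"
proof
 assume "before (xs @ ys) i j"
 then obtain a b where ab: "a < b" "b < length xs + length ys" "(xs @ ys) ! a = i" "(xs @ ys) ! b = j" unfolding before_def by auto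
 consider "b < length xs" | "a < length xs" "length xs<=b" | "length xs<=a" using ab(1) by linarith
 thus "before xs i j | before ys i j | (i:set xs & j:set ys)"
 proof cases
  case 1
  thus ?thesis using ab unfolding before_def by (auto simp: nth_append)
 next
  case 2
  thus ?thesis using ab by (auto simp: nth_append)
 next
  case 3
  hence "a - length xs < b - length xs" "b - length xs < length ys" "ys ! (a - length xs) = i" "ys ! (b - length xs) = j"
   using ab by (auto simp: nth_append)
  thus ?thesis unfolding before_def by blast
 qed
next
 assume "before xs i j | before ys i j | (i:set xs & j:set ys)"
 then consider "before xs i j" | "before ys i j" | "i:set xs" "j:set ys" by blast
 thus "before (xs @ ys) i j"
 proof cases
  case 1
  then obtain a b where "a < b" "b < length xs" "xs ! a = i" "xs ! b = j" unfolding before_def by blast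
  hence "a < b & b < length (xs @ ys) & (xs @ ys) ! a = i & (xs @ ys) ! b = j" by (auto simp: nth_append)
  thus ?thesis unfolding before_def by blast
 next
  case 2
  then obtain a b where "a < b" "b < length ys" "ys ! a = i" "ys ! b = j" unfolding before_def by blast
  hence "length xs + a < length xs + b & length xs + b < length (xs @ ys) & (xs @ ys) ! (length xs + a) = i & (xs @ ys) ! (length xs + b) = j"
   by (auto simp: nth_append)
  thus ?thesis unfolding before_def by blast
 next
  case 3
  then obtain a b where "a < length xs" "xs ! a = i" "b < length ys" "ys ! b = j" unfolding in_set_conv_nth by blast
  hence "a < length xs + b & length xs + b < length (xs @ ys) & (xs @ ys) ! a = i & (xs @ ys) ! (length xs + b) = j"
   by (auto simp: nth_append)
  thus ?thesis unfolding before_def by blast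
 qed
qed

lemma before_set: "before xs i j==>i:set xs & j:set xs" unfolding before_def by auto

lemma before_distinct: "distinct xs==>before xs i j==>i~=j"
 unfolding before_def by (auto simp: distinct_conv_nth)

definition cgeom :: "nat=>(nat=>nat)=>(nat=>complex)=>complex psd" where
 "cgeom l ds ze = pd + (\<Sum>a=1..l. pconst (of_nat (ds a))*pgeom (ze a))"

lemma cgeom_inverse: "EX u'. uinv (cgeom l ds ze) u'"
proof -
 have "pord 0 (\<Sum>a=1..l. pconst (of_nat (ds a))*pgeom (ze a)::complex psd)"
 proof (rule pord_sum)
  fix a
  have "pord (0 + 0) (pconst (of_nat (ds a))*pgeom (ze a)::complex psd)" by (rule pord_mult) (simp_all add: pord_pmon)
  thus "pord 0 (pconst (of_nat (ds a))*pgeom (ze a)::complex psd)" by simp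
 qed
 hence "pord 0 (cgeom l ds ze - pd)" by (simp add: cgeom_def)
 thus ?thesis using pinverse_monic by blast
qed

lemma pres_mult:
 assumes U: "cvec.subspace U" and F: "!!i j x. x:U==>lapp (pcoef F i j) x:U" and G: "!!i j x. x:U==>lapp (pcoef G i j) x:U"
  and x: "x:U"
 shows "lapp (pcoef (F*G) i j) x:U" unfolding pcoef_mult star_def lapp_sum
proof (rule cvec.subspace_sum[OF U])
 fix y assume "y:{(k, l, m, n, u). pcoef F k l~=0 & pcoef G m n~=0 & k + m - int u = i & l + n - int u = j}"
 obtain k l m n u where y: "y = (k, l, m, n, u)" by (cases y)
 show "lapp (case y of (k, l, m, n, u)=>of_int (wick l m u)*(pcoef F k l*pcoef G m n)) x:U"
  unfolding y by (simp add: lapp_of_int cvec.subspace_scale[OF U] F G x)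
qed

context weight_embedding
begin

definition U :: "'w tensor set" where "U = F ` small.W"

lemma U_subspace: "cvec.subspace U" unfolding U_def by (rule subspace_image[OF small.W_subspace linear_on_subset[OF clin_F]]) simp

definition PU :: "((nat=>'w)=>complex) lin" where
 "PU = Lin (SOME P. clin P & (ALL x. P x:U) & (ALL x:U. P x = x))"

lemma PU: "lapp PU x:U" "x:U==>lapp PU x = x"
proof -
 have "EX P. clin P & (ALL x. P x:U) & (ALL x:U. P x = x)"
  using projection_exists[OF U_subspace] by metis
 from someI_ex[OF this] show "lapp PU x:U" "x:U==>lapp PU x = x" unfolding PU_def by (simp_all add: lapp_Lin)
qed

text \<open>The action of the small algebra, carried to the ambient space of the large tensor
  product: the projection \<open>PU\<close> onto the image \<open>U\<close> is followed by
  generators that preserve \<open>U\<close>. In this way the large matrix and its block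
  \<open>PP\<close> have entries in the same ring.\<close>

definition rhU :: "gen=>((nat=>'w)=>complex) lin" where
 "rhU g = (if g:egens (set cs) l then big.trep g*PU else 0)"

lemma rhU_F: "T:small.W==>lapp (rhU g) (F T) = F (lapp (small.trep g) T)"
proof (cases "g:egens (set cs) l")
 case True
 assume T: "T:small.W"
 obtain a i j where g: "g = (a, i, j)" by (cases g)
 have m: "a:{1..l}" "i:set cs" "j:set cs" using True g by auto
 have big: "(a, i, j):egens (set (S1 @ cs @ S2)) l" using m by auto
 have "F T:U" using T by (simp add: U_def)
 thus ?thesis using True F_slot[OF m T] big.lapp_trep_W[OF big F_W[OF T]] small.lapp_trep_W[of a i j T] T
  by (simp only: rhU_def if_True lapp_ops PU(2) g)
next
 case False
 thus ?thesis by (simp only: rhU_def small.trep_def if_False lapp_ops linear_on_zero[OF clin_F UNIV_I])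
qed

lemma leval_rhU: "T:small.W==>lapp (leval rhU x) (F T) = F (lapp (leval small.trep x) T)"
proof (induction x rule: falg_induct)
 case (single w c)
 have "foldr (%g. lapp (small.trep g)) w T:small.W &
  foldr (%g. lapp (rhU g)) w (F T) = F (foldr (%g. lapp (small.trep g)) w T)"
 proof (induction w)
  case (Cons g w)
  have "lapp (small.trep g) x:small.W" if "x:small.W" for x
   using small.leval_trep_W[OF that, of "fvar g"] by (simp only: leval_fvar)
  thus ?case using Cons rhU_F by (simp only: foldr.simps o_apply)
 qed (use single in simp)
 thus ?case by (simp only: leval_single lapp_prod_list lapp_ops lapp_lsc linear_onD(2)[OF clin_F UNIV_I])
next
 case (add x y)
 thus ?case by (simp only: leval_add lapp_ops linear_onD(1)[OF clin_F UNIV_I UNIV_I])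
qed

abbreviation "Abig ze == gmat l ze big.trep"
abbreviation "Asm ze == gmat l ze small.trep"
abbreviation "PP ze == gmat l ze rhU"
abbreviation "ee == pconst PU"

lemma ee_mult_pgeom: "pconst x*pgeom (lsc z)*ee = pconst (x*PU)*pgeom (lsc z)"
 by (simp add: mult.assoc pgeom_pconst_commute pconst_mult)

lemma rho_PU:
 assumes "(a, i, j):egens (set cs) l"
 shows "big.trep (a, i, j)*PU = PU*rhU (a, i, j)"
proof (rule lin_eqI)
 fix x
 obtain T where T: "T:small.W" "lapp PU x = F T" using PU(1) unfolding U_def by blast
 have 1: "lapp (big.trep (a, i, j)) (lapp PU x) = F (lapp (small.trep (a, i, j)) T)"
 proof -
  have "lapp (rhU (a, i, j)) (F T) = lapp (big.trep (a, i, j)) (lapp PU (F T))" using assms by (simp only: rhU_def if_True lapp_ops)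
  thus ?thesis using rhU_F[OF T(1)] T(2) PU(2) T(1) by (simp add: U_def)
 qed
 have "lapp (small.trep (a, i, j)) T:small.W" using small.leval_trep_W[OF T(1), of "fvar (a, i, j)"] by (simp only: leval_fvar)
 hence "lapp PU (lapp (big.trep (a, i, j)) (lapp PU x)) = F (lapp (small.trep (a, i, j)) T)" unfolding 1 by (intro PU(2)) (simp add: U_def)
 thus "lapp (big.trep (a, i, j)*PU) x = lapp (PU*rhU (a, i, j)) x" using assms 1 by (simp only: rhU_def if_True lapp_ops)
qed

lemma trunc_cs:
 assumes "j:set cs" "k:set cs"
 shows "Abig ze j k*ee = ee*PP ze j k"
proof -
 have "eseries 1 l ze big.trep j k*ee = ee*eseries 1 l ze rhU j k"
  unfolding eseries_def sum_distrib_left sum_distrib_right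
 proof (rule sum.cong[OF refl])
  fix a assume "a:{1..l}"
  hence "big.trep (a, j, k)*PU = PU*rhU (a, j, k)" using rho_PU assms by auto
  thus "pconst (big.trep (a, j, k))*pgeom (lsc (ze a)) ^ 1*ee = ee*(pconst (rhU (a, j, k))*pgeom (lsc (ze a)) ^ 1)"
   by (simp add: ee_mult_pgeom mult.assoc[symmetric] pconst_mult[symmetric])
 qed
 thus ?thesis unfolding gmat_eseries by (simp add: left_diff_distrib right_diff_distrib pd_pconst)
qed

lemma trunc_zero:
 assumes "i~=j" "!!a T. a:{1..l}==>T:small.W==>slot_act l N a i j (F T) = 0" "i:J" "j:J"
 shows "Abig ze i j*ee = 0"
proof -
 have "big.trep (a, i, j)*PU = 0" if a: "a:{1..l}" for a
 proof (rule lin_eqI)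
  fix x
  obtain T where T: "T:small.W" "lapp PU x = F T" using PU(1) unfolding U_def by blast
  have "(a, i, j):egens (set (S1 @ cs @ S2)) l" using a assms(3,4) unfolding J by auto
  from big.lapp_trep_W[OF this F_W[OF T(1)]] show "lapp (big.trep (a, i, j)*PU) x = lapp 0 x"
   using assms(2)[OF a T(1)] by (simp only: lapp_ops T(2))
 qed
 hence "eseries 1 l ze big.trep i j*ee = 0" unfolding eseries_def sum_distrib_right by (intro sum.neutral) (simp add: ee_mult_pgeom)
 thus ?thesis unfolding gmat_eseries using assms(1) by (simp add: left_diff_distrib)
qed

lemma trunc_diag:
 assumes s: "s:set S1 Un set S2"
 shows "Abig ze s s*ee = ee*pmap lsc (if s:set S2 then pd else cgeom l ds ze)"
proof -
 have sJ: "s:J" using s J by auto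
 have 1: "big.trep (a, s, s)*PU = lsc (dt a s)*PU" if a: "a:{1..l}" for a
 proof (rule lin_eqI)
  fix x
  obtain T where T: "T:small.W" "lapp PU x = F T" using PU(1) unfolding U_def by blast
  have "(a, s, s):egens (set (S1 @ cs @ S2)) l" using a sJ unfolding J by auto
  from big.lapp_trep_W[OF this F_W[OF T(1)]] show "lapp (big.trep (a, s, s)*PU) x = lapp (lsc (dt a s)*PU) x"
   using slot_kill(3)[OF a T(1) sJ s] by (simp only: lapp_ops lapp_lsc T(2))
 qed
 have "eseries 1 l ze big.trep s s*ee = ee*(\<Sum>a=1..l. pconst (lsc (dt a s))*pgeom (lsc (ze a)))"
  unfolding eseries_def sum_distrib_right sum_distrib_left
 proof (rule sum.cong[OF refl])
  fix a assume "a:{1..l}"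
  thus "pconst (big.trep (a, s, s))*pgeom (lsc (ze a)) ^ 1*ee = ee*(pconst (lsc (dt a s))*pgeom (lsc (ze a)))"
   by (simp only: ee_mult_pgeom 1 mult.assoc[symmetric] pconst_mult[symmetric] lsc_commute power_one_right)
 qed
 also have "(\<Sum>a=1..l. pconst (lsc (dt a s))*pgeom (lsc (ze a))) = pmap lsc (\<Sum>a=1..l. pconst (dt a s)*pgeom (ze a))"
  by (simp add: rhom_sum[OF rhom_pmap[OF rhom_lsc]] rhomD(3)[OF rhom_pmap[OF rhom_lsc]] pmap_pmon[OF rhom_lsc] pmap_pgeom[OF rhom_lsc])
 finally have E: "eseries 1 l ze big.trep s s*ee = ee*pmap lsc (\<Sum>a=1..l. pconst (dt a s)*pgeom (ze a))" .
 have pd: "pmap lsc pd = pd" using pmap_pmon[OF rhom_lsc, of 0 1 1] by (simp add: rhomD(1)[OF rhom_lsc])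
 have "Abig ze s s*ee = ee*(pmap lsc pd - (if odd s then - pmap lsc (\<Sum>a=1..l. pconst (dt a s)*pgeom (ze a))
   else pmap lsc (\<Sum>a=1..l. pconst (dt a s)*pgeom (ze a))))" unfolding gmat_eseries
  by (cases "odd s") (simp_all only: if_True if_False refl left_diff_distrib right_diff_distrib pd_pconst E pd
   mult_minus_left mult_minus_right not_True_eq_False not_False_eq_True)
 also have "pmap lsc pd - (if odd s then - pmap lsc (\<Sum>a=1..l. pconst (dt a s)*pgeom (ze a))
   else pmap lsc (\<Sum>a=1..l. pconst (dt a s)*pgeom (ze a))) = pmap lsc (pd - (if odd s then - (\<Sum>a=1..l. pconst (dt a s)*pgeom (ze a))
   else (\<Sum>a=1..l. pconst (dt a s)*pgeom (ze a))))" by (simp add: rhomD[OF rhom_pmap[OF rhom_lsc]])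
 also have "pd - (if odd s then - (\<Sum>a=1..l. pconst (dt a s)*pgeom (ze a)) else (\<Sum>a=1..l. pconst (dt a s)*pgeom (ze a)))
   = (if s:set S2 then pd else cgeom l ds ze)" by (auto simp: dt cgeom_def pconst_uminus sum_negf)
 finally show ?thesis .
qed

end

lemma rhom_par_prod: "rhom h==>h (par_prod xs u u') = par_prod xs (h u) (h u')"
 by (induction xs rule: rev_induct) (auto simp: rhomD)

lemma uinv_par_prod: "uinv u u'==>EX w. uinv (par_prod xs u u') w"
proof (induction xs rule: rev_induct)
 case (snoc x xs)
 then obtain w where w: "uinv (par_prod xs u u') w" by blast
 show ?case using uinv_mult[OF w snoc.prems] uinv_mult[OF w uinv_sym[OF snoc.prems]] by (cases "even x") auto
qed (rule exI[of _ 1], simp)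

lemma eig_cancel:
 assumes "uinv A A'" "uinv B B'" and e: "eig (pmap lsc A*X*pmap lsc B) D v"
 shows "eig X (A'*D*B') v"
proof -
 have "pmap lsc A'*(pmap lsc A*X*pmap lsc B)*pmap lsc B' = (pmap lsc A'*pmap lsc A)*X*(pmap lsc B*pmap lsc B')"
  by (simp only: mult.assoc)
 also have "... = X"
  unfolding uinvD(2)[OF rhom_uinv[OF rhom_pmap[OF rhom_lsc] assms(1)]] uinvD(1)[OF rhom_uinv[OF rhom_pmap[OF rhom_lsc] assms(2)]] by simp
 finally have X: "pmap lsc A'*(pmap lsc A*X*pmap lsc B)*pmap lsc B' = X" .
 show ?thesis using eig_mult[OF eig_mult[OF eig_pmap_lsc e] eig_pmap_lsc, of A' B'] unfolding X .
qed

context weight_embedding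
begin

abbreviation "Bbig ze == ber (S1 @ cs @ S2) (Abig ze)"
abbreviation "Bsm ze == ber cs (Asm ze)"

text \<open>The constant series \<open>PU\<close> serves as multiplier in
  \<open>ber_truncation\<close>; \<open>slot_kill\<close> supplies the vanishing rows and columns
  and the diagonal entries.\<close>

lemma ber_trunc:
 assumes c: "uinv (cgeom l ds ze) c'"
 shows "Bbig ze*ee = ee*(pmap lsc (par_prod S1 (cgeom l ds ze) c')*ber cs (PP ze)*pmap lsc (par_prod S2 pd pdi))"
proof -
 let ?h = "pmap lsc::complex psd=>((nat=>'w)=>complex) lin psd"
 have lp: "rhom ?h" by (rule rhom_pmap[OF rhom_lsc])
 have pdi: "uinv pd (pdi::complex psd)" by (simp add: uinv_def)
 have J': "set (S1 @ cs @ S2) = J" unfolding J ..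
 show ?thesis unfolding rhom_par_prod[OF lp]
 proof (rule ber_truncation[where J = J])
  show "good J (Abig ze)" unfolding J by (rule monic_good[OF monic_gmat]) simp
  show "set (S1 @ cs @ S2)<=J" unfolding J' ..
  show "distinct (S1 @ cs @ S2)" by (rule dist)
  show "good (set cs) (PP ze)" by (rule monic_good[OF monic_gmat]) simp
  show "uinv (?h (cgeom l ds ze)) (?h c')" by (rule rhom_uinv[OF lp c])
  show "uinv (?h pd) (?h pdi)" by (rule rhom_uinv[OF lp pdi])
  show "Abig ze a j*ee = 0" if "a:set S1" "j:J" "j~=a" for a j
   by (rule trunc_zero) (use that slot_kill(1) J' in auto)
  show "Abig ze j b*ee = 0" if "b:set S2" "j:J" "j~=b" for b j
   by (rule trunc_zero) (use that slot_kill(2) J' in auto)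
  show "Abig ze a a*ee = ee*?h (cgeom l ds ze)" if "a:set S1" for a using trunc_diag[of a] that dist by auto
  show "Abig ze b b*ee = ee*?h pd" if "b:set S2" for b using trunc_diag[of b] that by auto
 qed (rule trunc_cs)
qed

lemma ber_PP:
 assumes T: "T:small.W"
 shows "lapp (pcoef (ber cs (PP ze)) k i) (F T) = F (lapp (pcoef (Bsm ze) k i) T)"
 unfolding ber_gmat[OF finite_set subset_refl] pcoef_pmap[OF rhom_leval] by (rule leval_rhU[OF T])

lemma eig_PP_iff:
 assumes T: "T:small.W"
 shows "eig (ber cs (PP ze)) D (F T) \<longleftrightarrow> eig (Bsm ze) D T"
proof -
 have "lapp (pcoef (Bsm ze) k i) T:small.W" for k i
  unfolding ber_gmat[OF finite_set subset_refl] pcoef_pmap[OF rhom_leval] by (rule small.leval_trep_W[OF T])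
 hence "F (lapp (pcoef (Bsm ze) k i) T) = F (D' *\<^sub>C T) \<longleftrightarrow> lapp (pcoef (Bsm ze) k i) T = D' *\<^sub>C T" for k i D'
  using F_inj cvec.subspace_scale[OF small.W_subspace T] by (auto dest: inj_onD)
 thus ?thesis unfolding eig_def ber_PP[OF T] linear_onD(2)[OF clin_F UNIV_I, symmetric] by blast
qed

lemma eig_big_iff:
 assumes c: "uinv (cgeom l ds ze) c'" and T: "T:small.W"
 shows "eig (Bbig ze) D (F T) \<longleftrightarrow>
  eig (pmap lsc (par_prod S1 (cgeom l ds ze) c')*ber cs (PP ze)*pmap lsc (par_prod S2 pd pdi)) D (F T)"
  (is "_ \<longleftrightarrow> eig ?X D (F T)")
proof -
 have FT: "F T:U" using T by (simp add: U_def)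
 have lscU: "lapp (pcoef (pmap lsc Z) i j) x:U" if "x:U" for Z i j x
  using that by (simp add: pcoef_pmap[OF rhom_lsc] cvec.subspace_scale[OF U_subspace])
 have PU': "lapp (pcoef (ber cs (PP ze)) i j) x:U" if x: "x:U" for i j x
 proof -
  obtain T where x: "x = F T" "T:small.W" using x unfolding U_def by blast
  have "lapp (pcoef (Bsm ze) i j) T:small.W"
   unfolding ber_gmat[OF finite_set subset_refl] pcoef_pmap[OF rhom_leval] by (rule small.leval_trep_W[OF x(2)])
  thus ?thesis unfolding x(1) ber_PP[OF x(2)] by (simp add: U_def)
 qed
 have X: "lapp (pcoef ?X i j) (F T):U" for i j by (rule pres_mult[OF U_subspace pres_mult[OF U_subspace lscU PU'] lscU FT])
 have "lapp (pcoef (Bbig ze) i j) (F T) = lapp (pcoef ?X i j) (F T)" for i j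
 proof -
  have "pcoef (Bbig ze*ee) i j = pcoef (ee*?X) i j" unfolding ber_trunc[OF c] ..
  hence "pcoef (Bbig ze) i j*PU = PU*pcoef ?X i j" by (simp only: pcoef_pmon_mult pcoef_mult_pmon diff_zero)
  hence "lapp (pcoef (Bbig ze) i j) (lapp PU (F T)) = lapp PU (lapp (pcoef ?X i j) (F T))" by (metis lapp_ops(6))
  thus ?thesis using PU(2)[OF FT] PU(2)[OF X] by simp
 qed
 thus ?thesis by (simp only: eig_def)
qed

lemma eig_up:
 assumes c: "uinv (cgeom l ds ze) c'" and T: "T:small.W" and e: "eig (Bsm ze) D T"
 shows "eig (Bbig ze) (par_prod S1 (cgeom l ds ze) c'*D*par_prod S2 pd pdi) (F T)" unfolding eig_big_iff[OF c T]
 by (intro eig_mult eig_pmap_lsc) (use e eig_PP_iff[OF T] in simp)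

lemma eig_down:
 assumes c: "uinv (cgeom l ds ze) c'" and T: "T:small.W" and e: "eig (Bbig ze) D (F T)"
  and w: "uinv (par_prod S1 (cgeom l ds ze) c') w1" "uinv (par_prod S2 pd pdi) w2"
 shows "eig (Bsm ze) (w1*D*w2) T" using eig_cancel[OF w e[unfolded eig_big_iff[OF c T]]] eig_PP_iff[OF T] by simp

lemma F_eq_0: "T:small.W==>F T = 0 \<longleftrightarrow> T = 0"
 using F_inj cvec.subspace_0[OF small.W_subspace] linear_on_zero[OF clin_F UNIV_I] by (metis inj_on_def)

definition bigwt :: "(int=>complex)=>(int=>complex)=>bool" where
 "bigwt w w' \<longleftrightarrow> (ALL s:set S1 Un set S2. w' s = (\<Sum>a=1..l. dt a s)) & (ALL j:set cs. w' j = w j)"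

lemma act_F:
 assumes T: "T:small.W" and j: "j:J"
 shows "s:set S1==>j~=s==>act (tensor_mod l N) s j (F T) = 0"
  "s:set S2==>j~=s==>act (tensor_mod l N) j s (F T) = 0"
  "s:set S1 Un set S2==>act (tensor_mod l N) s s (F T) = (\<Sum>a=1..l. dt a s) *\<^sub>C F T"
  "i:set cs==>k:set cs==>act (tensor_mod l N) i k (F T) = F (act (tensor_mod l M) i k T)"
proof -
 have A: "act (tensor_mod l N) i j T = (\<Sum>a=1..l. slot_act l N a i j T)" for i j T by (simp add: tensor_mod_def)
 have B: "act (tensor_mod l M) i j T = (\<Sum>a=1..l. slot_act l M a i j T)" for i j T by (simp add: tensor_mod_def)
 show "s:set S1==>j~=s==>act (tensor_mod l N) s j (F T) = 0"
  unfolding A using slot_kill(1)[OF _ T j] by (intro sum.neutral) blast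
 show "s:set S2==>j~=s==>act (tensor_mod l N) j s (F T) = 0"
  unfolding A using slot_kill(2)[OF _ T j] by (intro sum.neutral) blast
 show "s:set S1 Un set S2==>act (tensor_mod l N) s s (F T) = (\<Sum>a=1..l. dt a s) *\<^sub>C F T"
  unfolding A cvec.scale_sum_left using slot_kill(3)[OF _ T j] by (intro sum.cong refl) blast
 show "i:set cs==>k:set cs==>act (tensor_mod l N) i k (F T) = F (act (tensor_mod l M) i k T)"
  unfolding A B linear_on_sum[OF clin_F cvec.subspace_UNIV UNIV_I] using F_slot[OF _ _ _ T] by (intro sum.cong refl) (simp only:)
qed

end

lemma clin_sum: "(!!a. a:X==>clin (f a))==>clin (%T. SUM a:X. f a T)"
 unfolding linear_on_def by (simp add: sum.distrib cvec.scale_sum_right)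

lemma nat_sum_eq_zero:
 assumes "finite X" "(SUM a:X. d a - ny a) = (0::complex)" "!!a. a:X==>EX k::nat. ny a = d a - of_nat k" "a:X"
 shows "ny a = d a"
proof -
 obtain k where k: "!!a. a:X==>ny a = d a - of_nat (k a)" using assms(3) by metis
 have "(SUM a:X. d a - ny a) = of_nat (SUM a:X. k a)" using k by simp
 hence "(SUM a:X. k a) = 0" using assms(2) by (metis of_nat_eq_0_iff)
 thus ?thesis using k assms(1,4) by simp
qed

lemma singD:
 "v:sing ord P ny==>v:space_of P" "v:sing ord P ny==>before ord i j==>act P i j v = 0"
 "v:sing ord P ny==>j:set ord==>act P j j v = ny j *\<^sub>C v"
 by (auto simp: sing_def wt_space_def)

context weight_embedding
begin

abbreviation "Tm s == act (tensor_mod l N) s s"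

lemma clin_act: "clin (act (tensor_mod l N) i j)"
proof -
 have "act (tensor_mod l N) i j = (%T. \<Sum>a=1..l. slot_act l N a i j T)" by (simp add: tensor_mod_def fun_eq_iff)
 thus ?thesis using clin_sum[of "{1..l}" "%a. slot_act l N a i j"] big.clin_slot by metis
qed

lemma weight_pt:
 assumes vs: "!!b. b:{1..l}==>vs b:wt_space J (N b) (nys b)" and s: "s:J"
 shows "Tm s (big.pt vs) = (\<Sum>b=1..l. nys b s) *\<^sub>C big.pt vs"
proof -
 have "EX e. vs b:gr (N b) e" if "b:{1..l}" for b using supermoduleD(7)[OF N[OF that]] vs[OF that] by blast
 then obtain e where e: "!!b. b:{1..l}==>vs b:gr (N b) (e b)" by metis
 hence h: "big.homog vs e" by (simp add: big.homog_def)
 have "slot_act l N a s s (big.pt vs) = nys a s *\<^sub>C big.pt vs" if a: "a:{1..l}" for a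
 proof -
  have sJ: "s:set (S1 @ cs @ S2)" using s by (simp only: J)
  have "slot_act l N a s s (big.pt vs) = big.sgn (odd (s + s)) (big.nodd e a) *\<^sub>C big.pt (vs(a := nys a s *\<^sub>C vs a))"
   unfolding big.slot_homog(1)[OF sJ sJ h a] wt_spaceD(2)[OF vs[OF a] s] ..
  also have "big.pt (vs(a := nys a s *\<^sub>C vs a)) = nys a s *\<^sub>C big.pt (vs(a := vs a))"
  proof (rule linear_onD(2)[OF _ big.homog_space[OF h a]])
   show "linear_on (space_of (N a)) (%x. big.pt (vs(a := x)))" by (rule linear_pure_tensor[OF a big.homog_space[OF h]])
  qed
  finally show ?thesis by (simp add: big.sgn_def koszul_def scaleC_one)
 qed
 thus ?thesis unfolding cvec.scale_sum_left by (simp add: tensor_mod_def)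
qed

text \<open>In each slot a weight can deviate from the extremal value in one direction only, so an
  extremal total forces the extremal value in every slot. The conditions are imposed one index at a
  time: \<open>G A\<close> consists of pure tensors of weight vectors that satisfy those in
  \<open>A\<close>, and \<open>eigenspace_span\<close> adds the next index.\<close>

lemma sing_in_U:
 assumes x: "x:big.W" and wx: "!!s. s:set S1 Un set S2==>Tm s x = (\<Sum>a=1..l. dt a s) *\<^sub>C x"
 shows "x:U"
proof -
 define G where "G A = {big.pt vs | vs nys. (ALL b:{1..l}. vs b:wt_space J (N b) (nys b)) & (ALL s:A. (\<Sum>a=1..l. nys a s) = (\<Sum>a=1..l. dt a s))}" for A
 have "x:cvec.span (G A)" if "finite A" "A<=set S1 Un set S2" for A using that
 proof (induction A)
  case empty
  have "big.W = cvec.span {big.pt vs | vs. ALL b:{1..l}. vs b:(\<Union>ny. wt_space J (N b) ny)}"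
   by (rule big.W_span[OF weights])
  moreover have "{big.pt vs | vs. ALL b:{1..l}. vs b:(\<Union>ny. wt_space J (N b) ny)}<=G {}"
  proof
   fix y assume "y:{big.pt vs | vs. ALL b:{1..l}. vs b:(\<Union>ny. wt_space J (N b) ny)}"
   then obtain vs where y: "y = big.pt vs" "ALL b:{1..l}. EX ny. vs b:wt_space J (N b) ny" by blast
   from bchoice[OF y(2)] show "y:G {}" unfolding G_def using y(1) by blast
  qed
  ultimately show ?case using x cvec.span_mono by blast
 next
  case (insert s A)
  hence s: "s:set S1 Un set S2" by blast
  hence sJ: "s:J" using J by auto
  define wt where "wt g = (SOME c. Tm s g = c *\<^sub>C g)" for g
  have E: "EX nys. (ALL b:{1..l}. vs b:wt_space J (N b) (nys b))==>EX c. Tm s (big.pt vs) = c *\<^sub>C big.pt vs" for vs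
   using weight_pt[OF _ sJ] by blast
  have wt: "Tm s g = wt g *\<^sub>C g" if "g:G A" for g
  proof -
   have "EX c. Tm s g = c *\<^sub>C g" using that E unfolding G_def by blast
   thus ?thesis unfolding wt_def by (rule someI_ex)
  qed
  have "x:cvec.span {g:G A. wt g = (\<Sum>a=1..l. dt a s)}"
   by (rule eigenspace_span[OF clin_act wt _ wx[OF s]]) (use insert in blast)+
  moreover have "{g:G A. wt g = (\<Sum>a=1..l. dt a s)}<=cvec.span (G (insert s A))"
  proof
   fix g assume g: "g:{g:G A. wt g = (\<Sum>a=1..l. dt a s)}"
   then obtain vs nys where v: "g = big.pt vs" "ALL b:{1..l}. vs b:wt_space J (N b) (nys b)" "ALL s:A. (\<Sum>a=1..l. nys a s) = (\<Sum>a=1..l. dt a s)"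
    unfolding G_def by blast
   show "g:cvec.span (G (insert s A))"
   proof (cases "g = 0")
    case False
    have "Tm s g = (\<Sum>a=1..l. nys a s) *\<^sub>C g" unfolding v(1) by (rule weight_pt[OF _ sJ]) (use v(2) in blast)
    moreover have "Tm s g = (\<Sum>a=1..l. dt a s) *\<^sub>C g" using wt[of g] g by auto
    ultimately have "(\<Sum>a=1..l. nys a s) = (\<Sum>a=1..l. dt a s)" using False by (metis cvec.scale_cancel_right)
    hence "g:G (insert s A)" using v unfolding G_def by blast
    thus ?thesis by (rule cvec.span_base)
   qed (simp only: cvec.span_zero)
  qed
  ultimately show ?case using cvec.span_minimal[OF _ cvec.subspace_span] by blast
 qed
 from this[of "set S1 Un set S2"] have "x:cvec.span (G (set S1 Un set S2))" by simp
 moreover have "G (set S1 Un set S2)<=U"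
 proof
  fix g assume "g:G (set S1 Un set S2)"
  then obtain vs nys where v: "g = big.pt vs" "!!b. b:{1..l}==>vs b:wt_space J (N b) (nys b)"
   "!!s. s:set S1 Un set S2==>(\<Sum>a=1..l. nys a s) = (\<Sum>a=1..l. dt a s)" unfolding G_def by blast
  show "g:U"
  proof (cases "EX b:{1..l}. vs b = 0")
   case True
   then obtain b where b: "b:{1..l}" "vs b = 0" by blast
   have sp: "c:{1..l}==>vs c:space_of (N c)" for c using wt_spaceD(1)[OF v(2)] .
   have "linear_on (space_of (N b)) (%x. big.pt (vs(b := x)))" by (rule linear_pure_tensor[OF b(1) sp])
   from linear_on_zero[OF this cvec.subspace_0[OF supermoduleD(2)[OF N[OF b(1)]]]] have "big.pt (vs(b := 0)) = 0" .
   moreover have "vs(b := 0) = vs" using b(2) by auto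
   ultimately have "g = 0" unfolding v(1) by (simp only:)
   thus ?thesis using cvec.subspace_0[OF U_subspace] by (simp only:)
  next
   case False
   have eq: "nys b s = dt b s" if b: "b:{1..l}" and s: "s:set S1 Un set S2" for b s
   proof (cases "s:set S2")
    case True
    have 1: "(\<Sum>a=1..l. nys a s) = 0" using v(3)[OF s] True dt by simp
    have 2: "EX k::nat. nys a s = of_nat k" if "a:{1..l}" for a using ext2[OF that v(2)[OF that]] False that True by blast
    have "- nys b s = 0" by (rule nat_sum_eq_zero[of "{1..l}" "%_. 0" "%a. - nys a s" b]) (use 1 2 b in auto)
    thus ?thesis using True dt by simp
   next
    case F2: False
    hence "s:set S1" using s by blast
    hence 2: "EX k::nat. nys a s = dt a s - of_nat k" if "a:{1..l}" for a using ext1[OF that v(2)[OF that]] False that by blast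
    show ?thesis
     by (rule nat_sum_eq_zero[of "{1..l}" "%a. dt a s" "%a. nys a s" b]) (use v(3)[OF s] 2 b in \<open>auto simp: sum_subtractf\<close>)
   qed
   have "EX u. u:space_of (M b) & f b u = vs b" if b: "b:{1..l}" for b
   proof -
    have "vs b:wt_sum J (N b) {ny. ALL s:set S1 Un set S2. ny s = dt b s}"
     unfolding wt_sum_def by (rule cvec.span_base) (use v(2)[OF b] eq[OF b] in blast)
    thus ?thesis unfolding image[OF b, symmetric] by auto
   qed
   then obtain us where us: "!!b. b:{1..l}==>us b:space_of (M b) & f b (us b) = vs b" by metis
   have "g = F (small.pt us)" unfolding v(1) F_pt by (rule pure_tensor_cong) (use us in simp)
   thus ?thesis unfolding U_def using small.pt_in_W[of us] us by blast
  qed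
 qed
 ultimately show ?thesis using cvec.span_minimal[OF _ U_subspace] by blast
qed

text \<open>On the image of \<open>F\<close>, a raising operator whose first index lies in
  \<open>S1\<close> or whose second lies in \<open>S2\<close> vanishes, so only those of
  \<open>cs\<close> impose conditions. That every singular vector of the large product lies in the
  image is \<open>sing_in_U\<close>.\<close>

lemma sing_F:
 assumes w: "bigwt w w'"
 shows "bij_betw F (sing cs (tensor_mod l M) w) (sing (S1 @ cs @ S2) (tensor_mod l N) w')"
proof (rule bij_betwI')
 have cJ: "set cs<=J" using J by auto
 fix x y assume "x:sing cs (tensor_mod l M) w" "y:sing cs (tensor_mod l M) w"
 thus "F x = F y \<longleftrightarrow> x = y" using F_inj singD(1) by (metis inj_onD)
next
 fix T assume T: "T:sing cs (tensor_mod l M) w"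
 note TW = singD(1)[OF T]
 show "F T:sing (S1 @ cs @ S2) (tensor_mod l N) w'" unfolding sing_def wt_space_def
 proof (intro IntI CollectI conjI allI impI ballI F_W[OF TW])
  fix i j assume b: "before (S1 @ cs @ S2) i j"
  hence ij: "i:J" "j:J" "i~=j" using before_set[OF b] before_distinct[OF dist b] unfolding J by auto
  consider "i:set S1" | "j:set S2" | "before cs i j"
   using b before_set[of S1 i j] before_set[of S2 i j] unfolding before_append by auto
  thus "act (tensor_mod l N) i j (F T) = 0"
  proof cases
   case 3
   thus ?thesis using act_F(4)[OF TW ij(1)] before_set[OF 3] singD(2)[OF T 3] linear_on_zero[OF clin_F UNIV_I] by simp
  qed (use act_F(1,2)[OF TW] ij in auto)
 next
  fix j assume j: "j:set (S1 @ cs @ S2)"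
  hence jJ: "j:J" unfolding J .
  show "act (tensor_mod l N) j j (F T) = w' j *\<^sub>C F T"
  proof (cases "j:set cs")
   case True
   thus ?thesis using act_F(4)[OF TW jJ] singD(3)[OF T] w unfolding bigwt_def by (simp add: linear_onD(2)[OF clin_F UNIV_I])
  next
   case False
   thus ?thesis using act_F(3)[OF TW jJ] j w unfolding bigwt_def by auto
  qed
 qed
next
 fix x assume x: "x:sing (S1 @ cs @ S2) (tensor_mod l N) w'"
 have "x:U" by (rule sing_in_U[OF singD(1)[OF x]]) (use singD(3)[OF x] w in \<open>auto simp: bigwt_def\<close>)
 then obtain T where T: "T:small.W" "x = F T" unfolding U_def by blast
 have cl: "act (tensor_mod l M) i j T:small.W" if "i:set cs" "j:set cs" for i j
 proof -
  have "act (tensor_mod l M) i j T = (\<Sum>a=1..l. slot_act l M a i j T)" by (simp add: tensor_mod_def)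
  thus ?thesis by (simp only:, intro cvec.subspace_sum[OF small.W_subspace] small.slot_W[OF that _ T(1)])
 qed
 have csJ: "j:J" if "j:set cs" for j using that unfolding J by auto
 have "T:sing cs (tensor_mod l M) w" unfolding sing_def wt_space_def
 proof (intro IntI CollectI conjI allI impI ballI T(1))
  fix i j assume b: "before cs i j"
  hence ij: "i:set cs" "j:set cs" using before_set by auto
  have "before (S1 @ cs @ S2) i j" using b unfolding before_append by blast
  from singD(2)[OF x this] have "F (act (tensor_mod l M) i j T) = 0" unfolding T(2) act_F(4)[OF T(1) csJ[OF ij(1)] ij] .
  thus "act (tensor_mod l M) i j T = 0" using F_eq_0[OF cl[OF ij]] by simp
 next
  fix j assume j: "j:set cs"
  hence "act (tensor_mod l N) j j x = w j *\<^sub>C x" using singD(3)[OF x, of j] w unfolding bigwt_def by auto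
  hence "act (tensor_mod l N) j j (F T) = w j *\<^sub>C F T" unfolding T(2) .
  hence "F (act (tensor_mod l M) j j T) = F (w j *\<^sub>C T)" unfolding act_F(4)[OF T(1) csJ[OF j] j j] linear_onD(2)[OF clin_F UNIV_I] .
  thus "act (tensor_mod l M) j j T = w j *\<^sub>C T"
   by (rule inj_onD[OF F_inj]) (use cl[OF j j] cvec.subspace_scale[OF small.W_subspace T(1)] in auto)
 qed
 thus "EX y:sing cs (tensor_mod l M) w. x = F y" using T(2) by blast
qed

end

section \<open>Highest weights\<close>

lemma is_irr_hwD:
 assumes "is_irr_hw ord La P"
 shows "supermodule (set ord) P" "EX v:sing ord P La. v~=0" "irreducible_module (set ord) P"
 using assms by (auto simp: is_irr_hw_def irreducible_module_def)

text \<open>\<open>submodule\<close> asks for a graded subspace; weight vectors are homogeneous, so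
  their spans qualify.\<close>

lemma graded_span:
 assumes P: "supermodule I P" and G: "!!g. g:G==>g:gr P False | g:gr P True"
 shows "cvec.span G = {x + y | x y. x:cvec.span G Int gr P False & y:cvec.span G Int gr P True}" (is "?G = ?S")
proof
 note sub = supermoduleD(1)[OF P]
 show "?S<=cvec.span G" using cvec.span_add by blast
 have a: "cvec.subspace (cvec.span G Int gr P a)" for a by (intro cvec.subspace_inter cvec.subspace_span sub)
 have "cvec.subspace ?S" by (rule cvec.subspace_sums[OF a a])
 moreover have "G<=?S"
 proof
  fix g assume g: "g:G"
  hence gs: "g:cvec.span G" by (rule cvec.span_base)
  have z: "0:cvec.span G Int gr P e" for e using cvec.subspace_0[OF a] .
  from G[OF g] show "g:?S"
  proof
   assume "g:gr P False"
   hence "g = g + 0 & g:cvec.span G Int gr P False & 0:cvec.span G Int gr P True" using gs z by simp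
   thus ?thesis by blast
  next
   assume "g:gr P True"
   hence "g = 0 + g & 0:cvec.span G Int gr P False & g:cvec.span G Int gr P True" using gs z by simp
   thus ?thesis by blast
  qed
 qed
 ultimately show "cvec.span G<=?S" by (rule cvec.span_minimal[rotated])
qed

text \<open>The distance of \<open>ny\<close> from \<open>La\<close> as measured by the functional
  \<open>te\<close>; E_{i,j} changes it by \<open>te j - te i\<close>.\<close>

definition height :: "int set=>(int=>int)=>(int=>complex)=>(int=>complex)=>complex" where
 "height I te La ny = (SUM c:I. of_int (te c)*(La c - ny c))"

inductive_set nonraise :: "(int=>int)=>'v::complex_vector smod=>int set=>'v=>'v set"
 for te P I v where
 base: "v:nonraise te P I v"
| step: "x:nonraise te P I v==>i:I==>j:I==>te i<=te j==>act P i j x:nonraise te P I v"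

lemma span_act:
 assumes P: "supermodule I P" and ij: "i:I" "j:I" and G: "G<=space_of P" "!!g. g:G==>act P i j g:cvec.span H"
  and x: "x:cvec.span G"
 shows "act P i j x:cvec.span H"
proof -
 note L = supermoduleD(4)[OF P ij]
 have "x:space_of P & act P i j x:cvec.span H" using x
 proof (induction rule: cvec.span_induct_alt)
  case base
  show ?case using cvec.subspace_0[OF supermoduleD(2)[OF P]] linear_on_zero[OF L] cvec.span_zero by metis
 next
  case (step c x y)
  have x: "x:space_of P" using step(1) G(1) by blast
  have cx: "c *\<^sub>C x:space_of P" using cvec.subspace_scale[OF supermoduleD(2)[OF P] x] .
  have "act P i j (c *\<^sub>C x + y) = c *\<^sub>C act P i j x + act P i j y"
   using linear_onD(1)[OF L cx] linear_onD(2)[OF L x] step(2) by metis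
  thus ?case using cvec.subspace_add[OF supermoduleD(2)[OF P] cx] cvec.span_add[OF cvec.span_scale[OF G(2)[OF step(1)]]] step(2) by metis
 qed
 thus ?thesis ..
qed

lemma sg_in: "cvec.subspace X==>x:X==>sg a b x:X" by (simp add: sg_def cvec.subspace_neg)

text \<open>The vectors obtained from \<open>v\<close> by operators with \<open>te i <= te j\<close>
  span a submodule: any other operator kills \<open>v\<close>, because then \<open>i\<close>
  precedes \<open>j\<close>, and it moves past the factors up to terms covered by the induction.
  Irreducibility makes this span everything, and each of these operators adds a natural number to
  the height.\<close>

theorem hw_span:
 assumes hw: "is_irr_hw ord La P" and v: "v:sing ord P La" "v~=0" and te: "ALL i j. before ord i j-->te j<=te i"
 defines "I == set ord"
 shows "space_of P = cvec.span {g. EX ny k. g:wt_space I P ny & height I te La ny = of_nat k}" (is "_ = cvec.span ?B")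
proof -
 note P = is_irr_hwD(1)[OF hw, folded I_def]
 define G where "G = nonraise te P I v"
 have fin: "finite I" by (simp add: I_def)
 have GB: "G<=?B"
 proof
  fix g assume "g:G"
  thus "g:?B" unfolding G_def
  proof (induction rule: nonraise.induct)
   case base
   have "v:wt_space I P La" using v by (auto simp: sing_def I_def)
   moreover have "height I te La La = of_nat 0" by (simp add: height_def)
   ultimately show ?case by blast
  next
   case (step x i j)
   then obtain ny k where x: "x:wt_space I P ny" "height I te La ny = of_nat k" by blast
   let ?ny = "%k. ny k + (if k = i then 1 else 0) - (if k = j then 1 else 0)"
   have "height I te La ?ny = height I te La ny - (SUM c:I. if c = i then of_int (te c) else 0) + (SUM c:I. if c = j then of_int (te c) else 0)"
    unfolding height_def sum_subtractf[symmetric] sum.distrib[symmetric] by (rule sum.cong[OF refl]) (simp add: algebra_simps)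
   also have "... = of_nat k - of_int (te i) + of_int (te j)" using step(2,3) fin by (simp add: x(2))
   also have "... = of_nat (k + nat (te j - te i))" using step(4) by simp
   finally show ?case using wt_space_act[OF P x(1) step(2,3)] by blast
  qed
 qed
 hence Gs: "G<=space_of P" using wt_spaceD(1) by blast
 have Gact: "act P i j g:cvec.span G" if g: "g:G" and ij: "i:I" "j:I" for g i j using g ij unfolding G_def
 proof (induction arbitrary: i j rule: nonraise.induct)
  case base
  show ?case
  proof (cases "te i<=te j")
   case True
   thus ?thesis using base nonraise.step[OF nonraise.base] by (intro cvec.span_base)
  next
   case False
   hence "i~=j" by auto
   obtain a b where ab: "a < length ord" "ord ! a = i" "b < length ord" "ord ! b = j" using base unfolding I_def by (metis in_set_conv_nth)
   hence "before ord i j | before ord j i" using \<open>i \<noteq> j\<close> unfolding before_def by (metis linorder_neqE_nat)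
   hence "before ord i j" using te False by blast
   thus ?thesis using singD(2)[OF v(1)] cvec.span_zero by metis
  qed
 next
  case (step x k h)
  have xs: "x:space_of P" using step(1) Gs G_def by blast
  have cl: "act P k h y:cvec.span (nonraise te P I v)" if "y:cvec.span (nonraise te P I v)" for y
   by (rule span_act[OF P step(2,3) _ _ that]) (use Gs step(2-4) in \<open>auto simp: G_def intro: cvec.span_base nonraise.step\<close>)
  have "act P i j (act P k h x) = sg (i + j) (k + h) (act P k h (act P i j x)) +
    ((if j = k then act P i h x else 0) - sg (i + j) (k + h) (if i = h then act P k j x else 0))"
   using supermoduleD(6)[OF P step.prems step(2,3) xs] by (simp add: diff_eq_eq add.commute)
  moreover have "(if j = k then act P i h x else 0):cvec.span (nonraise te P I v)" "(if i = h then act P k j x else 0):cvec.span (nonraise te P I v)"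
   using step.IH step(2,3) step.prems cvec.span_zero by auto
  ultimately show ?case using cl[OF step.IH[OF step.prems]] by (simp only: cvec.span_add cvec.span_diff sg_in[OF cvec.subspace_span])
 qed
 have "submodule I P (cvec.span G)" unfolding submodule_def
 proof (intro conjI ballI)
  show "cvec.subspace (cvec.span G)" by (rule cvec.subspace_span)
  show "cvec.span G = {x + y | x y. x:cvec.span G Int gr P False & y:cvec.span G Int gr P True}"
  proof (rule graded_span[OF P])
   fix g assume "g:G"
   then obtain ny where "g:wt_space I P ny" using GB by blast
   thus "g:gr P False | g:gr P True" using supermoduleD(7)[OF P, of ny] by (metis (full_types) subsetD)
  qed
  fix i j assume ij: "i:I" "j:I"
  show "act P i j ` cvec.span G<=cvec.span G" using span_act[OF P ij Gs Gact[OF _ ij]] by blast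
 qed
 moreover have "v:cvec.span G" unfolding G_def by (intro cvec.span_base nonraise.base)
 ultimately have sp: "space_of P = cvec.span G" using is_irr_hwD(3)[OF hw, folded I_def] v(2) unfolding irreducible_module_def by auto
 show ?thesis
 proof
  show "space_of P<=cvec.span ?B" unfolding sp by (rule cvec.span_mono[OF GB])
  show "cvec.span ?B<=space_of P" by (rule cvec.span_minimal[OF _ supermoduleD(2)[OF P]]) (use wt_spaceD(1) in blast)
 qed
qed

lemma hw_weights:
 assumes hw: "is_irr_hw ord La P"
 shows "space_of P = cvec.span (\<Union>ny. wt_space (set ord) P ny)"
proof
 note P = is_irr_hwD(1)[OF hw]
 obtain v where v: "v:sing ord P La" "v~=0" using is_irr_hwD(2)[OF hw] by blast
 have "space_of P = cvec.span {g. EX ny k. g:wt_space (set ord) P ny & height (set ord) (%_. 0) La ny = of_nat k}"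
  by (rule hw_span[OF hw v]) simp
 also have "... <= cvec.span (\<Union>ny. wt_space (set ord) P ny)" by (rule cvec.span_mono) blast
 finally show "space_of P<=cvec.span (\<Union>ny. wt_space (set ord) P ny)" .
 show "cvec.span (\<Union>ny. wt_space (set ord) P ny)<=space_of P"
  by (rule cvec.span_minimal[OF _ supermoduleD(2)[OF P]]) (use wt_spaceD(1) in blast)
qed

text \<open>The height is the eigenvalue of the diagonal operator \<open>T0\<close>. By
  \<open>eigenspace_span\<close>, a nonzero \<open>u\<close> can only exist if a nonzero spanning
  vector from \<open>hw_span\<close> has the same height.\<close>

theorem hw_height:
 assumes hw: "is_irr_hw ord La P" and te: "ALL i j. before ord i j-->te j<=te i"
  and u: "u:wt_space (set ord) P ny" "u~=0"
 shows "EX k::nat. height (set ord) te La ny = of_nat k"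
proof -
 define I where "I = set ord"
 note P = is_irr_hwD(1)[OF hw, folded I_def]
 define B where "B = {g. EX ny k. g:wt_space I P ny & height I te La ny = of_nat k}"
 obtain v where v: "v:sing ord P La" "v~=0" using is_irr_hwD(2)[OF hw] by blast
 have sp: "space_of P = cvec.span B" unfolding B_def I_def by (rule hw_span[OF hw v te])
 define T0 where "T0 x = (SUM c:I. of_int (te c) *\<^sub>C (La c *\<^sub>C x - act P c c x))" for x
 have "linear_on (space_of P) T0" unfolding T0_def linear_on_def
 proof (intro conjI ballI allI)
  fix x y c assume x: "x:space_of P"
  show "(SUM k:I. of_int (te k) *\<^sub>C (La k *\<^sub>C c *\<^sub>C x - act P k k (c *\<^sub>C x))) = c *\<^sub>C (SUM k:I. of_int (te k) *\<^sub>C (La k *\<^sub>C x - act P k k x))"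
   unfolding cvec.scale_sum_right
   by (rule sum.cong[OF refl]) (simp add: linear_onD(2)[OF supermoduleD(4)[OF P] x] cvec.scale_right_diff_distrib scaleC_scaleC mult.left_commute mult.commute)
  assume y: "y:space_of P"
  show "(SUM c:I. of_int (te c) *\<^sub>C (La c *\<^sub>C (x + y) - act P c c (x + y))) =
   (SUM c:I. of_int (te c) *\<^sub>C (La c *\<^sub>C x - act P c c x)) + (SUM c:I. of_int (te c) *\<^sub>C (La c *\<^sub>C y - act P c c y))"
   unfolding sum.distrib[symmetric]
   by (rule sum.cong[OF refl]) (simp add: linear_onD(1)[OF supermoduleD(4)[OF P] x y] cvec.scale_right_diff_distrib scaleC_add_right)
 qed
 then obtain T where T: "clin T" "!!x. x:space_of P==>T x = T0 x"
  using linear_on_extend[OF supermoduleD(2)[OF P]] by metis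
 have Tw: "T x = height I te La ny *\<^sub>C x" if x: "x:wt_space I P ny" for x ny
 proof -
  have "T x = (SUM c:I. (of_int (te c)*(La c - ny c)) *\<^sub>C x)" unfolding T(2)[OF wt_spaceD(1)[OF x]] T0_def
   by (rule sum.cong[OF refl]) (simp add: wt_spaceD(2)[OF x] cvec.scale_left_diff_distrib[symmetric] scaleC_scaleC)
  thus ?thesis by (simp add: height_def cvec.scale_sum_left)
 qed
 define wt where "wt g = (SOME c. T g = c *\<^sub>C g & (g~=0-->c:range of_nat))" for g
 have wt: "T g = wt g *\<^sub>C g & (g~=0-->wt g:range of_nat)" if "g:B" for g
 proof -
  have "EX c. T g = c *\<^sub>C g & (g~=0-->c:range of_nat)" using that Tw unfolding B_def by blast
  thus ?thesis unfolding wt_def by (rule someI_ex)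
 qed
 have "u:cvec.span {g:B. wt g = height I te La ny}"
 proof (rule eigenspace_span[OF T(1)])
  show "T g = wt g *\<^sub>C g" if "g:B" for g using wt[OF that] ..
  show "u:cvec.span B" using wt_spaceD(1)[OF u(1)] unfolding sp .
  show "T u = height I te La ny *\<^sub>C u" by (rule Tw) (use u(1) in \<open>simp add: I_def\<close>)
 qed
 hence "EX g:B. g~=0 & wt g = height I te La ny"
  using u(2) cvec.span_minimal[of "{g:B. wt g = height I te La ny}" "{0}"] cvec.subspace_single_0 by blast
 then obtain g where "g:B" "g~=0" "wt g = height I te La ny" by blast
 thus ?thesis using wt[of g] unfolding I_def by auto
qed

lemma before_Cons: "before (x # zs) i j \<longleftrightarrow> (i = x & j:set zs) | before zs i j"
proof -
 have "~ before [x] i j" by (auto simp: before_def)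
 thus ?thesis using before_append[of "[x]" zs i j] by auto
qed

lemma prefix_antimono:
 "distinct (xs @ ys)==>ALL i j. before (xs @ ys) i j-->(if j:set xs then 1 else 0)<=(if i:set xs then 1 else 0::int)"
 unfolding before_append by (auto dest: before_set)

lemma suffix_antimono:
 "distinct (xs @ ys)==>ALL i j. before (xs @ ys) i j-->(if j:set ys then -1 else 0)<=(if i:set ys then -1 else 0::int)"
 unfolding before_append by (auto dest: before_set)

section \<open>Odd reflections\<close>

lemma before_swap:
 assumes "distinct (xs @ a # b # ys)"
 shows "before (xs @ b # a # ys) i j==>(i, j) = (b, a) | before (xs @ a # b # ys) i j & (i, j)~=(a, b)"
proof -
 assume "before (xs @ b # a # ys) i j"
 thus ?thesis using assms unfolding before_append before_Cons by (auto dest: before_set)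
qed

text \<open>Let \<open>u\<close> be E_{b,a} applied to \<open>v\<close>. Then E_{a,b} maps
  \<open>u\<close> to \<open>c\<close> times \<open>v\<close>, and all other raising operators kill
  \<open>u\<close>. For \<open>c = 0\<close> the vector \<open>u\<close> is zero, since otherwise it
  would be a highest weight vector with \<open>v\<close> above it. For \<open>c ~= 0\<close> and
  opposite parities, E_{b,a} squares to zero and \<open>u\<close> is the highest weight vector for
  the new order.\<close>

lemma odd_swap:
 fixes P :: "'v::complex_vector smod"
 assumes hw: "is_irr_hw (xs @ a # b # ys) La P" and dist: "distinct (xs @ a # b # ys)"
 defines "c == La a - sg (a + b) (a + b) (La b)"
 shows "c = 0==>is_irr_hw (xs @ b # a # ys) La P"
  "odd (a + b)==>c~=0==>is_irr_hw (xs @ b # a # ys) (La(a := La a - 1, b := La b + 1)) P"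
proof -
 let ?o = "xs @ a # b # ys" and ?o' = "xs @ b # a # ys"
 define I where "I = set ?o"
 have I': "set ?o' = I" by (auto simp: I_def)
 note P = is_irr_hwD(1)[OF hw, folded I_def]
 note irr = is_irr_hwD(3)[OF hw, folded I_def]
 have ab: "a:I" "b:I" "a~=b" using dist by (auto simp: I_def)
 obtain v where v: "v:sing ?o P La" "v~=0" using is_irr_hwD(2)[OF hw] by blast
 note vs = singD(1)[OF v(1)]
 have v0: "act P i j v = 0" if "before ?o i j" for i j using singD(2)[OF v(1) that] .
 have vw: "v:wt_space I P La" using v(1) by (simp add: sing_def I_def)
 have z: "act P i j 0 = 0" if "i:I" "j:I" for i j
  using linear_on_zero[OF supermoduleD(4)[OF P that]] cvec.subspace_0[OF supermoduleD(2)[OF P]] .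
 have bef: "before ?o a b" unfolding before_append before_Cons by simp
 define u where "u = act P b a v"
 have us: "u:space_of P" unfolding u_def by (rule supermodule_closed[OF P ab(2,1) vs])
 have uw: "u:wt_space I P (La(a := La a - 1, b := La b + 1))"
 proof -
  have "(%k. La k + (if k = b then 1 else 0) - (if k = a then 1 else 0)) = La(a := La a - 1, b := La b + 1)"
   using ab(3) by (auto simp: fun_eq_iff)
  thus ?thesis using wt_space_act[OF P vw ab(2,1)] by (simp add: u_def)
 qed
 have bounds: "i~=a==>before ?o i b==>before ?o i a" "j~=b==>before ?o a j==>before ?o b j" for i j
 proof -
  show "i~=a==>before ?o i b==>before ?o i a" "j~=b==>before ?o a j==>before ?o b j"
   using dist unfolding before_append before_Cons by (auto dest: before_set)
 qed
 have u0: "act P i j u = 0" if ij: "before ?o i j" "(i, j)~=(a, b)" for i j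
 proof -
  have m: "i:I" "j:I" "i~=j" using before_set[OF ij(1)] before_distinct[OF dist ij(1)] by (auto simp: I_def)
  have "(if j = b then act P i a v else 0) = 0" using bounds(1) ij v0 by auto
  moreover have "(if i = a then act P b j v else 0) = 0" using bounds(2) ij v0 by auto
  ultimately show ?thesis using supermoduleD(6)[OF P m(1,2) ab(2,1) vs] v0[OF ij(1)] z[OF ab(2,1)] by (simp add: u_def)
 qed
 have uab: "act P a b u = c *\<^sub>C v"
 proof -
  have 2: "sg x y (d *\<^sub>C w) = sg x y d *\<^sub>C w" for x y d and w :: 'v by (simp add: sg_def)
  show ?thesis using supermoduleD(6)[OF P ab(1,2) ab(2,1) vs] v0[OF bef] z[OF ab(2,1)] wt_spaceD(2)[OF vw ab(1)] wt_spaceD(2)[OF vw ab(2)]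
   by (simp add: u_def add.commute[of b a] 2 c_def cvec.scale_left_diff_distrib)
 qed
 show "is_irr_hw ?o' La P" if c: "c = 0"
 proof -
  have "u = 0"
  proof (rule ccontr)
   assume nz: "u~=0"
   have "u:sing ?o P (La(a := La a - 1, b := La b + 1))" unfolding sing_def
   proof (intro IntI CollectI conjI allI impI us)
    show "u:wt_space (set ?o) P (La(a := La a - 1, b := La b + 1))" using uw by (simp add: I_def)
    fix i j assume "before ?o i j"
    thus "act P i j u = 0" using u0[of i j] uab c by (cases "(i, j) = (a, b)") auto
   qed
   hence hw': "is_irr_hw ?o (La(a := La a - 1, b := La b + 1)) P" using irr nz unfolding is_irr_hw_def I_def by blast
   \<comment> \<open>The indicator of the indices up to \<open>a\<close>: the partial sum of weights
     that it measures drops by 1 from \<open>v\<close> to \<open>u\<close>, so that \<open>v\<close>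
     would have height -1 with respect to \<open>u\<close>.\<close>
   define te where "te = (%k. if k:set (xs @ [a]) then 1 else 0::int)"
   have e: "?o = (xs @ [a]) @ (b # ys)" by simp
   have "ALL i j. before ?o i j-->te j<=te i"
    unfolding e te_def by (rule prefix_antimono) (use dist in simp)
   from hw_height[OF hw' this vw[unfolded I_def] v(2)]
   obtain k :: nat where k: "height I te (La(a := La a - 1, b := La b + 1)) La = of_nat k" unfolding I_def by blast
   have "height I te (La(a := La a - 1, b := La b + 1)) La = (SUM k:I. if k = a then - 1 else 0)"
    unfolding height_def using dist by (intro sum.cong refl) (auto simp: te_def)
   also have "... = - 1" using ab by (simp add: I_def)
   finally have "of_nat k = (- 1::complex)" using k by simp
   hence "of_nat (Suc k) = (0::complex)" by simp
   thus False by (simp only: of_nat_eq_0_iff)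
  qed
  have "v:sing ?o' P La" unfolding sing_def I'
  proof (intro IntI CollectI conjI allI impI vs vw)
   fix i j assume "before ?o' i j"
   from before_swap[OF dist this] show "act P i j v = 0" using v0 \<open>u = 0\<close> u_def by auto
  qed
  thus ?thesis using irr v(2) unfolding is_irr_hw_def I' by blast
 qed
 show "is_irr_hw ?o' (La(a := La a - 1, b := La b + 1)) P" if c: "odd (a + b)" "c~=0"
 proof -
  have nz: "u~=0" using uab z[OF ab(1,2)] c(2) v(2) by (metis cvec.scale_eq_0_iff)
  have "act P b a u + act P b a u = 0" using supermoduleD(6)[OF P ab(2,1) ab(2,1) vs] ab(3) c(1) by (simp add: u_def sg_def add.commute)
  hence "(1 + 1) *\<^sub>C act P b a u = 0" unfolding scaleC_add_left scaleC_one .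
  hence "act P b a u = 0" by (simp only: cvec.scale_eq_0_iff) simp
  hence "u:sing ?o' P (La(a := La a - 1, b := La b + 1))" unfolding sing_def I'
  proof (intro IntI CollectI conjI allI impI us uw)
   fix i j assume "before ?o' i j"
   from before_swap[OF dist this] show "act P i j u = 0" using u0 \<open>act P b a u = 0\<close> by auto
  qed
  thus ?thesis using irr nz unfolding is_irr_hw_def I' by blast
 qed
qed

text \<open>Equal parities and equal weights give \<open>c = 0\<close> in \<open>odd_swap\<close>,
  so the exchange leaves the highest weight as it is.\<close>

lemma move_front:
 assumes "is_irr_hw (pre @ xs @ s # post) La P" "distinct (pre @ xs @ s # post)" "!!t. t:set xs==>even (t + s) & La t = La s"
 shows "is_irr_hw (pre @ s # xs @ post) La P" using assms
proof (induction xs arbitrary: post rule: rev_induct)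
 case (snoc t xs)
 have "is_irr_hw ((pre @ xs) @ s # t # post) La P" by (rule odd_swap(1)) (use snoc.prems in \<open>auto simp: sg_def\<close>)
 hence "is_irr_hw (pre @ s # xs @ (t # post)) La P" by (intro snoc.IH) (use snoc.prems in auto)
 thus ?case by simp
qed simp

lemma move_back:
 assumes "is_irr_hw (pre @ s # xs @ post) La P" "distinct (pre @ s # xs @ post)" "!!t. t:set xs==>even (t + s) & La t = La s"
 shows "is_irr_hw (pre @ xs @ s # post) La P" using assms
proof (induction xs arbitrary: pre)
 case (Cons t xs)
 have "is_irr_hw (pre @ t # s # (xs @ post)) La P"
  by (rule odd_swap(1)) (use Cons.prems in \<open>auto simp: sg_def add.commute\<close>)
 hence "is_irr_hw ((pre @ [t]) @ xs @ s # post) La P" by (intro Cons.IH) (use Cons.prems in auto)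
 thus ?case by simp
qed simp

text \<open>Every \<open>s\<close> of the block can be brought to the front without changing the
  weight. Its indicator is then an admissible \<open>te\<close>, with height
  \<open>La s - ny s\<close>.\<close>

lemma max_weight:
 assumes hw: "is_irr_hw (xs @ post) La P" and dist: "distinct (xs @ post)" and c: "!!t. t:set xs==>even (t + s) & La t = La s" and s: "s:set xs"
  and u: "u:wt_space (set (xs @ post)) P ny" "u~=0"
 shows "EX k::nat. ny s = La s - of_nat k"
proof -
 obtain ys zs where xs: "xs = ys @ s # zs" using s by (meson split_list)
 have hw': "is_irr_hw ([] @ s # ys @ (zs @ post)) La P"
 proof (rule move_front)
  show "is_irr_hw ([] @ ys @ s # zs @ post) La P" "distinct ([] @ ys @ s # zs @ post)" using hw dist xs by simp_all
  show "even (t + s) & La t = La s" if "t:set ys" for t by (rule c) (use that xs in simp)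
 qed
 define te where "te = (%k. if k:set [s] then 1 else 0::int)"
 have e: "[] @ s # ys @ (zs @ post) = [s] @ (ys @ zs @ post)" by simp
 have th: "ALL i j. before ([] @ s # ys @ (zs @ post)) i j-->te j<=te i"
  unfolding e te_def by (rule prefix_antimono) (use dist xs in auto)
 have set: "set ([] @ s # ys @ (zs @ post)) = set (xs @ post)" using xs by auto
 obtain k :: nat where "height (set (xs @ post)) te La ny = of_nat k"
  using hw_height[OF hw' th, unfolded set, OF u] by blast
 moreover have "height (set (xs @ post)) te La ny = (SUM c:set (xs @ post). if c = s then La c - ny c else 0)"
  unfolding height_def by (rule sum.cong) (auto simp: te_def)
 ultimately have "La s - ny s = of_nat k" using s by simp
 hence "ny s = La s - of_nat k" by (simp add: algebra_simps)
 thus ?thesis ..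
qed

text \<open>Dually, \<open>s\<close> is brought to the end, where minus its indicator is
  admissible.\<close>

lemma min_weight:
 assumes hw: "is_irr_hw (pre @ xs) La P" and dist: "distinct (pre @ xs)" and c: "!!t. t:set xs==>even (t + s) & La t = La s" and s: "s:set xs"
  and u: "u:wt_space (set (pre @ xs)) P ny" "u~=0"
 shows "EX k::nat. ny s = La s + of_nat k"
proof -
 obtain ys zs where xs: "xs = ys @ s # zs" using s by (meson split_list)
 have hw': "is_irr_hw ((pre @ ys) @ zs @ s # []) La P"
 proof (rule move_back)
  show "is_irr_hw ((pre @ ys) @ s # zs @ []) La P" "distinct ((pre @ ys) @ s # zs @ [])" using hw dist xs by simp_all
  show "even (t + s) & La t = La s" if "t:set zs" for t by (rule c) (use that xs in simp)
 qed
 define te where "te = (%k. if k:set [s] then -1 else 0::int)"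
 have e: "(pre @ ys) @ zs @ s # [] = ((pre @ ys) @ zs) @ [s]" by simp
 have th: "ALL i j. before ((pre @ ys) @ zs @ s # []) i j-->te j<=te i"
  unfolding e te_def by (rule suffix_antimono) (use dist xs in auto)
 have set: "set ((pre @ ys) @ zs @ s # []) = set (pre @ xs)" using xs by auto
 obtain k :: nat where "height (set (pre @ xs)) te La ny = of_nat k" using hw_height[OF hw' th, unfolded set, OF u] by blast
 moreover have "height (set (pre @ xs)) te La ny = (SUM c:set (pre @ xs). if c = s then ny c - La c else 0)"
  unfolding height_def by (rule sum.cong) (auto simp: te_def)
 ultimately have "ny s - La s = of_nat k" using s by simp
 hence "ny s = La s + of_nat k" by (simp add: algebra_simps)
 thus ?thesis ..
qed

text \<open>A constant \<open>te\<close> is admissible with either sign, so the height and its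
  negative are both natural numbers.\<close>

lemma hw_total:
 assumes hw: "is_irr_hw ord La P" and u: "u:wt_space (set ord) P ny" "u~=0"
 shows "(SUM c:set ord. ny c) = (SUM c:set ord. La c)"
proof -
 obtain k :: nat where k: "height (set ord) (%_. 1) La ny = of_nat k" using hw_height[OF hw _ u, of "%_. 1"] by auto
 obtain h :: nat where h: "height (set ord) (%_. -1) La ny = of_nat h" using hw_height[OF hw _ u, of "%_. -1"] by auto
 have "height (set ord) (%_. -1) La ny = - height (set ord) (%_. 1) La ny" by (simp add: height_def sum_negf[symmetric])
 hence "of_nat (h + k) = (0::complex)" using k h by simp
 hence "k = 0" by (simp only: of_nat_eq_0_iff)
 thus ?thesis using k by (simp add: height_def sum_subtractf)
qed

text \<open>The change of the two weights under an odd reflection: none if they add up to 0,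
  otherwise the odd root is subtracted.\<close>

abbreviation (input) odd_step :: "complex=>complex=>complex=>complex=>bool" where
 "odd_step u v u' v' == (if u + v = 0 then u' = u & v' = v else u' = u - 1 & v' = v + 1)"

lemma odd_reflection:
 assumes hw: "is_irr_hw (xs @ a # b # ys) La P" and dist: "distinct (xs @ a # b # ys)" and odd: "odd (a + b)"
  and step: "odd_step (La a) (La b) A B"
 shows "is_irr_hw (xs @ b # a # ys) (La(a := A, b := B)) P"
proof -
 have c: "La a - sg (a + b) (a + b) (La b) = La a + La b" using odd by (simp add: sg_def)
 show ?thesis
 proof (cases "La a + La b = 0")
  case True
  hence "La(a := A, b := B) = La" using step by (simp add: fun_eq_iff)
  thus ?thesis using odd_swap(1)[OF hw dist] True c by simp
 next
  case False
  thus ?thesis using odd_swap(2)[OF hw dist odd] step c by simp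
 qed
qed

lemma set_upt1: "set [1..<Suc p] = {1..p}" by auto

text \<open>A single \<open>y\<close> passes to the left through \<open>x p\<close>, ...,
  \<open>x 1\<close>. \<open>C k\<close> is its weight after \<open>k\<close> exchanges,
  \<open>A i\<close> and \<open>B i\<close> are those of \<open>x i\<close> before and after. The
  claim describes the state after \<open>n\<close> exchanges.\<close>

lemma pass_one:
 assumes hw: "is_irr_hw (pre @ map x [1..<Suc p] @ y # post) La P" and dist: "distinct (pre @ map x [1..<Suc p] @ y # post)"
  and odd: "!!i. i:{1..p}==>odd (x i + y)"
  and A: "!!i. i:{1..p}==>La (x i) = A i" and C: "La y = C 0"
  and step: "!!i. i:{1..p}==>odd_step (A i) (C (p - i)) (B i) (C (p - i + 1))"
  and n: "n<=p"
 shows "EX La'. is_irr_hw (pre @ map x [1..<Suc (p - n)] @ y # map x [Suc (p - n)..<Suc p] @ post) La' P &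
  (ALL i:{1..p - n}. La' (x i) = A i) & (ALL i:{p - n<..p}. La' (x i) = B i) & La' y = C n &
  (ALL c. c~=y-->c~:x ` {1..p}-->La' c = La c)" using n
proof (induction n)
 case 0
 thus ?case using hw A C by auto
next
 case (Suc n)
 define i where "i = p - n"
 have i: "i:{1..p}" "p - i = n" "p - Suc n = i - 1" "Suc (i - 1) = i" using Suc.prems by (auto simp: i_def)
 from Suc obtain La' where L: "is_irr_hw (pre @ map x [1..<Suc i] @ y # map x [Suc i..<Suc p] @ post) La' P"
  "ALL k:{1..i}. La' (x k) = A k" "ALL k:{i<..p}. La' (x k) = B k" "La' y = C n" "ALL c. c~=y-->c~:x ` {1..p}-->La' c = La c"
  unfolding i_def by auto
 have s1: "map x [1..<Suc i] = map x [1..<i] @ [x i]" using i by simp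
 have "[i..<Suc p] = i # [Suc i..<Suc p]" by (rule upt_conv_Cons) (use i in simp)
 hence s2: "map x [i..<Suc p] = x i # map x [Suc i..<Suc p]" by simp
 have split: "map x [1..<Suc p] = map x [1..<i] @ x i # map x [Suc i..<Suc p]"
 proof -
  have "[1..<Suc p] = [1..<i] @ [i..<Suc p]" using upt_add_eq_append[of 1 i "Suc p - i"] i by simp
  thus ?thesis using s2 by simp
 qed
 have e: "pre @ map x [1..<Suc i] @ y # map x [Suc i..<Suc p] @ post = (pre @ map x [1..<i]) @ x i # y # (map x [Suc i..<Suc p] @ post)"
  unfolding s1 by simp
 have d: "distinct ((pre @ map x [1..<i]) @ x i # y # (map x [Suc i..<Suc p] @ post))"
  using dist unfolding split by (simp only: append_assoc append_Cons distinct_append distinct.simps set_append list.set) blast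
 have "is_irr_hw ((pre @ map x [1..<i]) @ y # x i # (map x [Suc i..<Suc p] @ post)) (La'(x i := B i, y := C (Suc n))) P"
  by (rule odd_reflection[OF L(1)[unfolded e] d odd[OF i(1)]]) (use step[OF i(1)] L(2,4) i in auto)
 hence hw': "is_irr_hw (pre @ map x [1..<Suc (p - Suc n)] @ y # map x [Suc (p - Suc n)..<Suc p] @ post) (La'(x i := B i, y := C (Suc n))) P"
  unfolding i(3,4) s2 by simp
 have ne: "x k~=x i & x k~=y" if "k:{1..p}" "k~=i" for k
 proof -
  have "inj_on x {1..p}" "y~:x ` {1..p}"
   using dist by (simp_all only: distinct_append distinct_map set_append set_map set_upt1 list.set) blast+
  thus ?thesis using that i(1) unfolding inj_on_def by blast
 qed
 have yi: "x i~=y" using d by auto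
 show ?case
 proof (intro exI conjI ballI allI impI)
  show "is_irr_hw (pre @ map x [1..<Suc (p - Suc n)] @ y # map x [Suc (p - Suc n)..<Suc p] @ post) (La'(x i := B i, y := C (Suc n))) P" by (rule hw')
  show "(La'(x i := B i, y := C (Suc n))) (x k) = A k" if "k:{1..p - Suc n}" for k using L(2) ne[of k] that i by auto
  show "(La'(x i := B i, y := C (Suc n))) (x k) = B k" if "k:{p - Suc n<..p}" for k
   using L(3) ne[of k] that i yi by (cases "k = i") auto
  show "(La'(x i := B i, y := C (Suc n))) y = C (Suc n)" by simp
  show "(La'(x i := B i, y := C (Suc n))) c = La c" if "c~=y" "c~:x ` {1..p}" for c
   using L(5) that i(1) by auto
 qed
qed

text \<open>\<open>X i j\<close> is the weight of \<open>x i\<close> after the first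
  \<open>j\<close> of the \<open>y\<close> have passed it, \<open>Y j k\<close> that of
  \<open>y j\<close> after it has passed \<open>k\<close> of the \<open>x\<close>. When
  \<open>x i\<close> and \<open>y j\<close> are exchanged, \<open>j - 1\<close> others have passed
  \<open>x i\<close>, and \<open>y j\<close> has passed the \<open>p - i\<close> entries behind
  \<open>x i\<close>.\<close>

theorem block_move:
 assumes hw: "is_irr_hw (pre @ map x [1..<Suc p] @ map y [1..<Suc s] @ post) La P"
  and dist: "distinct (pre @ map x [1..<Suc p] @ map y [1..<Suc s] @ post)"
  and odd: "!!i j. i:{1..p}==>j:{1..s}==>odd (x i + y j)"
  and X: "!!i. i:{1..p}==>La (x i) = X i 0" and Y: "!!j. j:{1..s}==>La (y j) = Y j 0"
  and step: "!!i j. i:{1..p}==>j:{1..s}==>odd_step (X i (j - 1)) (Y j (p - i)) (X i j) (Y j (p - i + 1))"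
 shows "EX La'. is_irr_hw (pre @ map y [1..<Suc s] @ map x [1..<Suc p] @ post) La' P &
  (ALL i:{1..p}. La' (x i) = X i s) & (ALL j:{1..s}. La' (y j) = Y j p) &
  (ALL c. c~:x ` {1..p}-->c~:y ` {1..s}-->La' c = La c)"
proof -
 have "EX La'. is_irr_hw (pre @ map y [1..<Suc n] @ map x [1..<Suc p] @ map y [Suc n..<Suc s] @ post) La' P &
  (ALL i:{1..p}. La' (x i) = X i n) & (ALL j:{1..n}. La' (y j) = Y j p) & (ALL j:{n<..s}. La' (y j) = Y j 0) &
  (ALL c. c~:x ` {1..p}-->c~:y ` {1..s}-->La' c = La c)" if "n<=s" for n
  using that
 proof (induction n)
  case 0
  thus ?case using hw X Y by auto
 next
  case (Suc n)
  define j where "j = Suc n"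
  have j: "j:{1..s}" "j - 1 = n" using Suc.prems by (auto simp: j_def)
  from Suc obtain La' where L: "is_irr_hw (pre @ map y [1..<Suc n] @ map x [1..<Suc p] @ map y [Suc n..<Suc s] @ post) La' P"
   "ALL i:{1..p}. La' (x i) = X i n" "ALL j:{1..n}. La' (y j) = Y j p" "ALL j:{n<..s}. La' (y j) = Y j 0"
   "ALL c. c~:x ` {1..p}-->c~:y ` {1..s}-->La' c = La c" by auto
  have "[j..<Suc s] = j # [Suc j..<Suc s]" by (rule upt_conv_Cons) (use j in simp)
  hence s2: "map y [j..<Suc s] = y j # map y [Suc j..<Suc s]" by simp
  have s1: "map y [1..<Suc j] = map y [1..<Suc n] @ [y j]" by (simp add: j_def)
  have split: "map y [1..<Suc s] = map y [1..<Suc n] @ y j # map y [Suc j..<Suc s]"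
  proof -
   have "[1..<Suc s] = [1..<j] @ [j..<Suc s]" using upt_add_eq_append[of 1 j "Suc s - j"] j by simp
   thus ?thesis using s2 by (simp add: j_def)
  qed
  have e: "pre @ map y [1..<Suc n] @ map x [1..<Suc p] @ map y [Suc n..<Suc s] @ post =
   (pre @ map y [1..<Suc n]) @ map x [1..<Suc p] @ y j # (map y [Suc j..<Suc s] @ post)" using s2 by (simp add: j_def)
  have d: "distinct ((pre @ map y [1..<Suc n]) @ map x [1..<Suc p] @ y j # (map y [Suc j..<Suc s] @ post))"
  proof -
   have "distinct (pre @ B @ (A @ z # C) @ post)==>distinct ((pre @ A) @ B @ z # (C @ post))" for A B C :: "int list" and z by auto
   thus ?thesis using dist unfolding split .
  qed
  have "EX La''. is_irr_hw ((pre @ map y [1..<Suc n]) @ map x [1..<Suc (p - p)] @ y j # map x [Suc (p - p)..<Suc p] @ (map y [Suc j..<Suc s] @ post)) La'' P &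
   (ALL i:{1..p - p}. La'' (x i) = X i n) & (ALL i:{p - p<..p}. La'' (x i) = X i j) & La'' (y j) = Y j p &
   (ALL c. c~=y j-->c~:x ` {1..p}-->La'' c = La' c)"
  proof (rule pass_one[OF L(1)[unfolded e] d, where A = "%i. X i n" and B = "%i. X i j" and C = "Y j"])
   show "odd (x i + y j)" if "i:{1..p}" for i by (rule odd[OF that j(1)])
   show "La' (x i) = X i n" if "i:{1..p}" for i using L(2) that by blast
   show "La' (y j) = Y j 0" using L(4) j by auto
   show "odd_step (X i n) (Y j (p - i)) (X i j) (Y j (p - i + 1))" if "i:{1..p}" for i using step[OF that j(1)] unfolding j(2) .
  qed simp
  then obtain La'' where M: "is_irr_hw ((pre @ map y [1..<Suc n]) @ map x [1..<Suc (p - p)] @ y j # map x [Suc (p - p)..<Suc p] @ (map y [Suc j..<Suc s] @ post)) La'' P"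
   "ALL i:{p - p<..p}. La'' (x i) = X i j" "La'' (y j) = Y j p"
   "ALL c. c~=y j-->c~:x ` {1..p}-->La'' c = La' c" by blast
  have e2: "(pre @ map y [1..<Suc n]) @ map x [1..<Suc (p - p)] @ y j # map x [Suc (p - p)..<Suc p] @ (map y [Suc j..<Suc s] @ post)
   = pre @ map y [1..<Suc j] @ map x [1..<Suc p] @ map y [Suc j..<Suc s] @ post" unfolding s1 by simp
  have ne: "y k~=y j & y k~:x ` {1..p}" if "k:{1..s}" "k~=j" for k
  proof -
   have "inj_on y {1..s}" "x ` {1..p} Int y ` {1..s} = {}"
    using dist by (simp_all only: distinct_append distinct_map set_append set_map set_upt1) blast+
   thus ?thesis using that j(1) unfolding inj_on_def by blast
  qed
  have "is_irr_hw (pre @ map y [1..<Suc j] @ map x [1..<Suc p] @ map y [Suc j..<Suc s] @ post) La'' P" using M(1) unfolding e2 .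
  moreover have "ALL i:{1..p}. La'' (x i) = X i j" using M(2) by auto
  moreover have "ALL k:{1..j}. La'' (y k) = Y k p"
  proof
   fix k assume k: "k:{1..j}"
   show "La'' (y k) = Y k p" using M(3,4) L(3) ne[of k] k j by (cases "k = j") (auto simp: j_def)
  qed
  moreover have "ALL k:{j<..s}. La'' (y k) = Y k 0" using M(4) L(4) ne by (auto simp: j_def)
  moreover have "ALL c. c~:x ` {1..p}-->c~:y ` {1..s}-->La'' c = La c"
  proof (intro allI impI)
   fix c assume c: "c~:x ` {1..p}" "c~:y ` {1..s}"
   hence "c~=y j" using j(1) by blast
   thus "La'' c = La c" using M(4) L(5) c by metis
  qed
  ultimately show ?case unfolding j_def by blast
 qed
 from this[of s] show ?thesis by auto
qed

section \<open>Partitions and weights\<close>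

definition is_part :: "(nat=>nat)=>bool" where
 "is_part ny \<longleftrightarrow> (ALL i j. 1<=i-->i<=j-->ny j<=ny i) & (EX B. ALL i>B. ny i = 0)"

lemma is_partD: "is_part ny==>1<=i==>i<=j==>ny j<=ny i"
 by (auto simp: is_part_def)

lemma is_part_finite: "is_part ny==>finite {i. 1<=i & 1<=j & j<=ny i}"
proof -
 assume "is_part ny"
 then obtain B where B: "!!i. B < i==>ny i = 0" by (auto simp: is_part_def)
 have "{i. 1<=i & 1<=j & j<=ny i}<={..B}"
 proof
  fix i assume i: "i:{i. 1<=i & 1<=j & j<=ny i}"
  show "i:{..B}"
  proof (rule ccontr)
   assume "i~:{..B}"
   hence "ny i = 0" using B by simp
   thus False using i by auto
  qed
 qed
 thus ?thesis by (rule finite_subset) simp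
qed

text \<open>Both sides say that the box in row \<open>k\<close> and column \<open>j\<close> lies in
  the diagram. This Galois connection is the working form of conjugation in what follows.\<close>

lemma conj_ge:
 assumes ny: "is_part ny" and j: "1<=j" and k: "1<=k"
 shows "k<=conj_part ny j \<longleftrightarrow> j<=ny k"
proof
 assume "j<=ny k"
 hence "{1..k}<={i. 1<=i & 1<=j & j<=ny i}" using is_partD[OF ny, of _ k] j by (auto intro: order.trans)
 from card_mono[OF is_part_finite[OF ny] this] show "k<=conj_part ny j" by (simp add: conj_part_def)
next
 assume h: "k<=conj_part ny j"
 show "j<=ny k"
 proof (rule ccontr)
  assume n: "~ j<=ny k"
  have "{i. 1<=i & 1<=j & j<=ny i}<={1..<k}"
  proof
   fix i assume i: "i:{i. 1<=i & 1<=j & j<=ny i}"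
   have "i < k"
   proof (rule ccontr)
    assume "~ i < k"
    hence "ny i<=ny k" using is_partD[OF ny k] by simp
    thus False using i n by simp
   qed
   thus "i:{1..<k}" using i by simp
  qed
  from card_mono[OF _ this] have "conj_part ny j<=k - 1" by (simp add: conj_part_def)
  thus False using h k by simp
 qed
qed

lemma conj_eqI: "(!!k. 1<=k==>k<=(x::nat) \<longleftrightarrow> k<=y)==>x = y"
 by (metis One_nat_def Suc_leI le_antisym linorder_not_less not_less_eq_eq order_refl zero_order(2) le0 neq0_conv)

lemma is_part_conj:
 assumes ny: "is_part ny" shows "is_part (conj_part ny)" unfolding is_part_def
proof (intro conjI allI impI)
 fix i j :: nat assume "1<=i" "i<=j"
 thus "conj_part ny j<=conj_part ny i" unfolding conj_part_def by (intro card_mono is_part_finite[OF ny]) auto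
next
 have "conj_part ny i = 0" if "ny 1 < i" for i
 proof (rule ccontr)
  assume "conj_part ny i~=0"
  hence "1<=conj_part ny i" by simp
  hence "i<=ny 1" using conj_ge[OF ny, of i 1] that by simp
  thus False using that by simp
 qed
 thus "EX B. ALL i>B. conj_part ny i = 0" by blast
qed

lemma conj_conj: "is_part ny==>1<=k==>conj_part (conj_part ny) k = ny k"
 by (rule conj_eqI) (simp add: conj_ge is_part_conj)

lemma part_length_conj: "part_length ny = conj_part ny 1"
proof -
 have "{i. 1<=i & ny i~=0} = {i. 1<=i & 1<=(1::nat) & 1<=ny i}" by auto
 thus ?thesis by (simp add: part_length_def conj_part_def)
qed

lemma gen_partsD: "la:gen_parts p q m n d==>1<=i==>i<=j==>j<=d==>la j<=la i"
 by (auto simp: gen_parts_def)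

lemma is_part_plus: "la:gen_parts p q m n d==>is_part (plus_part d la)"
 unfolding is_part_def by (auto simp: plus_part_def intro!: exI[of _ d] nat_mono gen_partsD)

lemma is_part_minus:
 assumes "la:gen_parts p q m n d" shows "is_part (minus_part d la)" unfolding is_part_def
proof (intro conjI allI impI)
 fix i j :: nat assume "1<=i" "i<=j"
 show "minus_part d la j<=minus_part d la i"
 proof (cases "j<=d")
  case True
  have "la (d + 1 - i)<=la (d + 1 - j)" by (rule gen_partsD[OF assms]) (use \<open>1 \<le> i\<close> \<open>i \<le> j\<close> True in linarith)+
  thus ?thesis using \<open>1 \<le> i\<close> \<open>i \<le> j\<close> True by (simp add: minus_part_def)
 qed (simp add: minus_part_def)
qed (auto simp: minus_part_def intro!: exI[of _ d])

text \<open>The two numbers count the negative and the positive entries of the sequence of length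
  \<open>d\<close>, and these are at different places.\<close>

lemma conj_plus_minus:
 assumes la: "la:gen_parts p q m n d"
 shows "conj_part (minus_part d la) 1 + conj_part (plus_part d la) 1<=d"
proof (rule ccontr)
 define s t where "s = conj_part (minus_part d la) 1" and "t = conj_part (plus_part d la) 1"
 assume "~ conj_part (minus_part d la) 1 + conj_part (plus_part d la) 1<=d"
 hence st: "d < s + t" by (simp add: s_def t_def)
 have S: "s>=1==>1<=minus_part d la s" using conj_ge[OF is_part_minus[OF la], of 1 s] by (simp add: s_def)
 have T: "t>=1==>1<=plus_part d la t" using conj_ge[OF is_part_plus[OF la], of 1 t] by (simp add: t_def)
 have Sd: "s>=1==>s<=d & la (d + 1 - s) < 0" using S by (auto simp: minus_part_def split: if_splits)
 have Td: "t>=1==>t<=d & la t > 0" using T by (auto simp: plus_part_def split: if_splits)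
 have "s>=1" "t>=1" using st Sd Td by linarith+
 hence "la t<=la (d + 1 - s)" by (intro gen_partsD[OF la]) (use Sd Td st in linarith)+
 thus False using Sd Td \<open>s \<ge> 1\<close> \<open>t \<ge> 1\<close> by linarith
qed

lemma minus_bound:
 assumes la: "la:gen_parts p q m n d" and k: "q < k"
 shows "conj_part (minus_part d la) k<=p"
proof (rule ccontr)
 assume "~ conj_part (minus_part d la) k<=p"
 hence "k<=minus_part d la (p + 1)" using conj_ge[OF is_part_minus[OF la], of k "p + 1"] k by simp
 thus False using la k by (auto simp: minus_part_def gen_parts_def split: if_splits)
qed

lemma plus_bound:
 assumes la: "la:gen_parts p q m n d" and k: "m < k"
 shows "plus_part d la k<=n"
proof -
 have "plus_part d la k<=plus_part d la (m + 1)" by (rule is_partD[OF is_part_plus[OF la]]) (use k in auto)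
 also have "... <= n" using la by (auto simp: plus_part_def gen_parts_def)
 finally show ?thesis .
qed

text \<open>Each of the two pieces decreases as a conjugate partition or its complement; where they
  meet, at \<open>r\<close>, the inequality is \<open>conj_plus_minus\<close>.\<close>

lemma mu_conj_part:
 assumes la: "la:gen_parts p q m n d"
 shows "is_part (mu_conj r d la)" unfolding is_part_def
proof (intro conjI allI impI)
 note a = is_part_conj[OF is_part_minus[OF la]] and b = is_part_conj[OF is_part_plus[OF la]]
 fix i j :: nat assume ij: "1<=i" "i<=j"
 consider "j<=r" | "i<=r" "r < j" | "r < i" by linarith
 thus "mu_conj r d la j<=mu_conj r d la i"
 proof cases
  case 1
  thus ?thesis using is_partD[OF a, of "r + 1 - j" "r + 1 - i"] ij by (simp add: mu_conj_def diff_le_mono2)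
 next
  case 2
  have "conj_part (minus_part d la) (r + 1 - i)<=conj_part (minus_part d la) 1" using is_partD[OF a, of 1 "r + 1 - i"] 2 by simp
  moreover have "conj_part (plus_part d la) (j - r)<=conj_part (plus_part d la) 1" using is_partD[OF b, of 1 "j - r"] 2 by simp
  ultimately show ?thesis using conj_plus_minus[OF la] 2 by (simp add: mu_conj_def)
 next
  case 3
  thus ?thesis using is_partD[OF b, of "i - r" "j - r"] ij by (simp add: mu_conj_def)
 qed
next
 obtain B where B: "!!i. B < i==>conj_part (plus_part d la) i = 0"
  using is_part_conj[OF is_part_plus[OF la]] by (auto simp: is_part_def)
 show "EX B. ALL i>B. mu_conj r d la i = 0" by (rule exI[of _ "B + r"]) (auto simp: mu_conj_def intro!: B)
qed

lemma mu_part: "la:gen_parts p q m n d==>is_part (mu_part r d la)"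
 unfolding mu_part_def by (intro is_part_conj mu_conj_part)

lemma conj_mu_part: "la:gen_parts p q m n d==>1<=j==>conj_part (mu_part r d la) j = mu_conj r d la j"
 unfolding mu_part_def by (intro conj_conj mu_conj_part)

lemma mu_part_ge:
 assumes la: "la:gen_parts p q m n d" and i: "1<=i" and k: "1<=k"
 shows "k<=mu_part r d la i \<longleftrightarrow> i<=mu_conj r d la k"
 unfolding mu_part_def by (rule conj_ge[OF mu_conj_part[OF la] i k])

text \<open>Without its first \<open>r\<close> columns, the diagram has the columns of
  \<open>plus_part d la\<close> left.\<close>

lemma mu_part_minus_r:
 assumes la: "la:gen_parts p q m n d" and i: "1<=i"
 shows "mu_part r d la i - r = plus_part d la i"
proof (rule conj_eqI)
 fix k :: nat assume k: "1<=k"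
 have "k<=mu_part r d la i - r \<longleftrightarrow> k + r<=mu_part r d la i" using k by linarith
 also have "... \<longleftrightarrow> i<=conj_part (plus_part d la) k"
  using mu_part_ge[OF la i, of "k + r" r] k by (simp add: mu_conj_def)
 also have "... \<longleftrightarrow> k<=plus_part d la i" by (rule conj_ge[OF is_part_plus[OF la] k i])
 finally show "k<=mu_part r d la i - r \<longleftrightarrow> k<=plus_part d la i" .
qed

section \<open>Values of the weights and decompositions of the orders\<close>

lemma ev_od [simp]: "ev s = ev t \<longleftrightarrow> s = t" "od s = od t \<longleftrightarrow> s = t" "ev s~=od t" "od t~=ev s"
 "even (ev s)" "odd (od s)" unfolding ev_def od_def by presburger+

lemma sum_eps:
 fixes A :: "nat set"
 shows "(SUM s:A. c s *\<^sub>C eps (g s)) x = (SUM s:A. if g s = x then c s else 0)"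
proof -
 have "(SUM s:A. f s) x = (SUM s:A. f s x)" for f :: "nat=>int=>complex"
  by (induction A rule: infinite_finite_induct) auto
 from this[of "%s. c s *\<^sub>C eps (g s)"] show ?thesis by (auto simp: scaleC_fun_def scaleC_complex_def eps_def intro!: sum.cong)
qed

lemma sum_eps1: "(SUM s:(A::nat set). eps (g s)) x = (SUM s:A. if g s = x then 1 else 0)"
 using sum_eps[of "%_. 1" g A x] by (simp add: scaleC_one)

lemma ring_wt_value:
 "1<=k==>k<=p==>ring_wt p q m n d la (ev (- int k)) = - of_nat (minus_part d la k - q) - of_nat d"
 "1<=k==>k<=q==>ring_wt p q m n d la (od (1 - int k)) = of_nat d - of_nat (conj_part (minus_part d la) k)"
 "1<=k==>k<=m==>ring_wt p q m n d la (ev (int k)) = of_nat (plus_part d la k)"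
 "1<=k==>k<=n==>ring_wt p q m n d la (od (int k)) = of_nat (conj_part (plus_part d la) k - m)"
proof -
 have ap: "(f - g) x = f x - g x" "(f + g) x = f x + g x" "(- f) x = - f x" "(c *\<^sub>C f) x = c*f x" for f g :: "int=>complex" and x c
  by (simp_all add: scaleC_fun_def scaleC_complex_def)
 have e: "1 - int s = int t \<longleftrightarrow> False" "int t = 1 - int s \<longleftrightarrow> False" if "s>=1" "t>=1" for s t using that by auto
 have z: "(\<Sum>s=1..N. if g s = x then c s else 0) = (0::complex)" if "!!s. s:{1..N}==>g s~=x" for N g x and c :: "nat=>complex"
  by (rule sum.neutral) (use that in auto)
 have dl: "(\<Sum>s=1..N. if g s = g k then c s else 0) = (c k::complex)" if "k:{1..N}" "inj g" for N k c and g :: "nat=>int"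
  using that by (simp add: inj_eq)
 have inj: "inj (%s. ev (- int s))" "inj (%s. od (1 - int s))" "inj (%s. ev (int s))" "inj (%s. od (int s))"
  by (auto simp: inj_def)
 show "1<=k==>k<=p==>ring_wt p q m n d la (ev (- int k)) = - of_nat (minus_part d la k - q) - of_nat d"
  unfolding ring_wt_def ap sum_eps sum_eps1
  by (simp add: dl[OF _ inj(1), of k] z[of _ "%s. od (1 - int s)"] z[of _ "%s. ev (int s)"] z[of _ "%s. od (int s)"])
 show "1<=k==>k<=q==>ring_wt p q m n d la (od (1 - int k)) = of_nat d - of_nat (conj_part (minus_part d la) k)"
  unfolding ring_wt_def ap sum_eps sum_eps1
  by (simp add: dl[OF _ inj(2), of k] z[of _ "%s. ev (- int s)"] z[of _ "%s. ev (int s)"] z[of _ "%s. od (int s)"])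
 show "1<=k==>k<=m==>ring_wt p q m n d la (ev (int k)) = of_nat (plus_part d la k)"
  unfolding ring_wt_def ap sum_eps sum_eps1
  by (simp add: dl[OF _ inj(3), of k] z[of _ "%s. ev (- int s)"] z[of _ "%s. od (1 - int s)"] z[of _ "%s. od (int s)"])
 show "1<=k==>k<=n==>ring_wt p q m n d la (od (int k)) = of_nat (conj_part (plus_part d la) k - m)"
  unfolding ring_wt_def ap sum_eps sum_eps1
  by (simp add: dl[OF _ inj(4), of k] z[of _ "%s. ev (- int s)"] z[of _ "%s. od (1 - int s)"] z[of _ "%s. ev (int s)"])
qed

lemma part_wt_value:
 "1<=k==>k<=b==>tilde_wt a b ny (od (int k - int b)) = of_nat (conj_part ny k)"
 "1<=k==>k<=a==>tilde_wt a b ny (ev (int k)) = of_nat (ny k - b)"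
 "1<=k==>k<=b==>bar_wt a b ny (od (int k - int b)) = of_nat (conj_part ny k - a)"
 "1<=k==>k<=a==>bar_wt a b ny (ev (int k)) = of_nat (ny k)"
 "a < k==>bar_wt a b ny (ev (int k)) = 0"
proof -
 have ap: "(f + g) x = f x + g x" for f g :: "int=>complex" and x by simp
 have z: "(\<Sum>s=1..N. if g s = x then c s else 0) = (0::complex)" if "!!s. s:{1..N}==>g s~=x" for N g x and c :: "nat=>complex"
  by (rule sum.neutral) (use that in auto)
 have dl: "(\<Sum>s=1..N. if g s = g k then c s else 0) = (c k::complex)" if "k:{1..N}" "inj g" for N k c and g :: "nat=>int"
  using that by (simp add: inj_eq)
 have inj: "inj (%s. od (int s - int b))" "inj (%s. ev (int s))" by (auto simp: inj_def)
 show "1<=k==>k<=b==>tilde_wt a b ny (od (int k - int b)) = of_nat (conj_part ny k)"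
  "1<=k==>k<=b==>bar_wt a b ny (od (int k - int b)) = of_nat (conj_part ny k - a)"
  unfolding tilde_wt_def bar_wt_def ap sum_eps by (simp_all add: dl[OF _ inj(1), of k] z[of _ "%s. ev (int s)"])
 show "1<=k==>k<=a==>tilde_wt a b ny (ev (int k)) = of_nat (ny k - b)"
  "1<=k==>k<=a==>bar_wt a b ny (ev (int k)) = of_nat (ny k)"
  unfolding tilde_wt_def bar_wt_def ap sum_eps by (simp_all add: dl[OF _ inj(2), of k] z[of _ "%s. od (int s - int b)"])
 show "a < k==>bar_wt a b ny (ev (int k)) = 0"
  unfolding bar_wt_def ap sum_eps by (simp add: z[of _ "%s. od (int s - int b)"] z[of _ "%s. ev (int s)"])
qed

lemma upto_map: "[a + 1..a + int p] = map (%i. a + int i) [1..<Suc p]"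
proof (induction p)
 case (Suc p)
 have "[a + 1..a + int (Suc p)] = [a + 1..a + int p] @ [a + int (Suc p)]" using upto_rec2[of "a + 1" "a + int (Suc p)"] by simp
 also have "... = map (%i. a + int i) ([1..<Suc p] @ [Suc p])" unfolding Suc by simp
 also have "[1..<Suc p] @ [Suc p] = [1..<Suc (Suc p)]" by simp
 finally show ?case .
qed simp

lemma upto_append: "[a + 1..a + int p] @ [a + int p + 1..a + int p + int s] = [a + 1..a + int (p + s)]"
proof (induction s)
 case (Suc s)
 have "[a + int p + 1..a + int p + int (Suc s)] = [a + int p + 1..a + int p + int s] @ [a + int p + int (Suc s)]"
  using upto_rec2[of "a + int p + 1" "a + int p + int (Suc s)"] by (simp add: algebra_simps)
 moreover have "[a + 1..a + int (p + Suc s)] = [a + 1..a + int (p + s)] @ [a + int p + int (Suc s)]"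
  using upto_rec2[of "a + 1" "a + int (p + Suc s)"] by (simp add: algebra_simps)
 ultimately show ?case using Suc by (simp only: append_assoc[symmetric])
qed simp

lemma distinct_orders:
 "distinct (idx p q m n)" "distinct (theta_order r)" "distinct (pi_order r r')" "r<=r'==>distinct (theta'_order r r')"
 "m<=r==>q<=r==>distinct (sigma_order p q m n r)"
proof -
 have inj: "inj_on ev A" "inj_on od A" for A by (auto simp: inj_on_def)
 show "distinct (idx p q m n)" "distinct (theta_order r)" "distinct (pi_order r r')" "r<=r'==>distinct (theta'_order r r')"
  "m<=r==>q<=r==>distinct (sigma_order p q m n r)"
  unfolding idx_def theta_order_def pi_order_def theta'_order_def sigma_order_def by (auto simp: distinct_map inj)
qed

lemma idx_lists:
 "map ev [- int p..-1] = map (%i. ev (int i - int p - 1)) [1..<Suc p]"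
 "map od [1 - int r..0] = map (%i. od (int i - int r)) [1..<Suc r]"
 "q<=r==>map od [1 - int r..- int q] = map (%i. od (int i - int r)) [1..<Suc (r - q)]"
 "map ev [1..int m] = map (%i. ev (int i)) [1..<Suc m]"
 "map od [1..int m] = map (%i. od (int i)) [1..<Suc m]"
 "m<=r==>map ev [int m + 1..int r] = map (%i. ev (int m + int i)) [1..<Suc (r - m)]"
proof -
 show "map ev [- int p..-1] = map (%i. ev (int i - int p - 1)) [1..<Suc p]"
  using upto_map[of "- int p - 1" p] by (simp add: o_def algebra_simps del: upt_Suc)
 show "map od [1 - int r..0] = map (%i. od (int i - int r)) [1..<Suc r]"
  using upto_map[of "- int r" r] by (simp add: o_def algebra_simps del: upt_Suc)
 show "map ev [1..int m] = map (%i. ev (int i)) [1..<Suc m]" "map od [1..int m] = map (%i. od (int i)) [1..<Suc m]"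
  using upto_map[of 0 m] by (simp_all add: o_def del: upt_Suc)
 show "map od [1 - int r..- int q] = map (%i. od (int i - int r)) [1..<Suc (r - q)]" if "q<=r"
  using upto_map[of "- int r" "r - q"] that by (simp add: o_def algebra_simps of_nat_diff del: upt_Suc)
 show "map ev [int m + 1..int r] = map (%i. ev (int m + int i)) [1..<Suc (r - m)]" if "m<=r"
  using upto_map[of "int m" "r - m"] that by (simp add: o_def of_nat_diff del: upt_Suc)
qed

lemma idx_split:
 assumes "q<=r" "m<=r"
 shows "idx p r r n = map ev [- int p..-1] @ map od [1 - int r..- int q] @ map od [1 - int q..0] @ map ev [1..int m] @ map ev [int m + 1..int r] @ map od [1..int n]"
proof -
 have "[1 - int r..0] = [1 - int r..- int q] @ [1 - int q..0]"
  using upto_append[of "- int r" "r - q" q] assms by (simp add: of_nat_diff algebra_simps)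
 moreover have "[1..int r] = [1..int m] @ [int m + 1..int r]" using upto_append[of 0 m "r - m"] assms by (simp add: of_nat_diff)
 ultimately show ?thesis by (simp add: idx_def)
qed

text \<open>An odd reflection belongs to the box in row \<open>t\<close> and column
  \<open>k\<close>. Inside the diagram of \<open>a\<close> the two weights have a nonzero sum and
  one unit moves; outside it all truncated differences are 0 and nothing changes.\<close>

lemma neg_diff_step:
 fixes d :: complex
 assumes a: "is_part a" and t: "1<=t" and k: "1<=k"
 shows "odd_step (- d - of_nat (a t - k)) (d - of_nat (conj_part a k - (t - 1))) (- d - of_nat (a t - (k - 1))) (d - of_nat (conj_part a k - t))"
proof -
 have c: "t<=conj_part a k \<longleftrightarrow> k<=a t" by (rule conj_ge[OF a k t])
 have s: "(- d - of_nat x) + (d - of_nat y) = (0::complex) \<longleftrightarrow> x = 0 & y = 0" for x y :: nat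
 proof -
  have "(- d - of_nat x) + (d - of_nat y) = - (of_nat (x + y)::complex)" by simp
  thus ?thesis by (simp only: neg_equal_0_iff_equal of_nat_eq_0_iff add_is_0)
 qed
 show ?thesis
 proof (cases "k<=a t")
  case True
  hence "a t - (k - 1) = Suc (a t - k)" "conj_part a k - (t - 1) = Suc (conj_part a k - t)" using c t k by auto
  thus ?thesis unfolding s by simp
 next
  case False
  hence "a t - (k - 1) = 0" "a t - k = 0" "conj_part a k - (t - 1) = 0" "conj_part a k - t = 0" using c t k by auto
  thus ?thesis unfolding s by simp
 qed
qed

lemma pos_diff_step:
 assumes a: "is_part a" and t: "1<=t" and k: "1<=k"
 shows "odd_step (of_nat (a t - (k - 1))) (of_nat (conj_part a k - t)) (of_nat (a t - k)) (of_nat (conj_part a k - (t - 1)))"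
proof -
 have c: "t<=conj_part a k \<longleftrightarrow> k<=a t" by (rule conj_ge[OF a k t])
 have s: "of_nat x + of_nat y = (0::complex) \<longleftrightarrow> x = 0 & y = 0" for x y :: nat
  by (simp only: of_nat_add[symmetric] of_nat_eq_0_iff add_is_0)
 show ?thesis
 proof (cases "k<=a t")
  case True
  hence "a t - (k - 1) = Suc (a t - k)" "conj_part a k - (t - 1) = Suc (conj_part a k - t)" using c t k by auto
  thus ?thesis unfolding s by simp
 next
  case False
  hence "a t - (k - 1) = 0" "a t - k = 0" "conj_part a k - (t - 1) = 0" "conj_part a k - t = 0" using c t k by auto
  thus ?thesis unfolding s by simp
 qed
qed

text \<open>Two block moves: the outer negative odd indices pass the negative even ones, and the
  positive odd indices pass the even ones above \<open>m\<close>. The weights that remain at the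
  outer indices differ from the extremal values by truncations of column lengths at \<open>p\<close>
  and of row lengths at \<open>n\<close>, which vanish by the hook conditions on
  \<open>la\<close>.\<close>

lemma hw_sigma:
 assumes la: "la:gen_parts p q m n d" and r: "m<=r" "q<=r" "conj_part (plus_part d la) 1<=r" "minus_part d la 1<=r"
  and hw: "is_irr_hw (idx p r r n) (ring_wt p r r n d la) P"
 shows "EX La. is_irr_hw (sigma_order p q m n r) La P & (ALL s:set (map od [1 - int r..- int q]). La s = of_nat d) &
  (ALL s:set (map ev [int m + 1..int r]). La s = 0)"
proof -
 define La where "La = ring_wt p r r n d la"
 define a b where "a = minus_part d la" and "b = plus_part d la"
 have ap: "is_part a" "is_part b" unfolding a_def b_def using is_part_minus[OF la] is_part_plus[OF la] by auto
 have ar: "a k<=r" if "1<=k" for k using is_partD[OF ap(1) _ that] r(4) a_def by (meson le_trans order_refl)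
 have br: "conj_part b k<=r" if "1<=k" for k using is_partD[OF is_part_conj[OF ap(2)] _ that] r(3) b_def by (meson le_trans order_refl)
 define x where "x = (%i::nat. ev (int i - int p - 1))"
 define y where "y = (%i::nat. od (int i - int r))"
 define x2 where "x2 = (%i::nat. ev (int m + int i))"
 define y2 where "y2 = (%i::nat. od (int i))"
 define post where "post = map od [1 - int q..0] @ map ev [1..int m] @ map ev [int m + 1..int r] @ map od [1..int n]"
 have L1: "map ev [- int p..-1] = map x [1..<Suc p]" unfolding x_def by (rule idx_lists)
 have L2: "map od [1 - int r..- int q] = map y [1..<Suc (r - q)]" unfolding y_def by (rule idx_lists(3)[OF r(2)])
 have L3: "map ev [int m + 1..int r] = map x2 [1..<Suc (r - m)]" unfolding x2_def by (rule idx_lists(6)[OF r(1)])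
 have L4: "map od [1..int n] = map y2 [1..<Suc n]" unfolding y2_def by (rule idx_lists)
 have e: "idx p r r n = [] @ map x [1..<Suc p] @ map y [1..<Suc (r - q)] @ post" unfolding idx_split[OF r(2,1)] post_def L1 L2 by simp
 have xv: "La (x i) = - of_nat d - of_nat (a (p + 1 - i) - (r - 0))" if "i:{1..p}" for i
 proof -
  define t where "t = p + 1 - i"
  have t: "1<=t" "t<=p" "int i - int p - 1 = - int t" using that by (auto simp: t_def)
  show ?thesis using ring_wt_value(1)[OF t(1,2), of r r n d la] unfolding La_def a_def x_def t(3) t_def[symmetric] by simp
 qed
 have yv: "La (y j) = of_nat d - of_nat (conj_part a (r + 1 - j) - 0)" if "j:{1..r - q}" for j
 proof -
  define t where "t = r + 1 - j"
  have t: "1<=t" "t<=r" "int j - int r = 1 - int t" using that by (auto simp: t_def)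
  show ?thesis using ring_wt_value(2)[OF t(1,2), of p r n d la] unfolding La_def a_def y_def t(3) t_def[symmetric] by simp
 qed
 have "EX La'. is_irr_hw ([] @ map y [1..<Suc (r - q)] @ map x [1..<Suc p] @ post) La' P &
  (ALL i:{1..p}. La' (x i) = - of_nat d - of_nat (a (p + 1 - i) - (r - (r - q)))) &
  (ALL j:{1..r - q}. La' (y j) = of_nat d - of_nat (conj_part a (r + 1 - j) - p)) &
  (ALL c. c~:x ` {1..p}-->c~:y ` {1..r - q}-->La' c = La c)"
 proof (rule block_move[where X = "%i j. - of_nat d - of_nat (a (p + 1 - i) - (r - j))" and Y = "%j i. of_nat d - of_nat (conj_part a (r + 1 - j) - i)"])
  show "is_irr_hw ([] @ map x [1..<Suc p] @ map y [1..<Suc (r - q)] @ post) La P" using hw unfolding e La_def .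
  show "distinct ([] @ map x [1..<Suc p] @ map y [1..<Suc (r - q)] @ post)" using distinct_orders(1)[of p r r n] unfolding e .
  show "odd (x i + y j)" for i j by (simp add: x_def y_def)
  fix i assume i: "i:{1..p}" show "La (x i) = - of_nat d - of_nat (a (p + 1 - i) - (r - 0))" by (rule xv[OF i])
 next
  fix j assume j: "j:{1..r - q}" show "La (y j) = of_nat d - of_nat (conj_part a (r + 1 - j) - 0)" by (rule yv[OF j])
 next
  fix i j assume ij: "i:{1..p}" "j:{1..r - q}"
  \<comment> \<open>The lists run against the diagram: place \<open>i\<close> belongs to row
    \<open>p + 1 - i\<close> of \<open>a\<close>, place \<open>j\<close> to column
    \<open>r + 1 - j\<close>.\<close>
  define t k where "t = p + 1 - i" and "k = r + 1 - j"
  have n: "p + 1 - i = t" "r + 1 - j = k" "r - (j - 1) = k" "r - j = k - 1" "p - i = t - 1" "t - 1 + 1 = t" "1<=t" "1<=k"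
   using ij by (auto simp: t_def k_def)
  show "odd_step (- of_nat d - of_nat (a (p + 1 - i) - (r - (j - 1)))) (of_nat d - of_nat (conj_part a (r + 1 - j) - (p - i))) (- of_nat d - of_nat (a (p + 1 - i) - (r - j))) (of_nat d - of_nat (conj_part a (r + 1 - j) - (p - i + 1)))"
   unfolding n(1-6) by (rule neg_diff_step[OF ap(1) n(7,8)])
 qed
 then obtain La1 where L: "is_irr_hw (map y [1..<Suc (r - q)] @ map x [1..<Suc p] @ post) La1 P"
  "ALL j:{1..r - q}. La1 (y j) = of_nat d - of_nat (conj_part a (r + 1 - j) - p)"
  "ALL c. c~:x ` {1..p}-->c~:y ` {1..r - q}-->La1 c = La c" by auto
 define pre where "pre = map od [1 - int r..- int q] @ map ev [- int p..-1] @ map od [1 - int q..0] @ map ev [1..int m]"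
 have e2: "map y [1..<Suc (r - q)] @ map x [1..<Suc p] @ post = pre @ map x2 [1..<Suc (r - m)] @ map y2 [1..<Suc n] @ []"
  unfolding post_def pre_def L1[symmetric] L2[symmetric] L3[symmetric] L4[symmetric] by simp
 have x2v: "La1 (x2 i) = of_nat (b (m + i) - 0)" if "i:{1..r - m}" for i
 proof -
  have "x2 i~:x ` {1..p}" "x2 i~:y ` {1..r - q}" by (auto simp: x2_def x_def y_def)
  hence "La1 (x2 i) = La (x2 i)" using L(3) by blast
  moreover have "x2 i = ev (int (m + i))" by (simp add: x2_def)
  moreover have "1<=m + i" "m + i<=r" using that by auto
  ultimately show ?thesis using ring_wt_value(3)[of "m + i" r p r n d la] by (simp add: La_def b_def)
 qed
 have y2v: "La1 (y2 j) = of_nat (conj_part b j - (r - 0))" if "j:{1..n}" for j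
 proof -
  have "y2 j~:x ` {1..p}" "y2 j~:y ` {1..r - q}" using r(2) that by (auto simp: y2_def x_def y_def)
  hence "La1 (y2 j) = La (y2 j)" using L(3) by blast
  thus ?thesis using ring_wt_value(4)[of j n p r r d la] that by (simp add: La_def b_def y2_def)
 qed
 have d2: "distinct (pre @ map x2 [1..<Suc (r - m)] @ map y2 [1..<Suc n] @ [])"
 proof -
  have "distinct ([] @ A @ B @ C)==>distinct (B @ A @ C)" for A B C :: "int list" by auto
  from this[of "map x [1..<Suc p]" "map y [1..<Suc (r - q)]" post] show ?thesis
   using distinct_orders(1)[of p r r n] unfolding e e2[symmetric] by blast
 qed
 have "EX La'. is_irr_hw (pre @ map y2 [1..<Suc n] @ map x2 [1..<Suc (r - m)] @ []) La' P &
  (ALL i:{1..r - m}. La' (x2 i) = of_nat (b (m + i) - n)) & (ALL j:{1..n}. La' (y2 j) = of_nat (conj_part b j - (r - (r - m)))) &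
  (ALL c. c~:x2 ` {1..r - m}-->c~:y2 ` {1..n}-->La' c = La1 c)"
 proof (rule block_move[where X = "%i j. of_nat (b (m + i) - j)" and Y = "%j i. of_nat (conj_part b j - (r - i))"])
  show "is_irr_hw (pre @ map x2 [1..<Suc (r - m)] @ map y2 [1..<Suc n] @ []) La1 P" using L(1) unfolding e2 .
  show "distinct (pre @ map x2 [1..<Suc (r - m)] @ map y2 [1..<Suc n] @ [])" by (rule d2)
  show "odd (x2 i + y2 j)" for i j by (simp add: x2_def y2_def)
  fix i assume i: "i:{1..r - m}" show "La1 (x2 i) = of_nat (b (m + i) - 0)" by (rule x2v[OF i])
 next
  fix j assume j: "j:{1..n}" show "La1 (y2 j) = of_nat (conj_part b j - (r - 0))" by (rule y2v[OF j])
 next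
  fix i j assume ij: "i:{1..r - m}" "j:{1..n}"
  have n: "r - (r - m - i) = m + i" "r - (r - m - i + 1) = m + i - 1" using ij r(1) by auto
  show "odd_step (of_nat (b (m + i) - (j - 1))) (of_nat (conj_part b j - (r - (r - m - i)))) (of_nat (b (m + i) - j)) (of_nat (conj_part b j - (r - (r - m - i + 1))))"
   unfolding n by (rule pos_diff_step[OF ap(2)]) (use ij in auto)
 qed
 then obtain La2 where K: "is_irr_hw (pre @ map y2 [1..<Suc n] @ map x2 [1..<Suc (r - m)]) La2 P"
  "ALL i:{1..r - m}. La2 (x2 i) = of_nat (b (m + i) - n)"
  "ALL c. c~:x2 ` {1..r - m}-->c~:y2 ` {1..n}-->La2 c = La1 c" by auto
 have "is_irr_hw (sigma_order p q m n r) La2 P" using K(1) unfolding pre_def L3[symmetric] L4[symmetric] sigma_order_def by simp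
 moreover have "La2 s = of_nat d" if s: "s:set (map od [1 - int r..- int q])" for s
 proof -
  obtain j where j: "j:{1..r - q}" "s = y j" using s unfolding L2 set_map set_upt1 by blast
  have "s~:x2 ` {1..r - m}" "s~:y2 ` {1..n}" using j r(2) by (auto simp: x2_def y2_def y_def)
  hence "La2 s = La1 s" using K(3) by blast
  also have "... = of_nat d - of_nat (conj_part a (r + 1 - j) - p)" using L(2) j by simp
  also have "conj_part a (r + 1 - j) - p = 0" using minus_bound[OF la, of "r + 1 - j"] j(1) by (auto simp: a_def)
  finally show ?thesis by simp
 qed
 moreover have "La2 s = 0" if s: "s:set (map ev [int m + 1..int r])" for s
 proof -
  obtain i where i: "i:{1..r - m}" "s = x2 i" using s unfolding L3 set_map set_upt1 by blast
  have "b (m + i) - n = 0" using plus_bound[OF la, of "m + i"] i by (simp add: b_def)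
  thus ?thesis using K(2) i by simp
 qed
 ultimately show ?thesis by blast
qed

text \<open>The odd block is passed by the first \<open>s\<close> even indices; \<open>s = r\<close>
  leads to the order theta' and \<open>s = r'\<close> to the order pi. The partition and its
  conjugate exchange roles in \<open>pos_diff_step\<close>.\<close>

lemma hw_part_move:
 assumes mw: "is_part mw" and s: "s<=r'" and hw: "is_irr_hw (idx 0 r r' 0) (tilde_wt r' r mw) P"
 shows "EX La. is_irr_hw (map ev [1..int s] @ map od [1 - int r..0] @ map ev [int s + 1..int r']) La P &
  (ALL i:{1..r}. La (od (int i - int r)) = of_nat (conj_part mw i - s)) &
  (ALL i:{s<..r'}. La (ev (int i)) = of_nat (mw i - r))"
proof -
 define La where "La = tilde_wt r' r mw"
 define x where "x = (%i::nat. od (int i - int r))"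
 define y where "y = (%i::nat. ev (int i))"
 define post where "post = map ev [int s + 1..int r']"
 have "[1..int r'] = [1..int s] @ [int s + 1..int r']" using upto_append[of 0 s "r' - s"] s by (simp add: of_nat_diff)
 hence e: "idx 0 r r' 0 = [] @ map x [1..<Suc r] @ map y [1..<Suc s] @ post"
  unfolding x_def y_def post_def idx_lists[symmetric] by (simp add: idx_def)
 have "EX La'. is_irr_hw ([] @ map y [1..<Suc s] @ map x [1..<Suc r] @ post) La' P &
  (ALL i:{1..r}. La' (x i) = of_nat (conj_part mw i - s)) & (ALL j:{1..s}. La' (y j) = of_nat (mw j - (r - r))) &
  (ALL c. c~:x ` {1..r}-->c~:y ` {1..s}-->La' c = La c)"
 proof (rule block_move[where X = "%i j. of_nat (conj_part mw i - j)" and Y = "%j i. of_nat (mw j - (r - i))"])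
  show "is_irr_hw ([] @ map x [1..<Suc r] @ map y [1..<Suc s] @ post) La P" using hw unfolding e La_def .
  show "distinct ([] @ map x [1..<Suc r] @ map y [1..<Suc s] @ post)" using distinct_orders(1)[of 0 r r' 0] unfolding e .
  show "odd (x i + y j)" for i j by (simp add: x_def y_def)
  fix i assume i: "i:{1..r}" show "La (x i) = of_nat (conj_part mw i - 0)"
   using part_wt_value(1)[of i r r' mw] i by (simp add: La_def x_def)
 next
  fix j assume j: "j:{1..s}" show "La (y j) = of_nat (mw j - (r - 0))"
   using part_wt_value(2)[of j r' r mw] j s by (simp add: La_def y_def)
 next
  fix i j assume ij: "i:{1..r}" "j:{1..s}"
  have c: "conj_part (conj_part mw) j = mw j" by (rule conj_conj[OF mw]) (use ij in simp)
  have n: "r - (r - i) = i" "r - (r - i + 1) = i - 1" using ij by auto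
  show "odd_step (of_nat (conj_part mw i - (j - 1))) (of_nat (mw j - (r - (r - i)))) (of_nat (conj_part mw i - j)) (of_nat (mw j - (r - (r - i + 1))))"
   unfolding n using pos_diff_step[OF is_part_conj[OF mw], of i j] ij unfolding c by simp
 qed
 then obtain La' where L: "is_irr_hw ([] @ map y [1..<Suc s] @ map x [1..<Suc r] @ post) La' P"
  "ALL i:{1..r}. La' (x i) = of_nat (conj_part mw i - s)" "ALL c. c~:x ` {1..r}-->c~:y ` {1..s}-->La' c = La c" by blast
 have "is_irr_hw (map ev [1..int s] @ map od [1 - int r..0] @ map ev [int s + 1..int r']) La' P"
  using L(1) unfolding x_def y_def post_def idx_lists[symmetric] by simp
 moreover have "La' (ev (int i)) = of_nat (mw i - r)" if "i:{s<..r'}" for i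
 proof -
  have "ev (int i)~:x ` {1..r}" "ev (int i)~:y ` {1..s}" using that by (auto simp: x_def y_def)
  hence "La' (ev (int i)) = La (ev (int i))" using L(3) by blast
  thus ?thesis using part_wt_value(2)[of i r' r mw] that by (simp add: La_def)
 qed
 ultimately show ?thesis using L(2) unfolding x_def by blast
qed

section \<open>The four embeddings of tensor products\<close>

abbreviation (input) extremal :: "int list=>int list=>nat=>(int=>complex)=>bool" where
 "extremal S1 S2 k w == (ALL s:set S1. w s = osgn s k) & (ALL s:set S2. w s = 0)"

text \<open>The highest weight for \<open>ord\<close> is constant on \<open>S1\<close> and on
  \<open>S2\<close>, each of a single parity, so \<open>max_weight\<close> and
  \<open>min_weight\<close> turn it into bounds for all weights. Thus extremality has to be checked
  on the highest weight only.\<close>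

lemma weight_embeddingI:
 fixes cs S1 S2 :: "int list"
 assumes ord_def: "ord = S1 @ cs @ S2" and dist: "distinct ord" and M: "!!a. a:{1..l}==>supermodule (set cs) (M a)"
  and N: "!!a. a:{1..l}==>EX La. is_irr_hw ord La (N a) &
   extremal S1 S2 (ds a) La"
  and par: "!!s t. s:set S1==>t:set S1==>even (s + t)" "!!s t. s:set S2==>t:set S2==>even (s + t)"
  and id: "!!a. a:{1..l}==>EX X. identifies (set cs) (M a) (N a) (wt_sum (set ord) (N a) X) (f a) &
   X = {ny. extremal S1 S2 (ds a) ny}"
 shows "weight_embedding cs S1 S2 l M N f ds"
proof -
 have disj: "set S1 Int set S2 = {}" using dist by (auto simp: ord_def)
 have sub: "set cs<=set ord" by (auto simp: ord_def)
 have NM: "supermodule (set ord) (N a)" if "a:{1..l}" for a using N[OF that] is_irr_hwD(1) by blast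
 have id': "linear_on (space_of (M a)) (f a)" "bij_betw (f a) (space_of (M a)) (wt_sum (set ord) (N a) {ny. ALL s:set S1 Un set S2.
    ny s = (if s:set S2 then 0 else osgn s (ds a))})"
  "!!e. f a ` gr (M a) e<=gr (N a) e"
  "!!i j v. i:set cs==>j:set cs==>v:space_of (M a)==>f a (act (M a) i j v) = act (N a) i j (f a v)"
  if a: "a:{1..l}" for a
 proof -
  have eq: "{ny. extremal S1 S2 (ds a) ny} =
   {ny. ALL s:set S1 Un set S2. ny s = (if s:set S2 then 0 else osgn s (ds a)::complex)}"
   using disj by (auto simp: set_eq_iff disjoint_iff)
  show "linear_on (space_of (M a)) (f a)" "bij_betw (f a) (space_of (M a)) (wt_sum (set ord) (N a) {ny. ALL s:set S1 Un set S2.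
    ny s = (if s:set S2 then 0 else osgn s (ds a))})"
   "!!e. f a ` gr (M a) e<=gr (N a) e"
   "!!i j v. i:set cs==>j:set cs==>v:space_of (M a)==>f a (act (M a) i j v) = act (N a) i j (f a v)"
   using id[OF a] unfolding eq identifies_def by auto
 qed
 have hw: "EX La. is_irr_hw (S1 @ cs @ S2) La (N a) &
   (ALL s:set S1. La s = (if s:set S2 then 0 else osgn s (ds a))) & (ALL s:set S2. La s = 0)"
  if "a:{1..l}" for a using N[OF that] disj unfolding ord_def by (metis disjoint_iff)
 show ?thesis
 proof (unfold weight_embedding_def tensor_embedding_def tensor_family_def tensor_embedding_axioms_def weight_embedding_axioms_def ord_def[symmetric], intro conjI allI impI)
  show "supermodule (set cs) (M a)" if "a:{1..l}" for a by (rule M[OF that])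
  show "supermodule (set ord) (N a)" if "a:{1..l}" for a by (rule NM[OF that])
  show "set cs<=set ord" by (rule sub)
  show "linear_on (space_of (M a)) (f a)" if "a:{1..l}" for a by (rule id'(1)[OF that])
  show "inj_on (f a) (space_of (M a))" if "a:{1..l}" for a using id'(2)[OF that] unfolding bij_betw_def by (rule conjunct1)
  show "f a ` gr (M a) e<=gr (N a) e" if "a:{1..l}" for a e by (rule id'(3)[OF that])
  show "f a (act (M a) i j v) = act (N a) i j (f a v)" if "a:{1..l}" "i:set cs" "j:set cs" "v:space_of (M a)" for a i j v
   by (rule id'(4)[OF that])
  show "distinct ord" by (rule dist)
  show "space_of (N a) = cvec.span (\<Union> (range (wt_space (set ord) (N a))))" if "a:{1..l}" for a
   using N[OF that] hw_weights by blast
  show "f a ` space_of (M a) = wt_sum (set ord) (N a) {ny. ALL s:set S1 Un set S2.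
    ny s = (if s:set S2 then 0 else osgn s (ds a))}" if "a:{1..l}" for a
   using id'(2)[OF that] unfolding bij_betw_def by (rule conjunct2)
  fix a v ny s assume a: "a:{1..l}" and v: "v:wt_space (set ord) (N a) ny" "v~=0"
  obtain La where La: "is_irr_hw (S1 @ cs @ S2) La (N a)"
   "ALL s:set S1. La s = (if s:set S2 then 0 else osgn s (ds a))" "ALL s:set S2. La s = 0"
   using hw[OF a] by blast
  show "EX k. ny s = (if s:set S2 then 0 else osgn s (ds a)) - of_nat k" if s: "s:set S1"
  proof -
   have "EX k::nat. ny s = La s - of_nat k"
   proof (rule max_weight[OF La(1)])
    show "distinct (S1 @ cs @ S2)" using dist unfolding ord_def .
    show "even (t + s) & La t = La s" if "t:set S1" for t
    proof -
     have ts: "odd t \<longleftrightarrow> odd s" "t~:set S2" "s~:set S2" using par(1)[OF that s] disj that s by auto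
     hence "La t = La s" unfolding La(2)[rule_format, OF that] La(2)[rule_format, OF s] by simp
     thus ?thesis using par(1)[OF that s] by blast
    qed
   qed (use s v ord_def in auto)
   thus ?thesis unfolding La(2)[rule_format, OF s] .
  qed
  show "EX k. ny s = of_nat k" if s: "s:set S2"
  proof -
   have "EX k::nat. ny s = La s + of_nat k"
   proof (rule min_weight[where pre = "S1 @ cs"])
    show "is_irr_hw ((S1 @ cs) @ S2) La (N a)" using La(1) by simp
    show "distinct ((S1 @ cs) @ S2)" using dist unfolding ord_def by simp
    show "even (t + s) & La t = La s" if "t:set S2" for t
     using La(3)[rule_format, OF that] La(3)[rule_format, OF s] par(2)[OF that s] by simp
    show "v:wt_space (set ((S1 @ cs) @ S2)) (N a) ny" using v(1) unfolding ord_def by simp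
   qed (use s v in auto)
   thus ?thesis unfolding La(3)[rule_format, OF s] by simp
  qed
 qed
qed

lemma set_orders:
 "set (theta_order r) = set (idx 0 r r 0)" "set (pi_order r r') = set (idx 0 r r' 0)"
 "r<=r'==>set (theta'_order r r') = set (idx 0 r r' 0)"
 "q<=r==>m<=r==>set (sigma_order p q m n r) = set (idx p r r n)"
proof -
 show "set (theta_order r) = set (idx 0 r r 0)" "set (pi_order r r') = set (idx 0 r r' 0)"
  by (auto simp: theta_order_def pi_order_def idx_def)
 show "set (theta'_order r r') = set (idx 0 r r' 0)" if "r<=r'"
 proof -
  have "{1..int r'} = {1..int r} Un {int r + 1..int r'}" using that by auto
  thus ?thesis by (auto simp: theta'_order_def idx_def)
 qed
 show "set (sigma_order p q m n r) = set (idx p r r n)" if "q<=r" "m<=r"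
  unfolding idx_split[OF that] by (auto simp: sigma_order_def)
qed

lemma order_splits:
 "sigma_order p q m n r = map od [1 - int r..- int q] @ idx p q m n @ map ev [int m + 1..int r]"
 "idx p r r n = map ev [- int p..-1] @ idx 0 r r 0 @ map od [1..int n]"
 "pi_order r r' = [] @ idx 0 0 r' 0 @ map od [1 - int r..0]"
 "theta'_order r r' = [] @ theta_order r @ map ev [int r + 1..int r']"
 by (simp_all add: sigma_order_def idx_def pi_order_def theta'_order_def theta_order_def)

lemma embed_sigma:
 assumes r: "m<=r" "q<=r" "!!i. i:{1..l}==>conj_part (plus_part (ds i) (lams i)) 1<=r" "!!i. i:{1..l}==>minus_part (ds i) (lams i) 1<=r"
  and lams: "!!i. i:{1..l}==>lams i:gen_parts p q m n (ds i)"
  and L: "!!i. i:{1..l}==>is_irr_hw (idx p q m n) (w i) (L i)"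
  and L': "!!i. i:{1..l}==>is_irr_hw (idx p r r n) (ring_wt p r r n (ds i) (lams i)) (L' i)"
  and io: "!!i. i:{1..l}==>identifies (set (idx p q m n)) (L i) (L' i)
    (wt_sum (set (idx p r r n)) (L' i)
     {ny. (ALL j:{int m + 1..int r}. ny (ev j) = 0) &
       (ALL j:{1 - int r..- int q}. ny (od j) = of_nat (ds i))}) (io i)"
 shows "weight_embedding (idx p q m n) (map od [1 - int r..- int q]) (map ev [int m + 1..int r]) l L L' io ds"
proof (rule weight_embeddingI[OF order_splits(1)])
 show "distinct (sigma_order p q m n r)" by (rule distinct_orders(5)[OF r(1,2)])
 fix a assume a: "a:{1..l}"
 show "supermodule (set (idx p q m n)) (L a)" by (rule is_irr_hwD(1)[OF L[OF a]])
 show "EX La. is_irr_hw (sigma_order p q m n r) La (L' a) &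
   extremal (map od [1 - int r..- int q]) (map ev [int m + 1..int r]) (ds a) La"
  using hw_sigma[OF lams[OF a] r(1,2) r(3)[OF a] r(4)[OF a] L'[OF a]] by auto
 show "EX X. identifies (set (idx p q m n)) (L a) (L' a) (wt_sum (set (sigma_order p q m n r)) (L' a) X) (io a) &
   X = {ny. extremal (map od [1 - int r..- int q]) (map ev [int m + 1..int r]) (ds a) ny}" unfolding set_orders(4)[OF r(2,1)]
  by (rule exI, rule conjI, rule io[OF a]) auto
qed auto

lemma ring_wt_extremal:
 assumes la: "la:gen_parts p q m n d" and r: "conj_part (plus_part d la) 1<=r" "minus_part d la 1<=r"
 shows "j:{- int p..-1}==>ring_wt p r r n d la (ev j) = - of_nat d" "j:{1..int n}==>ring_wt p r r n d la (od j) = 0"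
proof -
 show "ring_wt p r r n d la (ev j) = - of_nat d" if j: "j:{- int p..-1}"
 proof -
  define k where "k = nat (- j)"
  have k: "1<=k" "k<=p" "j = - int k" using j by (auto simp: k_def)
  have "minus_part d la k<=r" using is_partD[OF is_part_minus[OF la] _ k(1)] r(2) by (meson le_trans order_refl)
  thus ?thesis using ring_wt_value(1)[OF k(1,2)] by (simp add: k(3))
 qed
 show "ring_wt p r r n d la (od j) = 0" if j: "j:{1..int n}"
 proof -
  define k where "k = nat j"
  have k: "1<=k" "k<=n" "j = int k" using j by (auto simp: k_def)
  have "conj_part (plus_part d la) k<=r" using is_partD[OF is_part_conj[OF is_part_plus[OF la]] _ k(1)] r(1) by (meson le_trans order_refl)
  thus ?thesis using ring_wt_value(4)[OF k(1,2)] by (simp add: k(3))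
 qed
qed

lemma embed_default:
 assumes r: "!!i. i:{1..l}==>conj_part (plus_part (ds i) (lams i)) 1<=r" "!!i. i:{1..l}==>minus_part (ds i) (lams i) 1<=r"
  and lams: "!!i. i:{1..l}==>lams i:gen_parts p q m n (ds i)"
  and L': "!!i. i:{1..l}==>is_irr_hw (idx p r r n) (ring_wt p r r n (ds i) (lams i)) (L' i)"
  and L'': "!!i. i:{1..l}==>is_irr_hw (idx 0 r r 0) (w i) (L'' i)"
  and ka: "!!i. i:{1..l}==>identifies (set (idx 0 r r 0)) (L'' i) (L' i)
    (wt_sum (set (idx p r r n)) (L' i)
     {ny. (ALL j:{- int p..-1}. ny (ev j) = - of_nat (ds i)) &
       (ALL j:{1..int n}. ny (od j) = 0)}) (ka i)"
 shows "weight_embedding (idx 0 r r 0) (map ev [- int p..-1]) (map od [1..int n]) l L'' L' ka ds"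
proof (rule weight_embeddingI[OF order_splits(2)])
 show "distinct (idx p r r n)" by (rule distinct_orders)
 fix a assume a: "a:{1..l}"
 show "supermodule (set (idx 0 r r 0)) (L'' a)" by (rule is_irr_hwD(1)[OF L''[OF a]])
 show "EX La. is_irr_hw (idx p r r n) La (L' a) &
   extremal (map ev [- int p..-1]) (map od [1..int n]) (ds a) La"
  by (intro exI[of _ "ring_wt p r r n (ds a) (lams a)"] conjI L'[OF a]) (auto simp: ring_wt_extremal[OF lams[OF a] r(1)[OF a] r(2)[OF a]])
 show "EX X. identifies (set (idx 0 r r 0)) (L'' a) (L' a) (wt_sum (set (idx p r r n)) (L' a) X) (ka a) &
   X = {ny. extremal (map ev [- int p..-1]) (map od [1..int n]) (ds a) ny}" by (rule exI, rule conjI, rule ka[OF a]) auto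
qed auto

lemma embed_theta':
 assumes r: "r<=r'" and mw: "!!i. i:{1..l}==>is_part (mws i)" "!!i k. i:{1..l}==>r < k==>mws i k<=r"
  and L'': "!!i. i:{1..l}==>is_irr_hw (idx 0 r r 0) (w i) (L'' i)"
  and V': "!!i. i:{1..l}==>is_irr_hw (idx 0 r r' 0) (tilde_wt r' r (mws i)) (V' i)"
  and ka: "!!i. i:{1..l}==>identifies (set (idx 0 r r 0)) (L'' i) (V' i)
    (wt_sum (set (idx 0 r r' 0)) (V' i) {ny. ALL j:{int r + 1..int r'}. ny (ev j) = 0}) (ka i)"
 shows "weight_embedding (theta_order r) [] (map ev [int r + 1..int r']) l L'' V' ka ds"
proof (rule weight_embeddingI[OF order_splits(4)])
 show "distinct (theta'_order r r')" by (rule distinct_orders(4)[OF r])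
 fix a assume a: "a:{1..l}"
 show "supermodule (set (theta_order r)) (L'' a)" unfolding set_orders by (rule is_irr_hwD(1)[OF L''[OF a]])
 obtain La where La: "is_irr_hw (theta'_order r r') La (V' a)" "ALL i:{r<..r'}. La (ev (int i)) = of_nat (mws a i - r)"
  using hw_part_move[OF mw(1)[OF a] r V'[OF a]] unfolding theta'_order_def by blast
 have "La (ev j) = 0" if j: "j:{int r + 1..int r'}" for j
 proof -
  have k: "nat j:{r<..r'}" "int (nat j) = j" using j by auto
  hence "mws a (nat j) - r = 0" using mw(2)[OF a, of "nat j"] by simp
  thus ?thesis using bspec[OF La(2) k(1)] k(2) by simp
 qed
 thus "EX La. is_irr_hw (theta'_order r r') La (V' a) &
   extremal [] (map ev [int r + 1..int r']) (ds a) La" by (intro exI[of _ La] conjI La(1)) auto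
 show "EX X. identifies (set (theta_order r)) (L'' a) (V' a) (wt_sum (set (theta'_order r r')) (V' a) X) (ka a) &
   X = {ny. extremal [] (map ev [int r + 1..int r']) (ds a) ny}" unfolding set_orders(1) set_orders(3)[OF r]
  by (rule exI, rule conjI, rule ka[OF a]) auto
qed auto

lemma wt_sum_zero:
 assumes P: "supermodule I P" and s: "s:I" and x: "x:wt_sum I P X" and X: "!!ny. ny:X==>ny s = 0"
 shows "act P s s x = 0"
proof -
 have "act P s s x:cvec.span {}"
 proof (rule span_act[OF P s s _ _ x[unfolded wt_sum_def]])
  show "(UN ny:X. wt_space I P ny)<=space_of P" using wt_spaceD(1) by blast
  show "act P s s g:cvec.span {}" if "g:(UN ny:X. wt_space I P ny)" for g
   using that wt_spaceD(2)[OF _ s] X by fastforce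
 qed
 thus ?thesis by simp
qed

text \<open>The total degree is constant on an irreducible highest weight module; comparing it for
 \<open>V\<close> and \<open>V'\<close> bounds the length of \<open>mw\<close>.\<close>

lemma length_bound:
 assumes mw: "is_part mw" and r: "1<=r"
  and V: "is_irr_hw (idx 0 0 r' 0) (bar_wt r' 0 mw) V" and V': "is_irr_hw (idx 0 r r' 0) (tilde_wt r' r mw) V'"
  and io: "identifies (set (idx 0 0 r' 0)) V V' (wt_sum (set (idx 0 r r' 0)) V' {ny. ALL j:{1 - int r..0}. ny (od j) = 0}) io"
 shows "conj_part mw 1<=r'"
proof -
 let ?I = "set (idx 0 r r' 0)"
 have I: "?I = od ` {1 - int r..0} Un ev ` {1..int r'}" by (auto simp: idx_def)
 have Iv: "set (idx 0 0 r' 0) = ev ` {1..int r'}" by (auto simp: idx_def)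
 obtain v where v: "v:sing (idx 0 0 r' 0) V (bar_wt r' 0 mw)" "v~=0" using is_irr_hwD(2)[OF V] by blast
 note vs = singD(1)[OF v(1)]
 note P' = is_irr_hwD(1)[OF V']
 have lin: "linear_on (space_of V) io" and bij: "bij_betw io (space_of V) (wt_sum ?I V' {ny. ALL j:{1 - int r..0}. ny (od j) = 0})"
  and act: "!!i j v. i:set (idx 0 0 r' 0)==>j:set (idx 0 0 r' 0)==>v:space_of V==>io (act V i j v) = act V' i j (io v)"
  using io unfolding identifies_def by auto
 have iv: "io v:wt_sum ?I V' {ny. ALL j:{1 - int r..0}. ny (od j) = 0}" using bij vs by (auto simp: bij_betw_def)
 have z: "0:space_of V" using cvec.subspace_0[OF supermoduleD(2)[OF is_irr_hwD(1)[OF V]]] .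
 have nz: "io v~=0"
 proof
  assume "io v = 0"
  hence "io v = io 0" using linear_on_zero[OF lin z] by (rule trans[OF _ sym])
  from inj_onD[OF _ this vs z] bij v(2) show False unfolding bij_betw_def by blast
 qed
 define ny where "ny k = (if even k then bar_wt r' 0 mw k else 0)" for k
 have w: "io v:wt_space ?I V' ny" unfolding wt_space_def
 proof (intro CollectI conjI ballI)
  have "wt_sum ?I V' {ny. ALL j:{1 - int r..0}. ny (od j) = 0}<=space_of V'"
   unfolding wt_sum_def by (rule cvec.span_minimal[OF _ supermoduleD(2)[OF P']]) (use wt_spaceD(1) in blast)
  thus "io v:space_of V'" using iv by blast
  fix k assume k: "k:?I"
  then consider j where "j:{1 - int r..0}" "k = od j" | "k:set (idx 0 0 r' 0)" "even k" unfolding I Iv by auto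
  thus "act V' k k (io v) = ny k *\<^sub>C io v"
  proof cases
   case 1
   have "act V' k k (io v) = 0" by (rule wt_sum_zero[OF P' k iv]) (use 1 in auto)
   thus ?thesis using 1 by (simp add: ny_def)
  next
   case 2
   have "act V' k k (io v) = io (bar_wt r' 0 mw k *\<^sub>C v)" using act[OF 2(1,1) vs] singD(3)[OF v(1) 2(1)] by simp
   thus ?thesis using 2 linear_onD(2)[OF lin vs] by (simp add: ny_def)
  qed
 qed
 have sums: "(SUM c:?I. f c) = (\<Sum>j=1..r. f (od (int j - int r))) + (\<Sum>j=1..r'. f (ev (int j)))" for f :: "int=>complex"
 proof -
  have "(SUM c:?I. f c) = (SUM c:od ` {1 - int r..0}. f c) + (SUM c:ev ` {1..int r'}. f c)"
   unfolding I by (rule sum.union_disjoint) auto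
  also have "od ` {1 - int r..0} = (%j. od (int j - int r)) ` {1..r}"
   using arg_cong[OF idx_lists(2)[of r], of set] unfolding set_map set_upto set_upt1 .
  also have "ev ` {1..int r'} = (%j. ev (int j)) ` {1..r'}"
   using arg_cong[OF idx_lists(4)[of r'], of set] unfolding set_map set_upto set_upt1 .
  also have "(SUM c:(%j. od (int j - int r)) ` {1..r}. f c) = (\<Sum>j=1..r. f (od (int j - int r)))"
   by (subst sum.reindex) (auto simp: inj_on_def)
  also have "(SUM c:(%j. ev (int j)) ` {1..r'}. f c) = (\<Sum>j=1..r'. f (ev (int j)))"
   by (subst sum.reindex) (auto simp: inj_on_def)
  finally show ?thesis .
 qed
 have "(\<Sum>j=1..r. ny (od (int j - int r))) + (\<Sum>j=1..r'. ny (ev (int j))) =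
  (\<Sum>j=1..r. tilde_wt r' r mw (od (int j - int r))) + (\<Sum>j=1..r'. tilde_wt r' r mw (ev (int j)))"
  using hw_total[OF V' w nz] unfolding sums .
 moreover have "(\<Sum>j=1..r. ny (od (int j - int r))) = 0" by (simp add: ny_def)
 moreover have "(\<Sum>j=1..r'. ny (ev (int j))) = of_nat (\<Sum>j=1..r'. mw j)"
  unfolding of_nat_sum by (rule sum.cong) (auto simp: ny_def part_wt_value)
 moreover have "(\<Sum>j=1..r. tilde_wt r' r mw (od (int j - int r))) = of_nat (\<Sum>j=1..r. conj_part mw j)"
  unfolding of_nat_sum by (rule sum.cong) (auto simp: part_wt_value)
 moreover have "(\<Sum>j=1..r'. tilde_wt r' r mw (ev (int j))) = of_nat (\<Sum>j=1..r'. mw j - r)"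
  unfolding of_nat_sum by (rule sum.cong) (auto simp: part_wt_value)
 \<comment> \<open>The total degree of \<open>V\<close> counts the boxes in the first
   \<open>r'\<close> rows; that of \<open>V'\<close> counts the first \<open>r\<close> columns and
   what the first \<open>r'\<close> rows have beyond them.\<close>
 ultimately have eq: "(\<Sum>j=1..r'. mw j) = (\<Sum>j=1..r. conj_part mw j) + (\<Sum>j=1..r'. mw j - r)"
  by (metis (no_types, lifting) add_0 of_nat_add of_nat_eq_iff)
 show ?thesis
 proof (rule ccontr)
  assume n: "~ conj_part mw 1<=r'"
  \<comment> \<open>A nonempty row \<open>r' + 1\<close> has boxes in the first \<open>r\<close>
    columns, which are counted on the right of \<open>eq\<close> but not on the left.\<close>
  have box: "(\<Sum>j=1..r. conj_part mw j)>=(\<Sum>j=1..r. card {i:{1..r' + 1}. j<=mw i})"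
   unfolding conj_part_def by (intro sum_mono card_mono is_part_finite[OF mw]) auto
  have "(\<Sum>j=1..r. card {i:{1..r' + 1}. j<=mw i}) = (\<Sum>j=1..r. \<Sum>i=1..r' + 1. if j<=mw i then 1 else 0)"
  proof (rule sum.cong[OF refl])
   have cf: "card {i:A. Q i} = (SUM i:A. if Q i then 1 else 0)" if "finite A" for A :: "nat set" and Q
    using that by (simp add: sum.If_cases Int_def)
   show "card {i:{1..r' + 1}. j<=mw i} = (\<Sum>i=1..r' + 1. if j<=mw i then 1 else 0)" for j
    by (rule cf) (rule finite_atLeastAtMost)
  qed
  also have "... = (\<Sum>i=1..r' + 1. \<Sum>j=1..r. if j<=mw i then 1 else 0)" by (rule sum.swap)
  also have "... = (\<Sum>i=1..r' + 1. min (mw i) r)"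
  proof (rule sum.cong[OF refl])
   fix i
   have "{1..r} Int {j. j<=mw i} = {1..min (mw i) r}" by auto
   thus "(\<Sum>j=1..r. if j<=mw i then 1 else 0) = min (mw i) r" by (simp add: sum.If_cases)
  qed
  also have "... = (\<Sum>i=1..r'. min (mw i) r) + min (mw (r' + 1)) r" by simp
  finally have "(\<Sum>j=1..r. conj_part mw j)>=(\<Sum>i=1..r'. min (mw i) r) + min (mw (r' + 1)) r" using box by simp
  moreover have "1<=mw (r' + 1)" using conj_ge[OF mw, of 1 "r' + 1"] n by simp
  moreover have "(\<Sum>j=1..r'. mw j) = (\<Sum>i=1..r'. min (mw i) r) + (\<Sum>j=1..r'. mw j - r)"
   unfolding sum.distrib[symmetric] by (rule sum.cong) auto
  ultimately show False using eq r by auto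
 qed
qed

text \<open>After the reflections the weights at the odd indices are column lengths truncated at
  \<open>r'\<close>; they vanish because \<open>length_bound\<close> bounds the number of rows of
  each partition.\<close>

lemma embed_pi:
 assumes r: "1<=r" and mw: "!!i. i:{1..l}==>is_part (mws i)"
  and V: "!!i. i:{1..l}==>is_irr_hw (idx 0 0 r' 0) (bar_wt r' 0 (mws i)) (V i)"
  and V': "!!i. i:{1..l}==>is_irr_hw (idx 0 r r' 0) (tilde_wt r' r (mws i)) (V' i)"
  and io: "!!i. i:{1..l}==>identifies (set (idx 0 0 r' 0)) (V i) (V' i)
    (wt_sum (set (idx 0 r r' 0)) (V' i) {ny. ALL j:{1 - int r..0}. ny (od j) = 0}) (io i)"
 shows "weight_embedding (idx 0 0 r' 0) [] (map od [1 - int r..0]) l V V' io ds"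
proof (rule weight_embeddingI[OF order_splits(3)])
 show "distinct (pi_order r r')" by (rule distinct_orders)
 fix a assume a: "a:{1..l}"
 show "supermodule (set (idx 0 0 r' 0)) (V a)" by (rule is_irr_hwD(1)[OF V[OF a]])
 have len: "conj_part (mws a) 1<=r'" by (rule length_bound[OF mw[OF a] r V[OF a] V'[OF a] io[OF a]])
 have pi: "pi_order r r' = map ev [1..int r'] @ map od [1 - int r..0] @ map ev [int r' + 1..int r']" by (simp add: pi_order_def)
 obtain La where La: "is_irr_hw (pi_order r r') La (V' a)" "ALL i:{1..r}. La (od (int i - int r)) = of_nat (conj_part (mws a) i - r')"
  using hw_part_move[OF mw[OF a] order_refl V'[OF a]] unfolding pi by blast
 have "La (od j) = 0" if j: "j:{1 - int r..0}" for j
 proof -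
  define i where "i = nat (j + int r)"
  have i: "i:{1..r}" "int i - int r = j" using j by (auto simp: i_def)
  have "conj_part (mws a) i<=conj_part (mws a) 1" by (rule is_partD[OF is_part_conj[OF mw[OF a]]]) (use i in auto)
  hence "conj_part (mws a) i - r' = 0" using len by simp
  thus ?thesis using bspec[OF La(2) i(1)] i(2) by simp
 qed
 thus "EX La. is_irr_hw (pi_order r r') La (V' a) &
   extremal [] (map od [1 - int r..0]) (ds a) La" by (intro exI[of _ La] conjI La(1)) auto
 show "EX X. identifies (set (idx 0 0 r' 0)) (V a) (V' a) (wt_sum (set (pi_order r r')) (V' a) X) (io a) &
   X = {ny. extremal [] (map od [1 - int r..0]) (ds a) ny}" unfolding set_orders(2) by (rule exI, rule conjI, rule io[OF a]) auto
qed auto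

section \<open>Transfer of eigenvectors\<close>

lemma rhom_coldet: "rhom h==>h (coldet N A f) = coldet N (%i j. h (A i j)) f"
proof -
 assume h: "rhom h"
 have "h (prod_list (map g xs)) = prod_list (map (%x. h (g x)) xs)" for g and xs :: "nat list"
  by (induction xs) (simp_all add: rhomD[OF h])
 thus ?thesis by (simp add: coldet_def rhom_sum[OF h] rhomD[OF h] rhom_of_int[OF h] col_term_def)
qed

lemma oswap_sigma: "q<=r==>m<=r==>oswap (idx p r r n) (sigma_order p q m n r)"
proof -
 assume qm: "q<=r" "m<=r"
 have b: "oswap (map ev [a..b] @ map od [c..d]) (map od [c..d] @ map ev [a..b])" for a b c d by (rule oswap_block) auto
 define A B C D where "A = map ev [- int p..-1]" "B = map od [1 - int r..- int q]" "C = map od [1 - int q..0] @ map ev [1..int m]"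
  "D = map ev [int m + 1..int r]"
 define E where "E = map od [1..int n]"
 have 1: "oswap ([] @ (A @ B) @ (C @ D @ E)) ([] @ (B @ A) @ (C @ D @ E))" by (rule oswap_cong) (simp add: A_B_C_D_def b)
 have 2: "oswap ((B @ A @ C) @ (D @ E) @ []) ((B @ A @ C) @ (E @ D) @ [])" by (rule oswap_cong) (simp add: A_B_C_D_def E_def b)
 have "oswap (A @ B @ C @ D @ E) (B @ A @ C @ E @ D)" using oswap_trans[of "B @ A @ C @ D @ E" "B @ A @ C @ E @ D" "A @ B @ C @ D @ E"] 1 2 by simp
 thus ?thesis unfolding idx_split[OF qm] sigma_order_def A_B_C_D_def E_def by simp
qed

lemma oswap_pi: "r<=r'==>oswap (pi_order r r') (theta'_order r r')"
proof -
 assume r: "r<=r'"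
 have "[1..int r'] = [1..int r] @ [int r + 1..int r']" using upto_append[of 0 r "r' - r"] r by (simp add: of_nat_diff)
 moreover have "oswap (map ev [1..int r] @ (map ev [int r + 1..int r'] @ map od [1 - int r..0]) @ [])
  (map ev [1..int r] @ (map od [1 - int r..0] @ map ev [int r + 1..int r']) @ [])" by (rule oswap_cong, rule oswap_block) auto
 ultimately show ?thesis by (simp add: pi_order_def theta'_order_def)
qed

lemma oswap_theta: "oswap (theta_order r) (idx 0 r r 0)"
proof -
 have "oswap (map ev [1..int r] @ map od [1 - int r..0]) (map od [1 - int r..0] @ map ev [1..int r])" by (rule oswap_block) auto
 thus ?thesis by (simp add: theta_order_def idx_def)
qed

lemma par_prod_const:
 "(!!x. x:set xs==>even x)==>par_prod xs u u' = u ^ length xs"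
 "(!!x. x:set xs==>odd x)==>par_prod xs u u' = u' ^ length xs"
 by (induction xs) (auto simp: par_prod_def)

lemma env_prod_carrier:
 assumes "ALL (i, j):set w. i:I & j:I"
 shows "env_prod I w:carrier (env I 1)"
proof -
 interpret E: ring_presentation "env I 1" "henv I 1" by (rule env_presentation)
 have "EX x. env_prod I w = henv I 1 x" using assms
 proof (induction w)
  case Nil
  show ?case by (rule exI[of _ 1]) (simp only: env_prod_def E.h_one foldr.simps id_apply)
 next
  case (Cons a w)
  obtain i j where a: "a = (i, j)" by (cases a)
  from Cons obtain x where x: "env_prod I w = henv I 1 x" by auto
  have "henv I 1 (fvar (1, i, j)) = env_class I 1 (word [(1, i, j)])"
   using frestr_single[of "[(1, i, j)]" "egens I 1" 1] Cons.prems a by (simp add: henv_def fvar_def scaleC_one)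
  hence "env_prod I (a # w) = henv I 1 (fvar (1, i, j)*x)"
   using x by (simp only: a env_prod_def E.h_mult foldr.simps o_apply case_prod_conv)
  thus ?case by blast
 qed
 thus ?thesis using E.h_carrier by metis
qed

section \<open>The diagonal action of the enveloping algebra on singular spaces\<close>

context tensor_family
begin

definition dg :: "int=>int=>((nat=>'v)=>complex) lin" where
 "dg i j = (\<Sum>a=1..l. trep (a, i, j))"

lemma act_dg: "v:W==>i:I==>j:I==>act (tensor_mod l M) i j v = lapp (dg i j) v"
 unfolding dg_def by (rule act_trep)

lemma act_W: "v:W==>i:I==>j:I==>act (tensor_mod l M) i j v:W"
proof -
 assume v: "v:W" "i:I" "j:I"
 have "act (tensor_mod l M) i j v = (\<Sum>a=1..l. slot_act l M a i j v)" by (simp add: tensor_mod_def)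
 thus ?thesis by (simp only:) (intro cvec.subspace_sum[OF W_subspace] slot_W v)
qed

text \<open>On \<open>W\<close> the element acts as a noncommutative polynomial \<open>Z\<close> in
  the diagonal operators \<open>dg i j\<close>, read off from the representative that
  \<open>module_act\<close> chooses. Such a polynomial commutes with whatever commutes with all
  \<open>dg i j\<close>, in particular with the coefficients of the Berezinian.\<close>

lemma module_act_lin:
 assumes X: "X:carrier (env I 1)"
 obtains Z where "!!v. v:W==>module_act (tensor_mod l M) X v = lapp Z v"
  "!!T. (!!i j. i:I==>j:I==>dg i j*T = T*dg i j)==>Z*T = T*Z"
proof -
 interpret F: ring_presentation "env_free I 1" "frestr (egens I 1)" by (rule free_alg_presentation)
 interpret ideal "env_ideal I 1" "env_free I 1" by (rule env_ideal)
 obtain g where g: "g:carrier (env_free I 1)" "X = env_ideal I 1 +>\<^bsub>env_free I 1\<^esub> g"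
  using X unfolding env_def FactRing_def A_RCOSETS_def' by auto
 have "g:X" unfolding g(2) by (rule a_rcos_self[OF g(1)])
 define f where "f = (SOME f. f:X)"
 have "f:X" unfolding f_def by (rule someI[of "%f. f:X", OF \<open>g \<in> X\<close>])
 then obtain h where h: "h:env_ideal I 1" "f = h \<oplus>\<^bsub>env_free I 1\<^esub> g" unfolding g(2) a_r_coset_def' by auto
 have "h:carrier (env_free I 1)" using h(1) a_subset by auto
 hence f: "f:carrier (env_free I 1)" unfolding h(2) by (rule F.a_closed[OF _ g(1)])
 define rh where "rh = (%g::gen. dg (fst (snd g)) (snd (snd g)))"
 define Z where "Z = (\<Sum>w | f w~=0. lsc (f w)*prod_list (map rh w))"
 have words: "set w<=egens I 1" if "f w~=0" for w using f that by (auto simp: free_alg_sel)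
 show ?thesis
 proof (rule that[of Z])
  fix v assume v: "v:W"
  have fold: "foldr (%(_, i, j). act (tensor_mod l M) i j) w v:W &
   foldr (%(_, i, j). act (tensor_mod l M) i j) w v = foldr (%g. lapp (rh g)) w v" if "set w<=egens I 1" for w
   using that
  proof (induction w)
   case (Cons g w)
   obtain a i j where g: "g = (a, i, j)" by (cases g)
   have ij: "i:I" "j:I" using Cons.prems g by auto
   define u where "u = foldr (%(_, i, j). act (tensor_mod l M) i j) w v"
   have "u:W & u = foldr (%g. lapp (rh g)) w v" unfolding u_def by (rule Cons.IH) (use Cons.prems in simp)
   hence u: "u:W" "u = foldr (%g. lapp (rh g)) w v" by blast+
   have "lapp (rh g) u = act (tensor_mod l M) i j u" using act_dg[OF u(1) ij] by (simp add: g rh_def)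
   thus ?case unfolding foldr.simps o_apply u(2)[symmetric] u_def[symmetric] using act_W[OF u(1) ij] by (simp add: g)
  qed (simp add: v)
  show "module_act (tensor_mod l M) X v = lapp Z v" unfolding module_act_def env_act_def f_def[symmetric] Let_def Z_def lapp_sum
   by (rule sum.cong[OF refl]) (use fold words in \<open>auto simp: lapp_prod_list\<close>)
 next
  fix T assume T: "!!i j. i:I==>j:I==>dg i j*T = T*dg i j"
  have "prod_list (map rh w)*T = T*prod_list (map rh w)" if "set w<=egens I 1" for w using that
  proof (induction w)
   case (Cons g w)
   have "rh g*T = T*rh g" unfolding rh_def by (rule T) (use Cons.prems in auto)
   thus ?case using Cons by (simp add: mult.assoc) (simp add: mult.assoc[symmetric])
  qed simp
  hence PT: "prod_list (map rh w)*T = T*prod_list (map rh w)" if "f w~=0" for w using words[OF that] by blast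
  have "lsc (f w)*prod_list (map rh w)*T = T*(lsc (f w)*prod_list (map rh w))" if "f w~=0" for w
  proof -
   have "lsc (f w)*prod_list (map rh w)*T = (lsc (f w)*T)*prod_list (map rh w)" by (simp only: mult.assoc PT[OF that])
   also have "... = T*(lsc (f w)*prod_list (map rh w))" unfolding lsc_commute[of T, symmetric] by (simp only: mult.assoc)
   finally show ?thesis .
  qed
  thus "Z*T = T*Z" unfolding Z_def sum_distrib_left sum_distrib_right by (intro sum.cong refl) blast
 qed
qed

lemma ber_dg_commute:
 assumes "set ord = I" "distinct ord" "i:I" "j:I"
 shows "dg i j*pcoef (ber ord (gmat l ze trep)) k h = pcoef (ber ord (gmat l ze trep)) k h*dg i j"
proof -
 have rep: "env_rep (set ord) l trep" unfolding assms(1) by (rule env_rep_trep)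
 show ?thesis unfolding dg_def by (rule ber_gmat_commute[OF rep assms(2)]) (use assms in auto)
qed

lemma ber_W: "set ord<=I==>finite I==>v:W==>lapp (pcoef (ber ord (gmat l ze trep)) k h) v:W"
 by (simp only: ber_gmat pcoef_pmap[OF rhom_leval] leval_trep_W)

lemma ber_sing:
 assumes ord: "set ord = I" "distinct ord" and o: "set o' = I" and v: "v:sing o' (tensor_mod l M) w"
 shows "lapp (pcoef (ber ord (gmat l ze trep)) k h) v:sing o' (tensor_mod l M) w"
proof -
 define T where "T = pcoef (ber ord (gmat l ze trep)) k h"
 note vW = singD(1)[OF v]
 have TW: "lapp T v:W" unfolding T_def by (rule ber_W) (use ord vW in auto)
 have c: "act (tensor_mod l M) i j (lapp T v) = lapp T (act (tensor_mod l M) i j v)" if "i:I" "j:I" for i j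
  unfolding act_dg[OF TW that] act_dg[OF vW that]
  using arg_cong[OF ber_dg_commute[OF ord that, of ze k h], of "%z. lapp z v"] by (simp only: T_def lapp_ops)
 show ?thesis unfolding T_def[symmetric] sing_def wt_space_def o
 proof (intro IntI CollectI conjI allI impI ballI TW)
  fix i j assume b: "before o' i j"
  hence "i:I" "j:I" using before_set o by auto
  thus "act (tensor_mod l M) i j (lapp T v) = 0" using c singD(2)[OF v b] by simp
 next
  fix j assume "j:I"
  thus "act (tensor_mod l M) j j (lapp T v) = w j *\<^sub>C lapp T v" using c singD(3)[OF v, of j] o by simp
 qed
qed

lemma sing_scale: "set o' = I==>v:sing o' (tensor_mod l M) w==>c *\<^sub>C v:sing o' (tensor_mod l M) w"
 and sing_add: "set o' = I==>v:sing o' (tensor_mod l M) w==>u:sing o' (tensor_mod l M) w==>v + u:sing o' (tensor_mod l M) w"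
 and sing_subspace: "set o' = I==>cvec.subspace (sing o' (tensor_mod l M) w)"
proof -
 assume o: "set o' = I"
 have lin: "act (tensor_mod l M) i j (x + y) = act (tensor_mod l M) i j x + act (tensor_mod l M) i j y"
  "act (tensor_mod l M) i j (c *\<^sub>C x) = c *\<^sub>C act (tensor_mod l M) i j x" if "x:W" "y:W" "i:I" "j:I" for x y i j c
  using that cvec.subspace_add[OF W_subspace] cvec.subspace_scale[OF W_subspace] by (simp_all only: act_dg lapp_simps)
 have mem: "x:sing o' (tensor_mod l M) w \<longleftrightarrow> x:W & (ALL i j. before o' i j-->act (tensor_mod l M) i j x = 0) & (ALL j:I. act (tensor_mod l M) j j x = w j *\<^sub>C x)" for x
  by (auto simp: sing_def wt_space_def o)
 have bI: "before o' i j==>i:I & j:I" for i j using before_set o by blast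
 have s: "c *\<^sub>C v:sing o' (tensor_mod l M) w" if "v:sing o' (tensor_mod l M) w" for c v
  using that bI cvec.subspace_scale[OF W_subspace] unfolding mem by (auto simp: lin(2) scaleC_scaleC mult.commute cvec.scale_zero_right)
 have a: "v + u:sing o' (tensor_mod l M) w" if "v:sing o' (tensor_mod l M) w" "u:sing o' (tensor_mod l M) w" for v u
  unfolding mem
 proof (intro conjI allI impI ballI)
  show "v + u:W" using that unfolding mem by (intro cvec.subspace_add[OF W_subspace]) auto
  show "act (tensor_mod l M) i j (v + u) = 0" if b: "before o' i j" for i j
   using \<open>v \<in> _\<close> \<open>u \<in> _\<close> b bI[OF b] unfolding mem by (simp only: lin(1) add_0_left)
  show "act (tensor_mod l M) j j (v + u) = w j *\<^sub>C (v + u)" if "j:I" for j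
   using \<open>v \<in> _\<close> \<open>u \<in> _\<close> that unfolding mem by (simp only: lin(1) scaleC_add_right)
 qed
 show "v:sing o' (tensor_mod l M) w==>c *\<^sub>C v:sing o' (tensor_mod l M) w" by (rule s)
 show "v:sing o' (tensor_mod l M) w==>u:sing o' (tensor_mod l M) w==>v + u:sing o' (tensor_mod l M) w" by (rule a)
 have "0:sing o' (tensor_mod l M) w"
  unfolding mem using cvec.subspace_0[OF W_subspace] bI lin(2)[of 0 0 _ _ 0] by (auto simp: cvec.scale_zero_left cvec.scale_zero_right)
 thus "cvec.subspace (sing o' (tensor_mod l M) w)" using s a by (intro cvec.subspaceI)
qed

text \<open>\<open>Z\<close> commutes with the coefficients of the Berezinian and is injective on
  the first singular space, which these coefficients preserve; injectivity gives the direction from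
  the image back to \<open>v\<close>.\<close>

lemma module_act_eig:
 assumes X: "X:carrier (env I 1)" and ord: "set ord = I" "distinct ord" and o: "set o1 = I" "set o2 = I"
  and bij: "bij_betw (module_act (tensor_mod l M) X) (sing o1 (tensor_mod l M) w1) (sing o2 (tensor_mod l M) w2)"
  and v: "v:sing o1 (tensor_mod l M) w1"
 shows "eig (ber ord (gmat l ze trep)) D (module_act (tensor_mod l M) X v) \<longleftrightarrow> eig (ber ord (gmat l ze trep)) D v"
proof -
 obtain Z where Z: "!!v. v:W==>module_act (tensor_mod l M) X v = lapp Z v"
  "!!T. (!!i j. i:I==>j:I==>dg i j*T = T*dg i j)==>Z*T = T*Z"
  using module_act_lin[OF X] by blast
 note Zv = Z(1)[OF singD(1)[OF v]]
 have "lapp (pcoef (ber ord (gmat l ze trep)) k h) (lapp Z v) = d *\<^sub>C lapp Z v \<longleftrightarrow> lapp (pcoef (ber ord (gmat l ze trep)) k h) v = d *\<^sub>C v" for k h d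
 proof -
  define T where "T = pcoef (ber ord (gmat l ze trep)) k h"
  have ZT: "lapp T (lapp Z x) = lapp Z (lapp T x)" for x
   using Z(2)[of T] ber_dg_commute[OF ord, of _ _ ze k h] unfolding T_def by (metis lapp_ops(6))
  have m: "lapp T v:sing o1 (tensor_mod l M) w1" "d *\<^sub>C v:sing o1 (tensor_mod l M) w1"
   unfolding T_def by (rule ber_sing[OF ord o(1) v], rule sing_scale[OF o(1) v])
  have "lapp Z (lapp T v) = lapp Z (d *\<^sub>C v) \<longleftrightarrow> lapp T v = d *\<^sub>C v"
   using bij m Z(1)[OF singD(1)[OF m(1)]] Z(1)[OF singD(1)[OF m(2)]] unfolding bij_betw_def by (metis inj_onD)
  thus ?thesis unfolding T_def[symmetric] ZT by simp
 qed
 thus ?thesis unfolding eig_def Zv by simp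
qed

lemma module_act_linear:
 assumes X: "X:carrier (env I 1)"
 shows "linear_on W (module_act (tensor_mod l M) X)"
proof -
 obtain Z where Z: "!!v. v:W==>module_act (tensor_mod l M) X v = lapp Z v" using module_act_lin[OF X] by blast
 show ?thesis unfolding linear_on_def
 proof (intro conjI ballI allI)
  fix x y c assume x: "x:W"
  show "module_act (tensor_mod l M) X (c *\<^sub>C x) = c *\<^sub>C module_act (tensor_mod l M) X x"
   unfolding Z[OF x] Z[OF cvec.subspace_scale[OF W_subspace x]] by (rule lapp_simps)
  assume y: "y:W"
  show "module_act (tensor_mod l M) X (x + y) = module_act (tensor_mod l M) X x + module_act (tensor_mod l M) X y"
   unfolding Z[OF x] Z[OF y] Z[OF cvec.subspace_add[OF W_subspace x y]] by (rule lapp_simps)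
 qed
qed

end

text \<open>An eigenvector of the algebra is one of the coefficients of the Berezinian, and these
  make up a series by \<open>eig_exists\<close>. Conversely, induction over the generated ring
  writes each element as the class of a free element that acts on \<open>v\<close> by a
  scalar.\<close>

lemma gaudin_eigenvector:
 assumes fam: "tensor_family (set (idx p q m n)) l M" and S: "S<=space_of (tensor_mod l M)"
 shows "eigenvector (gaudin_image p q m n l ze M S) S v \<longleftrightarrow> v:S & v~=0 &
  (EX D. eig (ber (idx p q m n) (gmat l ze (tensor_family.trep (set (idx p q m n)) l M))) D v)"
proof -
 let ?I = "set (idx p q m n)"
 interpret tensor_family ?I l M by (rule fam)
 interpret E: ring_presentation "env ?I l" "henv ?I l" by (rule env_presentation)
 define B where "B = ber (idx p q m n) (gmat l ze trep)"
 have B: "pcoef B k i = leval trep (pcoef (ber (idx p q m n) (afree l ze)) k i)" for k i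
  unfolding B_def ber_gmat[OF finite_set subset_refl] pcoef_pmap[OF rhom_leval] ..
 have act: "tensor_act l M (henv ?I l x) v = lapp (leval trep x) v" if "v:S" for x v by (rule tensor_act_henv) (use that S in auto)
 show ?thesis unfolding B_def[symmetric]
 proof
  assume e: "eigenvector (gaudin_image p q m n l ze M S) S v"
  hence v: "v:S" "v~=0" by (auto simp: eigenvector_def)
  have "EX c. lapp (pcoef B k i) v = c *\<^sub>C v" for k i
  proof -
   have "ber_L p q m n l ze k i:gaudin_alg p q m n l ze" unfolding gaudin_alg_def by (rule generate_ring.incl) blast
   hence "restrict (tensor_act l M (ber_L p q m n l ze k i)) S:gaudin_image p q m n l ze M S" unfolding gaudin_image_def by (rule imageI)
   then obtain c where "restrict (tensor_act l M (ber_L p q m n l ze k i)) S v = c *\<^sub>C v" using e unfolding eigenvector_def by blast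
   thus ?thesis using v(1) act[OF v(1)] unfolding ber_L_free B by auto
  qed
  thus "v:S & v~=0 & (EX D. eig B D v)" using v eig_exists[OF v(2)] by blast
 next
  assume h: "v:S & v~=0 & (EX D. eig B D v)"
  then obtain D where v: "v:S" "v~=0" and D: "eig B D v" by blast
  have "EX x c. X = henv ?I l x & lapp (leval trep x) v = c *\<^sub>C v" if "X:gaudin_alg p q m n l ze" for X
   using that unfolding gaudin_alg_def
  proof (induction rule: generate_ring.induct)
   case one
   have "lapp (leval trep 1) v = 1 *\<^sub>C v" by (simp add: rhomD[OF rhom_leval] scaleC_one)
   thus ?case using E.h_one by metis
  next
   case (incl x)
   then consider c where "x = env_class ?I l (c *\<^sub>C word [])" | k i where "x = ber_L p q m n l ze k i" by blast
   thus ?case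
   proof cases
    case 1
    have "x = henv ?I l (fsc c)" unfolding 1 henv_def fsc_def using frestr_single[of "[]" "egens ?I l" c] by simp
    moreover have "lapp (leval trep (fsc c)) v = c *\<^sub>C v" by (simp add: leval_fvar)
    ultimately show ?thesis by blast
   next
    case 2
    thus ?thesis using D unfolding ber_L_free B[symmetric] eig_def using B by metis
   qed
  next
   case (a_inv x)
   then obtain y c where y: "x = henv ?I l y" "lapp (leval trep y) v = c *\<^sub>C v" by blast
   have "lapp (leval trep (- y)) v = (- c) *\<^sub>C v" using y(2) by (simp add: rhomD[OF rhom_leval])
   thus ?case unfolding y(1) using E.h_minus by metis
  next
   case (eng_add x x')
   then obtain y c y' c' where y: "x = henv ?I l y" "lapp (leval trep y) v = c *\<^sub>C v" "x' = henv ?I l y'" "lapp (leval trep y') v = c' *\<^sub>C v" by blast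
   have "lapp (leval trep (y + y')) v = (c + c') *\<^sub>C v" using y by (simp add: rhomD[OF rhom_leval] scaleC_add_left)
   thus ?case unfolding y(1,3) using E.h_add by metis
  next
   case (eng_mult x x')
   then obtain y c y' c' where y: "x = henv ?I l y" "lapp (leval trep y) v = c *\<^sub>C v" "x' = henv ?I l y'" "lapp (leval trep y') v = c' *\<^sub>C v" by blast
   have "lapp (leval trep (y*y')) v = (c*c') *\<^sub>C v" using y by (simp add: rhomD[OF rhom_leval] scaleC_scaleC mult.commute)
   thus ?case unfolding y(1,3) using E.h_mult by metis
  qed
  hence "EX c. tensor_act l M X v = c *\<^sub>C v" if "X:gaudin_alg p q m n l ze" for X using that act[OF v(1)] by metis
  thus "eigenvector (gaudin_image p q m n l ze M S) S v" unfolding eigenvector_def gaudin_image_def using v by auto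
 qed
qed

lemma assoc_psdo_ber:
 assumes fam: "tensor_family (set (idx p q m n)) l M" and v: "v:space_of (tensor_mod l M)" "v~=0"
  and D: "eig (ber (idx p q m n) (gmat l ze (tensor_family.trep (set (idx p q m n)) l M))) D v"
 shows "assoc_psdo l M (ber_L p q m n l ze) v = pcoef D"
proof (intro ext)
 fix k i
 interpret tensor_family "set (idx p q m n)" l M by (rule fam)
 have "tensor_act l M (ber_L p q m n l ze k i) v = pcoef D k i *\<^sub>C v"
  using D tensor_act_henv[OF v(1)] unfolding ber_L_free eig_def ber_gmat[OF finite_set subset_refl] pcoef_pmap[OF rhom_leval] by simp
 thus "assoc_psdo l M (ber_L p q m n l ze) v k i = pcoef D k i" unfolding assoc_psdo_def using v(2) by (auto intro!: the_equality)
qed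

text \<open>The column determinant is formed over the free algebra and compared with the Berezinian
  only after evaluation, where the matrix is Manin and \<open>coldet_gmat\<close> applies.\<close>

lemma assoc_psdo_cdet:
 assumes fam: "tensor_family (set (idx 0 0 N 0)) l M" and v: "v:space_of (tensor_mod l M)" "v~=0"
  and D: "eig (ber (idx 0 0 N 0) (gmat l ze (tensor_family.trep (set (idx 0 0 N 0)) l M))) D v"
 shows "assoc_psdo l M (cdet_L N l ze) v = pcoef D"
proof (intro ext)
 fix k i
 let ?I = "set (idx 0 0 N 0)"
 interpret tensor_family ?I l M by (rule fam)
 have idx: "idx 0 0 N 0 = map (%i. ev (int i)) [1..<Suc N]" unfolding idx_lists(4)[symmetric] by (simp add: idx_def)
 have I: "ev ` int ` {1..N}<=?I" by (auto simp: idx_def)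
 have "leval trep (pcoef (coldet N (%i j. afree l ze (ev (int i)) (ev (int j))) id) k i) =
  pcoef (pmap (leval trep) (coldet N (%i j. afree l ze (ev (int i)) (ev (int j))) id)) k i" by (simp add: pcoef_pmap[OF rhom_leval])
 also have "... = pcoef (coldet N (%i j. gmat l ze trep (ev (int i)) (ev (int j))) id) k i"
  unfolding rhom_coldet[OF rhom_pmap[OF rhom_leval]] gmat_def ..
 also have "... = pcoef (ber (map (%i. ev (int i)) [1..<Suc N]) (gmat l ze trep)) k i"
  unfolding coldet_gmat[OF env_rep_trep finite_set I] ..
 also have "... = pcoef (ber (idx 0 0 N 0) (gmat l ze trep)) k i" by (simp only: idx[symmetric])
 finally have "tensor_act l M (cdet_L N l ze k i) v = pcoef D k i *\<^sub>C v"
  using D tensor_act_henv[OF v(1)] unfolding cdet_L_free eig_def by simp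
 thus "assoc_psdo l M (cdet_L N l ze) v k i = pcoef D k i" unfolding assoc_psdo_def using v(2) by (auto intro!: the_equality)
qed

section \<open>Linear bijections, eigenbases and the transfer along one embedding\<close>

lemma linear_bij_inv:
 assumes S: "cvec.subspace S" and f: "linear_on S f" "bij_betw f S T"
 shows "linear_on T (inv_into S f)"
proof -
 have m: "inv_into S f y:S" "f (inv_into S f y) = y" if "y:T" for y
  using f(2) that by (auto simp: bij_betw_def inv_into_into f_inv_into_f)
 have i: "inv_into S f (f x) = x" if "x:S" for x using f(2) that by (simp add: bij_betw_def inv_into_f_f)
 show ?thesis unfolding linear_on_def
 proof (intro conjI ballI allI)
  fix x y c assume x: "x:T"
  show "inv_into S f (c *\<^sub>C x) = c *\<^sub>C inv_into S f x"
   using i[OF cvec.subspace_scale[OF S m(1)[OF x], of c]] linear_onD(2)[OF f(1) m(1)[OF x]] m(2)[OF x] by simp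
  assume y: "y:T"
  show "inv_into S f (x + y) = inv_into S f x + inv_into S f y"
   using i[OF cvec.subspace_add[OF S m(1)[OF x] m(1)[OF y]]] linear_onD(1)[OF f(1) m(1)[OF x] m(1)[OF y]] m(2)[OF x] m(2)[OF y] by simp
 qed
qed

lemma linear_image_basis:
 assumes S: "cvec.subspace S" and f: "linear_on S f" "bij_betw f S T" and B: "cvec.independent B" "cvec.span B = S"
 shows "cvec.independent (f ` B)" "cvec.span (f ` B) = T"
proof -
 obtain g where g: "clin g" "!!x. x:S==>g x = f x" using linear_on_extend[OF S f(1)] by blast
 have lg: "Vector_Spaces.linear (*\<^sub>C) (*\<^sub>C) g" using g(1) clin_linear by blast
 have BS: "B<=S" using B(2) cvec.span_superset by blast
 have gB: "g ` B = f ` B" using g(2) BS by (intro image_cong) auto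
 have gS: "g ` S = T" using g(2) f(2) by (auto simp: bij_betw_def image_iff)
 have "inj_on g (cvec.span B)" using f(2) g(2) unfolding B(2) bij_betw_def by (simp add: inj_on_def)
 from vector_space_pair.linear_independent_injective_image[OF cvec_pair lg B(1) this]
 show "cvec.independent (f ` B)" unfolding gB .
 show "cvec.span (f ` B) = T" using vector_space_pair.linear_span_image[OF cvec_pair lg, of B] unfolding gB B(2) gS by simp
qed

lemma basis_correspondence:
 assumes S: "cvec.subspace S" "cvec.subspace T" and f: "linear_on S f" "bij_betw f S T" and PQ: "!!v. v:S==>P v \<longleftrightarrow> Q (f v)"
 shows "bij_betw (%B. f ` B) {B. cvec.independent B & cvec.span B = S & (ALL v:B. P v)} {B. cvec.independent B & cvec.span B = T & (ALL v:B. Q v)}" (is "bij_betw _ ?A ?B")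
proof (rule bij_betwI[where g = "%B. inv_into S f ` B"])
 let ?g = "inv_into S f"
 have g: "linear_on T ?g" "bij_betw ?g T S" by (rule linear_bij_inv[OF S(1) f], rule bij_betw_inv_into[OF f(2)])
 have gf: "?g (f x) = x" if "x:S" for x using f(2) that by (simp add: bij_betw_def inv_into_f_f)
 have fg: "f (?g y) = y" "?g y:S" if "y:T" for y using f(2) that by (auto simp: bij_betw_def inv_into_into f_inv_into_f)
 show "(%B. f ` B):?A \<rightarrow> ?B" using linear_image_basis[OF S(1) f] PQ cvec.span_base by fastforce
 show "(%B. ?g ` B):?B \<rightarrow> ?A"
 proof
  fix B assume B: "B:?B"
  hence BT: "B<=T" using cvec.span_superset by blast
  have "P v" if "v:?g ` B" for v using that BT fg PQ B by auto
  thus "?g ` B:?A" using linear_image_basis[OF S(2) g] B by blast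
 qed
 fix B assume "B:?A"
 hence "B<=S" using cvec.span_superset by blast
 thus "?g ` f ` B = B" using gf by (force simp: image_image)
next
 let ?g = "inv_into S f"
 have fg: "f (?g y) = y" if "y:T" for y using f(2) that by (auto simp: bij_betw_def f_inv_into_f)
 fix B assume "B:?B"
 hence "B<=T" using cvec.span_superset by blast
 thus "f ` ?g ` B = B" using fg by (force simp: image_image)
qed

lemma uinv_power: "uinv x y==>uinv (x ^ n) (y ^ n)"
proof (induction n)
 case (Suc n)
 from uinv_mult[OF Suc.IH[OF Suc.prems] Suc.prems] show ?case by (simp add: power_commutes)
qed simp

lemma linear_on_comp: "linear_on S f==>f ` S<=T==>linear_on T g==>linear_on S (%x. g (f x))"
 unfolding linear_on_def by (simp add: image_subset_iff)

text \<open>The facts on one embedding in the form in which they are composed. The inverse is taken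
  on the whole small tensor product, as in the definition of \<Psi>; on the large singular space it
  agrees with the inverse between the singular spaces.\<close>

lemma embedding_transfer:
 fixes M :: "nat=>'v::complex_vector smod" and N :: "nat=>'w::complex_vector smod" and f :: "nat=>'v=>'w" and l :: nat
 defines "Ph == tensor_map l (%a. space_of (N a)) f"
 assumes E: "weight_embedding cs S1 S2 l M N f ds" and ord: "ord = S1 @ cs @ S2" and I: "set ord = I" "set cs = K"
  and bw: "ALL s:set S1. w' s = osgn s (\<Sum>a=1..l. ds a)"
   "ALL s:set S2. w' s = 0" "ALL s:set cs. w' s = w s"
  and c: "uinv (cgeom l ds ze) c'"
 shows "bij_betw Ph (sing cs (tensor_mod l M) w) (sing ord (tensor_mod l N) w')" (is "bij_betw _ ?A ?B")
  "linear_on (sing cs (tensor_mod l M) w) Ph"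
  "bij_betw (inv_into (space_of (tensor_mod l M)) Ph) (sing ord (tensor_mod l N) w') (sing cs (tensor_mod l M) w)"
  "linear_on (sing ord (tensor_mod l N) w') (inv_into (space_of (tensor_mod l M)) Ph)"
  "!!y. y:sing ord (tensor_mod l N) w'==>Ph (inv_into (space_of (tensor_mod l M)) Ph y) = y"
  "!!T D. T:sing cs (tensor_mod l M) w==>eig (ber cs (gmat l ze (tensor_family.trep K l M))) D T \<longleftrightarrow>
   eig (ber ord (gmat l ze (tensor_family.trep I l N))) (par_prod S1 (cgeom l ds ze) c'*D*par_prod S2 pd pdi) (Ph T)"
  "tensor_family K l M" "tensor_family I l N"
proof -
 interpret weight_embedding cs S1 S2 l M N f ds "set (S1 @ cs @ S2)"
  "%a s. if s:set S2 then 0 else osgn s (ds a)" by (rule E, rule Pure.reflexive, rule Pure.reflexive)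
 have FP: "F = Ph" by (simp add: F_def Ph_def)
 have dj: "set S1 Int set S2 = {}" using dist by auto
 have "bigwt w w'" unfolding bigwt_def
 proof (intro conjI ballI)
  fix s assume s: "s:set S1 Un set S2"
  have "(\<Sum>a=1..l. osgn s (ds a)) =
   (osgn s (\<Sum>a=1..l. ds a)::complex)" by (simp add: sum_negf)
  thus "w' s = (\<Sum>a=1..l. if s:set S2 then 0 else osgn s (ds a))"
   using s bw(1)[rule_format, of s] bw(2)[rule_format, of s] by (cases "s:set S2") (simp_all del: of_nat_sum)
 qed (rule bw(3)[rule_format])
 from sing_F[OF this] show b: "bij_betw Ph ?A ?B" unfolding FP ord .
 have sub: "?A<=small.W" using singD(1) by blast
 have A: "cvec.subspace ?A" by (rule small.sing_subspace) simp
 show lin: "linear_on ?A Ph" using linear_on_subset[OF clin_F] unfolding FP by blast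
 have inv: "inv_into small.W Ph y = inv_into ?A Ph y" "inv_into ?A Ph y:?A" "Ph (inv_into ?A Ph y) = y" if y: "y:?B" for y
 proof -
  show 1: "inv_into ?A Ph y:?A" "Ph (inv_into ?A Ph y) = y"
   using b y by (auto simp: bij_betw_def inv_into_into f_inv_into_f)
  show "inv_into small.W Ph y = inv_into ?A Ph y" using inv_into_f_f[OF F_inj[unfolded FP], of "inv_into ?A Ph y"] 1 sub by auto
 qed
 show "bij_betw (inv_into small.W Ph) ?B ?A"
  using bij_betw_inv_into[OF b] bij_betw_cong[of ?B "inv_into small.W Ph" "inv_into ?A Ph" ?A] inv(1) by blast
 show "linear_on ?B (inv_into small.W Ph)"
 proof -
  have l: "linear_on ?B (inv_into ?A Ph)" by (rule linear_bij_inv[OF A lin b])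
  have B: "cvec.subspace ?B" unfolding ord by (rule big.sing_subspace) simp
  show ?thesis unfolding linear_on_def
  proof (intro conjI ballI allI)
   fix x y k assume x: "x:?B"
   show "inv_into small.W Ph (k *\<^sub>C x) = k *\<^sub>C inv_into small.W Ph x"
    unfolding inv(1)[OF x] inv(1)[OF cvec.subspace_scale[OF B x]] by (rule linear_onD(2)[OF l x])
   assume y: "y:?B"
   show "inv_into small.W Ph (x + y) = inv_into small.W Ph x + inv_into small.W Ph y"
    unfolding inv(1)[OF x] inv(1)[OF y] inv(1)[OF cvec.subspace_add[OF B x y]] by (rule linear_onD(1)[OF l x y])
  qed
 qed
 show "Ph (inv_into small.W Ph y) = y" if "y:?B" for y unfolding inv(1)[OF that] by (rule inv(3)[OF that])
 show "tensor_family K l M" "tensor_family I l N" unfolding I[symmetric] ord by (unfold_locales)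
 have "uinv pd (pdi::complex psd)" by (simp add: uinv_def)
 then obtain P' Q' where w: "uinv (par_prod S1 (cgeom l ds ze) c') P'" "uinv (par_prod S2 pd pdi::complex psd) Q'"
  using uinv_par_prod[OF c] uinv_par_prod by blast
 show "eig (ber cs (gmat l ze (tensor_family.trep K l M))) D T \<longleftrightarrow>
   eig (ber ord (gmat l ze (tensor_family.trep I l N))) (par_prod S1 (cgeom l ds ze) c'*D*par_prod S2 pd pdi) (Ph T)"
  if T: "T:?A" for T D
 proof -
  let ?P = "par_prod S1 (cgeom l ds ze) c'" and ?Q = "par_prod S2 pd pdi::complex psd"
  have TW: "T:small.W" using T sub by blast
  have "P'*(?P*D*?Q)*Q' = (P'*?P)*D*(?Q*Q')" by (simp only: mult.assoc)
  hence e: "P'*(?P*D*?Q)*Q' = D" using w by (simp add: uinvD)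
  show ?thesis using eig_up[OF c TW, of D] eig_down[OF c TW _ w, of "?P*D*?Q"] unfolding e FP ord I[symmetric] by blast
 qed
qed

text \<open>As \<open>q <= r\<close> and \<open>m <= r\<close>, the exponent of \<partial> + c is a
  natural number and that of \<partial> the negative of one, so the integer powers become natural
  powers of \<open>cgeom\<close> and \<open>pdi\<close>.\<close>

lemma transfer_series:
 assumes c: "uinv (cgeom l ds ze) c'" and qm: "q<=r" "m<=(r::nat)"
 shows "((deriv_op complex_ring \<oplus>\<^bsub>cpsdo\<^esub> c_series l ds ze) [^]\<^bsub>cpsdo\<^esub> (int p - int q + int r))
    \<otimes>\<^bsub>cpsdo\<^esub> pcoef D
    \<otimes>\<^bsub>cpsdo\<^esub> (deriv_op complex_ring [^]\<^bsub>cpsdo\<^esub> (int m - int n - int r - int r'))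
  = pcoef (cgeom l ds ze ^ (p + (r - q))*D*pdi ^ (r' + n + (r - m)))"
proof -
 interpret C: ring_presentation complex_ring "%x. x" by (rule complex_presentation)
 interpret P: ring_presentation cpsdo C.hpsd by (rule C.psdo_presentation)
 have id: "C.hpsd f = pcoef f" for f by (simp add: C.hpsd_def)
 have d: "deriv_op complex_ring = C.hpsd pd" using C.hpsd_pmon[of 0 1 1] by (simp add: complex_ring_def)
 have cs: "c_series l ds ze = C.hpsd (\<Sum>a=1..l. pconst (of_nat (ds a))*pgeom (ze a))"
  unfolding id by (auto simp: fun_eq_iff c_series_def pcoef_sum pcoef_pmon_mult pcoef_pgeom)
 have e: "deriv_op complex_ring \<oplus>\<^bsub>cpsdo\<^esub> c_series l ds ze = C.hpsd (cgeom l ds ze)"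
  unfolding d cs cgeom_def by (rule P.h_add[symmetric])
 have i: "int p - int q + int r = int (p + (r - q))" "nat (int p - int q + int r) = p + (r - q)" using qm by auto
 have p1: "C.hpsd (cgeom l ds ze) [^]\<^bsub>cpsdo\<^esub> (int p - int q + int r) = C.hpsd (cgeom l ds ze ^ (p + (r - q)))"
  unfolding P.int_pow_h[OF c] using i by simp
 have pdi: "uinv (pd::complex psd) pdi" by (simp add: uinv_def)
 have p2: "C.hpsd pd [^]\<^bsub>cpsdo\<^esub> (int m - int n - int r - int r') = C.hpsd (pdi ^ (r' + n + (r - m)))"
 proof (cases "int m - int n - int r - int r' < 0")
  case True
  moreover have "nat (- (int m - int n - int r - int r')) = r' + n + (r - m)" using qm by auto
  ultimately show ?thesis unfolding P.int_pow_h[OF pdi] by simp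
 next
  case False
  hence "nat (int m - int n - int r - int r') = 0" "r' + n + (r - m) = 0" using qm by auto
  thus ?thesis unfolding P.int_pow_h[OF pdi] using False by simp
 qed
 show ?thesis unfolding e unfolding d p1 p2 unfolding id[of D, symmetric] unfolding P.h_mult[symmetric] unfolding id ..
qed

theorem theorem6p2:
  fixes p q m n l r r' d :: nat
    and \<zeta> :: "nat \<Rightarrow> complex"
    and ds :: "nat \<Rightarrow> nat"
    and lams :: "nat \<Rightarrow> nat \<Rightarrow> int"
    and lam :: "nat \<Rightarrow> int"
    and L :: "nat \<Rightarrow> 'a::complex_vector smod"
    and L' :: "nat \<Rightarrow> 'b::complex_vector smod"
    and L'' :: "nat \<Rightarrow> 'c::complex_vector smod"
    and V :: "nat \<Rightarrow> 'e::complex_vector smod"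
    and V' :: "nat \<Rightarrow> 'f::complex_vector smod"
    and \<iota>L :: "nat \<Rightarrow> 'a \<Rightarrow> 'b"
    and \<kappa>L :: "nat \<Rightarrow> 'c \<Rightarrow> 'b"
    and \<iota>V :: "nat \<Rightarrow> 'e \<Rightarrow> 'f"
    and \<kappa>V :: "nat \<Rightarrow> 'c \<Rightarrow> 'f"
    and A X Y :: "(gen list \<Rightarrow> complex) set"
    and LL :: "'a tensor smod" and LL' :: "'b tensor smod" and LL'' :: "'c tensor smod"
    and VV :: "'e tensor smod" and VV' :: "'f tensor smod"
    and \<xi> \<xi>' :: "int \<Rightarrow> complex"
    and \<mu>s :: "nat \<Rightarrow> nat \<Rightarrow> nat" and \<mu> :: "nat \<Rightarrow> nat"
    and phi :: "'b tensor \<Rightarrow> 'b tensor"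
    and theta :: "'c tensor \<Rightarrow> 'c tensor"
    and varsig :: "'f tensor \<Rightarrow> 'f tensor"
    and \<Psi> :: "'e tensor \<Rightarrow> 'a tensor"
    and SV :: "'e tensor set" and SL :: "'a tensor set"
    and AV :: "('e tensor \<Rightarrow> 'e tensor) set" and AL :: "('a tensor \<Rightarrow> 'a tensor) set"
    and D :: "'e tensor \<Rightarrow> int \<Rightarrow> int \<Rightarrow> complex"
    and calD :: "'a tensor \<Rightarrow> int \<Rightarrow> int \<Rightarrow> complex"
    and transf :: "(int \<Rightarrow> int \<Rightarrow> complex) \<Rightarrow> int \<Rightarrow> int \<Rightarrow> complex"
  assumes pqmn: "(p, q, m, n) \<noteq> (0, 0, 0, 0)"
    and l_pos: "l \<ge> 1"
    and z_distinct: "inj_on \<zeta> {1..l}"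
    and ds_pos: "\<And>i. i \<in> {1..l} \<Longrightarrow> ds i \<ge> 1"
    and d_def: "d = (\<Sum>i=1..l. ds i)"
    and lams: "\<And>i. i \<in> {1..l} \<Longrightarrow> lams i \<in> gen_parts p q m n (ds i)"
    and lam: "lam \<in> gen_parts p q m n d"
    \<comment> \<open>the modules for the given Lie superalgebra and the singular weight\<close>
    and L: "\<And>i. i \<in> {1..l} \<Longrightarrow> is_irr_hw (idx p q m n) (ring_wt p q m n (ds i) (lams i)) (L i)"
    and LL: "LL = tensor_mod l L"
    and \<xi>: "\<xi> = ring_wt p q m n d lam"
    and \<xi>_sing: "\<exists>v\<in>sing (idx p q m n) LL \<xi>. v \<noteq> 0"
    \<comment> \<open>the choice of r\<close>
    and r: "r \<ge> 1" "m \<le> r" "q \<le> r"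
      "conj_part (plus_part d lam) 1 \<le> r" "minus_part d lam 1 \<le> r"
      "\<And>i. i \<in> {1..l} \<Longrightarrow> conj_part (plus_part (ds i) (lams i)) 1 \<le> r"
      "\<And>i. i \<in> {1..l} \<Longrightarrow> minus_part (ds i) (lams i) 1 \<le> r"
    and \<mu>: "\<mu> = mu_part r d lam" "\<mu>s = (\<lambda>i. mu_part r (ds i) (lams i))"
    \<comment> \<open>the modules L' and L'' and the identifications\<close>
    and L': "\<And>i. i \<in> {1..l} \<Longrightarrow> is_irr_hw (idx p r r n) (ring_wt p r r n (ds i) (lams i)) (L' i)"
    and LL': "LL' = tensor_mod l L'"
    and \<iota>L: "\<And>i. i \<in> {1..l} \<Longrightarrow> identifies (set (idx p q m n)) (L i) (L' i)
        (wt_sum (set (idx p r r n)) (L' i)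
          {\<nu>. (\<forall>j\<in>{int m + 1..int r}. \<nu> (ev j) = 0) \<and>
              (\<forall>j\<in>{1 - int r..- int q}. \<nu> (od j) = of_nat (ds i))}) (\<iota>L i)"
    and L'': "\<And>i. i \<in> {1..l} \<Longrightarrow> is_irr_hw (idx 0 r r 0) (tilde_wt r r (\<mu>s i)) (L'' i)"
    and LL'': "LL'' = tensor_mod l L''"
    and \<kappa>L: "\<And>i. i \<in> {1..l} \<Longrightarrow> identifies (set (idx 0 r r 0)) (L'' i) (L' i)
        (wt_sum (set (idx p r r n)) (L' i)
          {\<nu>. (\<forall>j\<in>{- int p..-1}. \<nu> (ev j) = - of_nat (ds i)) \<and>
              (\<forall>j\<in>{1..int n}. \<nu> (od j) = 0)}) (\<kappa>L i)"
    \<comment> \<open>the isomorphisms given by A and X\<close>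
    and \<xi>': "\<xi>' = ext_wt p q m n r d \<xi>"
    and A: "\<exists>w. (\<forall>(i, j)\<in>set w. i \<in> set (idx p r r n) \<and> j \<in> set (idx p r r n) \<and>
                  i * j > 0 \<and> odd (i + j)) \<and> A = env_prod (set (idx p r r n)) w"
    and phi: "phi = module_act LL' A"
      "bij_betw phi (sing (idx p r r n) LL' (ring_wt p r r n d lam)) (sing (sigma_order p q m n r) LL' \<xi>')"
    and X: "\<exists>w. (\<forall>(i, j)\<in>set w. i \<in> set (idx 0 r r 0) \<and> j \<in> set (idx 0 r r 0) \<and>
                  odd (i + j)) \<and> X = env_prod (set (idx 0 r r 0)) w"
    and theta: "theta = module_act LL'' X"
      "bij_betw theta (sing (theta_order r) LL'' (bar_wt r r \<mu>)) (sing (idx 0 r r 0) LL'' (tilde_wt r r \<mu>))"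
    \<comment> \<open>the choice of r', the modules V and V', the identifications and the isomorphism given by Y\<close>
    and r': "r' \<ge> r" "part_length \<mu> \<le> r'"
    and V: "\<And>i. i \<in> {1..l} \<Longrightarrow> is_irr_hw (idx 0 0 r' 0) (bar_wt r' 0 (\<mu>s i)) (V i)"
    and VV: "VV = tensor_mod l V"
    and V': "\<And>i. i \<in> {1..l} \<Longrightarrow> is_irr_hw (idx 0 r r' 0) (tilde_wt r' r (\<mu>s i)) (V' i)"
    and VV': "VV' = tensor_mod l V'"
    and \<iota>V: "\<And>i. i \<in> {1..l} \<Longrightarrow> identifies (set (idx 0 0 r' 0)) (V i) (V' i)
        (wt_sum (set (idx 0 r r' 0)) (V' i) {\<nu>. \<forall>j\<in>{1 - int r..0}. \<nu> (od j) = 0}) (\<iota>V i)"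
    and \<kappa>V: "\<And>i. i \<in> {1..l} \<Longrightarrow> identifies (set (idx 0 r r 0)) (L'' i) (V' i)
        (wt_sum (set (idx 0 r r' 0)) (V' i) {\<nu>. \<forall>j\<in>{int r + 1..int r'}. \<nu> (ev j) = 0}) (\<kappa>V i)"
    and Y: "Y \<in> carrier (env (set (idx 0 r r' 0)) 1)"
    and varsig: "varsig = module_act VV' Y"
      "bij_betw varsig (sing (pi_order r r') VV' (bar_wt r' r \<mu>)) (sing (theta'_order r r') VV' (bar_wt r r \<mu>))"
    \<comment> \<open>the composite of varsig, theta and phi, through the identifications\<close>
    and \<Psi>: "\<Psi> = (\<lambda>v. inv_into (space_of LL) (tensor_map l (\<lambda>i. space_of (L' i)) \<iota>L)
        (phi (tensor_map l (\<lambda>i. space_of (L' i)) \<kappa>L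
          (theta (inv_into (space_of LL'') (tensor_map l (\<lambda>i. space_of (V' i)) \<kappa>V)
            (varsig (tensor_map l (\<lambda>i. space_of (V' i)) \<iota>V v)))))))"
    \<comment> \<open>the singular spaces, the Gaudin algebras acting on them, the associated operators\<close>
    and SV: "SV = sing (idx 0 0 r' 0) VV (bar_wt r' 0 \<mu>)"
    and SL: "SL = sing (idx p q m n) LL \<xi>"
    and AV: "AV = gaudin_image 0 0 r' 0 l \<zeta> V SV"
    and AL: "AL = gaudin_image p q m n l \<zeta> L SL"
    and D: "D = assoc_psdo l V (cdet_L r' l \<zeta>)"
    and calD: "calD = assoc_psdo l L (ber_L p q m n l \<zeta>)"
    and transf: "transf = (\<lambda>D0.
        ((deriv_op complex_ring \<oplus>\<^bsub>cpsdo\<^esub> c_series l ds \<zeta>) [^]\<^bsub>cpsdo\<^esub> (int p - int q + int r))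
        \<otimes>\<^bsub>cpsdo\<^esub> D0
        \<otimes>\<^bsub>cpsdo\<^esub> (deriv_op complex_ring [^]\<^bsub>cpsdo\<^esub> (int m - int n - int r - int r')))"
  shows "(\<forall>v. eigenvector AV SV v \<longrightarrow>
            eigenvector AL SL (\<Psi> v) \<and>
            apply_psdo (calD (\<Psi> v)) (\<Psi> v) = apply_psdo (transf (D v)) (\<Psi> v))
    \<and> (\<forall>w. eigenvector AL SL w \<longrightarrow>
            eigenvector AV SV (inv_into SV \<Psi> w) \<and>
            apply_psdo (calD w) (inv_into SV \<Psi> w)
              = apply_psdo (transf (D (inv_into SV \<Psi> w))) (inv_into SV \<Psi> w))
    \<and> bij_betw (\<lambda>B. \<Psi> ` B) {B. eigenbasis AV SV B} {B. eigenbasis AL SL B}"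
proof -
 obtain c' where c: "uinv (cgeom l ds \<zeta>) c'" using cgeom_inverse by blast
 have mp: "is_part \<mu>" and mps: "!!i. i:{1..l}==>is_part (\<mu>s i)"
  using mu_part[OF lam] mu_part[OF lams] unfolding \<mu> by auto
 \<comment> \<open>Beyond row \<open>r\<close> the diagram stays within the first \<open>r\<close>
   columns, because \<open>plus_part\<close> has at most \<open>r\<close> rows.\<close>
 have mps_le: "\<mu>s i k<=r" if "i:{1..l}" "r < k" for i k
 proof -
  have "plus_part (ds i) (lams i) k = 0"
  proof (rule ccontr)
   assume "plus_part (ds i) (lams i) k~=0"
   hence "k<=conj_part (plus_part (ds i) (lams i)) 1" using conj_ge[OF is_part_plus[OF lams[OF that(1)]], of 1 k] that(2) by simp
   thus False using r(6)[OF that(1)] that(2) by simp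
  qed
  thus ?thesis using mu_part_minus_r[OF lams[OF that(1)], of k r] that(2) unfolding \<mu> by simp
 qed
 let ?I' = "set (idx p r r n)" and ?K' = "set (idx 0 r r' 0)" and ?I'' = "set (idx 0 r r 0)"

 \<comment> \<open>The four embeddings and the weights that they relate\<close>
 have E1: "weight_embedding (idx p q m n) (map od [1 - int r..- int q]) (map ev [int m + 1..int r]) l L L' \<iota>L ds"
  by (rule embed_sigma[OF r(2,3,6,7) lams L L' \<iota>L])
 have E2: "weight_embedding (idx 0 r r 0) (map ev [- int p..-1]) (map od [1..int n]) l L'' L' \<kappa>L ds"
  by (rule embed_default[OF r(6,7) lams L' L'' \<kappa>L])
 have E3: "weight_embedding (theta_order r) [] (map ev [int r + 1..int r']) l L'' V' \<kappa>V ds"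
  by (rule embed_theta'[OF r'(1) mps mps_le L'' V' \<kappa>V])
 have E4: "weight_embedding (idx 0 0 r' 0) [] (map od [1 - int r..0]) l V V' \<iota>V ds" by (rule embed_pi[OF r(1) mps V V' \<iota>V])

 have ds_sum: "(of_nat (\<Sum>a=1..l. ds a)::complex) = of_nat d" unfolding d_def ..
 have o1: "ALL s:set (map od [1 - int r..- int q]). \<xi>' s = osgn s (\<Sum>a=1..l. ds a)"
  "ALL s:set (map ev [int m + 1..int r]). \<xi>' s = 0" "ALL s:set (idx p q m n). \<xi>' s = \<xi> s"
  unfolding ds_sum \<xi>' ext_wt_def by (auto simp: idx_def)
 \<comment> \<open>On the inner indices both weights describe the diagram of \<mu>: its first
   \<open>r\<close> columns at the odd indices, the rest of its rows at the even ones.\<close>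
 have o2: "ALL s:set (map ev [- int p..-1]). ring_wt p r r n d lam s = osgn s (\<Sum>a=1..l. ds a)"
  "ALL s:set (map od [1..int n]). ring_wt p r r n d lam s = 0" "ALL s:set (idx 0 r r 0). ring_wt p r r n d lam s = tilde_wt r r \<mu> s"
 proof -
  show "ALL s:set (map ev [- int p..-1]). ring_wt p r r n d lam s = osgn s (\<Sum>a=1..l. ds a)" "ALL s:set (map od [1..int n]). ring_wt p r r n d lam s = 0"
   unfolding d_def[symmetric] by (auto simp: ring_wt_extremal[OF lam r(4,5)])
  show "ALL s:set (idx 0 r r 0). ring_wt p r r n d lam s = tilde_wt r r \<mu> s"
  proof
   fix s assume s: "s:set (idx 0 r r 0)"
   consider j where "j:{1 - int r..0}" "s = od j" | j where "j:{1..int r}" "s = ev j" using s by (auto simp: idx_def)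
   thus "ring_wt p r r n d lam s = tilde_wt r r \<mu> s"
   proof cases
    case 1
    define k t where "k = nat (1 - j)" and "t = nat (j + int r)"
    have k: "1<=k" "k<=r" "j = 1 - int k" "1<=t" "t<=r" "j = int t - int r" "r + 1 - t = k" using 1 by (auto simp: k_def t_def)
    have "conj_part (minus_part d lam) k<=conj_part (minus_part d lam) 1" using is_partD[OF is_part_conj[OF is_part_minus[OF lam]] _ k(1)] by simp
    hence kd: "conj_part (minus_part d lam) k<=d" using conj_plus_minus[OF lam] by simp
    have "tilde_wt r r \<mu> s = of_nat (conj_part \<mu> t)" unfolding 1(2) k(6) by (rule part_wt_value(1)[OF k(4,5)])
    also have "conj_part \<mu> t = d - conj_part (minus_part d lam) k"
     unfolding \<mu> conj_mu_part[OF lam k(4)] using k by (simp add: mu_conj_def)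
    finally have "tilde_wt r r \<mu> s = of_nat d - of_nat (conj_part (minus_part d lam) k)" using kd by (simp add: of_nat_diff)
    thus ?thesis unfolding 1(2) k(3) ring_wt_value(2)[OF k(1,2)] by simp
   next
    case 2
    define k where "k = nat j"
    have k: "1<=k" "k<=r" "j = int k" using 2 by (auto simp: k_def)
    show ?thesis unfolding 2(2) k(3) ring_wt_value(3)[OF k(1,2)] part_wt_value(2)[OF k(1,2)] unfolding \<mu> mu_part_minus_r[OF lam k(1)] ..
   qed
  qed
 qed
 have o3: "ALL s:set (map ev [int r + 1..int r']). bar_wt r r \<mu> s = 0"
 proof
  fix s assume "s:set (map ev [int r + 1..int r'])"
  then obtain j where j: "j:{int r + 1..int r'}" "s = ev j" by auto
  define k where "k = nat j"
  have k: "r < k" "j = int k" using j by (auto simp: k_def)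
  show "bar_wt r r \<mu> s = 0" unfolding j(2) k(2) by (rule part_wt_value(5)[OF k(1)])
 qed
 have o4: "ALL s:set (map od [1 - int r..0]). bar_wt r' r \<mu> s = 0" "ALL s:set (idx 0 0 r' 0). bar_wt r' r \<mu> s = bar_wt r' 0 \<mu> s"
 proof (rule_tac [!] ballI)
  fix s
  show "bar_wt r' r \<mu> s = 0" if s: "s:set (map od [1 - int r..0])"
  proof -
   obtain j where j: "j:{1 - int r..0}" "s = od j" using s by auto
   define t where "t = nat (j + int r)"
   have t: "1<=t" "t<=r" "j = int t - int r" using j by (auto simp: t_def)
   have "conj_part \<mu> t<=conj_part \<mu> 1" using is_partD[OF is_part_conj[OF mp] _ t(1)] by simp
   hence "conj_part \<mu> t - r' = 0" using r'(2) by (simp add: part_length_conj)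
   thus ?thesis unfolding j(2) t(3) part_wt_value(3)[OF t(1,2)] by simp
  qed
  show "bar_wt r' r \<mu> s = bar_wt r' 0 \<mu> s" if s: "s:set (idx 0 0 r' 0)"
  proof -
   obtain j where j: "j:{1..int r'}" "s = ev j" using s by (auto simp: idx_def)
   define k where "k = nat j"
   have k: "1<=k" "k<=r'" "j = int k" using j by (auto simp: k_def)
   show ?thesis unfolding j(2) k(3) part_wt_value(4)[OF k(1,2)] ..
  qed
 qed

 note t1 = embedding_transfer[OF E1 order_splits(1) set_orders(4)[OF r(3,2)] refl o1 c, folded LL LL']
 note t2 = embedding_transfer[OF E2 order_splits(2) refl refl o2 c, folded LL' LL'']
 have nilS: "ALL s:set []. w' s = osgn s (\<Sum>a=1..l. ds a)" for w' :: "int=>complex" by simp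
 have ballrefl: "ALL s:Z. f s = f s" for Z :: "int set" and f :: "int=>complex" by simp
 note t3 = embedding_transfer[OF E3 order_splits(4) set_orders(3)[OF r'(1)] set_orders(1) nilS o3 ballrefl c, folded LL'' VV']
 note t4 = embedding_transfer[OF E4 order_splits(3) set_orders(2) refl nilS o4 c, folded VV VV']

 define \<Phi>1 where "\<Phi>1 = tensor_map l (%i. space_of (L' i)) \<iota>L"
 define \<Phi>2 where "\<Phi>2 = tensor_map l (%i. space_of (L' i)) \<kappa>L"
 define \<Phi>3 where "\<Phi>3 = tensor_map l (%i. space_of (V' i)) \<kappa>V"
 define \<Phi>4 where "\<Phi>4 = tensor_map l (%i. space_of (V' i)) \<iota>V"
 define G1 where "G1 = inv_into (space_of LL) \<Phi>1"
 define G3 where "G3 = inv_into (space_of LL'') \<Phi>3"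
 note t1 = t1[folded \<Phi>1_def, folded G1_def] and t2 = t2[folded \<Phi>2_def] and t3 = t3[folded \<Phi>3_def, folded G3_def] and t4 = t4[folded \<Phi>4_def]
 have \<Psi>': "\<Psi> = (%v. G1 (phi (\<Phi>2 (theta (G3 (varsig (\<Phi>4 v)))))))"
  unfolding \<Psi> G1_def G3_def \<Phi>1_def \<Phi>2_def \<Phi>3_def \<Phi>4_def ..

 \<comment> \<open>The chain of linear isomorphisms composing \<Psi>\<close>
 define Spi where "Spi = sing (pi_order r r') VV' (bar_wt r' r \<mu>)"
 define Sth' where "Sth' = sing (theta'_order r r') VV' (bar_wt r r \<mu>)"
 define Sth where "Sth = sing (theta_order r) LL'' (bar_wt r r \<mu>)"
 define S'' where "S'' = sing (idx 0 r r 0) LL'' (tilde_wt r r \<mu>)"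
 define S' where "S' = sing (idx p r r n) LL' (ring_wt p r r n d lam)"
 define Ssig where "Ssig = sing (sigma_order p q m n r) LL' \<xi>'"

 have b4: "bij_betw \<Phi>4 SV Spi" and bvs: "bij_betw varsig Spi Sth'" and b3: "bij_betw G3 Sth' Sth" and bth: "bij_betw theta Sth S''"
  and b2: "bij_betw \<Phi>2 S'' S'" and bph: "bij_betw phi S' Ssig" and b1: "bij_betw G1 Ssig SL"
  unfolding SV SL Spi_def Sth'_def Sth_def S''_def S'_def Ssig_def by (fact t4(1) varsig(2) t3(3) theta(2) t2(1) phi(2) t1(3))+
 have bij: "bij_betw \<Psi> SV SL"
 proof -
  note bij_betw_trans[OF b4 bij_betw_trans[OF bvs bij_betw_trans[OF b3 bij_betw_trans[OF bth bij_betw_trans[OF b2 bij_betw_trans[OF bph b1]]]]]]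
  thus ?thesis unfolding \<Psi>' comp_def .
 qed

 have Ac: "A:carrier (env ?I' 1)"
 proof -
  obtain w where w: "ALL (i, j):set w. i:?I' & j:?I' & i*j > 0 & odd (i + j)" "A = env_prod ?I' w" using A by blast
  show ?thesis unfolding w(2) by (rule env_prod_carrier) (use w(1) in blast)
 qed
 have Xc: "X:carrier (env ?I'' 1)"
 proof -
  obtain w where w: "ALL (i, j):set w. i:?I'' & j:?I'' & odd (i + j)" "X = env_prod ?I'' w" using X by blast
  show ?thesis unfolding w(2) by (rule env_prod_carrier) (use w(1) in blast)
 qed
 note fam' = t1(8) and fam'' = t2(7) and famV' = t4(8)
 have linp: "linear_on (space_of LL') phi" "linear_on (space_of LL'') theta" "linear_on (space_of VV') varsig"
  unfolding phi(1) theta(1) varsig(1) unfolding LL' LL'' VV'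
  by (fact tensor_family.module_act_linear[OF fam' Ac] tensor_family.module_act_linear[OF fam'' Xc] tensor_family.module_act_linear[OF famV' Y])+
 have sub: "Spi<=space_of VV'" "Sth<=space_of LL''" "S'<=space_of LL'" "SV<=space_of VV" "SL<=space_of LL"
  unfolding Spi_def Sth_def S'_def SV SL using singD(1) by blast+
 have lin: "linear_on SV \<Psi>"
 proof -
  have l4: "linear_on SV \<Phi>4" and l3: "linear_on Sth' G3" and l2: "linear_on S'' \<Phi>2" and l1: "linear_on Ssig G1"
   unfolding SV Sth'_def S''_def Ssig_def by (fact t4(2) t3(4) t2(2) t1(4))+
  note lvs = linear_on_subset[OF linp(3) sub(1)] and lth = linear_on_subset[OF linp(2) sub(2)] and lph = linear_on_subset[OF linp(1) sub(3)]
  have im: "\<Phi>4 ` SV<=Spi" "varsig ` Spi<=Sth'" "G3 ` Sth'<=Sth" "theta ` Sth<=S''" "\<Phi>2 ` S''<=S'" "phi ` S'<=Ssig"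
   using b4 bvs b3 bth b2 bph by (simp_all add: bij_betw_def)
  note linear_on_comp[OF l4 im(1) linear_on_comp[OF lvs im(2) linear_on_comp[OF l3 im(3) linear_on_comp[OF lth im(4)
   linear_on_comp[OF l2 im(5) linear_on_comp[OF lph im(6) l1]]]]]]
  thus ?thesis unfolding \<Psi>' .
 qed
 have subs: "cvec.subspace SV" "cvec.subspace SL"
  unfolding SV SL VV LL using tensor_family.sing_subspace[OF t4(7) refl] tensor_family.sing_subspace[OF t1(7) refl] by blast+

 \<comment> \<open>Eigenvalue series along the chain\<close>
 define BV where "BV = ber (idx 0 0 r' 0) (gmat l \<zeta> (tensor_family.trep (set (idx 0 0 r' 0)) l V))"
 define BV' where "BV' = ber (pi_order r r') (gmat l \<zeta> (tensor_family.trep ?K' l V'))"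
 define BL'' where "BL'' = ber (theta_order r) (gmat l \<zeta> (tensor_family.trep ?I'' l L''))"
 define BL' where "BL' = ber (idx p r r n) (gmat l \<zeta> (tensor_family.trep ?I' l L'))"
 define BL where "BL = ber (idx p q m n) (gmat l \<zeta> (tensor_family.trep (set (idx p q m n)) l L))"
 \<comment> \<open>Each of the modules \<open>V'\<close>, \<open>L''\<close> and \<open>L'\<close>
   is met in two orders linked by \<open>oswap\<close>; one Berezinian serves for both.\<close>
 have BV'2: "ber (theta'_order r r') (gmat l \<zeta> (tensor_family.trep ?K' l V')) = BV'" unfolding BV'_def
  by (rule ber_gmat_oswap[OF tensor_family.env_rep_trep[OF famV'] finite_set oswap_pi[OF r'(1)] _ distinct_orders(3)]) (simp only: set_orders set_orders(3)[OF r'(1)] order_refl)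
 have BL''2: "ber (idx 0 r r 0) (gmat l \<zeta> (tensor_family.trep ?I'' l L'')) = BL''" unfolding BL''_def
  by (rule ber_gmat_oswap[OF tensor_family.env_rep_trep[OF fam''] finite_set oswap_theta _ distinct_orders(2)]) (simp only: set_orders set_orders(3)[OF r'(1)] order_refl)
 have BL'2: "ber (sigma_order p q m n r) (gmat l \<zeta> (tensor_family.trep ?I' l L')) = BL'" unfolding BL'_def
  by (rule ber_gmat_oswap[OF tensor_family.env_rep_trep[OF fam'] finite_set oswap_sigma[OF r(3,2)] _ distinct_orders(1)]) simp

 define C where "C = cgeom l ds \<zeta>"
 have pdi: "uinv pd (pdi::complex psd)" by (simp add: uinv_def)
 have len: "length (map od [1 - int r..- int q]) = r - q" "length (map ev [int m + 1..int r]) = r - m"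
  "length (map ev [- int p..-1]) = p" "length (map od [1..int n]) = n"
  "length (map ev [int r + 1..int r']) = r' - r" "length (map od [1 - int r..0]) = r"
  using r(2,3) r'(1) by (simp_all add: nat_diff_distrib')
 have ev: "x:set (map ev js)==>even x" and od: "x:set (map od js)==>odd x" for x js by auto
 have par: "par_prod (map od [1 - int r..- int q]) C c' = c' ^ (r - q)" "par_prod (map ev [int m + 1..int r]) pd pdi = (pd ^ (r - m)::complex psd)"
  "par_prod (map ev [- int p..-1]) C c' = C ^ p" "par_prod (map od [1..int n]) pd pdi = (pdi ^ n::complex psd)"
  "par_prod (map ev [int r + 1..int r']) pd pdi = (pd ^ (r' - r)::complex psd)" "par_prod (map od [1 - int r..0]) pd pdi = (pdi ^ r::complex psd)"
  by (simp_all only: par_prod_const(2)[OF od] par_prod_const(1)[OF ev] len)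

 have e4: "eig BV D0 v \<longleftrightarrow> eig BV' (D0*pdi ^ r) (\<Phi>4 v)" if "v:SV" for v D0
  using t4(6)[where D=D0] that unfolding SV BV_def BV'_def C_def[symmetric] par by simp
 have e3: "eig BL'' D0 u \<longleftrightarrow> eig BV' (D0*pd ^ (r' - r)) (\<Phi>3 u)" if "u:Sth" for u D0
  using t3(6)[where D=D0] that unfolding Sth_def BV'2 BL''_def[symmetric] C_def[symmetric] par by simp
 have e2: "eig BL'' D0 u \<longleftrightarrow> eig BL' (C ^ p*D0*pdi ^ n) (\<Phi>2 u)" if "u:S''" for u D0
  using t2(6)[where D=D0] that unfolding S''_def BL''2 BL'_def[symmetric] C_def[symmetric] par by simp
 have e1: "eig BL D0 u \<longleftrightarrow> eig BL' (c' ^ (r - q)*D0*pd ^ (r - m)) (\<Phi>1 u)" if "u:SL" for u D0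
  using t1(6)[where D=D0] that unfolding SL BL'2 BL_def[symmetric] C_def[symmetric] par by simp
 have evs: "eig BV' D0 (varsig u) \<longleftrightarrow> eig BV' D0 u" if "u:Spi" for u D0
  using tensor_family.module_act_eig[OF famV' Y set_orders(2) distinct_orders(3) set_orders(2) set_orders(3)[OF r'(1)], folded VV', folded varsig(1), OF varsig(2)] that
  unfolding BV'_def Spi_def by blast
 have eth: "eig BL'' D0 (theta u) \<longleftrightarrow> eig BL'' D0 u" if "u:Sth" for u D0
  using tensor_family.module_act_eig[OF fam'' Xc set_orders(1) distinct_orders(2) set_orders(1) refl, folded LL'', folded theta(1), OF theta(2)] that
  unfolding BL''_def Sth_def by blast
 have eph: "eig BL' D0 (phi u) \<longleftrightarrow> eig BL' D0 u" if "u:S'" for u D0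
  using tensor_family.module_act_eig[OF fam' Ac refl distinct_orders(1) refl set_orders(4)[OF r(3,2)], folded LL', folded phi(1), OF phi(2)] that
  unfolding BL'_def S'_def by blast

 \<comment> \<open>The effect of the whole chain on series. The embeddings \<Phi>1 and \<Phi>3 are
   passed backwards; \<open>x1\<close> and \<open>x2\<close> below cancel their factors.\<close>
 define R where "R D0 = C ^ (p + (r - q))*D0*pdi ^ (r' + n + (r - m))" for D0
 have main: "eig BL (R D0) (\<Psi> v) \<longleftrightarrow> eig BV D0 v" if v: "v:SV" for v D0
 proof -
  define u1 u2 u3 u4 u5 u6 where "u1 = \<Phi>4 v" and "u2 = varsig u1" and "u3 = G3 u2" and "u4 = theta u3" and "u5 = \<Phi>2 u4" and "u6 = phi u5"
  have u: "u1:Spi" "u2:Sth'" "u3:Sth" "u4:S''" "u5:S'" "u6:Ssig" "G1 u6:SL"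
   using v b4 bvs b3 bth b2 bph b1 unfolding u1_def u2_def u3_def u4_def u5_def u6_def by (simp_all add: bij_betw_apply)
  have \<Psi>v: "\<Psi> v = G1 u6" unfolding \<Psi>' u6_def u5_def u4_def u3_def u2_def u1_def ..
  have g1: "\<Phi>1 (G1 u6) = u6" using t1(5) u(6) unfolding Ssig_def by blast
  have g3: "\<Phi>3 u3 = u2" unfolding u3_def using t3(5) u(2) unfolding Sth'_def by blast
  have C1: "c' ^ b*C ^ b = 1" "C ^ b*c' ^ b = 1" for b using uinv_power[OF c, of b] by (simp_all add: uinv_def C_def)
  have P1: "pdi ^ b*pd ^ b = (1::complex psd)" for b using uinv_power[OF pdi, of b] by (simp add: uinv_def)
  have x1: "c' ^ (r - q)*R D0*pd ^ (r - m) = C ^ p*(D0*pdi ^ r')*pdi ^ n"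
  proof -
   have "C ^ (p + (r - q)) = C ^ (r - q)*C ^ p" by (simp add: power_add[symmetric] add.commute)
   hence "c' ^ (r - q)*R D0*pd ^ (r - m) = (c' ^ (r - q)*C ^ (r - q))*C ^ p*D0*(pdi ^ r'*pdi ^ n)*(pdi ^ (r - m)*pd ^ (r - m))"
    by (simp only: R_def power_add mult.assoc)
   thus ?thesis unfolding C1 P1 by (simp add: mult.assoc)
  qed
  have x2: "D0*pdi ^ r'*pd ^ (r' - r) = D0*pdi ^ r"
  proof -
   have "pdi ^ r' = (pdi ^ r*pdi ^ (r' - r)::complex psd)" using r'(1) by (simp add: power_add[symmetric])
   hence "D0*pdi ^ r'*pd ^ (r' - r) = D0*pdi ^ r*(pdi ^ (r' - r)*pd ^ (r' - r))" by (simp only: mult.assoc)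
   thus ?thesis unfolding P1 by simp
  qed
  have "eig BL (R D0) (\<Psi> v) \<longleftrightarrow> eig BL' (C ^ p*(D0*pdi ^ r')*pdi ^ n) u6"
   unfolding \<Psi>v e1[OF u(7)] g1 x1 ..
  also have "... \<longleftrightarrow> eig BL'' (D0*pdi ^ r') u4" unfolding u6_def eph[OF u(5)] unfolding u5_def e2[OF u(4)] ..
  also have "... \<longleftrightarrow> eig BV' (D0*pdi ^ r) u2" unfolding u4_def eth[OF u(3)] unfolding e3[OF u(3)] g3 x2 ..
  also have "... \<longleftrightarrow> eig BV D0 v" unfolding u2_def evs[OF u(1)] unfolding u1_def e4[OF v] ..
  finally show ?thesis .
 qed
 \<comment> \<open>Multiplication by units on both sides: every series occurring in \<open>L\<close>
   comes from one in \<open>V\<close>, so no eigenvector of the Gaudin algebra on \<open>L\<close>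
   is missed.\<close>
 have R_surj: "EX D0. R D0 = D1" for D1
 proof -
  obtain h where h: "h = r' + n + (r - m)" by blast
  have C1: "C ^ b*c' ^ b = 1" for b using uinv_power[OF c, of b] by (simp add: uinv_def C_def)
  have P1: "pd ^ b*pdi ^ b = (1::complex psd)" for b using uinv_power[OF pdi, of b] by (simp add: uinv_def)
  have "R (c' ^ (p + (r - q))*D1*pd ^ h) = (C ^ (p + (r - q))*c' ^ (p + (r - q)))*D1*(pd ^ h*pdi ^ h)"
   unfolding R_def h by (simp only: mult.assoc)
  thus ?thesis unfolding C1 P1 by auto
 qed

 have evV: "eigenvector AV SV v \<longleftrightarrow> v:SV & v~=0 & (EX D0. eig BV D0 v)" for v
  unfolding AV BV_def by (rule gaudin_eigenvector[OF t4(7) sub(4)[unfolded VV]])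
 have evL: "eigenvector AL SL v \<longleftrightarrow> v:SL & v~=0 & (EX D0. eig BL D0 v)" for v
  unfolding AL BL_def by (rule gaudin_eigenvector[OF t1(7) sub(5)[unfolded LL]])
 have zero: "\<Psi> v = 0 \<longleftrightarrow> v = 0" if "v:SV" for v
 proof -
  have "\<Psi> 0 = 0" "0:SV" using linear_on_zero[OF lin that] cvec.subspace_0[OF subs(1)] .
  thus ?thesis using bij that unfolding bij_betw_def by (metis inj_onD)
 qed
 have iff: "eigenvector AV SV v \<longleftrightarrow> eigenvector AL SL (\<Psi> v)" if v: "v:SV" for v
 proof -
  have "\<Psi> v:SL" using bij v by (auto simp: bij_betw_def)
  moreover have "(EX D0. eig BV D0 v) \<longleftrightarrow> (EX D0. eig BL D0 (\<Psi> v))" using main[OF v] R_surj by metis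
  ultimately show ?thesis unfolding evV evL using v zero[OF v] by simp
 qed
 \<comment> \<open>The eigenvalue series of a nonzero vector is unique, so \<open>assoc_psdo\<close>
   returns the series found in \<open>main\<close>.\<close>
 have calD_eq: "calD (\<Psi> v) = transf (D v)" if e: "eigenvector AV SV v" for v
 proof -
  obtain D0 where v: "v:SV" "v~=0" "eig BV D0 v" using e evV by blast
  have "D v = pcoef D0" unfolding D by (rule assoc_psdo_cdet[OF t4(7) _ v(2) v(3)[unfolded BV_def]]) (use v(1) sub(4)[unfolded VV] in blast)
  moreover have "calD (\<Psi> v) = pcoef (R D0)" unfolding calD
  proof (rule assoc_psdo_ber[OF t1(7)])
   show "\<Psi> v:space_of (tensor_mod l L)" using bij v(1) sub(5) unfolding LL bij_betw_def by blast
   show "\<Psi> v~=0" using zero[OF v(1)] v(2) by simp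
   show "eig (ber (idx p q m n) (gmat l \<zeta> (tensor_family.trep (set (idx p q m n)) l L))) (R D0) (\<Psi> v)"
    using main[OF v(1)] v(3) unfolding BL_def by blast
  qed
  ultimately show ?thesis unfolding transf R_def C_def by (simp only: transfer_series[OF c r(3,2)])
 qed
 have inv: "inv_into SV \<Psi> w:SV" "\<Psi> (inv_into SV \<Psi> w) = w" if "w:SL" for w
  using bij that by (auto simp: bij_betw_def inv_into_into f_inv_into_f)
 show ?thesis
 proof (intro conjI allI impI)
  fix v assume e: "eigenvector AV SV v"
  hence v: "v:SV" by (simp add: eigenvector_def)
  show "eigenvector AL SL (\<Psi> v)" using iff[OF v] e by blast
  show "apply_psdo (calD (\<Psi> v)) (\<Psi> v) = apply_psdo (transf (D v)) (\<Psi> v)" unfolding calD_eq[OF e] ..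
 next
  fix w assume e: "eigenvector AL SL w"
  hence w: "w:SL" by (simp add: eigenvector_def)
  show e': "eigenvector AV SV (inv_into SV \<Psi> w)" using iff[OF inv(1)[OF w]] e unfolding inv(2)[OF w] by blast
  \<comment> \<open>The two scalar operators are equal before they are applied to anything, so the
    equation may be applied to the preimage of \<open>w\<close> as well.\<close>
  show "apply_psdo (calD w) (inv_into SV \<Psi> w) = apply_psdo (transf (D (inv_into SV \<Psi> w))) (inv_into SV \<Psi> w)"
   using calD_eq[OF e'] unfolding inv(2)[OF w] by simp
 next
  show "bij_betw (%B. \<Psi> ` B) {B. eigenbasis AV SV B} {B. eigenbasis AL SL B}"
   unfolding eigenbasis_def by (rule basis_correspondence[OF subs lin bij]) (rule iff)
 qed
qed

end
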